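(* Let $(\mathcal F,\mathcal D,U,\Omega)$ be an involutive (potentially non-unitary) Möbius-covariant Wightman CFT on $S^1$. Let $\phi:\mathcal P(I_+)\to\mathbb C$ be the linear functional $\phi(x)=\langle x\Omega,\Omega\rangle$, and let $\alpha_t=\operatorname{Ad}V_t\in\operatorname{Aut}(\mathcal P(I_+))$, i.e. $\alpha_t(y)=V_tyV_t^{-1}$, for $t\in\mathbb R$. Let $\mathbb S_{2\pi i}=\{\tau\in\mathbb C:0\le\operatorname{Im}\tau\le2\pi\}$. Then for every $x,y\in\mathcal P(I_+)$ there exists a function $F:\mathbb S_{2\pi i}\to\mathbb C$ that is continuous on the closed strip, holomorphic in the interior, and satisfies for all $t\in\mathbb R$ $$F(t)=\phi(x\alpha_t(y)),\qquad F(t+2\pi i)=\phi(\alpha_t(y)x).$$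
   Context: **Wightman CFTs.** $S^1\subset\mathbb C$ is the unit circle and $C^\infty(S^1)$ is the space of complex-valued smooth functions, with the Fréchet topology of the norms $\|f\|_{C^N}=\sum_{j=0}^N\|\frac{d^j}{d\theta^j}f\|_\infty$. An interval is an open, connected, nonempty, non-dense subset of $S^1$. $\mathrm{Mob}=\mathrm{PSU}(1,1)$ is the group of holomorphic automorphisms of the unit disk (acting on $S^1$), and $r_\theta\in\mathrm{Mob}$ is rotation by $\theta$. For $\gamma\in\mathrm{Mob}$ put $X_\gamma(e^{i\theta})=-i\frac{d}{d\theta}\log\gamma(e^{i\theta})$, and for $d\in\mathbb Z_{\ge0}$ put $(\beta_d(\gamma)f)(z)=X_\gamma(\gamma^{-1}(z))^{d-1}f(\gamma^{-1}(z))$. Let $\mathcal D$ be a complex vector space. An operator-valued distribution with domain $\mathcal D$ is a linear map $\varphi$ from $C^\infty(S^1)$ to the linear operators on $\mathcal D$. Let $\mathcal F$ be a set of these. A linear functional $\lambda:\mathcal D\to\mathbb C$ is compatible with $\mathcal F$ if $(f_1,\dots,f_k)\mapsto\lambda(\varphi_1(f_1)\cdots\varphi_k(f_k)\Phi)$ is jointly continuous on $C^\infty(S^1)^k$ for all $k$, $\varphi_j\in\mathcal F$, $\Phi\in\mathcal D$; $\mathcal D_{\mathcal F}^*$ is the space of such functionals. $\mathcal F$ acts regularly if $\mathcal D_{\mathcal F}^*$ separates points of $\mathcal D$. The $\mathcal F$-strong topology on $\mathcal D$ is the finest locally convex topology for which all maps $(f_1,\dots,f_k)\mapsto\varphi_1(f_1)\cdots\varphi_k(f_k)\Phi$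 are jointly continuous. $\mathcal D$ carries this topology, and $\operatorname{End}(\mathcal D)$ denotes the continuous linear operators on $\mathcal D$. A Möbius-covariant Wightman CFT on $S^1$ is $(\mathcal F,\mathcal D,U,\Omega)$ with $\mathcal F$ acting regularly on $\mathcal D$, $U:\mathrm{Mob}\to\operatorname{End}(\mathcal D)$ a representation, $0\ne\Omega\in\mathcal D$, such that: (W1) each $\varphi\in\mathcal F$ has a conformal dimension $d_\varphi\in\mathbb Z_{\ge0}$ with $U(\gamma)\varphi(f)U(\gamma)^{-1}=\varphi(\beta_{d_\varphi}(\gamma)f)$ for all $\gamma,f$; (W2) $\varphi_1(f),\varphi_2(g)$ commute if $f,g$ have disjoint supports, $\varphi_1,\varphi_2\in\mathcal F$; (W3) if $d\in\mathbb Z$, $d<0$ and $U(r_\theta)\Phi=e^{id\theta}\Phi$ for all $\theta$, then $\Phi=0$; (W4) $\Omega$ is $U$-invariant and $\mathcal D$ is algebraically spanned by the vectors $\varphi_1(f_1)\cdots\varphi_k(f_k)\Omega$. For an interval $I$, $\mathcal P(I)\subset\operatorname{End}(\mathcal D)$ is the unital algebra generated by the $\varphi(f)$ with $\varphi\in\mathcal F$, $\operatorname{supp}f\subset I$. Set $I_+=\{z\in S^1:\operatorname{Im}z>0\}$, $v_t(z)=\frac{\cosh(t/2)z-\sinh(t/2)}{-\sinh(t/2)z+\cosh(t/2)}\in\mathrm{Mob}$ for $t\in\mathbb R$ (which preserves $I_+$), and $V_t=U(v_t)$. **Involutive theories.** The CFT is involutive if it is equipped with a nondegenerate, jointly $\mathcal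 F$-strongly continuous Hermitian form $\langle\cdot,\cdot\rangle$ on $\mathcal D$ (linear in the first variable) and a PCT operator $\theta$, i.e. an antiunitary involution $\theta:\mathcal D\to\mathcal D$ (antilinear, $\theta^2=1$, $\langle\theta\Phi,\theta\Psi\rangle=\overline{\langle\Phi,\Psi\rangle}$) with $\theta\Omega=\Omega$, such that the form is invariant: $\langle\varphi(f)\Phi,\Psi\rangle=\langle\Phi,\varphi^\dagger(\overline f)\Psi\rangle$ for all $\Phi,\Psi\in\mathcal D$, $\varphi\in\mathcal F$, $f\in C^\infty(S^1)$, where $\varphi^\dagger(f):=(-1)^{d_\varphi}\theta\varphi(\overline f\circ z^{-1})\theta$ (with $f\circ z^{-1}$ the function $z\mapsto f(z^{-1})$) and $(-1)^{d_\varphi}\varphi^\dagger\in\mathcal F$; and $\langle U(\gamma)\Phi,U(\gamma)\Psi\rangle=\langle\Phi,\Psi\rangle$ for all $\gamma\in\mathrm{Mob}$. *)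

theory Defs
  imports "HOL-Analysis.Analysis"
begin

section \<open>Smooth functions on the unit circle\<close>

text \<open>A function on the circle is represented by a function on the complex plane that vanishes
  off the unit circle, so that equality of functions is HOL equality.\<close>

definition angular_deriv :: "nat \<Rightarrow> (complex \<Rightarrow> complex) \<Rightarrow> real \<Rightarrow> complex" where
  "angular_deriv j f = ((\<lambda>g \<theta>. vector_derivative g (at \<theta>)) ^^ j) (\<lambda>\<theta>. f (cis \<theta>))"

definition smooth_circle :: "(complex \<Rightarrow> complex) set" where
  "smooth_circle = {f. (\<forall>z. z \<notin> sphere 0 1 \<longrightarrow> f z = 0) \<and>
                       (\<forall>j \<theta>. angular_deriv j f differentiable (at \<theta>))}"

definition C_norm :: "nat \<Rightarrow> (complex \<Rightarrow> complex) \<Rightarrow> real" where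
  "C_norm N f = (\<Sum>j\<le>N. SUP \<theta>. norm (angular_deriv j f \<theta>))"

definition smooth_topology :: "(complex \<Rightarrow> complex) topology" where
  "smooth_topology = topology_generated_by
     {{g \<in> smooth_circle. C_norm N (\<lambda>z. g z - f z) < e} | f N e. f \<in> smooth_circle \<and> e > 0}"

definition circle_support :: "(complex \<Rightarrow> complex) \<Rightarrow> complex set" where
  "circle_support f = closure {z \<in> sphere 0 1. f z \<noteq> 0}"

section \<open>The Moebius group of the disk\<close>

text \<open>Elements of PSU(1,1) are represented by their action on the closed unit disk, extended by the
  identity to a bijection of the plane. Thus \<open>id\<close>, \<open>\<circ>\<close> and \<open>inv\<close> are the group operations.\<close>

definition moebius :: "complex \<Rightarrow> complex \<Rightarrow> complex \<Rightarrow> complex" where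
  "moebius a b z = (if z \<in> cball 0 1 then (a * z + b) / (cnj b * z + cnj a) else z)"

definition Mob :: "(complex \<Rightarrow> complex) set" where
  "Mob = {moebius a b | a b. (cmod a)\<^sup>2 - (cmod b)\<^sup>2 = 1}"

text \<open>\<open>rot \<theta>\<close> is multiplication by \<open>cis \<theta>\<close> on the closed disk.\<close>

definition rot :: "real \<Rightarrow> complex \<Rightarrow> complex" where
  "rot \<theta> = moebius (cis (\<theta> / 2)) 0"

definition boost :: "real \<Rightarrow> complex \<Rightarrow> complex" where
  "boost t = moebius (of_real (cosh (t / 2))) (of_real (- sinh (t / 2)))"

text \<open>The derivative of \<open>log \<gamma>(e\<^sup>i\<^sup>\<theta>)\<close>, for any local branch of the logarithm, is the logarithmic
  derivative.\<close>

definition X :: "(complex \<Rightarrow> complex) \<Rightarrow> complex \<Rightarrow> complex" where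
  "X \<gamma> z = - \<i> * (vector_derivative (\<lambda>\<theta>. \<gamma> (cis \<theta>)) (at (Arg z)) / \<gamma> z)"

definition beta :: "nat \<Rightarrow> (complex \<Rightarrow> complex) \<Rightarrow> (complex \<Rightarrow> complex) \<Rightarrow> complex \<Rightarrow> complex" where
  "beta d \<gamma> f z = (X \<gamma> (inv \<gamma> z)) powi (int d - 1) * f (inv \<gamma> z)"

section \<open>Operator-valued distributions\<close>

text \<open>The domain is a type \<open>'d\<close> made into a complex vector space by a scalar multiplication
  \<open>smul\<close>.\<close>

type_synonym 'd qfield = "(complex \<Rightarrow> complex) \<Rightarrow> 'd \<Rightarrow> 'd"

text \<open>The value off the smooth functions is fixed to zero, so that distributions are equal as HOL
  functions iff they agree on smooth functions.\<close>

definition operator_valued_distribution ::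
    "(complex \<Rightarrow> 'd \<Rightarrow> 'd) \<Rightarrow> 'd::ab_group_add qfield \<Rightarrow> bool" where
  "operator_valued_distribution smul \<phi> \<longleftrightarrow>
     (\<forall>f \<in> smooth_circle. Vector_Spaces.linear smul smul (\<phi> f)) \<and>
     (\<forall>f \<in> smooth_circle. \<forall>g \<in> smooth_circle. \<forall>\<Phi>. \<phi> (\<lambda>z. f z + g z) \<Phi> = \<phi> f \<Phi> + \<phi> g \<Phi>) \<and>
     (\<forall>f \<in> smooth_circle. \<forall>c \<Phi>. \<phi> (\<lambda>z. c * f z) \<Phi> = smul c (\<phi> f \<Phi>)) \<and>
     (\<forall>f. f \<notin> smooth_circle \<longrightarrow> (\<forall>\<Phi>. \<phi> f \<Phi> = 0))"

definition field_product ::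
    "'d qfield list \<Rightarrow> (nat \<Rightarrow> complex \<Rightarrow> complex) \<Rightarrow> 'd \<Rightarrow> 'd" where
  "field_product \<phi>s f \<Phi> = foldr (\<lambda>j \<Psi>. (\<phi>s ! j) (f j) \<Psi>) [0..<length \<phi>s] \<Phi>"

text \<open>The space of k-tuples of smooth functions, indexed by \<open>{..<k}\<close>.\<close>

definition tuple_topology :: "nat \<Rightarrow> (nat \<Rightarrow> complex \<Rightarrow> complex) topology" where
  "tuple_topology k = product_topology (\<lambda>_. smooth_topology) {..<k}"

definition compatible_functionals ::
    "(complex \<Rightarrow> 'd \<Rightarrow> 'd) \<Rightarrow> 'd::ab_group_add qfield set \<Rightarrow> ('d \<Rightarrow> complex) set" where
  "compatible_functionals smul \<F> =
     {l. Vector_Spaces.linear smul (*) l \<and>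
         (\<forall>\<phi>s \<Phi>. set \<phi>s \<subseteq> \<F> \<longrightarrow>
            continuous_map (tuple_topology (length \<phi>s)) euclidean (\<lambda>f. l (field_product \<phi>s f \<Phi>)))}"

definition acts_regularly ::
    "(complex \<Rightarrow> 'd \<Rightarrow> 'd) \<Rightarrow> 'd::ab_group_add qfield set \<Rightarrow> bool" where
  "acts_regularly smul \<F> \<longleftrightarrow>
     (\<forall>\<Phi> \<Psi>. \<Phi> \<noteq> \<Psi> \<longrightarrow> (\<exists>l \<in> compatible_functionals smul \<F>. l \<Phi> \<noteq> l \<Psi>))"

definition scale_convex :: "(complex \<Rightarrow> 'd \<Rightarrow> 'd) \<Rightarrow> 'd::ab_group_add set \<Rightarrow> bool" where
  "scale_convex smul W \<longleftrightarrow>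
     (\<forall>x\<in>W. \<forall>y\<in>W. \<forall>u\<in>{0..1::real}. smul (of_real u) x + smul (of_real (1 - u)) y \<in> W)"

definition locally_convex_topology ::
    "(complex \<Rightarrow> 'd \<Rightarrow> 'd) \<Rightarrow> 'd::ab_group_add topology \<Rightarrow> bool" where
  "locally_convex_topology smul T \<longleftrightarrow>
     topspace T = UNIV \<and>
     continuous_map (prod_topology T T) T (\<lambda>(x, y). x + y) \<and>
     continuous_map (prod_topology euclidean T) T (\<lambda>(c, x). smul c x) \<and>
     (\<forall>V. openin T V \<and> 0 \<in> V \<longrightarrow> (\<exists>W. openin T W \<and> 0 \<in> W \<and> W \<subseteq> V \<and> scale_convex smul W))"

definition field_products_continuous :: "'d qfield set \<Rightarrow> 'd topology \<Rightarrow> bool" where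
  "field_products_continuous \<F> T \<longleftrightarrow>
     (\<forall>\<phi>s \<Phi>. set \<phi>s \<subseteq> \<F> \<longrightarrow>
        continuous_map (tuple_topology (length \<phi>s)) T (\<lambda>f. field_product \<phi>s f \<Phi>))"

text \<open>The finest locally convex topology making the products continuous, as the supremum of all
  such topologies; that the supremum is again such a topology is shown below.\<close>

definition strong_topology ::
    "(complex \<Rightarrow> 'd \<Rightarrow> 'd) \<Rightarrow> 'd::ab_group_add qfield set \<Rightarrow> 'd topology" where
  "strong_topology smul \<F> = topology_generated_by
     {V. \<exists>T. locally_convex_topology smul T \<and> field_products_continuous \<F> T \<and> openin T V}"

lemma strong_topology_finest:
  assumes "locally_convex_topology smul T" "field_products_continuous \<F> T" "openin T V"
  shows "openin (strong_topology smul \<F>) V"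
  unfolding strong_topology_def using assms by (intro topology_generated_by_Basis) blast

lemma locally_convex_indiscrete:
  fixes smul :: "complex \<Rightarrow> 'd \<Rightarrow> 'd::ab_group_add" and \<F> :: "'d qfield set"
  shows "locally_convex_topology smul (topology_generated_by {UNIV})"
    and "field_products_continuous \<F> (topology_generated_by {UNIV})"
proof -
  let ?T = "topology_generated_by {UNIV :: 'd set}"
  have "V = UNIV" if "generate_topology_on {UNIV} V" "V \<noteq> {}" for V :: "'d set"
    using that by (induction rule: generate_topology_on.induct) auto
  then have op: "V = UNIV" if "openin ?T V" "x \<in> V" for V x
    using that openin_topology_generated_by by blast
  have c: "scale_convex smul UNIV" by (simp add: scale_convex_def)
  have o: "openin ?T UNIV" by (rule topology_generated_by_Basis) simp
  have m: "continuous_map S ?T f" for S :: "'x topology" and f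
    by (rule continuous_on_generated_topo) auto
  have "\<exists>W. openin ?T W \<and> 0 \<in> W \<and> W \<subseteq> V \<and> scale_convex smul W" if "openin ?T V \<and> 0 \<in> V" for V
    using op[of V 0] that c o by (intro exI[of _ UNIV]) auto
  then show "locally_convex_topology smul ?T"
    unfolding locally_convex_topology_def by (intro conjI allI impI m) simp_all
  show "field_products_continuous \<F> ?T"
    unfolding field_products_continuous_def by (intro allI impI m)
qed

lemma strong_topology_topspace: "topspace (strong_topology smul \<F>) = UNIV"
proof -
  have "openin (strong_topology smul \<F>) UNIV"
    by (rule strong_topology_finest[OF locally_convex_indiscrete])
       (simp add: topology_generated_by_Basis)
  then show ?thesis using openin_subset by fastforce
qed

lemma strong_topology_continuous_id:
  assumes "locally_convex_topology smul T" "field_products_continuous \<F> T"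
  shows "continuous_map (strong_topology smul \<F>) T (\<lambda>x. x)"
  using strong_topology_finest[OF assms] assms(1)
  by (auto simp: continuous_map_alt strong_topology_topspace locally_convex_topology_def)

lemma continuous_map_strong_topology:
  assumes "\<And>T. locally_convex_topology smul T \<Longrightarrow> field_products_continuous \<F> T \<Longrightarrow> continuous_map S T f"
  shows "continuous_map S (strong_topology smul \<F>) f"
  unfolding strong_topology_def
proof (rule continuous_on_generated_topo)
  fix V assume "V \<in> {V. \<exists>T. locally_convex_topology smul T \<and> field_products_continuous \<F> T \<and> openin T V}"
  then obtain T where "locally_convex_topology smul T" "field_products_continuous \<F> T" "openin T V"
    by blast
  then show "openin S (f -` V \<inter> topspace S)"
    using assms by (auto simp: continuous_map_alt)
next
  have "\<Union> {V. \<exists>T. locally_convex_topology smul T \<and> field_products_continuous \<F> T \<and> openin T V} = UNIV"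
    using strong_topology_topspace[of smul \<F>] unfolding strong_topology_def by simp
  then show "f ` topspace S \<subseteq> \<Union> {V. \<exists>T. locally_convex_topology smul T \<and> field_products_continuous \<F> T \<and> openin T V}"
    by simp
qed

lemma strong_topology_products: "field_products_continuous \<F> (strong_topology smul \<F>)"
  unfolding field_products_continuous_def
  by (intro allI impI continuous_map_strong_topology)
     (auto simp: field_products_continuous_def)

lemma strong_topology_locally_convex:
  assumes "vector_space smul"
  shows "locally_convex_topology smul (strong_topology smul \<F>)"
proof -
  interpret vector_space smul by fact
  let ?S = "strong_topology smul \<F>"
  have nb: "\<exists>W. openin ?S W \<and> x \<in> W \<and> W \<subseteq> V \<and> scale_convex smul W"
    if "openin ?S V" "x \<in> V" for x V
  proof -
    have "generate_topology_on
        {V. \<exists>T. locally_convex_topology smul T \<and> field_products_continuous \<F> T \<and> openin T V} V"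
      using that(1) unfolding strong_topology_def by (rule openin_topology_generated_by)
    then show ?thesis using that(2)
    proof (induction rule: generate_topology_on.induct)
      case Empty
      then show ?case by simp
    next
      case (Int a b)
      then obtain A B where AB: "openin ?S A" "x \<in> A" "A \<subseteq> a" "scale_convex smul A"
        "openin ?S B" "x \<in> B" "B \<subseteq> b" "scale_convex smul B" by (metis IntE)
      then have "openin ?S (A \<inter> B)" "scale_convex smul (A \<inter> B)"
        by (auto simp: scale_convex_def)
      then show ?case using AB(2,3,6,7) by (intro exI[of _ "A \<inter> B"]) auto
    next
      case (UN K)
      then obtain k where k: "k \<in> K" "x \<in> k" by blast
      then obtain W where "openin ?S W" "x \<in> W" "W \<subseteq> k" "scale_convex smul W"
        using UN.IH by meson
      then show ?case using k(1) by (intro exI[of _ W]) auto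
    next
      case (Basis V)
      then obtain T where T: "locally_convex_topology smul T" "field_products_continuous \<F> T"
        and V: "openin T V" by blast
      have ts: "topspace T = UNIV"
        and ad: "continuous_map (prod_topology T T) T (\<lambda>(x, y). x + y)"
        using T(1) by (auto simp: locally_convex_topology_def)
      have tr: "continuous_map T T (\<lambda>y. y + c)" for c
      proof -
        have "continuous_map T (prod_topology T T) (\<lambda>y. (y, c))"
          by (simp add: continuous_map_paired ts)
        from continuous_map_compose[OF this ad] show ?thesis by (simp add: o_def)
      qed
      have op: "openin T {y. y + c \<in> U}" if "openin T U" for U c
        using tr[of c] that by (simp add: continuous_map_def ts)
      have "openin T {y. y + x \<in> V}" "0 \<in> {y. y + x \<in> V}"
        using op[OF V] Basis.prems by auto
      then obtain W where W: "openin T W" "0 \<in> W" "W \<subseteq> {y. y + x \<in> V}" "scale_convex smul W"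
        using T(1) unfolding locally_convex_topology_def by meson
      let ?W = "{y. y + (- x) \<in> W}"
      have "openin ?S ?W"
        using strong_topology_finest[OF T] op[OF W(1)] by blast
      moreover have "?W \<subseteq> V" using W(3) by fastforce
      moreover have "scale_convex smul ?W"
        unfolding scale_convex_def
      proof (intro ballI)
        fix y z and u :: real assume yz: "y \<in> ?W" "z \<in> ?W" "u \<in> {0..1}"
        have "smul (of_real u) y + smul (of_real (1 - u)) z + - x
            = smul (of_real u) (y + - x) + smul (of_real (1 - u)) (z + - x)"
          by (simp add: scale_right_distrib scale_right_diff_distrib scale_left_diff_distrib)
        then show "smul (of_real u) y + smul (of_real (1 - u)) z \<in> ?W"
          using W(4) yz unfolding scale_convex_def by auto
      qed
      ultimately show ?case using W(2) by (intro exI[of _ ?W]) auto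
    qed
  qed
  have add: "continuous_map (prod_topology ?S ?S) ?S (\<lambda>(x, y). x + y)"
  proof (rule continuous_map_strong_topology)
    fix T assume T: "locally_convex_topology smul T" "field_products_continuous \<F> T"
    note i = strong_topology_continuous_id[OF T]
    have "continuous_map (prod_topology ?S ?S) (prod_topology T T) (\<lambda>p. (fst p, snd p))"
      unfolding continuous_map_paired
      by (simp add: continuous_map_compose[OF continuous_map_fst i, unfolded o_def]
          continuous_map_compose[OF continuous_map_snd i, unfolded o_def])
    moreover have "continuous_map (prod_topology T T) T (\<lambda>(x, y). x + y)"
      using T(1) by (simp add: locally_convex_topology_def)
    ultimately have "continuous_map (prod_topology ?S ?S) T ((\<lambda>(x, y). x + y) \<circ> (\<lambda>p. (fst p, snd p)))"
      by (rule continuous_map_compose)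
    then show "continuous_map (prod_topology ?S ?S) T (\<lambda>(x, y). x + y)"
      by (simp add: o_def)
  qed
  have mul: "continuous_map (prod_topology euclidean ?S) ?S (\<lambda>(c, x). smul c x)"
  proof (rule continuous_map_strong_topology)
    fix T assume T: "locally_convex_topology smul T" "field_products_continuous \<F> T"
    note i = strong_topology_continuous_id[OF T]
    have "continuous_map (prod_topology euclidean ?S) (prod_topology euclidean T)
        (\<lambda>p. (fst p, snd p))"
      unfolding continuous_map_paired
      by (simp add: continuous_map_fst continuous_map_compose[OF continuous_map_snd i, unfolded o_def])
    moreover have "continuous_map (prod_topology euclidean T) T (\<lambda>(c, x). smul c x)"
      using T(1) by (simp add: locally_convex_topology_def)
    ultimately have "continuous_map (prod_topology euclidean ?S) T ((\<lambda>(c, x). smul c x) \<circ> (\<lambda>p. (fst p, snd p)))"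
      by (rule continuous_map_compose)
    then show "continuous_map (prod_topology euclidean ?S) T (\<lambda>(c, x). smul c x)"
      by (simp add: o_def)
  qed
  show ?thesis
    unfolding locally_convex_topology_def
    using strong_topology_topspace[of smul \<F>] add mul nb[where x = 0] by simp
qed

definition End :: "(complex \<Rightarrow> 'd \<Rightarrow> 'd) \<Rightarrow> 'd::ab_group_add qfield set \<Rightarrow> ('d \<Rightarrow> 'd) set" where
  "End smul \<F> = {A. Vector_Spaces.linear smul smul A \<and>
                     continuous_map (strong_topology smul \<F>) (strong_topology smul \<F>) A}"

section \<open>Wightman conformal field theories\<close>

locale wightman_cft = vector_space smul
  for smul :: "complex \<Rightarrow> 'd::ab_group_add \<Rightarrow> 'd" +
  fixes \<F> :: "'d qfield set"
    and d :: "'d qfield \<Rightarrow> nat"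
    and U :: "(complex \<Rightarrow> complex) \<Rightarrow> 'd \<Rightarrow> 'd"
    and \<Omega> :: 'd
  assumes fields: "\<phi> \<in> \<F> \<Longrightarrow> operator_valued_distribution smul \<phi>"
    and regular: "acts_regularly smul \<F>"
    and U_End: "\<gamma> \<in> Mob \<Longrightarrow> U \<gamma> \<in> End smul \<F>"
    and U_id: "U id = id"
    and U_comp: "\<gamma> \<in> Mob \<Longrightarrow> \<delta> \<in> Mob \<Longrightarrow> U (\<gamma> \<circ> \<delta>) = U \<gamma> \<circ> U \<delta>"
    and vacuum_nonzero: "\<Omega> \<noteq> 0"
    and covariance: "\<phi> \<in> \<F> \<Longrightarrow> \<gamma> \<in> Mob \<Longrightarrow> f \<in> smooth_circle \<Longrightarrow>
      U \<gamma> \<circ> \<phi> f \<circ> inv (U \<gamma>) = \<phi> (beta (d \<phi>) \<gamma> f)"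
    and locality: "\<phi> \<in> \<F> \<Longrightarrow> \<psi> \<in> \<F> \<Longrightarrow> f \<in> smooth_circle \<Longrightarrow> g \<in> smooth_circle \<Longrightarrow>
      circle_support f \<inter> circle_support g = {} \<Longrightarrow> \<phi> f \<circ> \<psi> g = \<psi> g \<circ> \<phi> f"
    and spectrum: "(n::int) < 0 \<Longrightarrow> (\<And>\<theta>. U (rot \<theta>) \<Phi> = smul (cis (of_int n * \<theta>)) \<Phi>) \<Longrightarrow> \<Phi> = 0"
    and vacuum_invariant: "\<gamma> \<in> Mob \<Longrightarrow> U \<gamma> \<Omega> = \<Omega>"
    and vacuum_cyclic:
      "span {field_product \<phi>s f \<Omega> | \<phi>s f. set \<phi>s \<subseteq> \<F> \<and> (\<forall>j < length \<phi>s. f j \<in> smooth_circle)} = UNIV"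

definition dagger ::
    "(complex \<Rightarrow> 'd \<Rightarrow> 'd) \<Rightarrow> ('d qfield \<Rightarrow> nat) \<Rightarrow> ('d \<Rightarrow> 'd) \<Rightarrow> 'd qfield \<Rightarrow> 'd qfield" where
  "dagger smul d pct \<phi> f \<Phi> = smul ((-1) ^ d \<phi>) (pct (\<phi> (\<lambda>z. cnj (f (inverse z))) (pct \<Phi>)))"

locale involutive_wightman_cft = wightman_cft smul \<F> d U \<Omega>
  for smul :: "complex \<Rightarrow> 'd::ab_group_add \<Rightarrow> 'd"
    and \<F> :: "'d qfield set"
    and d :: "'d qfield \<Rightarrow> nat"
    and U :: "(complex \<Rightarrow> complex) \<Rightarrow> 'd \<Rightarrow> 'd"
    and \<Omega> :: 'd +
  fixes form :: "'d \<Rightarrow> 'd \<Rightarrow> complex"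
    and pct :: "'d \<Rightarrow> 'd"
  assumes form_linear: "Vector_Spaces.linear smul (*) (\<lambda>\<Phi>. form \<Phi> \<Psi>)"
    and form_hermitian: "form \<Psi> \<Phi> = cnj (form \<Phi> \<Psi>)"
    and form_nondegenerate: "(\<And>\<Psi>. form \<Phi> \<Psi> = 0) \<Longrightarrow> \<Phi> = 0"
    and form_continuous:
      "continuous_map (prod_topology (strong_topology smul \<F>) (strong_topology smul \<F>)) euclidean
         (\<lambda>(\<Phi>, \<Psi>). form \<Phi> \<Psi>)"
    and pct_add: "pct (\<Phi> + \<Psi>) = pct \<Phi> + pct \<Psi>"
    and pct_scale: "pct (smul c \<Phi>) = smul (cnj c) (pct \<Phi>)"
    and pct_involution: "pct (pct \<Phi>) = \<Phi>"
    and pct_antiunitary: "form (pct \<Phi>) (pct \<Psi>) = cnj (form \<Phi> \<Psi>)"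
    and pct_vacuum: "pct \<Omega> = \<Omega>"
    and form_invariant: "\<phi> \<in> \<F> \<Longrightarrow> f \<in> smooth_circle \<Longrightarrow>
      form (\<phi> f \<Phi>) \<Psi> = form \<Phi> (dagger smul d pct \<phi> (\<lambda>z. cnj (f z)) \<Psi>)"
    and dagger_closed: "\<phi> \<in> \<F> \<Longrightarrow>
      (\<lambda>f \<Phi>. smul ((-1) ^ d \<phi>) (dagger smul d pct \<phi> f \<Phi>)) \<in> \<F>"
    and U_unitary: "\<gamma> \<in> Mob \<Longrightarrow> form (U \<gamma> \<Phi>) (U \<gamma> \<Psi>) = form \<Phi> \<Psi>"

section \<open>Local algebras and boosts\<close>

definition unital_subalgebra ::
    "(complex \<Rightarrow> 'd \<Rightarrow> 'd) \<Rightarrow> ('d \<Rightarrow> 'd::ab_group_add) set \<Rightarrow> bool" where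
  "unital_subalgebra smul A \<longleftrightarrow>
     id \<in> A \<and>
     (\<forall>x\<in>A. \<forall>y\<in>A. (\<lambda>\<Phi>. x \<Phi> + y \<Phi>) \<in> A) \<and>
     (\<forall>x\<in>A. \<forall>c. (\<lambda>\<Phi>. smul c (x \<Phi>)) \<in> A) \<and>
     (\<forall>x\<in>A. \<forall>y\<in>A. x \<circ> y \<in> A)"

definition local_algebra ::
    "(complex \<Rightarrow> 'd \<Rightarrow> 'd) \<Rightarrow> 'd::ab_group_add qfield set \<Rightarrow> complex set \<Rightarrow> ('d \<Rightarrow> 'd) set" where
  "local_algebra smul \<F> I =
     \<Inter> {A. unital_subalgebra smul A \<and>
          (\<forall>\<phi>\<in>\<F>. \<forall>f\<in>smooth_circle. circle_support f \<subseteq> I \<longrightarrow> \<phi> f \<in> A)}"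

definition upper_semicircle :: "complex set" where
  "upper_semicircle = {z \<in> sphere 0 1. Im z > 0}"

definition vacuum_functional :: "('d \<Rightarrow> 'd \<Rightarrow> complex) \<Rightarrow> 'd \<Rightarrow> ('d \<Rightarrow> 'd) \<Rightarrow> complex" where
  "vacuum_functional form \<Omega> x = form (x \<Omega>) \<Omega>"

definition boost_aut ::
    "((complex \<Rightarrow> complex) \<Rightarrow> 'd \<Rightarrow> 'd) \<Rightarrow> real \<Rightarrow> ('d \<Rightarrow> 'd) \<Rightarrow> 'd \<Rightarrow> 'd" where
  "boost_aut U t y = U (boost t) \<circ> y \<circ> inv (U (boost t))"

definition strip :: "complex set" where
  "strip = {\<tau>. 0 \<le> Im \<tau> \<and> Im \<tau> \<le> 2 * pi}"

end

(*
  In the coordinate u = ln (tan (theta / 2)) the semicircle I_+ becomes the real line and the boosts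
  become translations. If h is entire and decreases rapidly on horizontal strips, then h(u), weighted
  by X^(d-1), is one half of the boundary value of a function holomorphic in the disk, except possibly
  at the origin; the other half, on I_-, is the reflection of the test function attached to
  h(u + i pi). By the spectrum condition and the boosts, all modes of phi that extend into the disk
  annihilate the vacuum, so phi can be carried from I_+ through the disk to I_-, where it commutes
  with the operators of I_+; by invariance of the form it also acts on the vacuum from the left and
  can be carried back to I_+ through the exterior of the disk. In total u is shifted by 2 pi i, and
  moving the factors of y around one at a time gives the KMS relation for products of such fields,
  whose correlators are entire in the boost parameter.

  Arbitrary test functions on I_+ are convolved with Gaussians. The approximating correlators
  converge, up to a factor exp(K |t|), uniformly on the two boundary lines of the strip; after
  multiplication by exp(- tau^2) the maximum principle gives uniform convergence on the whole strip.
*)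
theory Submission
  imports Defs "HOL-Complex_Analysis.Complex_Analysis" "HOL-Probability.Distributions"
begin

section \<open>Smooth functions on the circle\<close>

text \<open>Without positivity there is no Hilbert space, so no spectral calculus for V_t and no
  analytic vectors; only correlators are available, as jointly continuous multilinear functionals of
  the test functions. All analyticity has to come from the test functions, and every limit has to be
  controlled by a single \<open>C_norm N\<close>. The obstacle: a nonzero test function supported in
  I_+ has compact support in u, hence no analytic continuation, while the arc functions of entire
  ones reach the end points 1 and -1, where I_+ and I_- touch and locality gives nothing. Rapid
  decrease in u, that is, flatness at the end points, is the compromise: Gaussian approximants have
  it, and it allows cutting off. The weight X^(d-1) makes boosts exact translations of u; its price
  is a pole of order d-1 at the origin for d > 1, so that the vacuum has to be annihilated by all
  modes n > -d and not just by n > 0. Each half turn costs a sign (-1)^d, and the two signs cancel.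
  The factor exp(K |t|) is the cost of a translation in the weighted norms; K grows with N and with
  the number of fields.\<close>

lemma angular_deriv_0: "angular_deriv 0 f \<theta> = f (cis \<theta>)"
  by (simp add: angular_deriv_def)

lemma angular_deriv_Suc: "angular_deriv (Suc j) f \<theta> = vector_derivative (angular_deriv j f) (at \<theta>)"
  by (simp add: angular_deriv_def)

lemma angular_deriv_has_derivative:
  assumes "f \<in> smooth_circle"
  shows "(angular_deriv j f has_vector_derivative angular_deriv (Suc j) f \<theta>) (at \<theta>)"
  using assms by (simp add: angular_deriv_Suc smooth_circle_def vector_derivative_works[symmetric])

text \<open>\<open>vector_derivative\<close> is a choice operator, so iterated derivatives are not
  computed from the definition: a tower \<open>G\<close> of functions, each the derivative of the
  one before, determines all orders at once. \<open>iter_deriv_unique\<close> is the same device on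
  the line.\<close>

lemma angular_deriv_unique:
  assumes "\<And>\<theta>. f (cis \<theta>) = G 0 \<theta>"
    and "\<And>j \<theta>. (G j has_vector_derivative G (Suc j) \<theta>) (at \<theta>)"
  shows "angular_deriv j f = G j"
proof (induction j)
  case 0
  show ?case using assms(1) by (auto simp: angular_deriv_0)
next
  case (Suc j)
  show ?case
    using assms(2)[of j] by (auto simp: angular_deriv_Suc Suc intro: vector_derivative_at)
qed

lemma smooth_circleI:
  assumes "\<And>z. z \<notin> sphere 0 1 \<Longrightarrow> f z = 0"
    and "\<And>\<theta>. f (cis \<theta>) = G 0 \<theta>"
    and "\<And>j \<theta>. (G j has_vector_derivative G (Suc j) \<theta>) (at \<theta>)"
  shows "f \<in> smooth_circle"
proof -
  have "angular_deriv j f differentiable (at \<theta>)" for j \<theta>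
    using assms(3)[of j \<theta>] angular_deriv_unique[of f G, OF assms(2,3)]
    by (simp add: differentiableI_vector)
  then show ?thesis using assms(1) by (auto simp: smooth_circle_def)
qed

lemma smooth_circle_outside: "f \<in> smooth_circle \<Longrightarrow> z \<notin> sphere 0 1 \<Longrightarrow> f z = 0"
  by (simp add: smooth_circle_def)

lemma smooth_circle_eqI:
  assumes "\<And>z. z \<notin> sphere 0 1 \<Longrightarrow> f z = 0" "\<And>z. z \<notin> sphere 0 1 \<Longrightarrow> g z = 0"
    and "\<And>\<theta>. f (cis \<theta>) = g (cis \<theta>)"
  shows "f = g"
proof
  fix z show "f z = g z"
  proof (cases "cmod z = 1")
    case True
    then have "z \<noteq> 0" by auto
    then have "cis (Arg z) = z" using True by (simp add: cis_Arg sgn_div_norm)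
    then show ?thesis using assms(3)[of "Arg z"] by simp
  next
    case False then show ?thesis using assms(1,2) by simp
  qed
qed

lemma angular_deriv_add:
  assumes "f \<in> smooth_circle" "g \<in> smooth_circle"
  shows "angular_deriv j (\<lambda>z. f z + g z) = (\<lambda>\<theta>. angular_deriv j f \<theta> + angular_deriv j g \<theta>)"
  by (rule angular_deriv_unique)
     (auto simp: angular_deriv_0 intro: has_vector_derivative_add assms angular_deriv_has_derivative)

lemma angular_deriv_scale:
  assumes "f \<in> smooth_circle"
  shows "angular_deriv j (\<lambda>z. c * f z) = (\<lambda>\<theta>. c * angular_deriv j f \<theta>)"
  by (rule angular_deriv_unique)
     (auto simp: angular_deriv_0 intro!: has_vector_derivative_mult_right assms angular_deriv_has_derivative)

lemma smooth_circle_add: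
  assumes "f \<in> smooth_circle" "g \<in> smooth_circle"
  shows "(\<lambda>z. f z + g z) \<in> smooth_circle"
  by (rule smooth_circleI[where G = "\<lambda>j \<theta>. angular_deriv j f \<theta> + angular_deriv j g \<theta>"])
     (use assms in \<open>auto simp: angular_deriv_0 smooth_circle_outside
        intro: has_vector_derivative_add angular_deriv_has_derivative\<close>)

lemma smooth_circle_scale:
  assumes "f \<in> smooth_circle"
  shows "(\<lambda>z. c * f z) \<in> smooth_circle"
  by (rule smooth_circleI[where G = "\<lambda>j \<theta>. c * angular_deriv j f \<theta>"])
     (use assms in \<open>auto simp: angular_deriv_0 smooth_circle_outside
        intro!: has_vector_derivative_mult_right angular_deriv_has_derivative\<close>)

lemma smooth_circle_zero: "(\<lambda>z. 0) \<in> smooth_circle"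
  by (rule smooth_circleI[where G = "\<lambda>j \<theta>. 0"]) auto

lemma smooth_circle_diff:
  assumes "f \<in> smooth_circle" "g \<in> smooth_circle"
  shows "(\<lambda>z. f z - g z) \<in> smooth_circle"
  using smooth_circle_add[OF assms(1) smooth_circle_scale[OF assms(2), of "-1"]] by simp

lemma angular_deriv_diff:
  assumes "f \<in> smooth_circle" "g \<in> smooth_circle"
  shows "angular_deriv j (\<lambda>z. f z - g z) = (\<lambda>\<theta>. angular_deriv j f \<theta> - angular_deriv j g \<theta>)"
  using angular_deriv_add[OF assms(1) smooth_circle_scale[OF assms(2), of "-1"]]
    angular_deriv_scale[OF assms(2), of _ "-1"] by simp

lemma smooth_circle_sum:
  assumes "\<And>i. i \<in> A \<Longrightarrow> f i \<in> smooth_circle"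
  shows "(\<lambda>z. \<Sum>i\<in>A. f i z) \<in> smooth_circle"
  using assms
  by (induction A rule: infinite_finite_induct) (auto intro: smooth_circle_zero smooth_circle_add)

text \<open>On the circle this is conjugation of the argument and exchanges the two semicircles.
  Written with \<open>inverse\<close>, it visibly sends \<open>mode n\<close> to
  \<open>mode (- n)\<close>; it also keeps the value 0 off the circle, because
  \<open>inverse\<close> maps the complement of the circle to itself.\<close>

definition reflect :: "(complex \<Rightarrow> complex) \<Rightarrow> complex \<Rightarrow> complex" where
  "reflect f = (\<lambda>z. f (inverse z))"

lemma reflect_reflect [simp]: "reflect (reflect f) = f"
  by (simp add: reflect_def)

lemma reflect_cis: "reflect f (cis \<theta>) = f (cis (- \<theta>))"
  by (simp add: reflect_def cis_inverse)

lemma reflect_derivative: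
  assumes "f \<in> smooth_circle"
  shows "((\<lambda>\<theta>. (-1)^j * angular_deriv j f (- \<theta>)) has_vector_derivative
           (-1)^(Suc j) * angular_deriv (Suc j) f (- \<theta>)) (at \<theta>)"
proof -
  have "((\<lambda>\<theta>. angular_deriv j f (- \<theta>)) has_vector_derivative (-1) *\<^sub>R angular_deriv (Suc j) f (- \<theta>)) (at \<theta>)"
    by (rule vector_diff_chain_at[of uminus "-1", unfolded o_def])
       (auto intro!: derivative_eq_intros angular_deriv_has_derivative[OF assms])
  from has_vector_derivative_mult_right[OF this, of "(-1)^j"] show ?thesis by simp
qed

lemma smooth_circle_reflect:
  assumes "f \<in> smooth_circle"
  shows "reflect f \<in> smooth_circle"
  by (rule smooth_circleI[where G = "\<lambda>j \<theta>. (-1)^j * angular_deriv j f (- \<theta>)"])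
     (use assms reflect_derivative in \<open>auto simp: angular_deriv_0 reflect_cis reflect_def norm_inverse
        intro!: smooth_circle_outside[OF assms]\<close>)

lemma angular_deriv_reflect:
  assumes "f \<in> smooth_circle"
  shows "angular_deriv j (reflect f) = (\<lambda>\<theta>. (-1)^j * angular_deriv j f (- \<theta>))"
  by (rule angular_deriv_unique) (use assms reflect_derivative in \<open>auto simp: angular_deriv_0 reflect_cis\<close>)

section \<open>Fourier modes\<close>

definition mode :: "int \<Rightarrow> complex \<Rightarrow> complex" where
  "mode n z = (if z \<in> sphere 0 1 then z powi n else 0)"

lemma mode_cis: "mode n (cis \<theta>) = cis (of_int n * \<theta>)"
  by (simp add: mode_def cis_power_int)

lemma mode_derivative:
  "((\<lambda>\<theta>. (\<i> * of_int n)^j * cis (of_int n * \<theta>)) has_vector_derivative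
           (\<i> * of_int n)^(Suc j) * cis (of_int n * \<theta>)) (at \<theta>)"
proof -
  have "((\<lambda>\<theta>. cis (of_int n * \<theta>)) has_vector_derivative of_int n *\<^sub>R (\<i> * cis (of_int n * \<theta>))) (at \<theta>)"
    by (rule vector_diff_chain_at[of "\<lambda>\<theta>. of_int n * \<theta>" "of_int n" _ cis, unfolded o_def])
       (auto intro!: derivative_eq_intros simp: has_vector_derivative_def cis_conv_exp scaleR_conv_of_real mult_ac)
  from has_vector_derivative_mult_right[OF this, of "(\<i> * of_int n)^j"] show ?thesis
    by (simp add: scaleR_conv_of_real mult_ac)
qed

lemma smooth_circle_mode: "mode n \<in> smooth_circle"
  by (rule smooth_circleI[where G = "\<lambda>j \<theta>. (\<i> * of_int n)^j * cis (of_int n * \<theta>)"])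
     (use mode_derivative in \<open>auto simp: mode_def cis_power_int\<close>)

lemma reflect_mode: "reflect (mode n) = mode (- n)"
  by (auto simp: reflect_def mode_def fun_eq_iff norm_inverse power_int_minus power_int_inverse)

section \<open>Periodicity and the C^N norms\<close>

lemma angular_deriv_periodic:
  "angular_deriv j f (\<theta> + 2 * pi) = angular_deriv j f \<theta>"
proof -
  have cs: "cis (\<theta> + 2 * pi) = cis \<theta>" for \<theta> by (simp add: cis_mult[symmetric])
  show ?thesis
  proof (induction j arbitrary: \<theta>)
    case 0 then show ?case by (simp add: angular_deriv_0 cs)
  next
    case (Suc j)
    \<comment> \<open>The defining predicates are compared for every candidate \<open>D\<close>.
      Since \<open>vector_derivative\<close> is a choice, this also settles the points where no
      derivative exists.\<close>
    have eq: "(angular_deriv j f has_vector_derivative D) (at (\<theta> + 2 * pi)) \<longleftrightarrow>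
          (angular_deriv j f has_vector_derivative D) (at \<theta>)" for D
    proof
      assume "(angular_deriv j f has_vector_derivative D) (at (\<theta> + 2 * pi))"
      then have "(angular_deriv j f \<circ> (\<lambda>x. x + 2 * pi) has_vector_derivative 1 *\<^sub>R D) (at \<theta>)"
        by (intro vector_diff_chain_at) (auto intro!: derivative_eq_intros)
      then show "(angular_deriv j f has_vector_derivative D) (at \<theta>)" by (simp add: o_def Suc)
    next
      assume "(angular_deriv j f has_vector_derivative D) (at \<theta>)"
      then have "(angular_deriv j f \<circ> (\<lambda>x. x - 2 * pi) has_vector_derivative 1 *\<^sub>R D) (at (\<theta> + 2 * pi))"
        by (intro vector_diff_chain_at) (auto intro!: derivative_eq_intros)
      moreover have "angular_deriv j f (x - 2 * pi) = angular_deriv j f x" for x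
        using Suc[of "x - 2 * pi"] by simp
      ultimately show "(angular_deriv j f has_vector_derivative D) (at (\<theta> + 2 * pi))" by (simp add: o_def)
    qed
    show ?case unfolding angular_deriv_Suc vector_derivative_def eq ..
  qed
qed

text \<open>The supremum in \<open>C_norm\<close> runs over the whole line and has a meaning only
  for a set that is bounded above; compactness of one period together with periodicity provides
  this.\<close>

lemma angular_deriv_bounded:
  assumes "f \<in> smooth_circle"
  shows "bdd_above (range (\<lambda>\<theta>. norm (angular_deriv j f \<theta>)))"
proof -
  have "continuous_on {0..2*pi} (angular_deriv j f)"
    by (meson angular_deriv_has_derivative[OF assms] continuous_at_imp_continuous_on has_vector_derivative_continuous)
  then have "compact (angular_deriv j f ` {0..2*pi})" by (rule compact_continuous_image) simp
  then obtain B where B: "\<And>x. x \<in> {0..2*pi} \<Longrightarrow> norm (angular_deriv j f x) \<le> B"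
    using compact_imp_bounded bounded_iff by (metis imageI)
  have per: "angular_deriv j f (x + 2 * pi * of_int n) = angular_deriv j f x" for x n
  proof (induction n rule: int_induct[where k = 0])
    case base then show ?case by simp
  next
    case (step1 i)
    show ?case using angular_deriv_periodic[of j f "x + 2 * pi * of_int i"] step1 by (simp add: algebra_simps)
  next
    case (step2 i)
    show ?case using angular_deriv_periodic[of j f "x + 2 * pi * of_int (i - 1)"] step2 by (simp add: algebra_simps)
  qed
  have "norm (angular_deriv j f x) \<le> B" for x
  proof -
    define n where "n = \<lfloor>x / (2*pi)\<rfloor>"
    have "of_int n \<le> x / (2*pi)" "x / (2*pi) < of_int n + 1" unfolding n_def by linarith+
    then have "x + 2 * pi * of_int (-n) \<in> {0..2*pi}" by (auto simp: field_simps)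
    from B[OF this] show ?thesis unfolding per .
  qed
  then show ?thesis by (intro bdd_aboveI[of _ B]) auto
qed

lemma norm_angular_deriv_le_C_norm:
  assumes "f \<in> smooth_circle" "j \<le> N"
  shows "norm (angular_deriv j f \<theta>) \<le> C_norm N f"
proof -
  have le: "norm (angular_deriv i f x) \<le> (SUP \<theta>. norm (angular_deriv i f \<theta>))" for i x
    by (rule cSUP_upper[OF _ angular_deriv_bounded[OF assms(1)]]) simp
  have nn: "0 \<le> (SUP \<theta>. norm (angular_deriv i f \<theta>))" for i
    using le[of i 0] norm_ge_zero order_trans by blast
  show ?thesis unfolding C_norm_def
    by (rule order_trans[OF le[of j \<theta>]], rule member_le_sum) (use assms nn in auto)
qed

lemma C_norm_nonneg: "f \<in> smooth_circle \<Longrightarrow> 0 \<le> C_norm N f"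
  using norm_angular_deriv_le_C_norm[of f 0 N 0] norm_ge_zero order_trans by blast

lemma C_norm_le:
  assumes "\<And>j \<theta>. j \<le> N \<Longrightarrow> norm (angular_deriv j f \<theta>) \<le> B j"
  shows "C_norm N f \<le> (\<Sum>j\<le>N. B j)"
  unfolding C_norm_def by (intro sum_mono cSUP_least) (use assms in auto)

lemma C_norm_mono:
  assumes "f \<in> smooth_circle" "N \<le> M"
  shows "C_norm N f \<le> C_norm M f"
proof -
  have nn: "0 \<le> (SUP \<theta>. norm (angular_deriv i f \<theta>))" for i
    by (rule order_trans[OF norm_ge_zero cSUP_upper[OF UNIV_I angular_deriv_bounded[OF assms(1)]]])
  show ?thesis unfolding C_norm_def by (rule sum_mono2) (use assms nn in auto)
qed

lemma C_norm_scale: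
  assumes "f \<in> smooth_circle"
  shows "C_norm N (\<lambda>z. c * f z) = cmod c * C_norm N f"
proof -
  have "(SUP \<theta>. norm (c * angular_deriv j f \<theta>)) = norm c * (SUP \<theta>. norm (angular_deriv j f \<theta>))" for j
  proof (cases "c = 0")
    case False
    have bd: "bdd_above (range (\<lambda>\<theta>. cmod (c * angular_deriv j f \<theta>)))"
      using angular_deriv_bounded[OF smooth_circle_scale[OF assms], of j c] by (simp add: angular_deriv_scale[OF assms])
    show ?thesis
    proof (rule antisym)
      show "(SUP \<theta>. norm (c * angular_deriv j f \<theta>)) \<le> norm c * (SUP \<theta>. norm (angular_deriv j f \<theta>))"
        by (intro cSUP_least) (auto simp: norm_mult intro!: mult_left_mono cSUP_upper angular_deriv_bounded assms)
      have "(SUP \<theta>. norm (angular_deriv j f \<theta>)) \<le> (SUP \<theta>. norm (c * angular_deriv j f \<theta>)) / norm c"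
      proof (intro cSUP_least)
        fix x
        have "cmod (c * angular_deriv j f x) \<le> (SUP \<theta>. norm (c * angular_deriv j f \<theta>))"
          by (rule cSUP_upper[OF _ bd]) simp
        then show "cmod (angular_deriv j f x) \<le> (SUP \<theta>. norm (c * angular_deriv j f \<theta>)) / norm c"
          using False by (simp add: norm_mult field_simps)
      qed simp
      then show "norm c * (SUP \<theta>. norm (angular_deriv j f \<theta>)) \<le> (SUP \<theta>. norm (c * angular_deriv j f \<theta>))"
        using False by (simp add: field_simps)
    qed
  qed auto
  then show ?thesis by (simp add: C_norm_def angular_deriv_scale[OF assms] sum_distrib_left)
qed

lemma C_norm_triangle:
  assumes "f \<in> smooth_circle" "g \<in> smooth_circle"
  shows "C_norm N (\<lambda>z. f z + g z) \<le> C_norm N f + C_norm N g"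
  unfolding C_norm_def sum.distrib[symmetric] angular_deriv_add[OF assms]
proof (intro sum_mono cSUP_least)
  fix i x
  show "norm (angular_deriv i f x + angular_deriv i g x)
      \<le> (SUP \<theta>. norm (angular_deriv i f \<theta>)) + (SUP \<theta>. norm (angular_deriv i g \<theta>))"
    by (rule order_trans[OF norm_triangle_ineq], intro add_mono cSUP_upper angular_deriv_bounded assms) simp_all
qed simp

lemma C_norm_reflect:
  assumes "f \<in> smooth_circle"
  shows "C_norm N (reflect f) = C_norm N f"
proof -
  have "range (\<lambda>\<theta>. norm (angular_deriv j f (- \<theta>))) = range (\<lambda>\<theta>. norm (angular_deriv j f \<theta>))" for j
    by (metis (no_types, lifting) surj_def minus_minus image_image[of "\<lambda>\<theta>. norm (angular_deriv j f \<theta>)" uminus UNIV])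
  then show ?thesis
    by (simp add: C_norm_def angular_deriv_reflect[OF assms] norm_mult norm_power)
qed

text \<open>\<open>C\<^sup>\<infinity>(S\<^sup>1)'\<close>: continuity for the Frechet topology amounts to a bound by a single \<open>C\<^sup>N\<close> norm.\<close>

definition circle_distribution :: "((complex \<Rightarrow> complex) \<Rightarrow> complex) \<Rightarrow> bool" where
  "circle_distribution L \<longleftrightarrow>
     (\<forall>f \<in> smooth_circle. \<forall>g \<in> smooth_circle. L (\<lambda>z. f z + g z) = L f + L g) \<and>
     (\<forall>f \<in> smooth_circle. \<forall>c. L (\<lambda>z. c * f z) = c * L f) \<and>
     (\<exists>N C. \<forall>f \<in> smooth_circle. norm (L f) \<le> C * C_norm N f)"

lemma circle_distribution_add:
  "circle_distribution L \<Longrightarrow> f \<in> smooth_circle \<Longrightarrow> g \<in> smooth_circle \<Longrightarrow> L (\<lambda>z. f z + g z) = L f + L g"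
  by (simp add: circle_distribution_def)

lemma circle_distribution_scale:
  "circle_distribution L \<Longrightarrow> f \<in> smooth_circle \<Longrightarrow> L (\<lambda>z. c * f z) = c * L f"
  by (simp add: circle_distribution_def)

lemma circle_distribution_zero: "circle_distribution L \<Longrightarrow> L (\<lambda>z. 0) = 0"
  using circle_distribution_scale[OF _ smooth_circle_zero, of L 0] by simp

lemma circle_distribution_diff:
  "circle_distribution L \<Longrightarrow> f \<in> smooth_circle \<Longrightarrow> g \<in> smooth_circle \<Longrightarrow> L (\<lambda>z. f z - g z) = L f - L g"
  using circle_distribution_add[OF _ _ smooth_circle_scale, of L f g "-1"]
    circle_distribution_scale[of L g "-1"] by simp

lemma circle_distribution_sum:
  assumes "circle_distribution L" "\<And>i. i \<in> A \<Longrightarrow> f i \<in> smooth_circle"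
  shows "L (\<lambda>z. \<Sum>i\<in>A. f i z) = (\<Sum>i\<in>A. L (f i))"
  using assms(2)
  by (induction A rule: infinite_finite_induct)
     (auto simp: circle_distribution_zero[OF assms(1)] circle_distribution_add[OF assms(1)] smooth_circle_sum)

lemma circle_distribution_bound:
  assumes "circle_distribution L"
  obtains N C where "C \<ge> 0" "\<And>f. f \<in> smooth_circle \<Longrightarrow> norm (L f) \<le> C * C_norm N f"
proof -
  obtain N C where *: "\<And>f. f \<in> smooth_circle \<Longrightarrow> norm (L f) \<le> C * C_norm N f"
    using assms unfolding circle_distribution_def by blast
  show ?thesis
  proof (rule that[of "\<bar>C\<bar>" N])
    fix f assume f: "f \<in> smooth_circle"
    have "C * C_norm N f \<le> \<bar>C\<bar> * C_norm N f" using C_norm_nonneg[OF f, of N] by (intro mult_right_mono) auto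
    then show "norm (L f) \<le> \<bar>C\<bar> * C_norm N f" using *[OF f] by simp
  qed simp
qed

lemma circle_distribution_tendsto:
  assumes L: "circle_distribution L" and "\<And>m. f m \<in> smooth_circle" "g \<in> smooth_circle"
    and "\<And>N. (\<lambda>m. C_norm N (\<lambda>z. f m z - g z)) \<longlonglongrightarrow> 0"
  shows "(\<lambda>m. L (f m)) \<longlonglongrightarrow> L g"
proof -
  obtain N C where C: "\<And>f. f \<in> smooth_circle \<Longrightarrow> norm (L f) \<le> C * C_norm N f"
    using circle_distribution_bound[OF L] by blast
  have "(\<lambda>m. C * C_norm N (\<lambda>z. f m z - g z)) \<longlonglongrightarrow> C * 0" by (intro tendsto_intros assms)
  then have lim: "(\<lambda>m. C * C_norm N (\<lambda>z. f m z - g z)) \<longlonglongrightarrow> 0" by simp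
  have "norm (L (f m) - L g) \<le> C * C_norm N (\<lambda>z. f m z - g z)" for m
    using C[OF smooth_circle_diff[OF assms(2,3)]] by (simp add: circle_distribution_diff[OF L assms(2,3)])
  then have "(\<lambda>m. L (f m) - L g) \<longlonglongrightarrow> 0"
    by (intro Lim_null_comparison[OF _ lim] always_eventually) simp
  then show ?thesis by (simp add: LIM_zero_iff)
qed

lemma circle_distribution_reflect:
  assumes L: "circle_distribution L"
  shows "circle_distribution (\<lambda>f. L (reflect f))"
proof -
  have "reflect (\<lambda>z. f z + g z) = (\<lambda>z. reflect f z + reflect g z)" "reflect (\<lambda>z. c * f z) = (\<lambda>z. c * reflect f z)"
    for f g c by (auto simp: reflect_def)
  moreover obtain N C where "\<And>f. f \<in> smooth_circle \<Longrightarrow> norm (L f) \<le> C * C_norm N f"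
    using circle_distribution_bound[OF L] by blast
  then have "\<forall>f \<in> smooth_circle. norm (L (reflect f)) \<le> C * C_norm N f"
    by (metis C_norm_reflect smooth_circle_reflect)
  ultimately show ?thesis unfolding circle_distribution_def
    by (auto simp: smooth_circle_reflect circle_distribution_add[OF L] circle_distribution_scale[OF L])
qed

section \<open>Functionals and boundary values\<close>

lemma has_vector_derivative_cis_mult:
  "((\<lambda>t. cis (a * t)) has_vector_derivative \<i> * of_real a * cis (a * t)) (at t within S)"
proof -
  have "(cis has_vector_derivative \<i> * cis x) (at x within T)" for x T
    by (auto intro!: derivative_eq_intros simp: has_vector_derivative_def scaleR_conv_of_real mult_ac)
  then have "((cis \<circ> (\<lambda>t. a * t)) has_vector_derivative a *\<^sub>R (\<i> * cis (a * t))) (at t within S)"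
    by (intro vector_diff_chain_within) (auto intro!: derivative_eq_intros)
  then show ?thesis by (simp add: o_def scaleR_conv_of_real mult_ac)
qed

text \<open>Integration by parts, one derivative at a time: the boundary terms at 0 and 1 cancel by
  periodicity, and each step contributes a factor i n. The period is scaled to [0,1] because
  \<open>circlepath\<close> is parametrised that way.\<close>

lemma fourier_coefficient_deriv:
  assumes q: "q \<in> smooth_circle"
    and a: "((\<lambda>t. q (cis (2 * pi * t)) * cis (- (2 * pi * of_int n) * t)) has_integral a) {0..1}"
  shows "((\<lambda>t. angular_deriv j q (2 * pi * t) * cis (- (2 * pi * of_int n) * t))
            has_integral (\<i> * of_int n) ^ j * a) {0..1}"
proof (induction j)
  case 0
  then show ?case using a by (simp add: angular_deriv_0)
next
  case (Suc j)
  let ?h = "\<lambda>t. angular_deriv j q (2 * pi * t)" and ?e = "\<lambda>t. cis (- (2 * pi * of_int n) * t)"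
  let ?h' = "\<lambda>t. angular_deriv (Suc j) q (2 * pi * t)"
  have h: "(?h has_vector_derivative (2 * pi) *\<^sub>R ?h' t) (at t within S)" for t S
  proof -
    have "((angular_deriv j q \<circ> (\<lambda>t. 2 * pi * t)) has_vector_derivative (2 * pi) *\<^sub>R ?h' t) (at t within S)"
      by (intro vector_diff_chain_within has_vector_derivative_at_within[OF angular_deriv_has_derivative[OF q]])
         (auto intro!: derivative_eq_intros)
    then show ?thesis by (simp add: o_def)
  qed
  have "((\<lambda>t. ?h t * ?e t) has_vector_derivative
        ?h t * (\<i> * of_real (- (2 * pi * of_int n)) * ?e t) + (2 * pi) *\<^sub>R ?h' t * ?e t) (at t within {0..1})" for t
    by (rule has_vector_derivative_mult[OF h has_vector_derivative_cis_mult])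
  then have "((\<lambda>t. ?h t * (\<i> * of_real (- (2 * pi * of_int n)) * ?e t) + (2 * pi) *\<^sub>R ?h' t * ?e t)
      has_integral (?h 1 * ?e 1 - ?h 0 * ?e 0)) {0..1}"
    by (intro fundamental_theorem_of_calculus) auto
  moreover have "?e 1 = 1"
    by (simp add: cis_multiple_2pi flip: cis_inverse)
  ultimately have 0: "((\<lambda>t. ?h t * (\<i> * of_real (- (2 * pi * of_int n)) * ?e t) + (2 * pi) *\<^sub>R ?h' t * ?e t)
      has_integral 0) {0..1}"
    using angular_deriv_periodic[of j q 0] by simp
  have "((\<lambda>t. (\<i> * of_real (2 * pi * of_int n)) * (?h t * ?e t)) has_integral
      (\<i> * of_real (2 * pi * of_int n)) * ((\<i> * of_int n) ^ j * a)) {0..1}"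
    by (rule has_integral_mult_right[OF Suc])
  from has_integral_add[OF 0 this]
  have "((\<lambda>t. (2 * pi) *\<^sub>R ?h' t * ?e t) has_integral
      (\<i> * of_real (2 * pi * of_int n)) * ((\<i> * of_int n) ^ j * a)) {0..1}"
    by (simp add: algebra_simps)
  from has_integral_mult_right[OF this, of "1 / (2 * of_real pi)"] show ?case
    by (simp add: scaleR_conv_of_real field_simps)
qed

lemma fourier_coefficient_bound:
  assumes q: "q \<in> smooth_circle"
    and a: "((\<lambda>t. q (cis (2 * pi * t)) * cis (- (2 * pi * of_int n) * t)) has_integral a) {0..1}"
  shows "\<bar>of_int n\<bar> ^ j * cmod a \<le> C_norm j q"
proof -
  have "norm ((\<i> * of_int n) ^ j * a) \<le> C_norm j q * measure lborel {0..1::real}"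
    by (rule has_integral_bound_real[OF _ finite.emptyI fourier_coefficient_deriv[OF assms]])
       (auto simp: norm_mult intro: C_norm_nonneg q norm_angular_deriv_le_C_norm)
  then show ?thesis by (simp add: norm_mult norm_power)
qed

text \<open>Cauchy's formula for the k-th derivative needs holomorphy in the open disk and
  continuity up to the circle, which is all that is known about \<open>H\<close>. The factor
  \<open>z powi p\<close> moves the k-th Taylor coefficient to the Fourier index k + p.\<close>

lemma boundary_value_coefficient:
  assumes H: "continuous_on (cball 0 1) H" "H holomorphic_on ball 0 1"
    and q: "\<And>z. z \<in> sphere 0 1 \<Longrightarrow> q z = z powi p * H z"
  shows "((\<lambda>t. q (cis (2 * pi * t)) * cis (- (2 * pi * of_int (int k + p)) * t))
           has_integral (deriv ^^ k) H 0 / fact k) {0..1}"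
proof -
  have "((\<lambda>u. H u / (u - 0) ^ Suc k) has_contour_integral (2 * pi * \<i>) / fact k * (deriv ^^ k) H 0)
           (circlepath 0 1)"
    by (rule Cauchy_has_contour_integral_higher_derivative_circlepath[OF H]) simp
  then have "((\<lambda>x::real. H (exp (2 * of_real pi * \<i> * of_real x)) / exp (2 * of_real pi * \<i> * of_real x) ^ Suc k *
      (2 * of_real pi * \<i> * exp (2 * of_real pi * \<i> * of_real x))) has_integral (2 * pi * \<i>) / fact k * (deriv ^^ k) H 0) {0..1}"
    unfolding has_contour_integral vector_derivative_circlepath by (simp add: circlepath mult_ac)
  from has_integral_mult_right[OF this, of "1 / (2 * of_real pi * \<i>)"]
  have "((\<lambda>x::real. H (exp (2 * of_real pi * \<i> * of_real x)) / exp (2 * of_real pi * \<i> * of_real x) ^ k)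
       has_integral (deriv ^^ k) H 0 / fact k) {0..1}"
    by (simp add: field_simps)
  moreover have "H (exp (2 * of_real pi * \<i> * x)) / exp (2 * of_real pi * \<i> * x) ^ k =
      q (cis (2 * pi * x)) * cis (- (2 * pi * of_int (int k + p)) * x)" for x :: real
  proof -
    have e: "exp (2 * of_real pi * \<i> * x) = cis (2 * pi * x)" by (simp add: cis_conv_exp mult_ac)
    have "cis (- (2 * pi * of_int (int k + p)) * x) = cis (2 * pi * x) powi (- (int k + p))"
      by (simp add: cis_power_int algebra_simps)
    moreover have "cis (2 * pi * x) powi p * cis (2 * pi * x) powi (- (int k + p)) = inverse (cis (2 * pi * x) ^ k)"
      by (simp add: power_int_minus flip: power_int_add)
    ultimately show ?thesis
      unfolding e by (simp add: q divide_inverse)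
  qed
  ultimately show ?thesis by simp
qed

text \<open>Two spare powers of the index give a comparison with 1/k^2. For k > 2 |p| the index
  satisfies |k + p| >= k/2, so the shift by p costs a factor 4 and nothing else.\<close>

lemma rapid_decay_summable:
  fixes a :: "nat \<Rightarrow> complex" and p :: int
  assumes "\<And>j k. \<bar>of_int (int k + p)\<bar> ^ j * cmod (a k) \<le> C j"
  shows "summable (\<lambda>k. \<bar>of_int (int k + p)\<bar> ^ j * cmod (a k))"
proof (rule summable_comparison_test_ev)
  have "norm (\<bar>of_int (int k + p)\<bar> ^ j * cmod (a k)) \<le> 4 * C (j + 2) * inverse (real k ^ 2)"
    if k: "k \<ge> 2 * nat \<bar>p\<bar> + 1" for k
  proof -
    have n: "real k / 2 \<le> \<bar>of_int (int k + p)\<bar>" "real k > 0" using k by linarith+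
    then have "(real k / 2) ^ 2 \<le> \<bar>of_int (int k + p)\<bar> ^ 2" by (intro power_mono) auto
    then have "(real k / 2) ^ 2 * (\<bar>of_int (int k + p)\<bar> ^ j * cmod (a k)) \<le> \<bar>of_int (int k + p)\<bar> ^ 2 * (\<bar>of_int (int k + p)\<bar> ^ j * cmod (a k))"
      by (intro mult_right_mono) auto
    also have "\<dots> \<le> C (j + 2)" using assms[of k "j + 2"] by (simp add: power_add mult_ac power2_eq_square)
    finally show ?thesis using n by (simp add: field_simps power2_eq_square)
  qed
  then show "\<forall>\<^sub>F k in sequentially. norm (\<bar>of_int (int k + p)\<bar> ^ j * cmod (a k)) \<le> 4 * C (j + 2) * inverse (real k ^ 2)"
    unfolding eventually_sequentially by blast
  show "summable (\<lambda>k. 4 * C (j + 2) * inverse (real k ^ 2))"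
    by (intro summable_mult inverse_power_summable) simp
qed

text \<open>The Taylor coefficients of \<open>H\<close> decay rapidly because they are Fourier coefficients of the
  smooth function \<open>q\<close>; hence the Laurent series of \<open>q\<close> converges in \<open>C\<^sup>\<infinity>(S\<^sup>1)\<close>.\<close>

theorem circle_distribution_boundary_value_eq_0:
  assumes L: "circle_distribution L" and kill: "\<And>n. n \<ge> p \<Longrightarrow> L (mode n) = 0"
    and q: "q \<in> smooth_circle"
    and H: "continuous_on (cball 0 1) H" "H holomorphic_on ball 0 1"
    and qH: "\<And>z. z \<in> sphere 0 1 \<Longrightarrow> q z = z powi p * H z"
  shows "L q = 0"
proof -
  define a where "a k = (deriv ^^ k) H 0 / fact k" for k
  define n where "n k = int k + p" for k
  define M where "M j k = \<bar>of_int (n k)\<bar> ^ j * cmod (a k)" for j k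
  \<comment> \<open>The j-th derivative in \<theta> of the k-th Laurent term; it is dominated by the
    summable \<open>M j k\<close>, uniformly in \<theta>, so the series can be differentiated term
    by term at every order.\<close>
  define G where "G j k \<theta> = a k * ((\<i> * of_int (n k)) ^ j * cis (of_int (n k) * \<theta>))" for j k \<theta>
  have sM: "summable (M j)" for j
    unfolding M_def n_def
    by (rule rapid_decay_summable[where C = "\<lambda>j. C_norm j q"])
       (rule fourier_coefficient_bound[OF q boundary_value_coefficient[OF H qH], folded a_def])
  have G_le: "norm (G j k \<theta>) \<le> M j k" for j k \<theta>
    by (simp add: G_def M_def norm_mult norm_power)
  have sG: "summable (\<lambda>k. G j k \<theta>)" for j \<theta>
    by (rule summable_comparison_test'[OF sM]) (rule G_le)
  have dG: "((\<lambda>\<theta>. G j k \<theta>) has_vector_derivative G (Suc j) k \<theta>) (at \<theta>)" for j k \<theta>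
    unfolding G_def using has_vector_derivative_mult_right[OF mode_derivative[where n = "n k" and j = j]] by simp
  have unif: "uniform_limit UNIV (\<lambda>m \<theta>. \<Sum>k<m. G j k \<theta>) (\<lambda>\<theta>. \<Sum>k. G j k \<theta>) sequentially" for j
    by (rule Weierstrass_m_test[OF G_le sM])
  have deriv: "((\<lambda>\<theta>. \<Sum>k. G j k \<theta>) has_vector_derivative (\<Sum>k. G (Suc j) k \<theta>)) (at \<theta>)" for j \<theta>
  proof -
    have "\<exists>g. \<forall>x\<in>UNIV. (\<lambda>k. G j k x) sums g x \<and>
        (g has_derivative (\<lambda>h. h *\<^sub>R (\<Sum>k. G (Suc j) k x))) (at x within UNIV)"
    proof (rule has_derivative_series[where f' = "\<lambda>k x h. h *\<^sub>R G (Suc j) k x"])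
      fix e :: real assume "e > 0"
      from uniform_limitD[OF unif[of "Suc j"] this]
      show "\<forall>\<^sub>F m in sequentially. \<forall>x\<in>UNIV. \<forall>h. norm ((\<Sum>k<m. h *\<^sub>R G (Suc j) k x) - h *\<^sub>R (\<Sum>k. G (Suc j) k x)) \<le> e * norm h"
      proof eventually_elim
        case (elim m)
        have "norm ((\<Sum>k<m. h *\<^sub>R G (Suc j) k x) - h *\<^sub>R (\<Sum>k. G (Suc j) k x))
            = norm ((\<Sum>k<m. G (Suc j) k x) - (\<Sum>k. G (Suc j) k x)) * norm h" for x h
          by (simp add: scaleR_sum_right[symmetric] scaleR_diff_right[symmetric])
        also have "\<dots> x h \<le> e * norm h" for x h
          using elim[rule_format, of x] by (intro mult_right_mono) (auto simp: dist_norm)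
        finally show ?case by blast
      qed
    qed (use dG sG[THEN summable_sums] in \<open>auto simp: has_vector_derivative_def\<close>)
    then obtain g where g: "\<And>x. (\<lambda>k. G j k x) sums g x"
        "\<And>x. (g has_vector_derivative (\<Sum>k. G (Suc j) k x)) (at x)"
      by (auto simp: has_vector_derivative_def)
    have "g = (\<lambda>x. \<Sum>k. G j k x)" using g(1) by (auto simp: sums_iff)
    then show ?thesis using g(2) by simp
  qed
  \<comment> \<open>The Taylor series represents \<open>H\<close> inside the disk only. Its
    coefficients are summable, so it converges uniformly on the closed disk to a continuous
    function, and continuous functions that agree inside agree on the circle.\<close>
  have G0: "(\<Sum>k. G 0 k \<theta>) = q (cis \<theta>)" for \<theta>
  proof -
    define S where "S z = (\<Sum>k. a k * z ^ k)" for z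
    have "summable (\<lambda>k. norm (a k))" using sM[of 0] unfolding M_def by simp
    then have us: "uniform_limit (cball 0 1) (\<lambda>m z. \<Sum>k<m. a k * z ^ k) S sequentially"
      unfolding S_def
      by (rule Weierstrass_m_test[rotated])
         (auto simp: norm_mult norm_power intro!: mult_left_le power_le_one)
    have contS: "continuous_on (cball 0 1) S"
      by (rule uniform_limit_theorem[OF _ us]) (auto intro!: always_eventually continuous_intros)
    have "S z - H z = 0" if "z \<in> ball 0 1" for z
      using holomorphic_power_series[OF H(2) that] by (simp add: S_def a_def sums_iff)
    moreover have "continuous_on (closure (ball 0 1)) (\<lambda>z. S z - H z)"
      using continuous_on_diff[OF contS H(1)] by (simp add: closure_ball)
    ultimately have SH: "S z - H z = 0" if "z \<in> closure (ball 0 1)" for z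
      using continuous_constant_on_closure that by blast
    have "summable (\<lambda>k. a k * cis \<theta> ^ k)"
      by (rule summable_comparison_test'[OF \<open>summable (\<lambda>k. norm (a k))\<close>]) (simp add: norm_mult norm_power)
    then have "(\<Sum>k. cis \<theta> powi p * (a k * cis \<theta> ^ k)) = cis \<theta> powi p * S (cis \<theta>)"
      unfolding S_def by (rule suminf_mult)
    moreover have "G 0 k \<theta> = cis \<theta> powi p * (a k * cis \<theta> ^ k)" for k
    proof -
      have "cis (of_int (n k) * \<theta>) = cis \<theta> powi p * cis \<theta> ^ k"
        unfolding cis_power_int[symmetric] n_def by (subst power_int_add) auto
      then show ?thesis by (simp add: G_def)
    qed
    ultimately show ?thesis using SH[of "cis \<theta>"] qH[of "cis \<theta>"] by (simp add: closure_ball)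
  qed
  have adq: "angular_deriv j q = (\<lambda>\<theta>. \<Sum>k. G j k \<theta>)" for j
    by (rule angular_deriv_unique[where G = "\<lambda>j \<theta>. \<Sum>k. G j k \<theta>"]) (auto simp: G0 deriv)
  \<comment> \<open>Trigonometric polynomials with modes n >= p only: \<open>L\<close> annihilates
    them, and their distance to \<open>q\<close> in each C^N norm is bounded by tails of the series
    \<open>M j\<close>.\<close>
  define s where "s m = (\<lambda>z. \<Sum>k<m. a k * mode (n k) z)" for m
  have ss: "s m \<in> smooth_circle" for m
    unfolding s_def by (intro smooth_circle_sum smooth_circle_scale smooth_circle_mode)
  have ads: "angular_deriv j (s m) = (\<lambda>\<theta>. \<Sum>k<m. G j k \<theta>)" for j m
    by (rule angular_deriv_unique[where G = "\<lambda>j \<theta>. \<Sum>k<m. G j k \<theta>"])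
       (auto simp: s_def G_def[of 0] mode_cis intro!: has_vector_derivative_sum dG)
  have "(\<lambda>m. C_norm N (\<lambda>z. s m z - q z)) \<longlonglongrightarrow> 0" for N
  proof (rule tendsto_sandwich[OF _ _ tendsto_const])
    have "(\<lambda>m. \<Sum>j\<le>N. (\<Sum>k. M j k) - (\<Sum>k<m. M j k)) \<longlonglongrightarrow> (\<Sum>j\<le>N. (\<Sum>k. M j k) - (\<Sum>k. M j k))"
      by (intro tendsto_intros summable_LIMSEQ sM)
    then show "(\<lambda>m. \<Sum>j\<le>N. (\<Sum>k. M j k) - (\<Sum>k<m. M j k)) \<longlonglongrightarrow> 0" by simp
    have "C_norm N (\<lambda>z. s m z - q z) \<le> (\<Sum>j\<le>N. (\<Sum>k. M j k) - (\<Sum>k<m. M j k))" for m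
    proof (rule C_norm_le)
      fix j \<theta>
      have "angular_deriv j (\<lambda>z. s m z - q z) \<theta> = - (\<Sum>k. G j (k + m) \<theta>)"
        unfolding angular_deriv_diff[OF ss q] adq ads suminf_minus_initial_segment[OF sG] by simp
      also have "norm \<dots> \<le> (\<Sum>k. M j (k + m))"
        unfolding norm_minus_cancel
        by (intro norm_suminf_le G_le summable_ignore_initial_segment sM)
      also have "\<dots> = (\<Sum>k. M j k) - (\<Sum>k<m. M j k)"
        by (rule suminf_minus_initial_segment[OF sM])
      finally show "norm (angular_deriv j (\<lambda>z. s m z - q z) \<theta>) \<le> (\<Sum>k. M j k) - (\<Sum>k<m. M j k)" .
    qed
    then show "\<forall>\<^sub>F m in sequentially. C_norm N (\<lambda>z. s m z - q z) \<le> (\<Sum>j\<le>N. (\<Sum>k. M j k) - (\<Sum>k<m. M j k))"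
      by simp
    show "\<forall>\<^sub>F m in sequentially. 0 \<le> C_norm N (\<lambda>z. s m z - q z)"
      by (intro always_eventually allI C_norm_nonneg smooth_circle_diff ss q)
  qed
  from circle_distribution_tendsto[OF L ss q this]
  have "(\<lambda>m. L (s m)) \<longlonglongrightarrow> L q" .
  moreover have "L (s m) = 0" for m
    unfolding s_def
    by (subst circle_distribution_sum[OF L])
       (auto intro!: smooth_circle_scale smooth_circle_mode sum.neutral
             simp: circle_distribution_scale[OF L smooth_circle_mode] kill n_def)
  ultimately show ?thesis by (simp add: LIMSEQ_const_iff)
qed

section \<open>Test functions on the semicircle\<close>

definition iter_deriv :: "nat \<Rightarrow> (real \<Rightarrow> complex) \<Rightarrow> real \<Rightarrow> complex" where
  "iter_deriv j g = ((\<lambda>g u. vector_derivative g (at u)) ^^ j) g"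

lemma iter_deriv_0 [simp]: "iter_deriv 0 g = g"
  by (simp add: iter_deriv_def)

lemma iter_deriv_Suc: "iter_deriv (Suc j) g u = vector_derivative (iter_deriv j g) (at u)"
  by (simp add: iter_deriv_def)

lemma iter_deriv_1: "iter_deriv 1 g u = vector_derivative g (at u)"
  by (simp add: iter_deriv_Suc)

text \<open>Peels off the innermost derivative where the definition gives the outermost one; in
  inductions on the order, the rule for one derivative has to be applied to the function
  first.\<close>

lemma iter_deriv_Suc': "iter_deriv (Suc j) g = iter_deriv j (iter_deriv 1 g)"
  by (simp add: iter_deriv_def funpow_Suc_right del: funpow.simps)

lemma angular_deriv_conv_iter_deriv: "angular_deriv j f = iter_deriv j (\<lambda>\<theta>. f (cis \<theta>))"
  by (simp add: angular_deriv_def iter_deriv_def)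

lemma iter_deriv_unique:
  assumes "\<And>u. g u = G 0 u"
    and "\<And>j u. (G j has_vector_derivative G (Suc j) u) (at u)"
  shows "iter_deriv j g = G j"
proof (induction j)
  case 0
  show ?case using assms(1) by auto
next
  case (Suc j)
  show ?case
    using assms(2)[of j] by (auto simp: iter_deriv_Suc Suc intro: vector_derivative_at)
qed

text \<open>Smooth functions on the line which decrease, with all derivatives, faster than every
  exponential; in the logarithmic coordinate \<open>u = ln (tan (\<theta> / 2))\<close> of the upper semicircle these are
  the functions that are flat at the end points.\<close>

definition rapid :: "(real \<Rightarrow> complex) \<Rightarrow> bool" where
  "rapid g \<longleftrightarrow> (\<forall>j u. iter_deriv j g differentiable (at u)) \<and>
     (\<forall>j K. \<exists>C. \<forall>u. norm (iter_deriv j g u) \<le> C * exp (- K * \<bar>u\<bar>))"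

lemma rapidI:
  assumes "\<And>u. g u = G 0 u"
    and "\<And>j u. (G j has_vector_derivative G (Suc j) u) (at u)"
    and "\<And>j K. \<exists>C. \<forall>u. norm (G j u) \<le> C * exp (- K * \<bar>u\<bar>)"
  shows "rapid g"
  using assms(2,3) unfolding rapid_def iter_deriv_unique[of g G, OF assms(1,2)]
  by (blast intro: differentiableI_vector)

lemma rapid_deriv:
  assumes "rapid g"
  shows "(iter_deriv j g has_vector_derivative iter_deriv (Suc j) g u) (at u)"
  using assms by (simp add: rapid_def iter_deriv_Suc vector_derivative_works[symmetric])

lemma rapid_bound:
  assumes "rapid g"
  obtains C where "C \<ge> 0" "\<And>i u. i \<le> j \<Longrightarrow> norm (iter_deriv i g u) \<le> C * exp (- K * \<bar>u\<bar>)"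
proof -
  have "\<forall>i. \<exists>C. \<forall>u. norm (iter_deriv i g u) \<le> C * exp (- K * \<bar>u\<bar>)"
    using assms unfolding rapid_def by blast
  then obtain C where C: "\<And>i u. norm (iter_deriv i g u) \<le> C i * exp (- K * \<bar>u\<bar>)"
    by metis
  have nn: "0 \<le> C i" for i using order_trans[OF norm_ge_zero C[of i 0]] by simp
  show ?thesis
  proof (rule that[of "\<Sum>i\<le>j. C i"])
    show "norm (iter_deriv i g u) \<le> (\<Sum>i\<le>j. C i) * exp (- K * \<bar>u\<bar>)" if "i \<le> j" for i u
      by (rule order_trans[OF C], intro mult_right_mono member_le_sum) (use nn that in auto)
  qed (use nn in \<open>auto intro: sum_nonneg\<close>)
qed

lemma rapid_iter_deriv_1: "rapid g \<Longrightarrow> rapid (iter_deriv 1 g)"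
  unfolding rapid_def iter_deriv_Suc'[symmetric] by blast

lemma rapid_shift:
  assumes "rapid g"
  shows "rapid (\<lambda>u. g (u - t))" "iter_deriv j (\<lambda>u. g (u - t)) = (\<lambda>u. iter_deriv j g (u - t))"
proof -
  have d: "((\<lambda>u. iter_deriv j g (u - t)) has_vector_derivative iter_deriv (Suc j) g (u - t)) (at u)" for j u
  proof -
    have "(iter_deriv j g \<circ> (\<lambda>u. u - t) has_vector_derivative 1 *\<^sub>R iter_deriv (Suc j) g (u - t)) (at u)"
      by (intro vector_diff_chain_at rapid_deriv assms) (auto intro!: derivative_eq_intros)
    then show ?thesis by (simp add: o_def)
  qed
  show "iter_deriv j (\<lambda>u. g (u - t)) = (\<lambda>u. iter_deriv j g (u - t))"
    by (rule iter_deriv_unique[where G = "\<lambda>j u. iter_deriv j g (u - t)"]) (auto intro: d)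
  show "rapid (\<lambda>u. g (u - t))"
  proof (rule rapidI[where G = "\<lambda>j u. iter_deriv j g (u - t)"])
    fix j K
    obtain C where C: "C \<ge> 0" "\<And>u. norm (iter_deriv j g u) \<le> C * exp (- K * \<bar>u\<bar>)"
      using rapid_bound[OF assms] by (metis order_refl)
    have "norm (iter_deriv j g (u - t)) \<le> C * exp (\<bar>K\<bar> * \<bar>t\<bar>) * exp (- K * \<bar>u\<bar>)" for u
    proof -
      have "\<bar>K * (\<bar>u\<bar> - \<bar>u - t\<bar>)\<bar> \<le> \<bar>K\<bar> * \<bar>t\<bar>" by (auto simp: abs_mult intro!: mult_left_mono)
      then have "- K * \<bar>u - t\<bar> \<le> \<bar>K\<bar> * \<bar>t\<bar> + - K * \<bar>u\<bar>" by (simp add: algebra_simps abs_le_iff)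
      then have "C * exp (- K * \<bar>u - t\<bar>) \<le> C * exp (\<bar>K\<bar> * \<bar>t\<bar> + - K * \<bar>u\<bar>)" using C(1) by (intro mult_left_mono) auto
      with C(2)[of "u - t"] show ?thesis unfolding exp_add mult.assoc by linarith
    qed
    then show "\<exists>C. \<forall>u. norm (iter_deriv j g (u - t)) \<le> C * exp (- K * \<bar>u\<bar>)" by blast
  qed (auto intro: d)
qed

lemma rapid_add:
  assumes "rapid g" "rapid h"
  shows "rapid (\<lambda>u. g u + h u)" "iter_deriv j (\<lambda>u. g u + h u) = (\<lambda>u. iter_deriv j g u + iter_deriv j h u)"
proof -
  have d: "((\<lambda>u. iter_deriv j g u + iter_deriv j h u) has_vector_derivative
      iter_deriv (Suc j) g u + iter_deriv (Suc j) h u) (at u)" for j u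
    by (intro has_vector_derivative_add rapid_deriv assms)
  show "iter_deriv j (\<lambda>u. g u + h u) = (\<lambda>u. iter_deriv j g u + iter_deriv j h u)"
    by (rule iter_deriv_unique[where G = "\<lambda>j u. iter_deriv j g u + iter_deriv j h u"]) (auto intro: d)
  show "rapid (\<lambda>u. g u + h u)"
  proof (rule rapidI[where G = "\<lambda>j u. iter_deriv j g u + iter_deriv j h u"])
    fix j K
    obtain C where C: "\<And>u. norm (iter_deriv j g u) \<le> C * exp (- K * \<bar>u\<bar>)"
      using rapid_bound[OF assms(1)] by (metis order_refl)
    obtain D where D: "\<And>u. norm (iter_deriv j h u) \<le> D * exp (- K * \<bar>u\<bar>)"
      using rapid_bound[OF assms(2)] by (metis order_refl)
    have "norm (iter_deriv j g u + iter_deriv j h u) \<le> (C + D) * exp (- K * \<bar>u\<bar>)" for u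
      using norm_triangle_mono[OF C D, of u u] by (simp add: distrib_right)
    then show "\<exists>C. \<forall>u. norm (iter_deriv j g u + iter_deriv j h u) \<le> C * exp (- K * \<bar>u\<bar>)" by blast
  qed (auto intro: d)
qed

lemma rapid_scale:
  assumes "rapid g"
  shows "rapid (\<lambda>u. c * g u)" "iter_deriv j (\<lambda>u. c * g u) = (\<lambda>u. c * iter_deriv j g u)"
proof -
  have d: "((\<lambda>u. c * iter_deriv j g u) has_vector_derivative c * iter_deriv (Suc j) g u) (at u)" for j u
    by (intro has_vector_derivative_mult_right rapid_deriv assms)
  show "iter_deriv j (\<lambda>u. c * g u) = (\<lambda>u. c * iter_deriv j g u)"
    by (rule iter_deriv_unique[where G = "\<lambda>j u. c * iter_deriv j g u"]) (auto intro: d)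
  show "rapid (\<lambda>u. c * g u)"
  proof (rule rapidI[where G = "\<lambda>j u. c * iter_deriv j g u"])
    fix j K
    obtain C where C: "\<And>u. norm (iter_deriv j g u) \<le> C * exp (- K * \<bar>u\<bar>)"
      using rapid_bound[OF assms(1)] by (metis order_refl)
    have "norm (c * iter_deriv j g u) \<le> (cmod c * C) * exp (- K * \<bar>u\<bar>)" for u
      using mult_left_mono[OF C[of u], of "cmod c"] by (simp add: norm_mult mult_ac)
    then show "\<exists>C. \<forall>u. norm (c * iter_deriv j g u) \<le> C * exp (- K * \<bar>u\<bar>)" by blast
  qed (auto intro: d)
qed

lemma rapid_diff:
  assumes "rapid g" "rapid h"
  shows "rapid (\<lambda>u. g u - h u)" "iter_deriv j (\<lambda>u. g u - h u) = (\<lambda>u. iter_deriv j g u - iter_deriv j h u)"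
  using rapid_add(1)[OF assms(1) rapid_scale(1)[OF assms(2), of "-1"]]
    rapid_add(2)[OF assms(1) rapid_scale(1)[OF assms(2), of "-1"], of j] rapid_scale(2)[OF assms(2), of j "-1"]
  by simp_all

text \<open>By the half-angle formula Im z / (1 + Re z) is tan (\<theta> / 2) for z = cis
  \<theta>.\<close>

definition arc_coord :: "complex \<Rightarrow> real" where
  "arc_coord z = ln (Im z / (1 + Re z))"

text \<open>Because du/d\<theta> = 1 / sin \<theta>, differentiating sin^p cos^b g(u) produces terms
  with other exponents. The family with both exponents is closed under differentiation, which the
  case b = 0 of interest is not. Negative p is harmless, since a rapid \<open>g\<close> decreases
  faster than any power of Im z.\<close>

definition arc_term :: "int \<Rightarrow> nat \<Rightarrow> (real \<Rightarrow> complex) \<Rightarrow> complex \<Rightarrow> complex" where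
  "arc_term p b g z =
     (if z \<in> sphere 0 1 \<and> Im z > 0 then of_real (Im z powi p * Re z ^ b) * g (arc_coord z) else 0)"

lemma sphere_Im_pos:
  assumes "z \<in> sphere 0 1" "Im z > 0"
  shows "Im z \<le> 1" "\<bar>Re z\<bar> < 1" "(Re z)\<^sup>2 + (Im z)\<^sup>2 = 1"
proof -
  show 1: "(Re z)\<^sup>2 + (Im z)\<^sup>2 = 1" using assms by (simp add: cmod_def)
  show "Im z \<le> 1" using assms abs_Im_le_cmod[of z] by simp
  have "(Re z)\<^sup>2 < 1\<^sup>2" using 1 assms(2) by (simp add: power2_eq_square) (smt (verit) mult_pos_pos)
  then show "\<bar>Re z\<bar> < 1" by (simp add: abs_square_less_1)
qed

text \<open>As Im z = 1 / cosh u, this amounts to cosh u <= exp |u|. It turns exponential decrease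
  in u into powers of Im z, that is, into flatness at the end points 1 and -1.\<close>

lemma exp_arc_coord_le:
  assumes z: "z \<in> sphere 0 1" "Im z > 0"
  shows "exp (- \<bar>arc_coord z\<bar>) \<le> Im z"
proof -
  note s = sphere_Im_pos[OF z]
  define x y where "x = Re z" and "y = Im z"
  have xy: "x\<^sup>2 + y\<^sup>2 = 1" "y > 0" "\<bar>x\<bar> < 1" using s z unfolding x_def y_def by auto
  have e: "exp (arc_coord z) = y / (1 + x)" using xy by (simp add: arc_coord_def x_def y_def)
  show ?thesis
  proof (cases "x \<ge> 0")
    case True
    then have "y / (1 + x) \<le> y" using xy by (simp add: field_simps)
    moreover have "y / (1 + x) \<le> 1" using s True xy by (simp add: y_def field_simps)
    ultimately have "exp (arc_coord z) \<le> 1" "exp (arc_coord z) \<le> y" using e by auto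
    then show ?thesis by (simp add: y_def)
  next
    case False
    have "(1 + x) * (1 - x) = y * y" using xy by (simp add: power2_eq_square algebra_simps)
    then have "(1 + x) / y = y / (1 - x)" using xy by (simp add: field_simps)
    also have "\<dots> \<le> y" using False xy mult_nonpos_nonneg[of x y] by (simp add: field_simps)
    finally have "inverse (y / (1 + x)) \<le> y" by simp
    then have "exp (- arc_coord z) \<le> y" unfolding exp_minus e .
    moreover from this have "exp (- arc_coord z) \<le> 1" using s unfolding y_def by linarith
    ultimately show ?thesis by (simp add: y_def)
  qed
qed

text \<open>Of the powers of Im z that the decrease of \<open>g\<close> supplies, |p| absorb the
  weight \<open>Im z powi p\<close>, also for negative p; the other m remain.\<close>

lemma arc_term_bound:
  assumes z: "z \<in> sphere 0 1" and K: "K \<ge> \<bar>of_int p\<bar> + real m"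
    and g: "\<And>u. norm (g u) \<le> \<epsilon> * exp (- K * \<bar>u\<bar>)"
  shows "norm (arc_term p b g z) \<le> \<epsilon> * \<bar>Im z\<bar> ^ m"
proof -
  have e0: "0 \<le> \<epsilon>" using order_trans[OF norm_ge_zero g[of 0]] by simp
  show ?thesis
  proof (cases "Im z > 0")
    case True
    note s = sphere_Im_pos[OF z True]
    define k where "k = nat \<bar>p\<bar> + m"
    have "exp (- K * \<bar>arc_coord z\<bar>) \<le> exp (- real k * \<bar>arc_coord z\<bar>)"
    proof -
      have "real k * \<bar>arc_coord z\<bar> \<le> K * \<bar>arc_coord z\<bar>"
        using K by (intro mult_right_mono) (auto simp: k_def)
      then show ?thesis unfolding exp_le_cancel_iff mult_minus_left by linarith
    qed
    also have "\<dots> = exp (- \<bar>arc_coord z\<bar>) ^ k" by (simp flip: exp_of_nat_mult)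
    also have "\<dots> \<le> Im z ^ k" by (intro power_mono exp_arc_coord_le z True) simp
    finally have "norm (g (arc_coord z)) \<le> \<epsilon> * Im z ^ k"
      using order_trans[OF g mult_left_mono[OF _ e0]] by blast
    moreover have "Im z powi p * \<bar>Re z\<bar> ^ b \<le> Im z powi p * 1"
      using s True by (intro mult_left_mono power_le_one) auto
    moreover have "norm (arc_term p b g z) = (Im z powi p * \<bar>Re z\<bar> ^ b) * norm (g (arc_coord z))"
      using z True by (simp add: arc_term_def norm_mult norm_power norm_power_int del: of_real_mult)
         (simp add: abs_mult power_abs)
    ultimately have "norm (arc_term p b g z) \<le> (Im z powi p * 1) * (\<epsilon> * Im z ^ k)"
      using True s by (metis (no_types, lifting) mult_mono norm_ge_zero zero_le_power_int less_imp_le mult.right_neutral)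
    also have "\<dots> = \<epsilon> * (Im z powi (p + \<bar>p\<bar>) * Im z ^ m)"
      using True by (simp add: k_def power_add power_int_add flip: power_int_of_nat)
    also have "\<dots> \<le> \<epsilon> * (1 * Im z ^ m)"
    proof (intro mult_left_mono mult_right_mono e0)
      show "Im z powi (p + \<bar>p\<bar>) \<le> 1" using True s by (simp add: power_int_def power_le_one)
    qed (use True in auto)
    finally show ?thesis using True by simp
  next
    case False then show ?thesis using e0 by (simp add: arc_term_def)
  qed
qed

text \<open>For the end points of the arc, where the function is given by different formulas on the
  two sides.\<close>

lemma has_vector_derivative_zero_of_square_bound:
  fixes f :: "real \<Rightarrow> 'a::real_normed_vector"
  assumes "f x = 0" and "\<And>y. norm (f y) \<le> C * \<bar>y - x\<bar>\<^sup>2"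
  shows "(f has_vector_derivative 0) (at x)"
proof -
  have "((\<lambda>y. C * \<bar>y - x\<bar>) \<longlongrightarrow> C * \<bar>x - x\<bar>) (at x)" by (intro tendsto_intros)
  then have "((\<lambda>y. C * \<bar>y - x\<bar>) \<longlongrightarrow> 0) (at x)" by simp
  then have "((\<lambda>y. norm (f y - f x - (y - x) *\<^sub>R 0) / \<bar>y - x\<bar>) \<longlongrightarrow> 0) (at x)"
  proof (rule Lim_null_comparison[rotated], intro always_eventually allI)
    fix y
    have "norm (f y) / \<bar>y - x\<bar> \<le> C * \<bar>y - x\<bar>"
      using assms(2)[of y] by (cases "y = x") (auto simp: divide_simps power2_eq_square mult_ac)
    then show "norm (norm (f y - f x - (y - x) *\<^sub>R 0) / \<bar>y - x\<bar>) \<le> C * \<bar>y - x\<bar>"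
      using assms(1) by simp
  qed
  then show ?thesis unfolding has_vector_derivative_def has_derivative_iff_norm
    by (auto intro: bounded_linear_zero)
qed

text \<open>Chain rule with du/d\<theta> = 1 / sin \<theta> inside the arc, zero on the open lower
  arc, and a quadratic bound at the two end points. For b = 0 the truncated exponent b - 1 comes
  with the coefficient 0.\<close>

lemma arc_term_deriv:
  assumes g: "rapid g"
  shows "((\<lambda>\<theta>. arc_term p b g (cis \<theta>)) has_vector_derivative
      of_int p * arc_term (p - 1) (b + 1) g (cis \<theta>) + (- of_nat b) * arc_term (p + 1) (b - 1) g (cis \<theta>)
      + arc_term (p - 1) b (iter_deriv 1 g) (cis \<theta>)) (at \<theta>)"
proof -
  consider "sin \<theta> > 0" | "sin \<theta> = 0" | "sin \<theta> < 0" by linarith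
  then show ?thesis
  proof cases
    case 1
    have c: "1 + cos \<theta> > 0" using sphere_Im_pos(2)[of "cis \<theta>"] 1 by auto
    have sc: "sin \<theta> * sin \<theta> + cos \<theta> * cos \<theta> = 1" using sin_cos_squared_add[of \<theta>] by (simp add: power2_eq_square)
    have "((\<lambda>\<theta>. ln (sin \<theta> / (1 + cos \<theta>))) has_real_derivative 1 / sin \<theta>) (at \<theta>)"
    proof -
      have "((\<lambda>\<theta>. sin \<theta> / (1 + cos \<theta>)) has_real_derivative
          (cos \<theta> * (1 + cos \<theta>) - sin \<theta> * (0 - sin \<theta>)) / ((1 + cos \<theta>) * (1 + cos \<theta>))) (at \<theta>)"
        using c by (intro DERIV_divide DERIV_sin) (auto intro!: derivative_eq_intros)
      moreover have "cos \<theta> * (1 + cos \<theta>) - sin \<theta> * (0 - sin \<theta>) = 1 + cos \<theta>"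
        using sc by (simp add: algebra_simps)
      ultimately have "((\<lambda>\<theta>. sin \<theta> / (1 + cos \<theta>)) has_real_derivative 1 / (1 + cos \<theta>)) (at \<theta>)"
        using c by simp
      from DERIV_chain2[OF DERIV_ln_divide this] show ?thesis using 1 c by simp
    qed
    then have dc: "((\<lambda>\<theta>. arc_coord (cis \<theta>)) has_vector_derivative 1 / sin \<theta>) (at \<theta>)"
      by (simp add: arc_coord_def has_real_derivative_iff_has_vector_derivative)
    have dg: "((\<lambda>\<theta>. g (arc_coord (cis \<theta>))) has_vector_derivative
        (1 / sin \<theta>) *\<^sub>R iter_deriv 1 g (arc_coord (cis \<theta>))) (at \<theta>)"
    proof -
      have "(g has_vector_derivative iter_deriv 1 g (arc_coord (cis \<theta>))) (at (arc_coord (cis \<theta>)))"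
        using rapid_deriv[OF g, of 0] by simp
      from vector_diff_chain_at[OF dc this] show ?thesis by (simp add: o_def)
    qed
    have dp: "((\<lambda>\<theta>. sin \<theta> powi p * cos \<theta> ^ b) has_real_derivative
        of_int p * (sin \<theta> powi (p - 1) * cos \<theta> ^ (b + 1)) - of_nat b * (sin \<theta> powi (p + 1) * cos \<theta> ^ (b - 1))) (at \<theta>)"
    proof -
      have "((\<lambda>\<theta>. sin \<theta> powi p) has_real_derivative of_int p * sin \<theta> powi (p - 1) * cos \<theta>) (at \<theta>)"
        using has_derivative_power_int[OF _ DERIV_sin[unfolded has_field_derivative_def], where n = p and x = \<theta>] 1
        by (auto simp: has_field_derivative_def fun_eq_iff elim!: has_derivative_eq_rhs)
      moreover have "((\<lambda>\<theta>. cos \<theta> ^ b) has_real_derivative of_nat b * (- sin \<theta> * cos \<theta> ^ (b - Suc 0))) (at \<theta>)"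
        by (rule DERIV_power[OF DERIV_cos])
      ultimately show ?thesis
        by (rule DERIV_cong[OF DERIV_mult]) (use power_int_add_1[of "sin \<theta>" p] 1 in \<open>simp add: algebra_simps\<close>)
    qed
    have "((\<lambda>\<theta>. of_real (sin \<theta> powi p * cos \<theta> ^ b) * g (arc_coord (cis \<theta>))) has_vector_derivative
        of_real (sin \<theta> powi p * cos \<theta> ^ b) * ((1 / sin \<theta>) *\<^sub>R iter_deriv 1 g (arc_coord (cis \<theta>)))
        + of_real (of_int p * (sin \<theta> powi (p - 1) * cos \<theta> ^ (b + 1)) - of_nat b * (sin \<theta> powi (p + 1) * cos \<theta> ^ (b - 1)))
          * g (arc_coord (cis \<theta>))) (at \<theta>)" (is "(_ has_vector_derivative ?D) _")
      by (intro has_vector_derivative_mult dg has_vector_derivative_of_real)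
         (use dp in \<open>simp add: has_real_derivative_iff_has_vector_derivative\<close>)
    moreover have "?D = of_int p * arc_term (p - 1) (b + 1) g (cis \<theta>) + (- of_nat b) * arc_term (p + 1) (b - 1) g (cis \<theta>)
      + arc_term (p - 1) b (iter_deriv 1 g) (cis \<theta>)"
      using 1 by (simp add: arc_term_def power_int_diff scaleR_conv_of_real algebra_simps)
    ultimately have D: "((\<lambda>\<theta>. of_real (sin \<theta> powi p * cos \<theta> ^ b) * g (arc_coord (cis \<theta>))) has_vector_derivative
        of_int p * arc_term (p - 1) (b + 1) g (cis \<theta>) + (- of_nat b) * arc_term (p + 1) (b - 1) g (cis \<theta>)
      + arc_term (p - 1) b (iter_deriv 1 g) (cis \<theta>)) (at \<theta>)" by simp
    have "open {\<theta>. sin \<theta> > (0::real)}" by (intro open_Collect_less continuous_intros)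
    from has_vector_derivative_transform_within_open[OF D this] show ?thesis
      using 1 by (simp add: arc_term_def)
  next
    case 2
    \<comment> \<open>The 2 asks for two spare powers of Im z; with |sin y| <= |y - \<theta>|, valid
      because sin \<theta> = 0, they give the quadratic bound.\<close>
    obtain C where C: "C \<ge> 0" "\<And>u. norm (g u) \<le> C * exp (- (\<bar>of_int p\<bar> + real 2) * \<bar>u\<bar>)"
      using rapid_bound[OF g, of 0 "\<bar>of_int p\<bar> + real 2"] by (metis iter_deriv_0 order_refl)
    have "\<bar>sin y\<bar> \<le> \<bar>y - \<theta>\<bar>" for y
    proof -
      have "sin y = sin (y - \<theta>) * cos \<theta>" using 2 sin_add[of "y - \<theta>" \<theta>] by simp
      moreover have "\<bar>cos \<theta>\<bar> \<le> 1" by (rule abs_cos_le_one)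
      ultimately have "\<bar>sin y\<bar> \<le> \<bar>sin (y - \<theta>)\<bar>" by (simp add: abs_mult mult_left_le)
      then show ?thesis using abs_sin_x_le_abs_x[of "y - \<theta>"] by linarith
    qed
    then have bd: "norm (arc_term p b g (cis y)) \<le> C * \<bar>y - \<theta>\<bar>\<^sup>2" for y
      by (intro order_trans[OF arc_term_bound[where m = 2, OF _ order_refl C(2)]] mult_left_mono power_mono C(1)) auto
    have "((\<lambda>\<theta>. arc_term p b g (cis \<theta>)) has_vector_derivative 0) (at \<theta>)"
      by (rule has_vector_derivative_zero_of_square_bound[OF _ bd]) (simp add: 2 arc_term_def)
    then show ?thesis using 2 by (simp add: arc_term_def)
  next
    case 3
    have "open {\<theta>. sin \<theta> < (0::real)}" by (intro open_Collect_less continuous_intros)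
    then have "((\<lambda>\<theta>. arc_term p b g (cis \<theta>)) has_vector_derivative 0) (at \<theta>)"
      by (rule has_vector_derivative_transform_within_open[OF has_vector_derivative_const])
         (use 3 in \<open>auto simp: arc_term_def\<close>)
    moreover have "arc_term p' b' g' (cis \<theta>) = 0" for p' b' g' using 3 by (simp add: arc_term_def)
    ultimately show ?thesis by simp
  qed
qed

text \<open>Replaces a formula for the j-th derivative: every member has a derivative inside the
  set, so a chosen derivative can be iterated.\<close>

inductive_set arc_span :: "(complex \<Rightarrow> complex) set" where
  arc_term: "rapid g \<Longrightarrow> arc_term p b g \<in> arc_span"
| add: "f \<in> arc_span \<Longrightarrow> h \<in> arc_span \<Longrightarrow> (\<lambda>z. f z + h z) \<in> arc_span"
| scale: "f \<in> arc_span \<Longrightarrow> (\<lambda>z. c * f z) \<in> arc_span"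

lemma arc_span_deriv:
  assumes "f \<in> arc_span"
  shows "\<exists>f'\<in>arc_span. \<forall>\<theta>. ((\<lambda>\<theta>. f (cis \<theta>)) has_vector_derivative f' (cis \<theta>)) (at \<theta>)"
  using assms
proof induction
  case (arc_term g p b)
  let ?f' = "\<lambda>z. of_int p * arc_term (p - 1) (b + 1) g z + (- of_nat b) * arc_term (p + 1) (b - 1) g z
      + arc_term (p - 1) b (iter_deriv 1 g) z"
  have "?f' \<in> arc_span"
    by (intro arc_span.intros arc_term rapid_iter_deriv_1)
  then show ?case
    by (rule bexI[of _ ?f', rotated]) (rule allI, rule arc_term_deriv[OF arc_term])
next
  case (add f h)
  from add.IH obtain f' h' where "f' \<in> arc_span" "h' \<in> arc_span"
    "\<And>\<theta>. ((\<lambda>\<theta>. f (cis \<theta>)) has_vector_derivative f' (cis \<theta>)) (at \<theta>)"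
    "\<And>\<theta>. ((\<lambda>\<theta>. h (cis \<theta>)) has_vector_derivative h' (cis \<theta>)) (at \<theta>)" by blast
  then show ?case
    by (intro bexI[of _ "\<lambda>z. f' z + h' z"] allI has_vector_derivative_add arc_span.add)
next
  case (scale f c)
  from scale.IH obtain f' where "f' \<in> arc_span"
    "\<And>\<theta>. ((\<lambda>\<theta>. f (cis \<theta>)) has_vector_derivative f' (cis \<theta>)) (at \<theta>)" by blast
  then show ?case
    by (intro bexI[of _ "\<lambda>z. c * f' z"] allI has_vector_derivative_mult_right arc_span.scale)
qed

lemma arc_span_smooth:
  assumes "f \<in> arc_span"
  shows "f \<in> smooth_circle"
proof -
  obtain D where D: "\<And>f. f \<in> arc_span \<Longrightarrow> D f \<in> arc_span"
    "\<And>f \<theta>. f \<in> arc_span \<Longrightarrow> ((\<lambda>\<theta>. f (cis \<theta>)) has_vector_derivative D f (cis \<theta>)) (at \<theta>)"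
    using arc_span_deriv by metis
  have mem: "(D ^^ j) f \<in> arc_span" for j by (induction j) (auto intro: assms D)
  have "f z = 0" if "z \<notin> sphere 0 1" for z
    using assms that by induction (auto simp: arc_term_def)
  then show ?thesis
  proof (rule smooth_circleI[where G = "\<lambda>j \<theta>. (D ^^ j) f (cis \<theta>)"])
    show "((\<lambda>\<theta>. (D ^^ j) f (cis \<theta>)) has_vector_derivative (D ^^ Suc j) f (cis \<theta>)) (at \<theta>)" for j \<theta>
      using D(2)[OF mem[of j]] by simp
  qed simp_all
qed

lemma smooth_circle_arc_term: "rapid g \<Longrightarrow> arc_term p b g \<in> smooth_circle"
  by (intro arc_span_smooth arc_span.arc_term)

lemma angular_deriv_Suc_arc_term:
  assumes "rapid g"
  shows "angular_deriv (Suc j) (arc_term p b g) \<theta> =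
      of_int p * angular_deriv j (arc_term (p - 1) (b + 1) g) \<theta>
      + (- of_nat b) * angular_deriv j (arc_term (p + 1) (b - 1) g) \<theta>
      + angular_deriv j (arc_term (p - 1) b (iter_deriv 1 g)) \<theta>"
proof -
  note s = smooth_circle_arc_term[OF assms] smooth_circle_arc_term[OF rapid_iter_deriv_1[OF assms]]
  have "iter_deriv 1 (\<lambda>\<theta>. arc_term p b g (cis \<theta>)) = (\<lambda>\<theta>.
      of_int p * arc_term (p - 1) (b + 1) g (cis \<theta>) + (- of_nat b) * arc_term (p + 1) (b - 1) g (cis \<theta>)
      + arc_term (p - 1) b (iter_deriv 1 g) (cis \<theta>))"
    by (rule ext) (subst iter_deriv_1, rule vector_derivative_at, rule arc_term_deriv[OF assms])
  then have "angular_deriv (Suc j) (arc_term p b g) = angular_deriv j (\<lambda>z.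
      of_int p * arc_term (p - 1) (b + 1) g z + (- of_nat b) * arc_term (p + 1) (b - 1) g z
      + arc_term (p - 1) b (iter_deriv 1 g) z)"
    unfolding angular_deriv_conv_iter_deriv iter_deriv_Suc' by simp
  then show ?thesis
    by (simp only: angular_deriv_add angular_deriv_scale smooth_circle_add smooth_circle_scale s)
qed

text \<open>The constant does not depend on \<open>g\<close>; this uniformity turns convergence on
  the line into convergence in C^N. One derivative changes p by at most 1 and uses up one order, so
  the weight |p| + j dominates the weights |p'| + j - 1 of the recursive terms.\<close>

lemma arc_term_angular_bound:
  "\<exists>C\<ge>0. \<forall>g \<epsilon> \<theta>. rapid g \<longrightarrow> (\<forall>i\<le>j. \<forall>u. norm (iter_deriv i g u) \<le> \<epsilon> * exp (- (\<bar>of_int p\<bar> + real j) * \<bar>u\<bar>)) \<longrightarrow>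
     norm (angular_deriv j (arc_term p b g) \<theta>) \<le> C * \<epsilon>"
proof (induction j arbitrary: p b)
  case 0
  show ?case
  proof (intro exI[of _ 1] conjI allI impI)
    fix g \<epsilon> \<theta>
    assume "\<forall>i\<le>0. \<forall>u. norm (iter_deriv i g u) \<le> \<epsilon> * exp (- (\<bar>of_int p\<bar> + real 0) * \<bar>u\<bar>)"
    then have "norm (arc_term p b g (cis \<theta>)) \<le> \<epsilon> * \<bar>Im (cis \<theta>)\<bar> ^ 0"
      by (intro arc_term_bound[OF _ order_refl]) auto
    then show "norm (angular_deriv 0 (arc_term p b g) \<theta>) \<le> 1 * \<epsilon>" by (simp add: angular_deriv_0)
  qed simp
next
  case (Suc j)
  obtain C1 where C1: "C1 \<ge> 0" "\<And>g \<epsilon> \<theta>. rapid g \<Longrightarrow> (\<forall>i\<le>j. \<forall>u. norm (iter_deriv i g u) \<le> \<epsilon> * exp (- (\<bar>of_int (p - 1)\<bar> + real j) * \<bar>u\<bar>)) \<Longrightarrow>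
     norm (angular_deriv j (arc_term (p - 1) (b + 1) g) \<theta>) \<le> C1 * \<epsilon>" using Suc by blast
  obtain C2 where C2: "C2 \<ge> 0" "\<And>g \<epsilon> \<theta>. rapid g \<Longrightarrow> (\<forall>i\<le>j. \<forall>u. norm (iter_deriv i g u) \<le> \<epsilon> * exp (- (\<bar>of_int (p + 1)\<bar> + real j) * \<bar>u\<bar>)) \<Longrightarrow>
     norm (angular_deriv j (arc_term (p + 1) (b - 1) g) \<theta>) \<le> C2 * \<epsilon>" using Suc by blast
  obtain C3 where C3: "C3 \<ge> 0" "\<And>g \<epsilon> \<theta>. rapid g \<Longrightarrow> (\<forall>i\<le>j. \<forall>u. norm (iter_deriv i g u) \<le> \<epsilon> * exp (- (\<bar>of_int (p - 1)\<bar> + real j) * \<bar>u\<bar>)) \<Longrightarrow>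
     norm (angular_deriv j (arc_term (p - 1) b g) \<theta>) \<le> C3 * \<epsilon>" using Suc by blast
  show ?case
  proof (intro exI[of _ "\<bar>of_int p\<bar> * C1 + real b * C2 + C3"] conjI allI impI)
    fix g \<epsilon> \<theta>
    assume g: "rapid g" and b: "\<forall>i\<le>Suc j. \<forall>u. norm (iter_deriv i g u) \<le> \<epsilon> * exp (- (\<bar>of_int p\<bar> + real (Suc j)) * \<bar>u\<bar>)"
    have "0 \<le> \<epsilon>" using b[rule_format, of 0 0] order_trans[OF norm_ge_zero] by fastforce
    have w: "norm (iter_deriv i g u) \<le> \<epsilon> * exp (- (\<bar>of_int p'\<bar> + real j) * \<bar>u\<bar>)"
      if "i \<le> Suc j" "\<bar>p'\<bar> \<le> \<bar>p\<bar> + 1" for i u p'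
    proof -
      have "\<bar>of_int p'\<bar> \<le> \<bar>of_int p\<bar> + (1::real)" using that(2) by linarith
      then have "(\<bar>of_int p'\<bar> + real j) * \<bar>u\<bar> \<le> (\<bar>of_int p\<bar> + real (Suc j)) * \<bar>u\<bar>"
        by (intro mult_right_mono) auto
      then have "\<epsilon> * exp (- (\<bar>of_int p\<bar> + real (Suc j)) * \<bar>u\<bar>) \<le> \<epsilon> * exp (- (\<bar>of_int p'\<bar> + real j) * \<bar>u\<bar>)"
        using \<open>0 \<le> \<epsilon>\<close> by (intro mult_left_mono) (simp_all add: algebra_simps)
      then show ?thesis using b that(1) order_trans by blast
    qed
    have "norm (angular_deriv j (arc_term (p - 1) (b + 1) g) \<theta>) \<le> C1 * \<epsilon>"
      by (rule C1(2)[OF g], intro allI impI w) auto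
    moreover have "norm (angular_deriv j (arc_term (p + 1) (b - 1) g) \<theta>) \<le> C2 * \<epsilon>"
      by (rule C2(2)[OF g], intro allI impI w) auto
    moreover have "norm (angular_deriv j (arc_term (p - 1) b (iter_deriv 1 g)) \<theta>) \<le> C3 * \<epsilon>"
      by (rule C3(2)[OF rapid_iter_deriv_1[OF g]], unfold iter_deriv_Suc'[symmetric], intro allI impI w) auto
    ultimately have "norm (of_int p * angular_deriv j (arc_term (p - 1) (b + 1) g) \<theta>) \<le> \<bar>of_int p\<bar> * (C1 * \<epsilon>)"
      "norm ((- of_nat b) * angular_deriv j (arc_term (p + 1) (b - 1) g) \<theta>) \<le> real b * (C2 * \<epsilon>)"
      "norm (angular_deriv j (arc_term (p - 1) b (iter_deriv 1 g)) \<theta>) \<le> C3 * \<epsilon>"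
      by (auto simp: norm_mult intro!: mult_left_mono)
    from norm_triangle_mono[OF norm_triangle_mono[OF this(1,2)] this(3)]
    show "norm (angular_deriv (Suc j) (arc_term p b g) \<theta>) \<le> (\<bar>of_int p\<bar> * C1 + real b * C2 + C3) * \<epsilon>"
      unfolding angular_deriv_Suc_arc_term[OF g] by (simp add: algebra_simps)
  qed (use C1 C2 C3 in auto)
qed

text \<open>Im z = sin \<theta> is the vector field that generates the boosts in the angle \<theta>.
  Its power d - 1 compensates the power of \<open>X\<close> in \<open>beta\<close>, which makes
  boosts act as translations of u. For d = 0 the weight is 1 / Im z.\<close>

definition arc_fun :: "nat \<Rightarrow> (real \<Rightarrow> complex) \<Rightarrow> complex \<Rightarrow> complex" where
  "arc_fun d g = arc_term (int d - 1) 0 g"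

lemma arc_fun_eq:
  "arc_fun d g z = (if z \<in> sphere 0 1 \<and> Im z > 0 then of_real (Im z powi (int d - 1)) * g (arc_coord z) else 0)"
  by (simp add: arc_fun_def arc_term_def)

lemma smooth_circle_arc_fun: "rapid g \<Longrightarrow> arc_fun d g \<in> smooth_circle"
  unfolding arc_fun_def by (rule smooth_circle_arc_term)

lemma arc_fun_diff: "arc_fun d (\<lambda>u. g u - h u) = (\<lambda>z. arc_fun d g z - arc_fun d h z)"
  by (auto simp: arc_fun_eq algebra_simps)

lemma arc_fun_scale: "arc_fun d (\<lambda>u. c * g u) = (\<lambda>z. c * arc_fun d g z)"
  by (auto simp: arc_fun_eq algebra_simps)

text \<open>The rate d + 1 + N dominates |d - 1| + j for all j <= N, also for d = 0.\<close>

lemma C_norm_arc_fun_bound: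
  obtains C where "C \<ge> 0"
    "\<And>g \<epsilon>. rapid g \<Longrightarrow> (\<And>i u. i \<le> N \<Longrightarrow> norm (iter_deriv i g u) \<le> \<epsilon> * exp (- (real d + 1 + real N) * \<bar>u\<bar>)) \<Longrightarrow>
       C_norm N (arc_fun d g) \<le> C * \<epsilon>"
proof -
  obtain C where C: "\<And>j. C j \<ge> 0" "\<And>j g \<epsilon> \<theta>. rapid g \<Longrightarrow>
      (\<forall>i\<le>j. \<forall>u. norm (iter_deriv i g u) \<le> \<epsilon> * exp (- (\<bar>of_int (int d - 1)\<bar> + real j) * \<bar>u\<bar>)) \<Longrightarrow>
     norm (angular_deriv j (arc_term (int d - 1) 0 g) \<theta>) \<le> C j * \<epsilon>"
    using arc_term_angular_bound[where p = "int d - 1" and b = 0] by metis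
  show ?thesis
  proof (rule that[of "\<Sum>j\<le>N. C j"])
    fix g \<epsilon>
    assume g: "rapid g" and b: "\<And>i u. i \<le> N \<Longrightarrow> norm (iter_deriv i g u) \<le> \<epsilon> * exp (- (real d + 1 + real N) * \<bar>u\<bar>)"
    have e0: "0 \<le> \<epsilon>" using order_trans[OF norm_ge_zero b[of 0 0]] by simp
    have "norm (iter_deriv i g u) \<le> \<epsilon> * exp (- (\<bar>of_int (int d - 1)\<bar> + real j) * \<bar>u\<bar>)"
      if "i \<le> j" "j \<le> N" for i j u
    proof -
      have "(\<bar>of_int (int d - 1)\<bar> + real j) * \<bar>u\<bar> \<le> (real d + 1 + real N) * \<bar>u\<bar>"
        using that by (intro mult_right_mono) auto
      then have "\<epsilon> * exp (- (real d + 1 + real N) * \<bar>u\<bar>) \<le> \<epsilon> * exp (- (\<bar>of_int (int d - 1)\<bar> + real j) * \<bar>u\<bar>)"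
        using e0 by (intro mult_left_mono) (simp_all add: algebra_simps)
      then show ?thesis using b[of i u] that by linarith
    qed
    then have "norm (angular_deriv j (arc_fun d g) \<theta>) \<le> C j * \<epsilon>" if "j \<le> N" for j \<theta>
      unfolding arc_fun_def using C(2)[OF g] that by blast
    then show "C_norm N (arc_fun d g) \<le> (\<Sum>j\<le>N. C j) * \<epsilon>"
      unfolding sum_distrib_right by (rule C_norm_le)
  qed (use C in \<open>auto intro: sum_nonneg\<close>)
qed

section \<open>Passage through the disk\<close>

text \<open>Strips of every width are needed: the argument is moved by i \<pi> and by 2 \<pi> i, and
  Cauchy estimates of the derivatives widen the strip by 1.\<close>

definition rapid_entire :: "(complex \<Rightarrow> complex) \<Rightarrow> bool" where
  "rapid_entire h \<longleftrightarrow> h holomorphic_on UNIV \<and>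
     (\<forall>K V. \<exists>C. \<forall>z. \<bar>Im z\<bar> \<le> V \<longrightarrow> norm (h z) \<le> C * exp (- K * \<bar>Re z\<bar>))"

lemma rapid_entire_bound:
  assumes "rapid_entire h"
  obtains C where "C \<ge> 0" "\<And>z. \<bar>Im z\<bar> \<le> V \<Longrightarrow> norm (h z) \<le> C * exp (- K * \<bar>Re z\<bar>)"
proof -
  obtain C where C: "\<And>z. \<bar>Im z\<bar> \<le> \<bar>V\<bar> \<Longrightarrow> norm (h z) \<le> C * exp (- K * \<bar>Re z\<bar>)"
    using assms unfolding rapid_entire_def by blast
  have "0 \<le> C" using order_trans[OF norm_ge_zero C[of 0]] by simp
  then show ?thesis using C that by force
qed

lemma exp_abs_shift_le:
  fixes K x y :: real
  shows "exp (- K * \<bar>x\<bar>) \<le> exp (\<bar>K\<bar> * \<bar>x - y\<bar>) * exp (- K * \<bar>y\<bar>)"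
proof -
  have "\<bar>K * (\<bar>y\<bar> - \<bar>x\<bar>)\<bar> \<le> \<bar>K\<bar> * \<bar>x - y\<bar>" unfolding abs_mult by (intro mult_left_mono) auto
  then have "- K * \<bar>x\<bar> \<le> \<bar>K\<bar> * \<bar>x - y\<bar> + - K * \<bar>y\<bar>" by (simp add: algebra_simps abs_le_iff)
  then show ?thesis unfolding exp_add[symmetric] by simp
qed

lemma rapid_entire_shift:
  assumes "rapid_entire h"
  shows "rapid_entire (\<lambda>z. h (z - a))"
  unfolding rapid_entire_def
proof (intro conjI allI)
  have "h holomorphic_on UNIV" using assms by (simp add: rapid_entire_def)
  then have "(h \<circ> (\<lambda>z. z - a)) holomorphic_on UNIV"
    by (intro holomorphic_on_compose_gen[where t = UNIV]) (auto intro!: holomorphic_intros)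
  then show "(\<lambda>z. h (z - a)) holomorphic_on UNIV" by (simp add: o_def)
  fix K V
  obtain C where C: "C \<ge> 0" "\<And>z. \<bar>Im z\<bar> \<le> V + \<bar>Im a\<bar> \<Longrightarrow> norm (h z) \<le> C * exp (- K * \<bar>Re z\<bar>)"
    using rapid_entire_bound[OF assms, where V = "V + \<bar>Im a\<bar>" and K = K] by blast
  have "norm (h (z - a)) \<le> C * exp (\<bar>K\<bar> * \<bar>Re a\<bar>) * exp (- K * \<bar>Re z\<bar>)" if "\<bar>Im z\<bar> \<le> V" for z
  proof -
    have "norm (h (z - a)) \<le> C * exp (- K * \<bar>Re (z - a)\<bar>)" using that by (intro C) auto
    also have "\<dots> \<le> C * (exp (\<bar>K\<bar> * \<bar>Re (z - a) - Re z\<bar>) * exp (- K * \<bar>Re z\<bar>))"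
      by (intro mult_left_mono exp_abs_shift_le C)
    finally show ?thesis by (simp add: mult_ac)
  qed
  then show "\<exists>C. \<forall>z. \<bar>Im z\<bar> \<le> V \<longrightarrow> norm (h (z - a)) \<le> C * exp (- K * \<bar>Re z\<bar>)" by blast
qed

text \<open>Cauchy's inequality on unit disks, at the price of a strip wider by 1 and of a factor
  exp |K|.\<close>

lemma rapid_entire_higher_deriv:
  assumes "rapid_entire h"
  shows "rapid_entire ((deriv ^^ j) h)"
  unfolding rapid_entire_def
proof (intro conjI allI)
  have h: "h holomorphic_on UNIV" using assms by (simp add: rapid_entire_def)
  then show "(deriv ^^ j) h holomorphic_on UNIV" by (intro holomorphic_higher_deriv) auto
  fix K V
  obtain C where C: "C \<ge> 0" "\<And>z. \<bar>Im z\<bar> \<le> V + 1 \<Longrightarrow> norm (h z) \<le> C * exp (- K * \<bar>Re z\<bar>)"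
    using rapid_entire_bound[OF assms, where V = "V + 1" and K = K] by blast
  have "norm ((deriv ^^ j) h z) \<le> (fact j * C * exp \<bar>K\<bar>) * exp (- K * \<bar>Re z\<bar>)" if "\<bar>Im z\<bar> \<le> V" for z
  proof -
    have "norm ((deriv ^^ j) h z) \<le> fact j * (C * exp \<bar>K\<bar> * exp (- K * \<bar>Re z\<bar>)) / 1 ^ j"
    proof (rule Cauchy_inequality)
      show "h holomorphic_on ball z 1" "continuous_on (cball z 1) h"
        using h holomorphic_on_imp_continuous_on holomorphic_on_subset continuous_on_subset by blast+
      fix x assume x: "norm (z - x) = 1"
      have xz: "\<bar>Re x - Re z\<bar> \<le> 1" "\<bar>Im x - Im z\<bar> \<le> 1"
        using x abs_Re_le_cmod[of "z - x"] abs_Im_le_cmod[of "z - x"] by auto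
      have "norm (h x) \<le> C * exp (- K * \<bar>Re x\<bar>)" using xz that by (intro C) auto
      also have "\<dots> \<le> C * (exp (\<bar>K\<bar> * \<bar>Re x - Re z\<bar>) * exp (- K * \<bar>Re z\<bar>))"
        by (intro mult_left_mono exp_abs_shift_le C)
      also have "\<dots> \<le> C * (exp \<bar>K\<bar> * exp (- K * \<bar>Re z\<bar>))"
        using xz by (intro mult_left_mono mult_right_mono C) (auto intro: mult_left_le)
      finally show "norm (h x) \<le> C * exp \<bar>K\<bar> * exp (- K * \<bar>Re z\<bar>)" by (simp add: mult_ac)
    qed simp
    then show ?thesis by (simp add: mult_ac)
  qed
  then show "\<exists>C. \<forall>z. \<bar>Im z\<bar> \<le> V \<longrightarrow> norm ((deriv ^^ j) h z) \<le> C * exp (- K * \<bar>Re z\<bar>)" by blast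
qed

lemma rapid_entire_restrict:
  assumes "rapid_entire h"
  shows "rapid (\<lambda>u. h (of_real u))" "iter_deriv j (\<lambda>u. h (of_real u)) = (\<lambda>u. (deriv ^^ j) h (of_real u))"
proof -
  have d: "((\<lambda>u. (deriv ^^ j) h (of_real u)) has_vector_derivative (deriv ^^ Suc j) h (of_real u)) (at u)" for j u
  proof -
    have "((deriv ^^ j) h has_field_derivative deriv ((deriv ^^ j) h) (of_real u)) (at (of_real u))"
      using rapid_entire_higher_deriv[OF assms, of j] holomorphic_derivI[of _ UNIV]
      by (auto simp: rapid_entire_def)
    from has_vector_derivative_real_field[OF this] show ?thesis by simp
  qed
  show "iter_deriv j (\<lambda>u. h (of_real u)) = (\<lambda>u. (deriv ^^ j) h (of_real u))"
    by (rule iter_deriv_unique[where G = "\<lambda>j u. (deriv ^^ j) h (of_real u)"]) (simp, rule d)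
  show "rapid (\<lambda>u. h (of_real u))"
  proof (rule rapidI[where G = "\<lambda>j u. (deriv ^^ j) h (of_real u)"])
    fix j K
    obtain C where "\<And>z. \<bar>Im z\<bar> \<le> 0 \<Longrightarrow> norm ((deriv ^^ j) h z) \<le> C * exp (- K * \<bar>Re z\<bar>)"
      using rapid_entire_bound[OF rapid_entire_higher_deriv[OF assms]] by blast
    then have "\<forall>u. norm ((deriv ^^ j) h (complex_of_real u)) \<le> C * exp (- K * \<bar>u\<bar>)"
      by (metis Im_complex_of_real Re_complex_of_real abs_zero order_refl)
    then show "\<exists>C. \<forall>u. norm ((deriv ^^ j) h (complex_of_real u)) \<le> C * exp (- K * \<bar>u\<bar>)" ..
  qed (simp, rule d)
qed

text \<open>The Cayley transform maps the closed disk without 1 and -1 into the closed right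
  half-plane without 0, which avoids the cut of the principal logarithm.\<close>

lemma Re_halfplane_pos:
  fixes z :: complex
  assumes "z \<in> cball 0 1" "z \<noteq> 1" "z \<noteq> -1"
  shows "(1 - z) / (1 + z) \<noteq> 0" "(1 - z) / (1 + z) \<notin> \<real>\<^sub>\<le>\<^sub>0"
proof -
  have z1: "1 + z \<noteq> 0" using assms(3) by (metis add_eq_0_iff minus_minus)
  have "1 - z \<noteq> 0" using assms(2) by (metis right_minus_eq)
  then show nz: "(1 - z) / (1 + z) \<noteq> 0" using z1 unfolding divide_eq_0_iff by blast
  have "cmod z \<le> 1" using assms(1) by simp
  then have "(cmod z)\<^sup>2 \<le> 1" by (simp add: power_le_one)
  then have "(Re z)\<^sup>2 + (Im z)\<^sup>2 \<le> 1" by (simp add: cmod_power2)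
  moreover have "Re ((1 - z) / (1 + z)) = (1 - ((Re z)\<^sup>2 + (Im z)\<^sup>2)) / ((1 + Re z)\<^sup>2 + (Im z)\<^sup>2)"
    by (simp add: Re_divide power2_eq_square algebra_simps)
  ultimately have "Re ((1 - z) / (1 + z)) \<ge> 0" by simp
  then show "(1 - z) / (1 + z) \<notin> \<real>\<^sub>\<le>\<^sub>0"
    using nz by (auto simp: complex_nonpos_Reals_iff complex_eq_iff)
qed

text \<open>Counterpart of \<open>exp_arc_coord_le\<close> inside the disk. With a = |1 - z| and b =
  |1 + z| the left side is the smaller of a/b and b/a, and the right side is a b. Since a + b >= 2,
  the larger of a and b is at least 1.\<close>

lemma exp_neg_abs_ln_le:
  assumes "z \<in> cball 0 1" "z \<noteq> 1" "z \<noteq> -1"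
  shows "exp (- \<bar>Re (Ln ((1 - z) / (1 + z)))\<bar>) \<le> cmod (z\<^sup>2 - 1)"
proof -
  define a b where "a = cmod (1 - z)" and "b = cmod (1 + z)"
  have z1: "1 + z \<noteq> 0" using assms(3) by (metis add_eq_0_iff minus_minus)
  then have ab: "a > 0" "b > 0" using assms(2) by (auto simp: a_def b_def)
  have "a + b \<ge> 2" using norm_triangle_ineq[of "1 - z" "1 + z"] by (simp add: a_def b_def)
  have "z\<^sup>2 - 1 = - ((1 - z) * (1 + z))" by (simp add: algebra_simps power2_eq_square)
  then have n: "cmod (z\<^sup>2 - 1) = a * b" by (simp add: norm_mult a_def b_def)
  have r: "Re (Ln ((1 - z) / (1 + z))) = ln (a / b)"
    using Re_halfplane_pos(1)[OF assms] by (simp add: norm_divide a_def b_def Re_Ln)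
  show ?thesis
  proof (cases "a \<le> b")
    case True
    then have "exp (- \<bar>ln (a / b)\<bar>) = a / b" using ab by (auto simp: abs_if ln_div exp_diff)
    moreover have "b \<ge> 1" using True \<open>a + b \<ge> 2\<close> by simp
    then have "b * b \<ge> 1" using mult_mono[of 1 b 1 b] by simp
    then have "a / b \<le> a * b" using ab mult_left_mono[of 1 "b * b" a] by (simp add: field_simps)
    ultimately show ?thesis using r n by simp
  next
    case False
    then have "exp (- \<bar>ln (a / b)\<bar>) = b / a" using ab by (simp add: abs_if ln_div exp_minus exp_diff)
    moreover have "a \<ge> 1" using False \<open>a + b \<ge> 2\<close> by simp
    then have "a * a \<ge> 1" using mult_mono[of 1 a 1 a] by simp
    then have "b / a \<le> a * b" using ab mult_left_mono[of 1 "a * a" b] by (simp add: field_simps)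
    ultimately show ?thesis using r n by simp
  qed
qed

text \<open>The boundary values of \<open>X\<^sup>d\<^sup>-\<^sup>1 h(u)\<close>, where \<open>u = ln ((1 - z) / (1 + z)) + i \<pi> / 2\<close> maps the disk to the
  strip \<open>0 < Im u < \<pi>\<close> and \<open>X = (z - 1/z) / 2i\<close> generates the boosts. The factor \<open>z\<^sup>d\<^sup>-\<^sup>1\<close> removes the
  singularity of \<open>X\<^sup>d\<^sup>-\<^sup>1\<close> at the origin.\<close>

definition strip_extension :: "nat \<Rightarrow> (complex \<Rightarrow> complex) \<Rightarrow> complex \<Rightarrow> complex" where
  "strip_extension d h z = (if z = 1 \<or> z = -1 then 0
     else ((z\<^sup>2 - 1) / (2 * \<i>)) powi (int d - 1) * h (Ln ((1 - z) / (1 + z)) + \<i> * (pi / 2)))"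

lemma strip_extension_holomorphic:
  assumes "rapid_entire h" "S \<subseteq> cball 0 1 - {1, -1}"
  shows "strip_extension d h holomorphic_on S"
proof -
  have "h holomorphic_on UNIV" using assms(1) by (simp add: rapid_entire_def)
  moreover have "(\<lambda>z. Ln ((1 - z) / (1 + z)) + \<i> * (pi / 2)) holomorphic_on S"
  proof (intro holomorphic_intros)
    fix z assume "z \<in> S"
    then have z: "z \<in> cball 0 1" "z \<noteq> 1" "z \<noteq> -1" using assms(2) by auto
    show "(1 - z) / (1 + z) \<notin> \<real>\<^sub>\<le>\<^sub>0" by (rule Re_halfplane_pos(2)[OF z])
    show "1 + z \<noteq> 0" using z(3) by (metis add_eq_0_iff minus_minus)
  qed
  ultimately have "(h \<circ> (\<lambda>z. Ln ((1 - z) / (1 + z)) + \<i> * (pi / 2))) holomorphic_on S"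
    using holomorphic_on_compose holomorphic_on_subset by blast
  moreover have "(\<lambda>z. ((z\<^sup>2 - 1) / (2 * \<i>)) powi (int d - 1)) holomorphic_on S"
    using assms(2) by (intro holomorphic_intros) (auto simp: power2_eq_1_iff)
  ultimately have "(\<lambda>z. ((z\<^sup>2 - 1) / (2 * \<i>)) powi (int d - 1) * (h \<circ> (\<lambda>z. Ln ((1 - z) / (1 + z)) + \<i> * (pi / 2))) z)
      holomorphic_on S" by (rule holomorphic_on_mult[rotated])
  then show ?thesis
    by (rule holomorphic_transform) (use assms(2) in \<open>auto simp: strip_extension_def\<close>)
qed

lemma strip_extension_bound:
  assumes "rapid_entire h"
  obtains C where "\<And>z. z \<in> cball 0 1 \<Longrightarrow> norm (strip_extension d h z) \<le> C * cmod (z\<^sup>2 - 1)"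
proof -
  \<comment> \<open>The width 2 \<pi> accommodates the crude bound |Im w| <= \<pi> plus \<pi>/2. The
    rate 2 gives two factors |z^2 - 1|: one compensates the exponent -1 that occurs for d = 0, the
    other is left to vanish at 1 and -1.\<close>
  obtain C where C: "C \<ge> 0" "\<And>z. \<bar>Im z\<bar> \<le> 2 * pi \<Longrightarrow> norm (h z) \<le> C * exp (- 2 * \<bar>Re z\<bar>)"
    using rapid_entire_bound[OF assms, where V = "2 * pi" and K = 2] by auto
  have "norm (strip_extension d h z) \<le> (C * 2) * cmod (z\<^sup>2 - 1)" if z: "z \<in> cball 0 1" for z
  proof (cases "z = 1 \<or> z = -1")
    case False
    define w where "w = Ln ((1 - z) / (1 + z))"
    define r where "r = cmod (z\<^sup>2 - 1)"
    have r0: "r > 0" using False by (auto simp: r_def power2_eq_1_iff)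
    have "cmod (z\<^sup>2) \<le> 1" using z by (simp add: norm_power power_le_one)
    then have r2: "r / 2 \<le> 1" using norm_triangle_ineq4[of "z\<^sup>2" 1] by (simp add: r_def)
    have "\<bar>Im w\<bar> \<le> pi" using Im_Ln_le_pi mpi_less_Im_Ln Re_halfplane_pos(1)[OF z] False
      unfolding w_def by (smt (verit, best))
    then have "norm (h (w + \<i> * (pi / 2))) \<le> C * exp (- 2 * \<bar>Re w\<bar>)"
      using C(2)[of "w + \<i> * (pi / 2)"] pi_gt_zero by (simp add: abs_le_iff)
    also have "exp (- 2 * \<bar>Re w\<bar>) = (exp (- \<bar>Re w\<bar>)) ^ 2" by (simp flip: exp_of_nat_mult)
    also have "C * \<dots> \<le> C * r ^ 2"
      unfolding w_def r_def using False by (intro mult_left_mono power_mono exp_neg_abs_ln_le z C) auto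
    finally have hw: "norm (h (w + \<i> * (pi / 2))) \<le> C * r ^ 2" .
    have "norm (strip_extension d h z) = (r / 2) powi (int d - 1) * norm (h (w + \<i> * (pi / 2)))"
      using False by (simp add: strip_extension_def w_def r_def norm_mult norm_power_int norm_divide)
    also have "\<dots> \<le> (r / 2) powi (int d - 1) * (C * r ^ 2)"
      using hw r0 by (intro mult_left_mono) auto
    also have "\<dots> = (r / 2) ^ d * (C * 2 * r)"
      using r0 by (simp add: power_int_diff power2_eq_square)
    also have "\<dots> \<le> 1 * (C * 2 * r)"
      using r0 r2 C by (intro mult_right_mono power_le_one) auto
    finally show ?thesis by (simp add: r_def)
  qed (auto simp: strip_extension_def C)
  then show ?thesis by (rule that)
qed

text \<open>At 1 and -1 the logarithm diverges, and continuity comes from the bound by |z^2 - 1|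
  instead of from holomorphy.\<close>

lemma strip_extension_continuous:
  assumes "rapid_entire h"
  shows "continuous_on (cball 0 1) (strip_extension d h)"
proof (rule continuous_on_eq_continuous_within[THEN iffD2], rule ballI)
  fix z :: complex assume z: "z \<in> cball 0 1"
  show "continuous (at z within cball 0 1) (strip_extension d h)"
  proof (cases "z = 1 \<or> z = -1")
    case True
    obtain C where C: "\<And>z. z \<in> cball 0 1 \<Longrightarrow> norm (strip_extension d h z) \<le> C * cmod (z\<^sup>2 - 1)"
      using strip_extension_bound[OF assms, where d = d] by blast
    have "((\<lambda>x. C * cmod (x\<^sup>2 - 1)) \<longlongrightarrow> C * cmod (z\<^sup>2 - 1)) (at z within cball 0 1)"
      by (intro tendsto_intros)
    moreover have "z\<^sup>2 - 1 = 0" using True by auto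
    ultimately have "((\<lambda>x. C * cmod (x\<^sup>2 - 1)) \<longlongrightarrow> 0) (at z within cball 0 1)" by simp
    then have "(strip_extension d h \<longlongrightarrow> 0) (at z within cball 0 1)"
      by (rule Lim_null_comparison[rotated]) (use C in \<open>auto simp: eventually_at_filter\<close>)
    then show ?thesis using True by (simp add: continuous_within strip_extension_def)
  next
    case False
    have "continuous_on (cball 0 1 - {1, -1}) (strip_extension d h)"
      by (intro holomorphic_on_imp_continuous_on strip_extension_holomorphic assms) auto
    then have "continuous (at z within cball 0 1 - {1, -1}) (strip_extension d h)"
      using False z by (auto simp: continuous_on_eq_continuous_within)
    moreover have "at z within cball 0 1 - {1, -1} = at z within cball 0 1"
      using False by (intro at_within_nhd[of z "- {1, -1}"] open_Compl finite_imp_closed) auto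
    ultimately show ?thesis by simp
  qed
qed

text \<open>On the circle (z^2 - 1) / 2i = z Im z and (1 - z) / (1 + z) = -i tan (\<theta>/2). The
  principal logarithm of the latter has imaginary part -\<pi>/2 on the upper and \<pi>/2 on the
  lower semicircle. After adding i \<pi>/2 the argument of \<open>h\<close> is u above and u + i
  \<pi> below, with u taken at the reflected point. The sign comes from (- Im z) powi (d -
  1).\<close>

lemma strip_extension_circle:
  assumes z: "z \<in> sphere 0 1"
  shows "arc_fun d (\<lambda>u. h (of_real u)) z
      + (-1) ^ Suc d * reflect (arc_fun d (\<lambda>u. h (of_real u + \<i> * pi))) z
    = z powi (1 - int d) * strip_extension d h z"
proof (cases "z = 1 \<or> z = -1")
  case True
  then show ?thesis by (auto simp: arc_fun_eq reflect_def strip_extension_def)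
next
  case False
  define x y where "x = Re z" and "y = Im z"
  have xy: "x * x + y * y = 1" using z by (simp add: x_def y_def cmod_def power2_eq_square)
  have zc: "z = Complex x y" by (simp add: x_def y_def)
  have y0: "y \<noteq> 0"
  proof
    assume "y = 0"
    then have "x = 1 \<or> x = -1" using xy by (simp add: square_eq_1_iff)
    then show False using False \<open>y = 0\<close> by (auto simp: zc complex_eq_iff)
  qed
  then have "y * y > 0" using not_real_square_gt_zero by blast
  then have "x\<^sup>2 < 1" using xy by (simp add: power2_eq_square)
  then have x1: "1 + x > 0" by (simp add: abs_square_less_1 abs_less_iff)
  have z0: "z \<noteq> 0" using z by auto
  have inv: "inverse z = Complex x (- y)"
    using xy by (simp add: zc complex_eq_iff power2_eq_square)
  have sq: "(z\<^sup>2 - 1) / (2 * \<i>) = z * of_real y"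
  proof -
    have "z\<^sup>2 - 1 = 2 * \<i> * (z * of_real y)"
      using xy by (simp add: zc complex_eq_iff power2_eq_square)
    then show ?thesis by simp
  qed
  have fac: "z powi (1 - int d) * ((z\<^sup>2 - 1) / (2 * \<i>)) powi (int d - 1) = of_real (y powi (int d - 1))"
    unfolding sq power_int_mult_distrib using z0
    by (simp flip: power_int_add add: mult.assoc[symmetric])
  have q: "(1 - z) / (1 + z) = - \<i> * of_real (y / (1 + x))"
  proof -
    have "(1 - z) = - \<i> * of_real (y / (1 + x)) * (1 + z)"
      using x1 xy by (simp add: zc complex_eq_iff field_simps)
    moreover have "1 + z \<noteq> 0" using x1 by (auto simp: zc complex_eq_iff)
    ultimately show ?thesis by (simp add: field_simps)
  qed
  have main: "strip_extension d h z = ((z\<^sup>2 - 1) / (2 * \<i>)) powi (int d - 1) * h (Ln ((1 - z) / (1 + z)) + \<i> * (pi / 2))"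
    using False by (simp add: strip_extension_def)
  show ?thesis
  proof (cases "y > 0")
    case True
    have "Ln ((1 - z) / (1 + z)) = ln (y / (1 + x)) - \<i> * (pi / 2)"
    proof -
      define r where "r = y / (1 + x)"
      have "r > 0" using True x1 by (simp add: r_def)
      then have "Ln (of_real r * (- \<i>)) = of_real (ln r) - \<i> * (pi / 2)"
        by (subst Ln_times_of_real) (auto simp: Ln_of_real)
      then show ?thesis unfolding q r_def by (simp only: mult.commute)
    qed
    then have "strip_extension d h z = ((z\<^sup>2 - 1) / (2 * \<i>)) powi (int d - 1) * h (of_real (ln (y / (1 + x))))"
      unfolding main by simp
    moreover have "reflect (arc_fun d (\<lambda>u. h (of_real u + \<i> * pi))) z = 0"
      using True unfolding reflect_def inv arc_fun_eq by simp
    moreover have "arc_fun d (\<lambda>u. h (of_real u)) z = of_real (y powi (int d - 1)) * h (of_real (ln (y / (1 + x))))"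
      using True z by (simp add: arc_fun_eq arc_coord_def x_def y_def)
    ultimately show ?thesis
      by (simp only: fac mult.assoc[symmetric] mult_zero_right add_0_right add_0_left)
  next
    case neg: False
    then have y: "- y > 0" using y0 by simp
    have "Ln ((1 - z) / (1 + z)) = ln (- y / (1 + x)) + \<i> * (pi / 2)"
    proof -
      define r where "r = - y / (1 + x)"
      have "r > 0" using y x1 unfolding r_def by (intro divide_pos_pos)
      then have "Ln (of_real r * \<i>) = of_real (ln r) + \<i> * (pi / 2)"
        by (subst Ln_times_of_real) (auto simp: Ln_of_real)
      moreover have "- \<i> * of_real (y / (1 + x)) = of_real r * \<i>" by (simp add: r_def)
      ultimately show ?thesis unfolding q by (simp only: r_def)
    qed
    then have "strip_extension d h z = ((z\<^sup>2 - 1) / (2 * \<i>)) powi (int d - 1) * h (of_real (ln (- y / (1 + x))) + \<i> * pi)"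
      unfolding main by (simp add: add_ac)
    moreover have "arc_fun d (\<lambda>u. h (of_real u)) z = 0"
      using y by (simp add: arc_fun_eq y_def)
    moreover have "reflect (arc_fun d (\<lambda>u. h (of_real u + \<i> * pi))) z =
        of_real ((- y) powi (int d - 1)) * h (of_real (ln (- y / (1 + x))) + \<i> * pi)"
      using y xy unfolding reflect_def inv arc_fun_eq arc_coord_def by (simp add: cmod_def power2_eq_square)
    moreover have "(-1) ^ Suc d * (- y) powi (int d - 1) = y powi (int d - 1)"
    proof -
      have "(- y) powi (int d - 1) = (-1) powi (int d - 1) * y powi (int d - 1)"
        using power_int_mult_distrib[of "-1" y "int d - 1"] by simp
      moreover have "(-1::real) powi (int d - 1) = (-1) ^ Suc d"
        using y by (simp add: power_int_diff)
      ultimately show ?thesis by (simp flip: power_mult_distrib)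
    qed
    then have "(-1) ^ Suc d * complex_of_real ((- y) powi (int d - 1)) = of_real (y powi (int d - 1))"
      by (metis of_real_1 of_real_minus of_real_mult of_real_power)
    ultimately show ?thesis
      by (simp only: fac mult.assoc[symmetric] mult_zero_right add_0_right add_0_left)
  qed
qed

text \<open>The boundary value starts with the power z^(1-d), so it suffices that the modes n > -d
  are killed. Passing to the other semicircle continues u by i \<pi> and costs the sign
  (-1)^d.\<close>

lemma half_circle_rotation:
  assumes L: "circle_distribution L" and kill: "\<And>n. n > - int d \<Longrightarrow> L (mode n) = 0"
    and h: "rapid_entire h"
  shows "L (arc_fun d (\<lambda>u. h (of_real u)))
    = (-1) ^ d * L (reflect (arc_fun d (\<lambda>u. h (of_real u + \<i> * pi))))"
proof -
  have r: "rapid (\<lambda>u. h (of_real u))" "rapid (\<lambda>u. h (of_real u + \<i> * pi))"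
    using rapid_entire_restrict(1)[OF h] rapid_entire_restrict(1)[OF rapid_entire_shift[OF h, of "- \<i> * pi"]]
    by simp_all
  note s = smooth_circle_arc_fun[OF r(1)] smooth_circle_reflect[OF smooth_circle_arc_fun[OF r(2)]]
  let ?q = "\<lambda>z. arc_fun d (\<lambda>u. h (of_real u)) z
      + (-1) ^ Suc d * reflect (arc_fun d (\<lambda>u. h (of_real u + \<i> * pi))) z"
  have "L ?q = 0"
  proof (rule circle_distribution_boundary_value_eq_0[OF L])
    show "strip_extension d h holomorphic_on ball 0 1"
      by (rule strip_extension_holomorphic[OF h]) auto
    show "?q \<in> smooth_circle" by (intro smooth_circle_add smooth_circle_scale s)
    show "?q z = z powi (1 - int d) * strip_extension d h z" if "z \<in> sphere 0 1" for z
      by (rule strip_extension_circle[OF that])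
    show "L (mode n) = 0" if "n \<ge> 1 - int d" for n using kill that by simp
  qed (rule strip_extension_continuous[OF h])
  then show ?thesis
    by (simp add: circle_distribution_add[OF L s(1) smooth_circle_scale[OF s(2)]]
        circle_distribution_scale[OF L s(2)] add_eq_0_iff del: power_Suc)
       (simp add: add_eq_0_iff)
qed

section \<open>Boosts and vacuum modes\<close>

text \<open>The rational function without the restriction to the disk, so that algebraic identities
  need no case distinction.\<close>

definition boost_map :: "real \<Rightarrow> complex \<Rightarrow> complex" where
  "boost_map t z = (of_real (cosh (t / 2)) * z - of_real (sinh (t / 2))) /
                   (of_real (cosh (t / 2)) - of_real (sinh (t / 2)) * z)"

lemma boost_eq: "boost t z = (if z \<in> cball 0 1 then boost_map t z else z)"
  by (simp add: boost_def moebius_def boost_map_def)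

lemma rot_eq: "rot \<theta> z = (if z \<in> cball 0 1 then cis \<theta> * z else z)"
proof -
  have "cis (\<theta> / 2) * z / cis (- (\<theta> / 2)) = (cis (\<theta> / 2) * cis (\<theta> / 2)) * z"
    unfolding cis_inverse[symmetric] divide_inverse inverse_inverse_eq
    by (simp only: mult.assoc mult.commute mult.left_commute)
  also have "cis (\<theta> / 2) * cis (\<theta> / 2) = cis \<theta>" by (simp add: cis_mult)
  finally show ?thesis by (simp add: rot_def moebius_def cis_cnj)
qed

section \<open>Boosts and rotations on the circle and on test functions\<close>

lemma cosh_sinh_half: "cosh (t / 2) ^ 2 - sinh (t / 2) ^ 2 = (1::real)"
  by (simp add: cosh_square_eq)

lemma boost_Mob: "boost t \<in> Mob"
proof -
  have "(cmod (of_real (cosh (t / 2))))\<^sup>2 - (cmod (of_real (- sinh (t / 2))))\<^sup>2 = 1"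
    using cosh_sinh_half[of t] by simp
  then show ?thesis unfolding Mob_def boost_def by blast
qed

lemma rot_Mob: "rot \<theta> \<in> Mob"
proof -
  have "(cmod (cis (\<theta> / 2)))\<^sup>2 - (cmod 0)\<^sup>2 = 1" by simp
  then show ?thesis unfolding Mob_def rot_def by blast
qed

lemma boost_denominator:
  assumes "z \<in> cball 0 1"
  shows "of_real (cosh (t / 2)) - of_real (sinh (t / 2)) * z \<noteq> (0::complex)"
proof
  assume "of_real (cosh (t / 2)) - of_real (sinh (t / 2)) * z = (0::complex)"
  then have "cmod (of_real (cosh (t / 2))) = cmod (of_real (sinh (t / 2)) * z)" by simp
  then have "cosh (t / 2) = \<bar>sinh (t / 2)\<bar> * cmod z" by (simp add: norm_mult)
  also have "\<dots> \<le> \<bar>sinh (t / 2)\<bar> * 1" using assms by (intro mult_left_mono) auto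
  finally have "cosh (t / 2) ^ 2 \<le> sinh (t / 2) ^ 2"
    by (metis abs_le_square_iff abs_of_pos cosh_real_pos mult.right_neutral abs_abs power2_abs)
  then show False using cosh_sinh_half[of t] by simp
qed

lemma boost_norm:
  "cmod (of_real (cosh (t / 2)) - of_real (sinh (t / 2)) * z) ^ 2
     - cmod (of_real (cosh (t / 2)) * z - of_real (sinh (t / 2))) ^ 2 = 1 - (cmod z)\<^sup>2"
proof -
  define c s x y where "c = cosh (t / 2)" and "s = sinh (t / 2)" and "x = Re z" and "y = Im z"
  have "((c - s * x)\<^sup>2 + (s * y)\<^sup>2) - ((c * x - s)\<^sup>2 + (c * y)\<^sup>2) = (c\<^sup>2 - s\<^sup>2) * (1 - (x\<^sup>2 + y\<^sup>2))"
    by (simp add: power2_eq_square algebra_simps)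
  moreover have "c\<^sup>2 - s\<^sup>2 = 1" using cosh_sinh_half[of t] by (simp add: c_def s_def)
  ultimately show ?thesis by (simp add: cmod_power2 c_def s_def x_def y_def)
qed

lemma boost_map_norm:
  assumes "z \<in> cball 0 1"
  shows "cmod (boost_map t z) \<le> 1" "cmod (boost_map t z) = 1 \<longleftrightarrow> cmod z = 1"
proof -
  let ?n = "cmod (of_real (cosh (t / 2)) * z - of_real (sinh (t / 2)))"
    and ?d = "cmod (of_real (cosh (t / 2)) - of_real (sinh (t / 2)) * z)"
  have d: "?d > 0" using boost_denominator[OF assms] by simp
  have z1: "(cmod z)\<^sup>2 \<le> 1" using assms by (simp add: power_le_one)
  then have "?n\<^sup>2 \<le> ?d\<^sup>2" using boost_norm[of t z] by linarith
  then have "?n \<le> ?d" by (rule power2_le_imp_le) simp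
  then show "cmod (boost_map t z) \<le> 1" using d by (simp add: boost_map_def norm_divide)
  have "?n = ?d \<longleftrightarrow> ?n\<^sup>2 = ?d\<^sup>2" by (simp add: power2_eq_iff_nonneg)
  also have "\<dots> \<longleftrightarrow> (cmod z)\<^sup>2 = 1" using boost_norm[of t z] by auto
  also have "\<dots> \<longleftrightarrow> cmod z = 1" by (simp add: power2_eq_1_iff) (smt (verit) norm_ge_zero)
  finally have "?n = ?d \<longleftrightarrow> cmod z = 1" .
  moreover have "cmod (boost_map t z) = ?n / ?d" by (simp add: boost_map_def norm_divide)
  moreover have "?n / ?d = 1 \<longleftrightarrow> ?n = ?d" using d by auto
  ultimately show "cmod (boost_map t z) = 1 \<longleftrightarrow> cmod z = 1" by simp
qed

lemma boost_map_inverse: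
  assumes "z \<in> cball 0 1"
  shows "boost_map t (boost_map (- t) z) = z"
proof -
  define c s where "c = complex_of_real (cosh (t / 2))" and "s = complex_of_real (sinh (t / 2))"
  have cs: "c * c - s * s = 1"
    using cosh_sinh_half[of t] unfolding c_def s_def by (simp add: power2_eq_square flip: of_real_mult of_real_diff)
  have d: "c + s * z \<noteq> 0" using boost_denominator[OF assms, of "- t"] by (simp add: c_def s_def)
  have e: "boost_map (- t) z = (c * z + s) / (c + s * z)" by (simp add: boost_map_def c_def s_def)
  have "c * ((c * z + s) / (c + s * z)) - s = (c * (c * z + s) - s * (c + s * z)) / (c + s * z)"
    using d by (simp add: field_simps)
  also have "c * (c * z + s) - s * (c + s * z) = (c * c - s * s) * z" by (simp add: algebra_simps)
  finally have n: "c * ((c * z + s) / (c + s * z)) - s = z / (c + s * z)" by (simp add: cs)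
  have "c - s * ((c * z + s) / (c + s * z)) = (c * (c + s * z) - s * (c * z + s)) / (c + s * z)"
    using d by (simp add: field_simps)
  also have "c * (c + s * z) - s * (c * z + s) = c * c - s * s" by (simp add: algebra_simps)
  finally have m: "c - s * ((c * z + s) / (c + s * z)) = 1 / (c + s * z)" by (simp add: cs)
  show ?thesis unfolding e using d n m by (simp add: boost_map_def flip: c_def s_def)
qed

lemma boost_comp_inverse: "boost t \<circ> boost (- t) = id"
  using boost_map_inverse boost_map_norm(1) by (auto simp: boost_eq fun_eq_iff)

lemma inv_boost: "inv (boost t) = boost (- t)"
  using boost_comp_inverse[of t] boost_comp_inverse[of "- t"] by (intro inv_equality) (auto simp: fun_eq_iff)

lemma inv_rot: "inv (rot \<theta>) = rot (- \<theta>)"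
  by (intro inv_equality) (auto simp: rot_eq norm_mult cis_mult simp flip: mult.assoc)

lemma inverse_sphere:
  assumes "z \<in> sphere 0 1"
  shows "inverse z = cnj z"
proof -
  have "z * cnj z = 1" using assms by (simp flip: complex_norm_square)
  then show ?thesis by (rule inverse_unique)
qed

text \<open>With half-angle parameters c and s, where c^2 - s^2 = 1, both expressions are |c - s
  z|^2, because inverse z = cnj z on the circle. This is the reciprocal of
  \<open>X (boost t)\<close>.\<close>

lemma norm_boost_denominator:
  assumes "z \<in> sphere 0 1"
  shows "of_real (cosh t - sinh t * Re z) =
     (of_real (cosh (t / 2)) - of_real (sinh (t / 2)) * z) * (of_real (cosh (t / 2)) - of_real (sinh (t / 2)) * inverse z)"
    and "cosh t - sinh t * Re z > 0"
proof -
  define c s where "c = cosh (t / 2)" and "s = sinh (t / 2)"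
  have ch: "cosh t = c\<^sup>2 + s\<^sup>2" "sinh t = 2 * c * s"
    using cosh_double[of "t / 2"] sinh_double[of "t / 2"] by (simp_all add: c_def s_def)
  have inv: "inverse z = cnj z" by (rule inverse_sphere[OF assms])
  have zz: "z * cnj z = 1" using assms by (simp flip: complex_norm_square)
  have "(of_real c - of_real s * z) * (of_real c - of_real s * cnj z)
      = of_real (c\<^sup>2) + of_real (s\<^sup>2) * (z * cnj z) - of_real (c * s) * (z + cnj z)"
    by (simp add: algebra_simps power2_eq_square)
  also have "\<dots> = of_real (c\<^sup>2 + s\<^sup>2 - 2 * c * s * Re z)"
    unfolding zz complex_add_cnj by (simp add: algebra_simps)
  finally show 1: "of_real (cosh t - sinh t * Re z) =
     (of_real (cosh (t / 2)) - of_real (sinh (t / 2)) * z) * (of_real (cosh (t / 2)) - of_real (sinh (t / 2)) * inverse z)"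
    unfolding inv ch c_def[symmetric] s_def[symmetric] by simp
  have "of_real (cosh t - sinh t * Re z) = complex_of_real ((cmod (of_real c - of_real s * z))\<^sup>2)"
    unfolding 1 inv complex_norm_square by (simp add: c_def s_def)
  then have "cosh t - sinh t * Re z = (cmod (of_real c - of_real s * z))\<^sup>2" by (rule of_real_eq_iff[THEN iffD1])
  moreover have "of_real c - of_real s * z \<noteq> 0" unfolding c_def s_def by (rule boost_denominator) (use assms in auto)
  ultimately show "cosh t - sinh t * Re z > 0" by simp
qed

lemma cis_Arg_sphere: "z \<in> sphere 0 1 \<Longrightarrow> cis (Arg z) = z"
  by (subst cis_Arg) (auto simp: sgn_div_norm)

lemma X_boost:
  assumes z: "z \<in> sphere 0 1"
  shows "X (boost t) z = of_real (1 / (cosh t - sinh t * Re z))"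
proof -
  define c s where "c = complex_of_real (cosh (t / 2))" and "s = complex_of_real (sinh (t / 2))"
  have cs: "c * c - s * s = 1"
    using cosh_sinh_half[of t] unfolding c_def s_def by (simp add: power2_eq_square flip: of_real_mult of_real_diff)
  have z0: "z \<noteq> 0" using z by auto
  have d: "c - s * z \<noteq> 0" using boost_denominator[of z t] z by (auto simp: c_def s_def)
  have "cmod (inverse z) \<le> 1" using z by (simp add: norm_inverse)
  then have d': "c - s * inverse z \<noteq> 0" using boost_denominator[of "inverse z" t] by (auto simp: c_def s_def)
  have n: "c * z - s = z * (c - s * inverse z)" using z0 by (simp add: field_simps)
  have "((\<lambda>z. (c * z - s) / (c - s * z)) has_field_derivative
        (c * (c - s * z) - (c * z - s) * (- s)) / ((c - s * z) * (c - s * z))) (at (cis (Arg z)))"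
    using d unfolding cis_Arg_sphere[OF z]
    by (intro DERIV_divide) (auto intro!: derivative_eq_intros)
  moreover have "c * (c - s * z) - (c * z - s) * (- s) = c * c - s * s" by (simp add: algebra_simps)
  ultimately have D: "((\<lambda>z. (c * z - s) / (c - s * z)) has_field_derivative
        1 / ((c - s * z) * (c - s * z))) (at (cis (Arg z)))" by (simp add: cs)
  have "((\<lambda>\<theta>. cis (1 * \<theta>)) has_vector_derivative \<i> * of_real 1 * cis (1 * Arg z)) (at (Arg z))"
    by (rule has_vector_derivative_cis_mult)
  then have "(cis has_vector_derivative \<i> * z) (at (Arg z))" by (simp add: cis_Arg_sphere[OF z])
  from field_vector_diff_chain_at[OF this D]
  have "((\<lambda>\<theta>. boost t (cis \<theta>)) has_vector_derivative \<i> * z * (1 / ((c - s * z) * (c - s * z)))) (at (Arg z))"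
    by (simp add: o_def boost_eq boost_map_def c_def s_def)
  then have "X (boost t) z = - \<i> * ((\<i> * z * (1 / ((c - s * z) * (c - s * z)))) / ((c * z - s) / (c - s * z)))"
    unfolding X_def using z by (simp add: vector_derivative_at boost_eq boost_map_def c_def s_def)
  also have "\<dots> = 1 / ((c - s * z) * (c - s * inverse z))"
    unfolding n using z0 d d' by (simp add: divide_simps)
  also have "\<dots> = of_real (1 / (cosh t - sinh t * Re z))"
    unfolding of_real_divide norm_boost_denominator(1)[OF z] by (simp add: c_def s_def)
  finally show ?thesis .
qed

lemma X_rot:
  assumes z: "z \<in> sphere 0 1"
  shows "X (rot \<theta>) z = 1"
proof -
  have "((\<lambda>x. cis \<theta> * cis (1 * x)) has_vector_derivative cis \<theta> * (\<i> * of_real 1 * cis (1 * Arg z))) (at (Arg z))"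
    by (intro has_vector_derivative_mult_right has_vector_derivative_cis_mult)
  then have "((\<lambda>x. rot \<theta> (cis x)) has_vector_derivative cis \<theta> * (\<i> * z)) (at (Arg z))"
    by (simp add: rot_eq cis_Arg_sphere[OF z])
  then show ?thesis using z unfolding X_def by (auto simp: vector_derivative_at rot_eq)
qed

text \<open>Stated for the inverse boost, with which \<open>beta\<close> composes.\<close>

lemma Re_Im_boost:
  assumes z: "z \<in> sphere 0 1"
  shows "Re (boost_map (- t) z) = (sinh t + cosh t * Re z) / (cosh t + sinh t * Re z)"
    and "Im (boost_map (- t) z) = Im z / (cosh t + sinh t * Re z)"
proof -
  define c s x y where "c = cosh (t / 2)" and "s = sinh (t / 2)" and "x = Re z" and "y = Im z"
  have zc: "z = Complex x y" by (simp add: x_def y_def)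
  have xy: "x * x + y * y = 1" using z by (simp add: x_def y_def cmod_def power2_eq_square)
  have ch: "cosh t = c\<^sup>2 + s\<^sup>2" "sinh t = 2 * c * s"
    using cosh_double[of "t / 2"] sinh_double[of "t / 2"] by (simp_all add: c_def s_def)
  have cs: "c\<^sup>2 - s\<^sup>2 = 1" using cosh_sinh_half[of t] by (simp add: c_def s_def)
  have b: "boost_map (- t) z = (of_real c * z + of_real s) / (of_real c + of_real s * z)"
    by (simp add: boost_map_def c_def s_def)
  have D: "(c + s * x)\<^sup>2 + (s * y)\<^sup>2 = cosh t + sinh t * x"
  proof -
    have "(c + s * x)\<^sup>2 + (s * y)\<^sup>2 = c\<^sup>2 + 2 * c * s * x + s\<^sup>2 * (x * x + y * y)"
      by (simp add: power2_eq_square algebra_simps)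
    then show ?thesis by (simp add: xy ch)
  qed
  have "(c * x + s) * (c + s * x) + c * y * (s * y) = 2 * c * s * 1 + c\<^sup>2 * x + s\<^sup>2 * x + c * s * (x * x + y * y - 1)"
    by (simp add: power2_eq_square algebra_simps)
  then have R: "(c * x + s) * (c + s * x) + c * y * (s * y) = sinh t + cosh t * x"
    by (simp add: xy ch algebra_simps)
  have "c * y * (c + s * x) - (c * x + s) * (s * y) = (c\<^sup>2 - s\<^sup>2) * y"
    by (simp add: power2_eq_square algebra_simps)
  then have I: "c * y * (c + s * x) - (c * x + s) * (s * y) = y" by (simp add: cs)
  show "Re (boost_map (- t) z) = (sinh t + cosh t * Re z) / (cosh t + sinh t * Re z)"
    unfolding b Re_divide using R D by (simp add: zc)
  show "Im (boost_map (- t) z) = Im z / (cosh t + sinh t * Re z)"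
    unfolding b Im_divide using I D by (simp add: zc)
qed

lemma smooth_circle_off_circle: "f \<in> smooth_circle \<Longrightarrow> \<forall>z. z \<notin> sphere 0 1 \<longrightarrow> f z = 0"
  by (simp add: smooth_circle_def)

lemma beta_boost:
  assumes f: "\<forall>z. z \<notin> sphere 0 1 \<longrightarrow> f z = 0"
  shows "beta d (boost t) f z = (if z \<in> sphere 0 1
     then of_real ((cosh t + sinh t * Re z) powi (int d - 1)) * f (boost_map (- t) z) else 0)"
proof (cases "z \<in> sphere 0 1")
  case True
  define w where "w = boost_map (- t) z"
  have w: "w \<in> sphere 0 1" using boost_map_norm(2)[of z "- t"] True by (auto simp: w_def)
  have D: "cosh t + sinh t * Re z > 0" using norm_boost_denominator(2)[OF True, of "- t"] by simp
  have "cosh t - sinh t * Re w = (cosh t * (cosh t + sinh t * Re z) - sinh t * (sinh t + cosh t * Re z)) / (cosh t + sinh t * Re z)"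
    unfolding w_def Re_Im_boost[OF True] using D by (simp add: field_simps)
  also have "cosh t * (cosh t + sinh t * Re z) - sinh t * (sinh t + cosh t * Re z) = (cosh t)\<^sup>2 - (sinh t)\<^sup>2"
    by (simp add: algebra_simps power2_eq_square)
  also have "\<dots> = 1" by (simp add: cosh_square_eq)
  finally have "X (boost t) w = of_real (cosh t + sinh t * Re z)" unfolding X_boost[OF w] by simp
  moreover have "inv (boost t) z = w" using True by (simp add: inv_boost boost_eq w_def)
  ultimately show ?thesis using True by (simp add: beta_def w_def of_real_power_int)
next
  case False
  then have "inv (boost t) z \<notin> sphere 0 1"
    using boost_map_norm(2)[of z "- t"] by (auto simp: inv_boost boost_eq)
  then show ?thesis using False f by (simp add: beta_def)
qed

lemma beta_rot:
  assumes f: "\<forall>z. z \<notin> sphere 0 1 \<longrightarrow> f z = 0"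
  shows "beta d (rot \<theta>) f z = f (cis (- \<theta>) * z)"
proof (cases "z \<in> sphere 0 1")
  case True
  then have "cis (- \<theta>) * z \<in> sphere 0 1" by (simp add: norm_mult)
  then show ?thesis using True by (simp add: beta_def inv_rot rot_eq X_rot)
next
  case False
  then have "inv (rot \<theta>) z \<notin> sphere 0 1" "cis (- \<theta>) * z \<notin> sphere 0 1" by (auto simp: inv_rot rot_eq norm_mult)
  then show ?thesis using False f by (simp add: beta_def)
qed

text \<open>The inverse boost divides Im z by D = cosh t + sinh t Re z and tan (\<theta>/2) by exp
  t. The powers of D cancel against the factor that \<open>beta\<close> takes from \<open>X\<close>,
  and nothing but the translation of u remains.\<close>

lemma beta_boost_arc_fun: "beta d (boost t) (arc_fun d g) = arc_fun d (\<lambda>u. g (u - t))"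
proof
  fix z
  have o: "\<forall>z. z \<notin> sphere 0 1 \<longrightarrow> arc_fun d g z = 0" by (simp add: arc_fun_eq)
  show "beta d (boost t) (arc_fun d g) z = arc_fun d (\<lambda>u. g (u - t)) z"
  proof (cases "z \<in> sphere 0 1")
    case True
    define D where "D = cosh t + sinh t * Re z"
    have D: "D > 0" using norm_boost_denominator(2)[OF True, of "- t"] by (simp add: D_def)
    have w: "boost_map (- t) z \<in> sphere 0 1" using boost_map_norm(2)[of z "- t"] True by auto
    note RI = Re_Im_boost[OF True, of t, folded D_def]
    show ?thesis
    proof (cases "Im z > 0")
      case pos: True
      have x1: "1 + Re z > 0" using sphere_Im_pos(2)[OF True pos] by linarith
      have "1 + Re (boost_map (- t) z) = (D + (sinh t + cosh t * Re z)) / D"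
        unfolding RI using D by (simp add: field_simps)
      also have "D + (sinh t + cosh t * Re z) = exp t * (1 + Re z)"
        unfolding D_def sinh_plus_cosh[symmetric] by (simp add: algebra_simps)
      finally have "Im (boost_map (- t) z) / (1 + Re (boost_map (- t) z)) = Im z / (1 + Re z) / exp t"
        unfolding RI using D by simp
      then have "arc_coord (boost_map (- t) z) = arc_coord z - t"
        unfolding arc_coord_def using pos x1 by (simp add: ln_div ln_mult)
      moreover have "D powi (int d - 1) * (Im z / D) powi (int d - 1) = Im z powi (int d - 1)"
        using D by (simp flip: power_int_mult_distrib)
      then have "complex_of_real (D powi (int d - 1)) * complex_of_real ((Im z / D) powi (int d - 1)) = of_real (Im z powi (int d - 1))"
        by (metis of_real_mult)
      ultimately show ?thesis
        unfolding beta_boost[OF o] D_def[symmetric] using True pos w RI D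
        by (simp only: arc_fun_eq if_True mult.assoc[symmetric]) simp
    next
      case False
      then show ?thesis unfolding beta_boost[OF o] using True w RI D
        by (simp add: arc_fun_eq divide_less_0_iff not_less zero_less_divide_iff)
    qed
  next
    case False
    then show ?thesis unfolding beta_boost[OF o] by (simp add: arc_fun_eq)
  qed
qed

text \<open>The coefficients of a boost are real, so it commutes with z -> 1/z.\<close>

lemma beta_boost_reflect:
  assumes f: "\<forall>z. z \<notin> sphere 0 1 \<longrightarrow> f z = 0"
  shows "beta d (boost t) (reflect f) = reflect (beta d (boost t) f)"
proof
  fix z
  have r: "\<forall>z. z \<notin> sphere 0 1 \<longrightarrow> reflect f z = 0" using f by (simp add: reflect_def norm_inverse)
  show "beta d (boost t) (reflect f) z = reflect (beta d (boost t) f) z"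
  proof (cases "z \<in> sphere 0 1")
    case True
    define c s where "c = complex_of_real (cosh (t / 2))" and "s = complex_of_real (sinh (t / 2))"
    have z0: "z \<noteq> 0" using True by auto
    have "inverse (boost_map (- t) z) = boost_map (- t) (inverse z)"
    proof -
      have "boost_map (- t) (inverse z) = (c * inverse z + s) / (c + s * inverse z)"
        by (simp add: boost_map_def c_def s_def)
      also have "\<dots> = (z * (c * inverse z + s)) / (z * (c + s * inverse z))" using z0 by simp
      also have "\<dots> = (c + s * z) / (c * z + s)" using z0 by (simp add: algebra_simps)
      finally show ?thesis by (simp add: boost_map_def c_def s_def)
    qed
    moreover have "Re (inverse z) = Re z" by (simp add: inverse_sphere[OF True])
    ultimately show ?thesis
      using True by (simp add: beta_boost[OF f] beta_boost[OF r]) (simp add: reflect_def norm_inverse beta_boost[OF f])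
  next
    case False
    then show ?thesis unfolding beta_boost[OF r] unfolding reflect_def beta_boost[OF f] by (simp add: norm_inverse)
  qed
qed

text \<open>Conjugation by z -> 1/z inverts a rotation.\<close>

lemma beta_rot_reflect:
  assumes f: "\<forall>z. z \<notin> sphere 0 1 \<longrightarrow> f z = 0"
  shows "beta d (rot \<theta>) (reflect f) = reflect (beta d (rot (- \<theta>)) f)"
proof
  fix z
  have r: "\<forall>z. z \<notin> sphere 0 1 \<longrightarrow> reflect f z = 0" using f by (simp add: reflect_def norm_inverse)
  show "beta d (rot \<theta>) (reflect f) z = reflect (beta d (rot (- \<theta>)) f) z"
    unfolding beta_rot[OF r] unfolding reflect_def beta_rot[OF f] by (simp add: cis_inverse)
qed

text \<open>On boundary values d/d\<theta> is i z d/dz, which does not leave the functions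
  holomorphic on \<open>S\<close>.\<close>

lemma smooth_circle_holomorphic:
  assumes F: "F holomorphic_on S" and S: "open S" "sphere 0 1 \<subseteq> S"
  shows "(\<lambda>z. if z \<in> sphere 0 1 then F z else 0) \<in> smooth_circle"
proof -
  define D where "D F z = \<i> * z * deriv F z" for F and z :: complex
  have hol: "(D ^^ j) F holomorphic_on S" for j
    by (induction j) (auto simp: F D_def[abs_def] intro!: holomorphic_intros holomorphic_deriv S)
  show ?thesis
  proof (rule smooth_circleI[where G = "\<lambda>j \<theta>. (D ^^ j) F (cis \<theta>)"])
    fix j \<theta>
    have "((D ^^ j) F has_field_derivative deriv ((D ^^ j) F) (cis \<theta>)) (at (cis \<theta>))"
      using hol[of j] S by (intro holomorphic_derivI[of _ S]) auto
    moreover have "(cis has_vector_derivative \<i> * cis \<theta>) (at \<theta>)"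
      using has_vector_derivative_cis_mult[of 1 \<theta>] by simp
    ultimately show "((\<lambda>\<theta>. (D ^^ j) F (cis \<theta>)) has_vector_derivative (D ^^ Suc j) F (cis \<theta>)) (at \<theta>)"
      using field_vector_diff_chain_at by (fastforce simp: o_def D_def mult_ac)
  qed auto
qed

text \<open>\<open>Ls\<close> stands for the functionals \<open>f \<mapsto> \<langle>\<phi>(f)\<Omega>, \<Phi>\<rangle>\<close>. Boosting the lowering mode \<open>z\<close> produces all
  modes of the window \<open>-d < n \<le> 0\<close>, which are then separated by rotations.\<close>

lemma vacuum_modes_vanish:
  assumes dist: "\<And>L. L \<in> Ls \<Longrightarrow> circle_distribution L"
    and pos: "\<And>L n. L \<in> Ls \<Longrightarrow> n > 0 \<Longrightarrow> L (mode n) = 0"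
    and boost: "\<And>f t L. f \<in> smooth_circle \<Longrightarrow> (\<And>L. L \<in> Ls \<Longrightarrow> L f = 0) \<Longrightarrow> L \<in> Ls \<Longrightarrow> L (beta d (boost t) f) = 0"
    and rot: "\<And>f \<theta> L. f \<in> smooth_circle \<Longrightarrow> (\<And>L. L \<in> Ls \<Longrightarrow> L f = 0) \<Longrightarrow> L \<in> Ls \<Longrightarrow> L (beta d (rot \<theta>) f) = 0"
    and L: "L \<in> Ls" and n: "n > - int d"
  shows "L (mode n) = 0"
proof (cases "n > 0")
  case True then show ?thesis using pos L by blast
next
  case n0: False
  \<comment> \<open>Half-angle parameters of the boost by 1. Both are positive, which excludes
    cancellation in the coefficients of the polynomial below.\<close>
  define c s where "c = cosh (1 / 2 :: real)" and "s = sinh (1 / 2 :: real)"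
  have cs0: "c > 0" "s > 0" "s < c" by (simp_all add: c_def s_def sinh_less_cosh_real)
  have csC: "complex_of_real c * of_real c - of_real s * of_real s = 1"
    using cosh_sinh_half[of 1] unfolding c_def s_def by (simp add: power2_eq_square flip: of_real_mult of_real_diff)
  have dd: "of_real c + of_real s * z \<noteq> (0::complex)" if "z \<in> cball 0 1" for z
    using boost_denominator[OF that, of "- 1"] by (simp add: c_def s_def)
  define f where "f = beta d (boost 1) (mode 1)"
  have Lf: "L f = 0" if "L \<in> Ls" for L
    unfolding f_def by (rule boost[OF smooth_circle_mode _ that]) (use pos in auto)
  have mode0: "\<forall>z. z \<notin> sphere 0 1 \<longrightarrow> mode 1 z = 0" by (simp add: mode_def)
  \<comment> \<open>The Jacobian factor is (c + s z)(c z + s)/z and the inverse boost is (c z +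
    s)/(c + s z).\<close>
  have f_eq: "f z = (z powi (1 - int d) * (of_real c * z + of_real s) ^ d * (of_real c + of_real s * z) powi (int d - 2))"
    if z: "z \<in> sphere 0 1" for z
  proof -
    define a b where "a = of_real c * z + of_real s" and "b = of_real c + of_real s * z"
    have z0: "z \<noteq> 0" using z by auto
    have b0: "b \<noteq> 0" using dd[of z] z by (simp add: b_def)
    have "of_real (cosh 1 + sinh 1 * Re z) = b * (of_real c + of_real s * inverse z)"
      using norm_boost_denominator(1)[OF z, of "- 1"] by (simp add: b_def c_def s_def)
    also have "of_real c + of_real s * inverse z = a * inverse z" using z0 by (simp add: a_def algebra_simps)
    finally have D: "complex_of_real (cosh 1 + sinh 1 * Re z) = b * (a * inverse z)" .
    moreover have "cosh 1 + sinh 1 * Re z > 0" using norm_boost_denominator(2)[OF z, of "- 1"] by simp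
    ultimately have a0: "a \<noteq> 0" by (metis mult_zero_left mult_zero_right of_real_eq_0_iff less_irrefl)
    have "f z = (b * (a * inverse z)) powi (int d - 1) * (a / b)"
    proof -
      have "boost_map (- 1) z \<in> sphere 0 1" using z boost_map_norm(2)[of z "- 1"] by auto
      then have w: "mode 1 (boost_map (- 1) z) = a / b"
        by (simp add: mode_def) (simp add: boost_map_def a_def b_def c_def s_def)
      show ?thesis
        unfolding f_def beta_boost[OF mode0] w of_real_power_int D using z by simp
    qed
    also have "\<dots> = z powi (1 - int d) * (a powi (int d - 1) * a) * (b powi (int d - 1) / b)"
      by (simp add: power_int_mult_distrib power_int_inverse flip: power_int_minus)
    also have "a powi (int d - 1) * a = a ^ d" using a0 by (simp add: power_int_diff)
    also have "b powi (int d - 1) / b = b powi (int d - 2)" using b0 power_int_diff[of b "int d - 1" 1] by simp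
    finally show ?thesis by (simp add: a_def b_def)
  qed
  \<comment> \<open>For d = 0 the window of remaining modes is empty. For d = 1 the exponent d - 2
    is -1, so \<open>f\<close> is no Laurent polynomial and is treated as a boundary value
    instead.\<close>
  consider "d = 0" | "d = 1" | "d \<ge> 2" by linarith
  then show ?thesis
  proof cases
    case 1 then show ?thesis using n n0 by simp
  next
    case 2
    \<comment> \<open>s / c is the value of (c z + s)/(c + s z) at the origin. The rest is z times a
      holomorphic function, and functionals that kill the positive modes kill it.\<close>
    define q where "q = (\<lambda>z. f z - of_real (s / c) * mode 0 z)"
    have f0: "f z = (if z \<in> sphere 0 1 then (of_real c * z + of_real s) / (of_real c + of_real s * z) else 0)" for z
      using f_eq[of z] 2 by (auto simp: f_def beta_boost[OF mode0] power_int_minus field_simps)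
    have "open {z. of_real c + of_real s * z \<noteq> (0::complex)}"
      by (intro open_Collect_neq continuous_intros)
    then have "(\<lambda>z. if z \<in> sphere 0 1 then (of_real c * z + of_real s) / (of_real c + of_real s * z) else 0) \<in> smooth_circle"
      by (rule smooth_circle_holomorphic[rotated]) (use dd in \<open>auto intro!: holomorphic_intros\<close>)
    then have fs: "f \<in> smooth_circle" using f0 by presburger
    have "L q = 0"
    proof (rule circle_distribution_boundary_value_eq_0[OF dist[OF L], where p = 1 and H = "\<lambda>z. 1 / (of_real c * (of_real c + of_real s * z))"])
      show "q \<in> smooth_circle" unfolding q_def by (intro smooth_circle_diff smooth_circle_scale fs smooth_circle_mode)
      have ho: "(\<lambda>z. 1 / (of_real c * (of_real c + of_real s * z))) holomorphic_on cball 0 1"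
        using dd cs0 by (intro holomorphic_intros) auto
      then show "(\<lambda>z. 1 / (of_real c * (of_real c + of_real s * z))) holomorphic_on ball 0 1"
        "continuous_on (cball 0 1) (\<lambda>z. 1 / (of_real c * (of_real c + of_real s * z)) :: complex)"
        using holomorphic_on_subset holomorphic_on_imp_continuous_on ball_subset_cball by blast+
      fix z :: complex assume z: "z \<in> sphere 0 1"
      have b0: "of_real c + of_real s * z \<noteq> 0" using dd[of z] z by simp
      have "q z = (of_real c * z + of_real s) / (of_real c + of_real s * z) - of_real s / of_real c"
        using z by (simp add: q_def f0 mode_def)
      also have "\<dots> = ((of_real c * of_real c - of_real s * of_real s) * z) / (of_real c * (of_real c + of_real s * z))"
        using b0 cs0 by (simp add: divide_simps) (simp add: algebra_simps)
      finally show "q z = z powi 1 * (1 / (of_real c * (of_real c + of_real s * z)))" by (simp add: csC)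
    qed (use pos L in auto)
    then have "of_real (s / c) * L (mode 0) = 0"
      unfolding q_def circle_distribution_diff[OF dist[OF L] fs smooth_circle_scale[OF smooth_circle_mode]]
        circle_distribution_scale[OF dist[OF L] smooth_circle_mode] Lf[OF L] by simp
    moreover have "n = 0" using n n0 2 by simp
    ultimately show ?thesis using cs0 by simp
  next
    case 3
    define p where "p = [:complex_of_real s, of_real c:] ^ d * [:complex_of_real c, of_real s:] ^ (d - 2)"
    define N where "N = degree p"
    have fp: "f = (\<lambda>z. \<Sum>k\<le>N. coeff p k * mode (int k + 1 - int d) z)"
    proof
      fix z
      show "f z = (\<Sum>k\<le>N. coeff p k * mode (int k + 1 - int d) z)"
      proof (cases "z \<in> sphere 0 1")
        case True
        then have z0: "z \<noteq> 0" by auto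
        have pz: "poly p z = (of_real c * z + of_real s) ^ d * (of_real c + of_real s * z) ^ (d - 2)"
          by (simp add: p_def algebra_simps)
        have e: "int d - 2 = int (d - 2)" using 3 by simp
        have "f z = z powi (1 - int d) * poly p z"
          unfolding f_eq[OF True] pz e by (simp add: mult.assoc)
        also have "\<dots> = (\<Sum>k\<le>N. coeff p k * (z powi (1 - int d) * z ^ k))"
          by (simp add: poly_altdef N_def sum_distrib_left mult_ac)
        also have "\<dots> = (\<Sum>k\<le>N. coeff p k * mode (int k + 1 - int d) z)"
        proof (intro sum.cong refl)
          fix k
          have "z powi (int k + 1 - int d) = z powi (1 - int d) * z powi int k"
            using z0 power_int_add[of z "1 - int d" "int k"] by (simp add: algebra_simps)
          then show "coeff p k * (z powi (1 - int d) * z ^ k) = coeff p k * mode (int k + 1 - int d) z"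
            using True by (simp add: mode_def)
        qed
        finally show ?thesis .
      next
        case False
        then show ?thesis by (simp add: f_def beta_boost[OF mode0] mode_def)
      qed
    qed
    have fs: "f \<in> smooth_circle" unfolding fp by (intro smooth_circle_sum smooth_circle_scale smooth_circle_mode)
    \<comment> \<open>Under a rotation each mode acquires its own phase. Up to a common phase the
      sum is a polynomial in cis \<theta>; it vanishes on the whole circle, so each coefficient is
      zero.\<close>
    have "(\<Sum>k\<le>N. (coeff p k * L (mode (int k + 1 - int d))) * cis \<theta> ^ k) = 0" for \<theta>
    proof -
      have "L (beta d (rot (- \<theta>)) f) = 0" by (rule rot[OF fs _ L]) (rule Lf)
      moreover have "beta d (rot (- \<theta>)) f = (\<lambda>z. \<Sum>k\<le>N. (coeff p k * cis (of_int (int k + 1 - int d) * \<theta>)) * mode (int k + 1 - int d) z)"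
      proof
        fix z
        have "mode m (cis \<theta> * z) = cis (of_int m * \<theta>) * mode m z" for m
          by (simp add: mode_def norm_mult power_int_mult_distrib cis_power_int)
        then show "beta d (rot (- \<theta>)) f z = (\<Sum>k\<le>N. (coeff p k * cis (of_int (int k + 1 - int d) * \<theta>)) * mode (int k + 1 - int d) z)"
          by (subst beta_rot[OF smooth_circle_off_circle[OF fs]]) (simp_all add: fp mult_ac)
      qed
      ultimately have "(\<Sum>k\<le>N. coeff p k * cis (of_int (int k + 1 - int d) * \<theta>) * L (mode (int k + 1 - int d))) = 0"
        by (simp add: circle_distribution_sum[OF dist[OF L]] circle_distribution_scale[OF dist[OF L]]
            smooth_circle_mode smooth_circle_scale)
      then have "cis (of_int (int d - 1) * \<theta>) * (\<Sum>k\<le>N. coeff p k * cis (of_int (int k + 1 - int d) * \<theta>) * L (mode (int k + 1 - int d))) = 0"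
        by simp
      moreover have "cis (of_int (int d - 1) * \<theta>) * (\<Sum>k\<le>N. coeff p k * cis (of_int (int k + 1 - int d) * \<theta>) * L (mode (int k + 1 - int d)))
          = (\<Sum>k\<le>N. (coeff p k * L (mode (int k + 1 - int d))) * cis \<theta> ^ k)"
        unfolding sum_distrib_left
      proof (intro sum.cong refl)
        fix k
        have cc: "cis (of_int (int d - 1) * \<theta>) * cis (of_int (int k + 1 - int d) * \<theta>) = cis \<theta> ^ k"
          unfolding cis_mult Complex.DeMoivre by (simp add: algebra_simps)
        have ac: "x * (y * z * w) = (y * w) * (x * z)" for x y z w :: complex by (simp add: algebra_simps)
        show "cis (of_int (int d - 1) * \<theta>) * (coeff p k * cis (of_int (int k + 1 - int d) * \<theta>) * L (mode (int k + 1 - int d)))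
          = (coeff p k * L (mode (int k + 1 - int d))) * cis \<theta> ^ k"
          by (subst ac, subst cc, rule refl)
      qed
      ultimately show ?thesis by simp
    qed
    note on_circle = this
    have "sphere 0 1 \<subseteq> {z. (\<Sum>k\<le>N. (coeff p k * L (mode (int k + 1 - int d))) * z ^ k) = 0}"
    proof
      fix z :: complex assume "z \<in> sphere 0 1"
      from on_circle[of "Arg z", unfolded cis_Arg_sphere[OF this]]
      show "z \<in> {z. (\<Sum>k\<le>N. (coeff p k * L (mode (int k + 1 - int d))) * z ^ k) = 0}" by blast
    qed
    moreover have "infinite (sphere (0::complex) 1)"
    proof
      assume fin: "finite (sphere (0::complex) 1)"
      have "connected (sphere (0::complex) 1)" by (rule connected_sphere) simp
      from connected_finite_iff_sing[OF this] fin
      have "sphere (0::complex) 1 = {} \<or> (\<exists>a. sphere (0::complex) 1 = {a})" by simp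
      moreover have "1 \<in> sphere (0::complex) 1" "-1 \<in> sphere (0::complex) 1" by auto
      ultimately obtain a where a: "sphere (0::complex) 1 = {a}" by force
      have "(1::complex) \<in> {a}" "(-1::complex) \<in> {a}" unfolding a[symmetric] by auto
      then show False by simp
    qed
    ultimately have "infinite {z. (\<Sum>k\<le>N. (coeff p k * L (mode (int k + 1 - int d))) * z ^ k) = 0}"
      using finite_subset by blast
    then have zero: "coeff p k * L (mode (int k + 1 - int d)) = 0" if "k \<le> N" for k
      using polyfun_finite_roots[where c = "\<lambda>k. coeff p k * L (mode (int k + 1 - int d))" and n = N] that by blast
    define k where "k = nat (n + int d - 1)"
    have k: "int k + 1 - int d = n" "k < d" using n n0 by (auto simp: k_def)
    \<comment> \<open>Coefficient k of the product is a convolution sum of nonnegative terms, and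
      its term i = k is positive because k < d; so \<open>coeff p k\<close> can be divided
      out.\<close>
    have nn: "coeff ([:complex_of_real a, of_real b:] ^ m) i \<in> \<real>\<^sub>\<ge>\<^sub>0" if "a > 0" "b > 0" for a b m i
    proof (cases "i \<le> m")
      case True
      then have "coeff ([:complex_of_real a, of_real b:] ^ m) i = of_real (of_nat (m choose i) * b ^ i * a ^ (m - i))"
        by (simp add: coeff_linear_poly_power)
      then show ?thesis using that by (simp only: nonneg_Reals_of_real_iff) auto
    next
      case False
      then have "coeff ([:complex_of_real a, of_real b:] ^ m) i = 0"
        using that by (intro coeff_eq_0) (simp add: degree_power_eq)
      then show ?thesis by simp
    qed
    have "coeff p k = (\<Sum>i\<le>k. coeff ([:complex_of_real s, of_real c:] ^ d) i * coeff ([:complex_of_real c, of_real s:] ^ (d - 2)) (k - i))"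
      by (simp add: p_def coeff_mult)
    also have "\<dots> = coeff ([:complex_of_real s, of_real c:] ^ d) k * coeff ([:complex_of_real c, of_real s:] ^ (d - 2)) 0 +
        (\<Sum>i\<in>{..<k}. coeff ([:complex_of_real s, of_real c:] ^ d) i * coeff ([:complex_of_real c, of_real s:] ^ (d - 2)) (k - i))"
      unfolding lessThan_Suc_atMost[symmetric] sum.lessThan_Suc diff_self_eq_0 by (rule add.commute)
    finally have ck: "coeff p k = coeff ([:complex_of_real s, of_real c:] ^ d) k * coeff ([:complex_of_real c, of_real s:] ^ (d - 2)) 0 +
        (\<Sum>i\<in>{..<k}. coeff ([:complex_of_real s, of_real c:] ^ d) i * coeff ([:complex_of_real c, of_real s:] ^ (d - 2)) (k - i))" .
    have "coeff ([:complex_of_real s, of_real c:] ^ d) k * coeff ([:complex_of_real c, of_real s:] ^ (d - 2)) 0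
        = of_real ((of_nat (d choose k) * c ^ k * s ^ (d - k)) * c ^ (d - 2))"
      using k by (simp add: coeff_linear_poly_power coeff_0_power)
    moreover have "(of_nat (d choose k) * c ^ k * s ^ (d - k)) * c ^ (d - 2) > 0"
      using k cs0 by (intro mult_pos_pos) auto
    ultimately have R1: "Re (coeff ([:complex_of_real s, of_real c:] ^ d) k * coeff ([:complex_of_real c, of_real s:] ^ (d - 2)) 0) > 0"
      by (simp only: Re_complex_of_real)
    have "coeff ([:complex_of_real s, of_real c:] ^ d) i * coeff ([:complex_of_real c, of_real s:] ^ (d - 2)) (k - i) \<in> \<real>\<^sub>\<ge>\<^sub>0" for i
      by (intro nonneg_Reals_mult_I nn cs0)
    then have "0 \<le> (\<Sum>i\<in>{..<k}. Re (coeff ([:complex_of_real s, of_real c:] ^ d) i * coeff ([:complex_of_real c, of_real s:] ^ (d - 2)) (k - i)))"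
      unfolding complex_nonneg_Reals_iff by (intro sum_nonneg) blast
    then have "Re (coeff p k) > 0" unfolding ck plus_complex.sel Re_sum using R1 by linarith
    then have cp: "coeff p k \<noteq> 0" by auto
    then have "k \<le> N" unfolding N_def by (rule le_degree)
    from zero[OF this] cp k show ?thesis by simp
  qed
qed

section \<open>Bumps and cutoffs\<close>

definition smooth_line :: "(real \<Rightarrow> complex) \<Rightarrow> bool" where
  "smooth_line g \<longleftrightarrow> (\<forall>j u. iter_deriv j g differentiable (at u))"

lemma smooth_lineD:
  "smooth_line g \<Longrightarrow> (iter_deriv j g has_vector_derivative iter_deriv (Suc j) g u) (at u)"
  by (simp add: smooth_line_def iter_deriv_Suc vector_derivative_works[symmetric])

lemma smooth_lineI:
  assumes "\<And>u. g u = G 0 u" "\<And>j u. (G j has_vector_derivative G (Suc j) u) (at u)"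
  shows "smooth_line g"
  using assms(2) unfolding smooth_line_def iter_deriv_unique[of g G, OF assms]
  by (blast intro: differentiableI_vector)

text \<open>Smoothness of products and pullbacks is obtained from a set of functions closed under
  differentiation, without a formula for the j-th derivative.\<close>

lemma smooth_line_closed_set:
  assumes "\<And>f. f \<in> S \<Longrightarrow> \<exists>f'\<in>S. \<forall>u. (f has_vector_derivative f' u) (at u)" "f \<in> S"
  shows "smooth_line f"
proof -
  obtain D where D: "\<And>f. f \<in> S \<Longrightarrow> D f \<in> S" "\<And>f u. f \<in> S \<Longrightarrow> (f has_vector_derivative D f u) (at u)"
    using assms(1) by metis
  have mem: "(D ^^ j) f \<in> S" for j by (induction j) (auto intro: assms(2) D)
  show ?thesis
  proof (rule smooth_lineI[where G = "\<lambda>j. (D ^^ j) f"])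
    show "((D ^^ j) f has_vector_derivative (D ^^ Suc j) f u) (at u)" for j u
      using D(2)[OF mem[of j]] by simp
  qed simp
qed

lemma smooth_line_iter_deriv_1: "smooth_line g \<Longrightarrow> smooth_line (iter_deriv 1 g)"
  unfolding smooth_line_def iter_deriv_Suc'[symmetric] by blast

lemma smooth_line_deriv_1: "smooth_line g \<Longrightarrow> (g has_vector_derivative iter_deriv 1 g u) (at u)"
  using smooth_lineD[of g 0] by simp

lemma rapid_iff: "rapid g \<longleftrightarrow> smooth_line g \<and> (\<forall>j K. \<exists>C. \<forall>u. norm (iter_deriv j g u) \<le> C * exp (- K * \<bar>u\<bar>))"
  by (simp add: rapid_def smooth_line_def)

lemma iter_deriv_add:
  assumes "smooth_line g" "smooth_line h"
  shows "iter_deriv j (\<lambda>u. g u + h u) = (\<lambda>u. iter_deriv j g u + iter_deriv j h u)"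
  by (rule iter_deriv_unique[where G = "\<lambda>j u. iter_deriv j g u + iter_deriv j h u"])
     (auto intro: has_vector_derivative_add smooth_lineD assms)

inductive_set product_span :: "(real \<Rightarrow> complex) set" where
  mult: "smooth_line g \<Longrightarrow> smooth_line h \<Longrightarrow> (\<lambda>u. g u * h u) \<in> product_span"
| add: "f \<in> product_span \<Longrightarrow> f' \<in> product_span \<Longrightarrow> (\<lambda>u. f u + f' u) \<in> product_span"

lemma smooth_line_mult:
  assumes "smooth_line g" "smooth_line h"
  shows "smooth_line (\<lambda>u. g u * h u)"
proof (rule smooth_line_closed_set[where S = product_span])
  fix f assume "f \<in> product_span"
  then show "\<exists>f'\<in>product_span. \<forall>u. (f has_vector_derivative f' u) (at u)"
  proof induction
    case (mult g h)
    show ?case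
      by (rule bexI[of _ "\<lambda>u. g u * iter_deriv 1 h u + iter_deriv 1 g u * h u"])
         (auto intro!: product_span.intros mult smooth_line_iter_deriv_1 smooth_line_deriv_1 has_vector_derivative_mult
           simp del: One_nat_def)
  next
    case (add f h)
    from add.IH obtain f' h' where "f' \<in> product_span" "h' \<in> product_span"
      "\<And>u. (f has_vector_derivative f' u) (at u)" "\<And>u. (h has_vector_derivative h' u) (at u)" by blast
    then show ?case by (intro bexI[of _ "\<lambda>u. f' u + h' u"] allI has_vector_derivative_add product_span.add)
  qed
qed (rule product_span.mult[OF assms])

lemma iter_deriv_Suc_mult:
  assumes "smooth_line g" "smooth_line h"
  shows "iter_deriv (Suc j) (\<lambda>u. g u * h u) u =
     iter_deriv j (\<lambda>u. g u * iter_deriv 1 h u) u + iter_deriv j (\<lambda>u. iter_deriv 1 g u * h u) u"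
proof -
  have "iter_deriv 1 (\<lambda>u. g u * h u) = (\<lambda>u. g u * iter_deriv 1 h u + iter_deriv 1 g u * h u)"
    by (rule ext, subst iter_deriv_1, rule vector_derivative_at)
       (intro has_vector_derivative_mult smooth_line_deriv_1 assms)
  then show ?thesis
    unfolding iter_deriv_Suc'
    by (simp only: iter_deriv_add smooth_line_mult assms smooth_line_iter_deriv_1)
qed

text \<open>Leibniz rule in recursive form, with 2^j counting the terms. The second factor may grow
  like exp |u|, which costs one unit of the rate K.\<close>

lemma iter_deriv_mult_bound:
  assumes "smooth_line g" "smooth_line h" "A \<ge> 0" "B \<ge> 0"
    and "\<And>i u. i \<le> j \<Longrightarrow> norm (iter_deriv i g u) \<le> A * exp (- K * \<bar>u\<bar>)"
    and "\<And>i u. i \<le> j \<Longrightarrow> norm (iter_deriv i h u) \<le> B * exp \<bar>u\<bar>"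
  shows "norm (iter_deriv j (\<lambda>u. g u * h u) u) \<le> 2 ^ j * (A * B * exp (- (K - 1) * \<bar>u\<bar>))"
  using assms
proof (induction j arbitrary: g h u)
  case 0
  have "norm (g u) * norm (h u) \<le> (A * exp (- K * \<bar>u\<bar>)) * (B * exp \<bar>u\<bar>)"
    using "0.prems"(5)[of 0 u] "0.prems"(6)[of 0 u] 0 by (intro mult_mono) auto
  also have "\<dots> = A * B * (exp (- K * \<bar>u\<bar>) * exp \<bar>u\<bar>)" by simp
  also have "exp (- K * \<bar>u\<bar>) * exp \<bar>u\<bar> = exp (- (K - 1) * \<bar>u\<bar>)"
    unfolding exp_add[symmetric] by (simp add: algebra_simps)
  finally show ?case by (simp add: norm_mult)
next
  case (Suc j)
  have "norm (iter_deriv j (\<lambda>u. g u * iter_deriv 1 h u) u) \<le> 2 ^ j * (A * B * exp (- (K - 1) * \<bar>u\<bar>))"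
    using Suc.prems by (intro Suc.IH smooth_line_iter_deriv_1) (auto simp: iter_deriv_Suc'[symmetric] simp del: One_nat_def)
  moreover have "norm (iter_deriv j (\<lambda>u. iter_deriv 1 g u * h u) u) \<le> 2 ^ j * (A * B * exp (- (K - 1) * \<bar>u\<bar>))"
    using Suc.prems by (intro Suc.IH smooth_line_iter_deriv_1) (auto simp: iter_deriv_Suc'[symmetric] simp del: One_nat_def)
  ultimately have "norm (iter_deriv j (\<lambda>u. g u * iter_deriv 1 h u) u + iter_deriv j (\<lambda>u. iter_deriv 1 g u * h u) u)
     \<le> 2 ^ j * (A * B * exp (- (K - 1) * \<bar>u\<bar>)) + 2 ^ j * (A * B * exp (- (K - 1) * \<bar>u\<bar>))"
    by (rule norm_triangle_mono)
  then show ?case unfolding iter_deriv_Suc_mult[OF Suc.prems(1,2)] by (simp only: power_Suc mult.assoc mult_2 distrib_right)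
qed

lemma iter_deriv_eq_0_open:
  assumes "open S" "\<And>u. u \<in> S \<Longrightarrow> g u = 0" "u \<in> S"
  shows "iter_deriv j g u = 0"
  using assms(3)
proof (induction j arbitrary: u)
  case (Suc j)
  have "(iter_deriv j g has_vector_derivative 0) (at u)"
    by (rule has_vector_derivative_transform_within_open[OF has_vector_derivative_const[of 0] assms(1) Suc.prems])
       (simp add: Suc.IH)
  then show ?case by (simp add: iter_deriv_Suc vector_derivative_at)
qed (simp add: assms(2))

lemma smooth_line_compact_support_rapid:
  assumes "smooth_line g" "\<And>u. \<bar>u\<bar> > M \<Longrightarrow> g u = 0"
  shows "rapid g"
  unfolding rapid_iff
proof (intro conjI allI)
  fix j K
  have op: "open {u. \<bar>u\<bar> > M}" by (intro open_Collect_less continuous_intros)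
  have z: "iter_deriv j g u = 0" if "\<bar>u\<bar> > M" for u
    by (rule iter_deriv_eq_0_open[OF op]) (use assms(2) that in auto)
  have "continuous_on {- M..M} (iter_deriv j g)"
    by (intro continuous_at_imp_continuous_on ballI has_vector_derivative_continuous[OF smooth_lineD[OF assms(1)]])
  then have "continuous_on {- M..M} (\<lambda>u. exp (K * \<bar>u\<bar>) * norm (iter_deriv j g u))"
    by (intro continuous_intros)
  then have "compact ((\<lambda>u. exp (K * \<bar>u\<bar>) * norm (iter_deriv j g u)) ` {- M..M})" by (rule compact_continuous_image) simp
  from compact_imp_bounded[OF this]
  obtain B where B0: "\<forall>x\<in>(\<lambda>u. exp (K * \<bar>u\<bar>) * norm (iter_deriv j g u)) ` {- M..M}. norm x \<le> B"
    unfolding bounded_iff by (elim exE)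
  have B: "norm (exp (K * \<bar>u\<bar>) * norm (iter_deriv j g u)) \<le> B" if "u \<in> {- M..M}" for u
    using bspec[OF B0 imageI[OF that]] .
  have "norm (iter_deriv j g u) \<le> \<bar>B\<bar> * exp (- K * \<bar>u\<bar>)" for u
  proof (cases "\<bar>u\<bar> > M")
    case False
    then have "u \<in> {- M..M}" by auto
    from B[OF this] have "exp (K * \<bar>u\<bar>) * norm (iter_deriv j g u) \<le> \<bar>B\<bar>" by simp
    then show ?thesis by (simp add: exp_minus field_simps)
  qed (simp add: z)
  then show "\<exists>C. \<forall>u. norm (iter_deriv j g u) \<le> C * exp (- K * \<bar>u\<bar>)" by blast
qed (rule assms(1))

lemma smooth_line_holomorphic:
  assumes F: "F holomorphic_on S" and S: "open S" "\<And>u. complex_of_real u \<in> S"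
  shows "smooth_line (\<lambda>u. F (of_real u))"
proof (rule smooth_lineI[where G = "\<lambda>j u. (deriv ^^ j) F (of_real u)"])
  fix j u
  have "(deriv ^^ j) F holomorphic_on S" by (intro holomorphic_higher_deriv F S)
  then have "((deriv ^^ j) F has_field_derivative deriv ((deriv ^^ j) F) (of_real u)) (at (of_real u))"
    by (rule holomorphic_derivI) (use S in auto)
  from has_vector_derivative_real_field[OF this]
  show "((\<lambda>u. (deriv ^^ j) F (of_real u)) has_vector_derivative (deriv ^^ Suc j) F (of_real u)) (at u)" by simp
qed simp

text \<open>cosh has no real zeros, so even a negative power is holomorphic near the real
  line.\<close>

lemma smooth_line_cosh: "smooth_line (\<lambda>u. of_real (cosh u powi n))"
proof -
  have ch: "cosh (complex_of_real u) = of_real (cosh u)" for u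
    by (simp add: cosh_field_def exp_of_real flip: of_real_minus)
  have ne: "cosh (of_real u) \<noteq> (0::complex)" for u
    unfolding ch of_real_eq_0_iff by simp
  have "smooth_line (\<lambda>u. (\<lambda>z. cosh z powi n) (complex_of_real u))"
  proof (rule smooth_line_holomorphic[where S = "{z. cosh z \<noteq> 0}"])
    show "open {z::complex. cosh z \<noteq> 0}" by (intro open_Collect_neq continuous_intros)
    have "cosh holomorphic_on {z::complex. cosh z \<noteq> 0}"
      unfolding cosh_field_def[abs_def] by (intro holomorphic_intros) auto
    then show "(\<lambda>z. cosh z powi n) holomorphic_on {z. cosh z \<noteq> 0}"
      by (rule holomorphic_on_power_int[rotated]) auto
  qed (use ne in simp)
  then show ?thesis by (simp add: ch of_real_power_int)
qed

text \<open>The inverse of the coordinate u = ln (tan (\<theta> / 2)); its derivative is 1 / cosh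
  u.\<close>

definition arc_angle :: "real \<Rightarrow> real" where
  "arc_angle u = 2 * arctan (exp u)"

lemma arc_angle_deriv: "(arc_angle has_real_derivative 1 / cosh u) (at u)"
proof -
  have "(arc_angle has_real_derivative 2 * (inverse (1 + (exp u)\<^sup>2) * exp u)) (at u)"
    unfolding arc_angle_def by (intro DERIV_cmult DERIV_chain2[OF DERIV_arctan] DERIV_exp)
  moreover have "2 * (inverse (1 + (exp u)\<^sup>2) * exp u) = 1 / cosh u"
    by (simp add: cosh_def exp_minus field_simps power2_eq_square) 
  ultimately show ?thesis by simp
qed

lemma cis_arc_angle: "cis (arc_angle u) = Complex (- tanh u) (1 / cosh u)"
proof -
  define w where "w = exp u"
  have w: "w > 0" by (simp add: w_def)
  have c2: "cos (arctan w) ^ 2 = 1 / (1 + w\<^sup>2)" and sc: "sin (arctan w) = w * cos (arctan w)"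
    using w by (simp_all add: cos_arctan sin_arctan power_divide)
  have "cos (2 * arctan w) = cos (arctan w) ^ 2 - w\<^sup>2 * cos (arctan w) ^ 2"
    by (simp add: cos_double sc power_mult_distrib)
  then have "cos (2 * arctan w) = (1 - w\<^sup>2) / (1 + w\<^sup>2)" by (simp add: c2 diff_divide_distrib)
  moreover have "sin (2 * arctan w) = 2 * w * cos (arctan w) ^ 2"
    by (simp add: sin_double sc power2_eq_square)
  then have "sin (2 * arctan w) = 2 * w / (1 + w\<^sup>2)" by (simp add: c2)
  moreover have "(1 - w\<^sup>2) / (1 + w\<^sup>2) = - tanh u" "2 * w / (1 + w\<^sup>2) = 1 / cosh u"
  proof -
    have "sinh u = (w\<^sup>2 - 1) / (2 * w)" "cosh u = (1 + w\<^sup>2) / (2 * w)"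
      using w by (simp_all add: sinh_def cosh_def exp_minus w_def[symmetric] field_simps power2_eq_square)
    then show "(1 - w\<^sup>2) / (1 + w\<^sup>2) = - tanh u" "2 * w / (1 + w\<^sup>2) = 1 / cosh u"
      using w by (simp_all add: tanh_def minus_divide_left)
  qed
  ultimately show ?thesis by (simp add: complex_eq_iff arc_angle_def w_def)
qed

lemma cis_arc_angle_arc_coord:
  assumes z: "z \<in> sphere 0 1" "Im z > 0"
  shows "cis (arc_angle (arc_coord z)) = z" "cosh (arc_coord z) = 1 / Im z"
proof -
  note s = sphere_Im_pos[OF z]
  define x y where "x = Re z" and "y = Im z"
  have xy: "x\<^sup>2 + y\<^sup>2 = 1" "y > 0" "1 + x > 0" using s z unfolding x_def y_def by auto
  have e: "exp (arc_coord z) = y / (1 + x)" using xy by (simp add: arc_coord_def x_def y_def)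
  have em: "exp (- arc_coord z) = (1 + x) / y" unfolding exp_minus e using xy by simp
  have yy: "y * y = 1 - x * x" using xy by (simp add: power2_eq_square)
  have "y / (1 + x) = (1 - x) / y" using xy yy by (simp add: field_simps)
  then have e': "exp (arc_coord z) = (1 - x) / y" using e by simp
  have "cosh (arc_coord z) = 1 / y" "sinh (arc_coord z) = - x / y"
    unfolding cosh_def sinh_def e' em using xy by (simp_all add: field_simps)
  then show "cosh (arc_coord z) = 1 / Im z" "cis (arc_angle (arc_coord z)) = z"
    unfolding cis_arc_angle tanh_def using xy by (simp_all add: x_def y_def complex_eq_iff)
qed

text \<open>The coefficients \<open>a\<close> collect the powers of 1 / cosh u that the chain rule
  produces.\<close>

inductive_set pullback_span :: "(complex \<Rightarrow> complex) \<Rightarrow> (real \<Rightarrow> complex) set" for f where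
  pull: "smooth_line a \<Longrightarrow> (\<lambda>u. a u * angular_deriv j f (arc_angle u)) \<in> pullback_span f"
| add: "g \<in> pullback_span f \<Longrightarrow> h \<in> pullback_span f \<Longrightarrow> (\<lambda>u. g u + h u) \<in> pullback_span f"

lemma smooth_line_pullback:
  assumes f: "f \<in> smooth_circle" and "smooth_line a"
  shows "smooth_line (\<lambda>u. a u * f (cis (arc_angle u)))"
proof (rule smooth_line_closed_set[where S = "pullback_span f"])
  fix g assume "g \<in> pullback_span f"
  then show "\<exists>g'\<in>pullback_span f. \<forall>u. (g has_vector_derivative g' u) (at u)"
  proof induction
    case (pull a j)
    let ?D = "\<lambda>u. a u * (of_real (cosh u powi (-1)) * angular_deriv (Suc j) f (arc_angle u))
        + iter_deriv 1 a u * angular_deriv j f (arc_angle u)"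
    have "(\<lambda>u. (a u * of_real (cosh u powi (-1))) * angular_deriv (Suc j) f (arc_angle u)
        + iter_deriv 1 a u * angular_deriv j f (arc_angle u)) \<in> pullback_span f"
      by (intro pullback_span.intros smooth_line_mult smooth_line_cosh smooth_line_iter_deriv_1 pull)
    moreover have "((\<lambda>u. a u * angular_deriv j f (arc_angle u)) has_vector_derivative ?D u) (at u)" for u
    proof -
      have "(arc_angle has_vector_derivative 1 / cosh u) (at u)"
        using arc_angle_deriv by (simp add: has_real_derivative_iff_has_vector_derivative)
      from vector_diff_chain_at[OF this angular_deriv_has_derivative[OF f]]
      have "((\<lambda>u. angular_deriv j f (arc_angle u)) has_vector_derivative
          of_real (cosh u powi (-1)) * angular_deriv (Suc j) f (arc_angle u)) (at u)"
        by (simp add: o_def scaleR_conv_of_real power_int_minus divide_inverse)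
      then show ?thesis by (intro has_vector_derivative_mult smooth_line_deriv_1 pull)
    qed
    ultimately show ?case by (intro bexI[of _ ?D]) (auto simp: mult.assoc)
  next
    case (add g h)
    from add.IH obtain g' h' where "g' \<in> pullback_span f" "h' \<in> pullback_span f"
      "\<And>u. (g has_vector_derivative g' u) (at u)" "\<And>u. (h has_vector_derivative h' u) (at u)" by blast
    then show ?case by (intro bexI[of _ "\<lambda>u. g' u + h' u"] allI has_vector_derivative_add pullback_span.add)
  qed
next
  show "(\<lambda>u. a u * f (cis (arc_angle u))) \<in> pullback_span f"
    using pullback_span.pull[OF assms(2), of 0 f] by (simp add: angular_deriv_0)
qed

lemma circle_support_superset: "z \<in> sphere 0 1 \<Longrightarrow> f z \<noteq> 0 \<Longrightarrow> z \<in> circle_support f"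
  unfolding circle_support_def by (rule subsetD[OF closure_subset]) simp

text \<open>The support is compact and inside the open arc, so Im z >= e on it for some e > 0; in
  the coordinate u this is a compact support. As Im z = 1 / cosh u, the factor
  \<open>cosh u powi (int d - 1)\<close> undoes the weight of \<open>arc_fun\<close>.\<close>

lemma local_function_arc_fun:
  assumes f: "f \<in> smooth_circle" and supp: "circle_support f \<subseteq> upper_semicircle"
  obtains g M where "rapid g" "\<And>u. \<bar>u\<bar> > M \<Longrightarrow> g u = 0" "f = arc_fun d g"
proof -
  define g where "g u = of_real (cosh u powi (int d - 1)) * f (cis (arc_angle u))" for u
  have sl: "smooth_line g" unfolding g_def by (intro smooth_line_pullback f smooth_line_cosh)
  have "compact (circle_support f)"
    unfolding circle_support_def
    by (intro compact_closure[THEN iffD2] bounded_subset[OF bounded_sphere[of 0 1]]) auto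
  moreover have "0 \<notin> Im ` circle_support f" using supp by (auto simp: upper_semicircle_def)
  ultimately have "closed (Im ` circle_support f)" "0 \<notin> Im ` circle_support f"
    by (auto intro!: compact_imp_closed compact_continuous_image continuous_intros)
  then obtain e where e: "e > 0" "\<And>x. x \<in> Im ` circle_support f \<Longrightarrow> e \<le> dist 0 x"
    using separate_point_closed by metis
  have supp0: "Im z \<ge> e" if "z \<in> sphere 0 1" "f z \<noteq> 0" for z
  proof -
    have "z \<in> circle_support f" using circle_support_superset that by blast
    then show ?thesis using e(2)[of "Im z"] supp by (auto simp: upper_semicircle_def)
  qed
  \<comment> \<open>From 1 / cosh u >= e and exp |u| <= 2 cosh u.\<close>
  have zero: "g u = 0" if u: "\<bar>u\<bar> > ln (2 / e)" for u
  proof (rule ccontr)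
    assume "g u \<noteq> 0"
    then have "Im (cis (arc_angle u)) \<ge> e" by (intro supp0) (auto simp: g_def)
    then have c: "cosh u \<le> 1 / e" using e by (simp add: cis_arc_angle field_simps)
    have "exp \<bar>u\<bar> \<le> 2 * cosh u" by (simp add: cosh_def abs_if)
    then have "exp \<bar>u\<bar> \<le> 2 / e" using c by simp
    then have "\<bar>u\<bar> \<le> ln (2 / e)" using e by (subst ln_ge_iff) auto
    then show False using u by simp
  qed
  have "f = arc_fun d g"
  proof
    fix z show "f z = arc_fun d g z"
    proof (cases "z \<in> sphere 0 1 \<and> Im z > 0")
      case True
      then have z: "z \<in> sphere 0 1" "Im z > 0" by auto
      have "Im z powi (int d - 1) * (1 / Im z) powi (int d - 1) = 1"
        using z by (simp flip: power_int_mult_distrib)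
      then have "complex_of_real (Im z powi (int d - 1)) * complex_of_real ((1 / Im z) powi (int d - 1)) = 1"
        by (metis of_real_1 of_real_mult)
      then show ?thesis using True
        by (simp only: arc_fun_eq g_def cis_arc_angle_arc_coord[OF z] if_True mult.assoc[symmetric]) simp
    next
      case False
      then have "f z = 0"
        using supp0[of z] e(1) smooth_circle_outside[OF f, of z] by force
      then show ?thesis using False by (auto simp: arc_fun_eq)
    qed
  qed
  with that smooth_line_compact_support_rapid[OF sl zero] zero show ?thesis by blast
qed

definition gauss :: "complex \<Rightarrow> complex" where "gauss z = exp (- z\<^sup>2)"

lemma rapid_entire_gauss: "rapid_entire gauss"
  unfolding rapid_entire_def
proof (intro conjI allI)
  show "gauss holomorphic_on UNIV" unfolding gauss_def by (intro holomorphic_intros)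
  fix K V
  have "norm (gauss z) \<le> exp (V\<^sup>2 + K\<^sup>2) * exp (- K * \<bar>Re z\<bar>)" if "\<bar>Im z\<bar> \<le> V" for z
  proof -
    have "(Im z)\<^sup>2 \<le> V\<^sup>2" using that by (metis abs_ge_zero power_mono power2_abs)
    moreover have "0 \<le> (\<bar>Re z\<bar> - K / 2)\<^sup>2" by simp
    then have "- (Re z)\<^sup>2 \<le> K\<^sup>2 / 4 - K * \<bar>Re z\<bar>" by (simp add: power2_eq_square algebra_simps)
    moreover have "K\<^sup>2 / 4 \<le> K\<^sup>2" using zero_le_power2[of K] by linarith
    ultimately have "- (Re z)\<^sup>2 + (Im z)\<^sup>2 \<le> (V\<^sup>2 + K\<^sup>2) + - K * \<bar>Re z\<bar>"
      unfolding mult_minus_left by linarith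
    then show ?thesis
      unfolding gauss_def norm_exp_eq_Re exp_add[symmetric] by (simp add: power2_eq_square)
  qed
  then show "\<exists>C. \<forall>z. \<bar>Im z\<bar> \<le> V \<longrightarrow> norm (gauss z) \<le> C * exp (- K * \<bar>Re z\<bar>)" by blast
qed

text \<open>A Gaussian in the coordinate of the upper semicircle is flat at the end points, hence smooth on the
  circle with support in that semicircle; this is the bump.\<close>

lemma bump_function:
  obtains \<kappa> where "smooth_line \<kappa>" "\<kappa> 0 = 1" "\<And>u. \<bar>u\<bar> > pi \<Longrightarrow> \<kappa> u = 0"
    "\<And>j. \<exists>B. \<forall>u. norm (iter_deriv j \<kappa> u) \<le> B"
proof -
  define f where "f = arc_term 0 0 (\<lambda>u. gauss (of_real u))"
  have f: "f \<in> smooth_circle"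
    unfolding f_def by (intro smooth_circle_arc_term rapid_entire_restrict rapid_entire_gauss)
  \<comment> \<open>One period of the circle, recentred so that the middle of the arc, where the
    coordinate is 0 and the Gaussian is 1, lies at 0. All derivatives vanish for |u| > \<pi>/2, so
    the truncation at \<pi> does not affect smoothness.\<close>
  define K where "K j u = (if \<bar>u\<bar> < pi then angular_deriv j f (u + pi / 2) else 0)" for j u
  have "open {\<theta>. sin \<theta> < (0::real)}" by (intro open_Collect_less continuous_intros)
  then have AD0: "angular_deriv j f \<theta> = 0" if "sin \<theta> < 0" for j \<theta>
    unfolding angular_deriv_conv_iter_deriv
    by (rule iter_deriv_eq_0_open) (use that in \<open>auto simp: f_def arc_term_def\<close>)
  have K0: "K j u = 0" if "\<bar>u\<bar> > pi / 2" for j u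
  proof (cases "\<bar>u\<bar> < pi")
    case True
    have "cos \<bar>u\<bar> < 0" using that True cos_lt_zero_pi[of "\<bar>u\<bar>"] pi_gt_zero by simp
    then have "sin (u + pi / 2) < 0" by (simp add: sin_add)
    then show ?thesis by (simp add: K_def AD0)
  qed (simp add: K_def)
  have d: "(K j has_vector_derivative K (Suc j) u) (at u)" for j u
  proof (cases "\<bar>u\<bar> < pi")
    case True
    have "(angular_deriv j f \<circ> (\<lambda>u. u + pi / 2) has_vector_derivative 1 *\<^sub>R angular_deriv (Suc j) f (u + pi / 2)) (at u)"
      by (intro vector_diff_chain_at angular_deriv_has_derivative f) (auto intro!: derivative_eq_intros)
    then have "((\<lambda>u. angular_deriv j f (u + pi / 2)) has_vector_derivative K (Suc j) u) (at u)"
      using True by (simp add: o_def K_def)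
    moreover have "open {u. \<bar>u\<bar> < pi}" by (intro open_Collect_less continuous_intros)
    ultimately show ?thesis
      by (rule has_vector_derivative_transform_within_open) (use True in \<open>auto simp: K_def\<close>)
  next
    case False
    then have u: "\<bar>u\<bar> > pi / 2" using pi_gt_zero by linarith
    have "open {u. \<bar>u\<bar> > pi / 2}" by (intro open_Collect_less continuous_intros)
    then have "(K j has_vector_derivative 0) (at u)"
      by (rule has_vector_derivative_transform_within_open[OF has_vector_derivative_const[of 0]])
         (use u K0 in simp_all)
    then show ?thesis using K0[OF u] by simp
  qed
  have it: "iter_deriv j (K 0) = K j" for j by (rule iter_deriv_unique[where G = K]) (rule refl d)+
  show ?thesis
  proof (rule that[of "K 0"])
    show "smooth_line (K 0)" by (rule smooth_lineI[where G = K]) (rule refl d)+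
    show "K 0 0 = 1" by (simp add: K_def angular_deriv_0 f_def arc_term_def arc_coord_def gauss_def)
    show "K 0 u = 0" if "\<bar>u\<bar> > pi" for u using that by (simp add: K_def)
    show "\<exists>B. \<forall>u. norm (iter_deriv j (K 0) u) \<le> B" for j
    proof (intro exI allI)
      fix u
      show "norm (iter_deriv j (K 0) u) \<le> \<bar>C_norm j f\<bar>"
        unfolding it K_def using norm_angular_deriv_le_C_norm[OF f order_refl] order_trans[OF _ abs_ge_self] by auto
    qed
  qed
qed

lemma C_norm_arc_fun_tendsto:
  assumes "\<And>m. rapid (g m)" "rapid h"
    and "\<And>j K. \<exists>e. e \<longlonglongrightarrow> (0::real) \<and> (\<forall>m u. \<forall>i\<le>j. norm (iter_deriv i (g m) u - iter_deriv i h u) \<le> e m * exp (- K * \<bar>u\<bar>))"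
  shows "(\<lambda>m. C_norm N (\<lambda>z. arc_fun d (g m) z - arc_fun d h z)) \<longlonglongrightarrow> 0"
proof -
  obtain C where C: "C \<ge> 0" "\<And>g \<epsilon>. rapid g \<Longrightarrow> (\<And>i u. i \<le> N \<Longrightarrow> norm (iter_deriv i g u) \<le> \<epsilon> * exp (- (real d + 1 + real N) * \<bar>u\<bar>)) \<Longrightarrow>
       C_norm N (arc_fun d g) \<le> C * \<epsilon>"
    using C_norm_arc_fun_bound[of N d] by blast
  obtain e where e: "e \<longlonglongrightarrow> 0" "\<And>m u i. i \<le> N \<Longrightarrow> norm (iter_deriv i (g m) u - iter_deriv i h u) \<le> e m * exp (- (real d + 1 + real N) * \<bar>u\<bar>)"
    using assms(3)[of N "real d + 1 + real N"] by blast
  have b: "C_norm N (\<lambda>z. arc_fun d (g m) z - arc_fun d h z) \<le> C * e m" for m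
    unfolding arc_fun_diff[symmetric]
    by (rule C(2)[OF rapid_diff(1)[OF assms(1,2)]]) (simp only: rapid_diff(2)[OF assms(1,2)] e(2))
  show ?thesis
  proof (rule tendsto_sandwich[OF _ _ tendsto_const])
    show "(\<lambda>m. C * e m) \<longlonglongrightarrow> 0" using tendsto_mult[OF tendsto_const e(1), of C] by simp
    show "\<forall>\<^sub>F m in sequentially. 0 \<le> C_norm N (\<lambda>z. arc_fun d (g m) z - arc_fun d h z)"
      by (intro always_eventually allI C_norm_nonneg smooth_circle_diff smooth_circle_arc_fun assms)
  qed (use b in simp)
qed

text \<open>Multiplication by \<kappa>(r u) with r = 1 / (m + 1). The error g(u) (\<kappa>(r u) - 1)
  is small with all derivatives: each derivative of \<kappa>(r u) carries a factor r, and the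
  difference itself is at most a multiple of r |u|, whose growth the decrease of \<open>g\<close>
  absorbs.\<close>

lemma arc_fun_cutoff:
  assumes g: "rapid g"
  obtains G where "\<And>m. rapid (G m)" "\<And>m u. \<bar>u\<bar> > pi * (real m + 1) \<Longrightarrow> G m u = 0"
    "\<And>N. (\<lambda>m. C_norm N (\<lambda>z. arc_fun d (G m) z - arc_fun d g z)) \<longlonglongrightarrow> 0"
proof -
  obtain \<kappa> where k: "smooth_line \<kappa>" "\<kappa> 0 = 1" "\<And>u. \<bar>u\<bar> > pi \<Longrightarrow> \<kappa> u = 0"
    "\<And>j. \<exists>B. \<forall>u. norm (iter_deriv j \<kappa> u) \<le> B" using bump_function by blast
  obtain B where B: "\<And>j u. norm (iter_deriv j \<kappa> u) \<le> B j" using k(4) by metis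
  have B0: "0 \<le> B j" for j using order_trans[OF norm_ge_zero B[of j 0]] .
  define r where "r m = 1 / (real m + 1)" for m
  have r: "0 < r m" "r m \<le> 1" for m by (auto simp: r_def)
  \<comment> \<open>The tower of derivatives of \<kappa>(r u) - 1; the constant is visible at j = 0
    only.\<close>
  define H where "H m j u = of_real (r m ^ j) * iter_deriv j \<kappa> (r m * u) - (if j = 0 then 1 else 0)" for m j u
  have dH: "(H m j has_vector_derivative H m (Suc j) u) (at u)" for m j u
  proof -
    have "(iter_deriv j \<kappa> \<circ> (\<lambda>u. r m * u) has_vector_derivative r m *\<^sub>R iter_deriv (Suc j) \<kappa> (r m * u)) (at u)"
      by (intro vector_diff_chain_at smooth_lineD k) (auto intro!: derivative_eq_intros)
    from has_vector_derivative_diff[OF has_vector_derivative_mult_right[OF this, of "of_real (r m ^ j)"]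
        has_vector_derivative_const[of "if j = 0 then 1 else 0"]]
    show ?thesis unfolding H_def by (simp add: o_def scaleR_conv_of_real mult_ac)
  qed
  have slH: "smooth_line (H m 0)" for m by (rule smooth_lineI[where G = "H m"]) (rule refl dH)+
  have itH: "iter_deriv j (H m 0) = H m j" for m j by (rule iter_deriv_unique[where G = "H m"]) (rule refl dH)+
  have sg: "smooth_line g" using g by (simp add: rapid_iff)
  define E where "E m u = g u * H m 0 u" for m u
  have HB: "norm (H m i u) \<le> (r m * (\<Sum>l\<le>Suc j. B l)) * exp \<bar>u\<bar>" if "i \<le> j" for m i j u
  proof -
    have Bi: "B l \<le> (\<Sum>l\<le>Suc j. B l)" if "l \<le> Suc j" for l by (rule member_le_sum) (use that B0 in auto)
    have s0: "0 \<le> (\<Sum>l\<le>Suc j. B l)" using B0 by (intro sum_nonneg)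
    show ?thesis
    proof (cases i)
      case 0
      have "norm (\<kappa> (r m * u) - \<kappa> 0) \<le> B 1 * norm (r m * u - 0)"
      proof (rule differentiable_bound[where S = UNIV])
        show "(\<kappa> has_derivative (\<lambda>x. x *\<^sub>R iter_deriv 1 \<kappa> v)) (at v within UNIV)" for v
          using smooth_line_deriv_1[OF k(1)] by (simp add: has_vector_derivative_def)
        show "onorm (\<lambda>x. x *\<^sub>R iter_deriv 1 \<kappa> v) \<le> B 1" for v
          by (rule onorm_le) (use mult_right_mono[OF B[of 1 v]] in \<open>simp add: mult_ac\<close>)
      qed auto
      also have "\<dots> \<le> (\<Sum>l\<le>Suc j. B l) * (r m * exp \<bar>u\<bar>)"
      proof (rule mult_mono[OF Bi])
        have "\<bar>u\<bar> \<le> exp \<bar>u\<bar>" using exp_ge_add_one_self[of "\<bar>u\<bar>"] by linarith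
        then show "norm (r m * u - 0) \<le> r m * exp \<bar>u\<bar>" using r[of m] by (simp add: abs_mult)
      qed (use s0 in auto)
      finally show ?thesis using 0 by (simp add: H_def k(2) mult_ac)
    next
      case (Suc i')
      have "norm (H m i u) = r m ^ i * norm (iter_deriv i \<kappa> (r m * u))"
        using Suc r[of m] by (simp add: H_def norm_mult norm_power)
      also have "\<dots> \<le> r m * (\<Sum>l\<le>Suc j. B l)"
      proof (rule mult_mono)
        show "r m ^ i \<le> r m" using r[of m] Suc by (simp add: mult_left_le power_le_one)
        show "norm (iter_deriv i \<kappa> (r m * u)) \<le> (\<Sum>l\<le>Suc j. B l)" using B Bi[of i] that order_trans by fastforce
      qed (use r[of m] in auto)
      also have "\<dots> \<le> (r m * (\<Sum>l\<le>Suc j. B l)) * exp \<bar>u\<bar>"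
        using mult_left_mono[of 1 "exp \<bar>u\<bar>" "r m * (\<Sum>l\<le>Suc j. B l)"] r[of m] s0 by simp
      finally show ?thesis .
    qed
  qed
  have slE: "smooth_line (E m)" for m unfolding E_def by (intro smooth_line_mult sg slH)
  have EB: "\<exists>C\<ge>0. \<forall>m u. \<forall>i\<le>j. norm (iter_deriv i (E m) u) \<le> (C * r m) * exp (- K * \<bar>u\<bar>)" for j K
  proof -
    obtain A where A: "A \<ge> 0" "\<And>i u. i \<le> j \<Longrightarrow> norm (iter_deriv i g u) \<le> A * exp (- (K + 1) * \<bar>u\<bar>)"
      using rapid_bound[OF g] by blast
    define S where "S = (\<Sum>l\<le>Suc j. B l)"
    have S0: "S \<ge> 0" unfolding S_def using B0 by (intro sum_nonneg)
    have "norm (iter_deriv i (E m) u) \<le> (2 ^ j * A * S * r m) * exp (- K * \<bar>u\<bar>)" if "i \<le> j" for m u i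
    proof -
      have "norm (iter_deriv i (E m) u) \<le> 2 ^ i * (A * (r m * S) * exp (- (K + 1 - 1) * \<bar>u\<bar>))"
        unfolding E_def
        by (rule iter_deriv_mult_bound[OF sg slH A(1)])
           (use A(2) HB[where j = j] that S0 r[of m] in \<open>auto simp: itH S_def\<close>)
      also have "\<dots> \<le> 2 ^ j * (A * (r m * S) * exp (- (K + 1 - 1) * \<bar>u\<bar>))"
        using that A S0 r[of m] by (intro mult_right_mono power_increasing) auto
      finally show ?thesis by (simp add: mult_ac)
    qed
    then show ?thesis using A S0 by (intro exI[of _ "2 ^ j * A * S"]) auto
  qed
  have rE: "rapid (E m)" for m
    unfolding rapid_iff using slE EB by (metis order_refl)
  define G where "G m u = g u + E m u" for m u
  show ?thesis
  proof (rule that[of G])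
    show rG: "rapid (G m)" for m unfolding G_def by (rule rapid_add(1)[OF g rE])
    show "G m u = 0" if "\<bar>u\<bar> > pi * (real m + 1)" for m u
    proof -
      have "\<bar>r m * u\<bar> > pi" using that by (simp add: r_def abs_mult field_simps)
      then show ?thesis using k(3) by (simp add: G_def E_def H_def algebra_simps)
    qed
    show "(\<lambda>m. C_norm N (\<lambda>z. arc_fun d (G m) z - arc_fun d g z)) \<longlonglongrightarrow> 0" for N
    proof (rule C_norm_arc_fun_tendsto[OF rG g])
      fix j K
      obtain C where C: "\<And>m u i. i \<le> j \<Longrightarrow> norm (iter_deriv i (E m) u) \<le> (C * r m) * exp (- K * \<bar>u\<bar>)"
        using EB[of j K] by blast
      have "r \<longlonglongrightarrow> 0" unfolding r_def using LIMSEQ_inverse_real_of_nat by (simp add: inverse_eq_divide add_ac)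
      then have "(\<lambda>m. C * r m) \<longlonglongrightarrow> 0" using tendsto_mult_right_zero by blast
      moreover have "iter_deriv i (G m) u - iter_deriv i g u = iter_deriv i (E m) u" for i m u
        unfolding G_def rapid_add(2)[OF g rE] by simp
      ultimately show "\<exists>e. e \<longlonglongrightarrow> 0 \<and> (\<forall>m u. \<forall>i\<le>j. norm (iter_deriv i (G m) u - iter_deriv i g u) \<le> e m * exp (- K * \<bar>u\<bar>))"
        using C by (intro exI[of _ "\<lambda>m. C * r m"]) simp
    qed
  qed
qed

section \<open>Gaussian approximation\<close>

text \<open>The density of the normal distribution, continued to complex arguments.\<close>

definition heat_kernel :: "real \<Rightarrow> complex \<Rightarrow> complex" where
  "heat_kernel \<sigma> z = of_real (1 / sqrt (2 * pi * \<sigma>\<^sup>2)) * exp (- (z\<^sup>2) / of_real (2 * \<sigma>\<^sup>2))"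

lemma heat_kernel_real: "heat_kernel \<sigma> (of_real (u - s)) = of_real (normal_density u \<sigma> s)"
proof -
  have "(s - u)\<^sup>2 = (u - s)\<^sup>2" by (simp add: power2_eq_square algebra_simps)
  then show ?thesis
    unfolding heat_kernel_def normal_density_def
    by (simp add: exp_of_real flip: of_real_power of_real_minus of_real_divide of_real_mult of_real_diff)
qed

lemma heat_kernel_deriv:
  "(heat_kernel \<sigma> has_field_derivative - (z / of_real (\<sigma>\<^sup>2)) * heat_kernel \<sigma> z) (at z within S)"
proof (cases "\<sigma> = 0")
  case True
  then show ?thesis by (simp add: heat_kernel_def[abs_def])
next
  case False
  then show ?thesis
    unfolding heat_kernel_def
    by (auto intro!: derivative_eq_intros simp: divide_simps power2_eq_square)
qed

lemma heat_kernel_bound: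
  assumes "\<sigma> > 0" "\<bar>Im z\<bar> \<le> V" "K \<ge> 0"
  shows "norm (heat_kernel \<sigma> z) \<le> (1 / sqrt (2 * pi * \<sigma>\<^sup>2) * exp (V\<^sup>2 / (2 * \<sigma>\<^sup>2) + K\<^sup>2 * \<sigma>\<^sup>2)) * exp (- K * \<bar>Re z\<bar>)"
proof -
  define x y where "x = Re z" and "y = Im z"
  have y: "y\<^sup>2 \<le> V\<^sup>2" using assms(2) by (metis abs_ge_zero power_mono power2_abs y_def)
  \<comment> \<open>This square yields K |x| <= x^2 / (4 \<sigma>^2) + K^2 \<sigma>^2, which uses
    half of what the Gaussian exponent provides.\<close>
  have "0 \<le> (\<bar>x\<bar> / (2 * \<sigma>) - K * \<sigma>)\<^sup>2" by simp
  also have "\<dots> = x\<^sup>2 / (4 * \<sigma>\<^sup>2) - K * \<bar>x\<bar> + K\<^sup>2 * \<sigma>\<^sup>2"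
    using assms(1) by (simp add: power2_eq_square field_simps)
  also have "\<dots> \<le> x\<^sup>2 / (2 * \<sigma>\<^sup>2) - K * \<bar>x\<bar> + K\<^sup>2 * \<sigma>\<^sup>2"
    using assms(1) by (simp add: field_simps)
  finally have "- (x\<^sup>2 / (2 * \<sigma>\<^sup>2)) \<le> K\<^sup>2 * \<sigma>\<^sup>2 - K * \<bar>x\<bar>" by simp
  moreover have "y\<^sup>2 / (2 * \<sigma>\<^sup>2) \<le> V\<^sup>2 / (2 * \<sigma>\<^sup>2)" using y by (intro divide_right_mono) auto
  ultimately have "- ((x\<^sup>2 - y\<^sup>2) / (2 * \<sigma>\<^sup>2)) \<le> (V\<^sup>2 / (2 * \<sigma>\<^sup>2) + K\<^sup>2 * \<sigma>\<^sup>2) + - K * \<bar>x\<bar>"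
    by (simp add: diff_divide_distrib)
  moreover have "Re (- (z\<^sup>2) / of_real (2 * \<sigma>\<^sup>2)) = - ((x\<^sup>2 - y\<^sup>2) / (2 * \<sigma>\<^sup>2))"
    unfolding Re_divide_of_real minus_divide_left by (simp add: x_def y_def power2_eq_square)
  ultimately have "exp (Re (- (z\<^sup>2) / of_real (2 * \<sigma>\<^sup>2))) \<le> exp (V\<^sup>2 / (2 * \<sigma>\<^sup>2) + K\<^sup>2 * \<sigma>\<^sup>2) * exp (- K * \<bar>x\<bar>)"
    unfolding exp_add[symmetric] exp_le_cancel_iff by linarith
  then have "1 / sqrt (2 * pi * \<sigma>\<^sup>2) * exp (Re (- (z\<^sup>2) / of_real (2 * \<sigma>\<^sup>2)))
     \<le> 1 / sqrt (2 * pi * \<sigma>\<^sup>2) * (exp (V\<^sup>2 / (2 * \<sigma>\<^sup>2) + K\<^sup>2 * \<sigma>\<^sup>2) * exp (- K * \<bar>x\<bar>))"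
    by (intro mult_left_mono) auto
  then show ?thesis
    unfolding heat_kernel_def norm_mult norm_exp_eq_Re norm_of_real x_def by (simp add: mult.assoc)
qed

text \<open>Over a compact interval one can differentiate under the integral sign, so the result is
  entire although \<open>g\<close> need only be continuous.\<close>

definition heat_conv :: "real \<Rightarrow> real \<Rightarrow> (real \<Rightarrow> complex) \<Rightarrow> complex \<Rightarrow> complex" where
  "heat_conv M \<sigma> g z = integral {-M..M} (\<lambda>s. heat_kernel \<sigma> (z - of_real s) * g s)"

lemma continuous_on_heat_kernel:
  "continuous_on S f \<Longrightarrow> continuous_on S (\<lambda>x. heat_kernel \<sigma> (f x))"
  unfolding heat_kernel_def by (cases "\<sigma> = 0") (auto intro!: continuous_intros)

lemma heat_conv_deriv:
  assumes g: "continuous_on {-M..M} g"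
  shows "(heat_conv M \<sigma> g has_field_derivative
     integral {-M..M} (\<lambda>s. - ((z - of_real s) / of_real (\<sigma>\<^sup>2)) * heat_kernel \<sigma> (z - of_real s) * g s)) (at z)"
proof -
  have "((\<lambda>z. integral (cbox (-M) M) (\<lambda>s. heat_kernel \<sigma> (z - of_real s) * g s)) has_field_derivative
     integral (cbox (-M) M) (\<lambda>s. - ((z - of_real s) / of_real (\<sigma>\<^sup>2)) * heat_kernel \<sigma> (z - of_real s) * g s)) (at z within UNIV)"
  proof (rule leibniz_rule_field_derivative)
    fix z s
    have "(heat_kernel \<sigma> \<circ> (\<lambda>z. z - of_real s) has_field_derivative
        (- ((z - of_real s) / of_real (\<sigma>\<^sup>2)) * heat_kernel \<sigma> (z - of_real s)) * 1) (at z within UNIV)"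
      by (rule DERIV_chain'[OF _ heat_kernel_deriv, folded o_def]) (auto intro!: derivative_eq_intros)
    from DERIV_cmult_right[OF this]
    show "((\<lambda>z. heat_kernel \<sigma> (z - of_real s) * g s) has_field_derivative
       - ((z - of_real s) / of_real (\<sigma>\<^sup>2)) * heat_kernel \<sigma> (z - of_real s) * g s) (at z within UNIV)"
      by (simp add: o_def)
  next
    show "(\<lambda>s. heat_kernel \<sigma> (z - of_real s) * g s) integrable_on cbox (-M) M" for z
      using g by (intro integrable_continuous continuous_intros continuous_on_heat_kernel) auto
    have "continuous_on (UNIV \<times> {-M..M}) (\<lambda>p. g (snd p))"
      by (rule continuous_on_compose2[OF g]) (auto intro!: continuous_intros)
    then show "continuous_on (UNIV \<times> cbox (-M) M) (\<lambda>(z, s). - ((z - of_real s) / of_real (\<sigma>\<^sup>2)) * heat_kernel \<sigma> (z - of_real s) * g s)"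
      unfolding case_prod_beta by (cases "\<sigma> = 0") (auto intro!: continuous_intros continuous_on_heat_kernel)
  qed auto
  then show ?thesis by (simp add: heat_conv_def[abs_def])
qed

text \<open>The kernel depends on z - s, so its z-derivative is minus its s-derivative; integration
  by parts moves it to \<open>g\<close>, and the boundary terms vanish with \<open>g\<close>.
  Convolution thus commutes with differentiation, and one error estimate serves for all
  orders.\<close>

lemma heat_conv_deriv_parts:
  assumes M: "M \<ge> 0" and g: "\<And>s. (g has_vector_derivative g' s) (at s)" "\<And>s. (g' has_vector_derivative g'' s) (at s)"
    and z: "g M = 0" "g (-M) = 0"
  shows "(heat_conv M \<sigma> g has_field_derivative heat_conv M \<sigma> g' z) (at z)"
proof -
  have cont: "continuous_on S g" "continuous_on S g'" for S
    by (intro continuous_at_imp_continuous_on ballI has_vector_derivative_continuous[OF g(1)])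
      (intro continuous_at_imp_continuous_on ballI has_vector_derivative_continuous[OF g(2)])
  let ?k' = "\<lambda>s. (z - of_real s) / of_real (\<sigma>\<^sup>2) * heat_kernel \<sigma> (z - of_real s)"
  have k: "((\<lambda>s. heat_kernel \<sigma> (z - of_real s)) has_vector_derivative ?k' s) (at s)" for s
  proof -
    have "((\<lambda>s. z - of_real s) has_vector_derivative -1) (at s)"
      by (auto intro!: derivative_eq_intros simp: has_vector_derivative_def scaleR_conv_of_real)
    from field_vector_diff_chain_at[OF this heat_kernel_deriv] show ?thesis by (simp add: o_def)
  qed
  have "((\<lambda>s. ?k' s * g s) has_integral - heat_conv M \<sigma> g' z) {-M..M}"
  proof (rule integration_by_parts[OF bounded_bilinear_mult])
    have "((\<lambda>s. heat_kernel \<sigma> (z - of_real s) * g' s) has_integral heat_conv M \<sigma> g' z) {-M..M}"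
      unfolding heat_conv_def
      by (intro integrable_integral integrable_continuous_real continuous_intros continuous_on_heat_kernel cont)
    then show "((\<lambda>s. heat_kernel \<sigma> (z - of_real s) * g' s) has_integral
       heat_kernel \<sigma> (z - of_real M) * g M - heat_kernel \<sigma> (z - of_real (-M)) * g (-M) - - heat_conv M \<sigma> g' z) {-M..M}"
      by (simp add: z)
  qed (use M k g in \<open>auto intro!: continuous_intros continuous_on_heat_kernel cont\<close>)
  then have "((\<lambda>s. - ((z - of_real s) / of_real (\<sigma>\<^sup>2)) * heat_kernel \<sigma> (z - of_real s) * g s) has_integral heat_conv M \<sigma> g' z) {-M..M}"
    by (drule_tac has_integral_neg) (simp only: minus_mult_left minus_minus)
  from integral_unique[OF this] heat_conv_deriv[OF cont(1)] show ?thesis by metis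
qed

lemma rapid_entire_heat_conv:
  assumes "\<sigma> > 0" "M \<ge> 0" and g: "continuous_on {-M..M} g"
  shows "rapid_entire (heat_conv M \<sigma> g)"
  unfolding rapid_entire_def
proof (intro conjI allI)
  show "heat_conv M \<sigma> g holomorphic_on UNIV"
  proof (rule holomorphic_on_open[THEN iffD2, OF open_UNIV], intro ballI exI)
    show "(heat_conv M \<sigma> g has_field_derivative
     integral {-M..M} (\<lambda>s. - ((z - of_real s) / of_real (\<sigma>\<^sup>2)) * heat_kernel \<sigma> (z - of_real s) * g s)) (at z)" for z
      by (rule heat_conv_deriv[OF g])
  qed
  fix K V :: real
  have "compact (g ` {-M..M})" by (rule compact_continuous_image[OF g]) simp
  from compact_imp_bounded[OF this] obtain B0 where B0: "\<forall>x\<in>g ` {-M..M}. norm x \<le> B0"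
    unfolding bounded_iff by (elim exE)
  define B where "B = \<bar>B0\<bar>"
  have B: "norm (g s) \<le> B" if "s \<in> {-M..M}" for s using bspec[OF B0 imageI[OF that]] by (simp add: B_def)
  define D where "D = 1 / sqrt (2 * pi * \<sigma>\<^sup>2) * exp (V\<^sup>2 / (2 * \<sigma>\<^sup>2) + \<bar>K\<bar>\<^sup>2 * \<sigma>\<^sup>2)"
  have D0: "D \<ge> 0" by (simp add: D_def)
  have "norm (heat_conv M \<sigma> g z) \<le> (D * exp (\<bar>K\<bar> * M) * B * (2 * M)) * exp (- K * \<bar>Re z\<bar>)" if V: "\<bar>Im z\<bar> \<le> V" for z
  proof -
    have "norm (heat_conv M \<sigma> g z) \<le> (D * (exp (\<bar>K\<bar> * M) * exp (- \<bar>K\<bar> * \<bar>Re z\<bar>)) * B) * (M - (-M))"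
      unfolding heat_conv_def
    proof (rule integral_bound)
      show "continuous_on {-M..M} (\<lambda>s. heat_kernel \<sigma> (z - of_real s) * g s)"
        by (intro continuous_intros continuous_on_heat_kernel g)
      fix s assume s: "s \<in> {-M..M}"
      have "norm (heat_kernel \<sigma> (z - of_real s)) \<le> D * exp (- \<bar>K\<bar> * \<bar>Re (z - of_real s)\<bar>)"
        unfolding D_def using V by (intro heat_kernel_bound assms(1)) auto
      also have "\<dots> \<le> D * (exp (\<bar>\<bar>K\<bar>\<bar> * \<bar>Re (z - of_real s) - Re z\<bar>) * exp (- \<bar>K\<bar> * \<bar>Re z\<bar>))"
        by (intro mult_left_mono exp_abs_shift_le D0)
      also have "\<dots> \<le> D * (exp (\<bar>K\<bar> * M) * exp (- \<bar>K\<bar> * \<bar>Re z\<bar>))"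
        using s D0 by (intro mult_left_mono mult_right_mono) (auto intro!: mult_left_mono)
      finally show "norm (heat_kernel \<sigma> (z - of_real s) * g s) \<le> D * (exp (\<bar>K\<bar> * M) * exp (- \<bar>K\<bar> * \<bar>Re z\<bar>)) * B"
        unfolding norm_mult using B[OF s] D0 by (intro mult_mono) auto
    qed (use assms in auto)
    also have "\<dots> = (D * exp (\<bar>K\<bar> * M) * B * (2 * M)) * exp (- \<bar>K\<bar> * \<bar>Re z\<bar>)" by simp
    also have "\<dots> \<le> (D * exp (\<bar>K\<bar> * M) * B * (2 * M)) * exp (- K * \<bar>Re z\<bar>)"
      using D0 assms by (intro mult_left_mono) (auto simp: B_def intro!: mult_right_mono)
    finally show ?thesis .
  qed
  then show "\<exists>C. \<forall>z. \<bar>Im z\<bar> \<le> V \<longrightarrow> norm (heat_conv M \<sigma> g z) \<le> C * exp (- K * \<bar>Re z\<bar>)" by blast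
qed

text \<open>The factor |s - u| exp (K |s - u|) is paid for by doubling the width of the Gaussian,
  and a factor \<sigma> is gained; the wider density again has total mass 1.\<close>

lemma normal_density_moment_bound:
  assumes "\<sigma> > 0" "\<sigma> \<le> 1" "K \<ge> 0"
  shows "normal_density u \<sigma> s * (\<bar>s - u\<bar> * exp (K * \<bar>s - u\<bar>)) \<le> (2 * exp ((K + 1)\<^sup>2) * \<sigma>) * normal_density u (2 * \<sigma>) s"
proof -
  \<comment> \<open>In units of \<sigma>: w <= exp w, and \<sigma> <= 1 gives exp (K \<sigma> w) <=
    exp (K w). Then (K + 1) w <= (K + 1)^2 + w^2 / 4 is absorbed by the gap between w^2 / 2 and w^2
    / 8.\<close>
  define w where "w = \<bar>s - u\<bar> / \<sigma>"
  have w: "w \<ge> 0" "\<bar>s - u\<bar> = \<sigma> * w" using assms by (auto simp: w_def)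
  have sq: "(s - u)\<^sup>2 = \<sigma>\<^sup>2 * w\<^sup>2" using w(2) by (metis power2_abs power_mult_distrib)
  have "w \<le> exp w" using exp_ge_add_one_self[of w] by linarith
  then have "w * exp (K * (\<sigma> * w)) \<le> exp w * exp (K * w)"
    using w assms by (intro mult_mono) (auto intro!: mult_left_mono mult_left_le_one_le)
  also have "\<dots> = exp ((K + 1) * w)" by (simp add: exp_add[symmetric] algebra_simps)
  finally have 1: "w * exp (K * (\<sigma> * w)) \<le> exp ((K + 1) * w)" .
  have "0 \<le> (w / 2 - (K + 1))\<^sup>2" by simp
  then have "(K + 1) * w \<le> (K + 1)\<^sup>2 + w\<^sup>2 / 4" by (simp add: power2_eq_square algebra_simps)
  moreover have "w\<^sup>2 / 4 \<le> w\<^sup>2 * (3 / 8)" by simp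
  ultimately have 2: "(K + 1) * w + - (w\<^sup>2) / 2 \<le> (K + 1)\<^sup>2 + - (w\<^sup>2) / 8"
    using zero_le_power2[of w] by linarith
  have "exp (- (w\<^sup>2) / 2) * (w * exp (K * (\<sigma> * w))) \<le> exp (- (w\<^sup>2) / 2) * exp ((K + 1) * w)"
    using 1 by (intro mult_left_mono) auto
  also have "\<dots> = exp ((K + 1) * w + - (w\<^sup>2) / 2)" by (simp add: exp_add[symmetric] add.commute)
  also have "\<dots> \<le> exp ((K + 1)\<^sup>2) * exp (- (w\<^sup>2) / 8)" unfolding exp_add[symmetric] using 2 by simp
  finally have 3: "exp (- (w\<^sup>2) / 2) * (w * exp (K * (\<sigma> * w))) \<le> exp ((K + 1)\<^sup>2) * exp (- (w\<^sup>2) / 8)" .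
  have n1: "normal_density u \<sigma> s = (1 / (sqrt (2 * pi) * \<sigma>)) * exp (- (w\<^sup>2) / 2)"
    using assms by (simp add: normal_density_def sq real_sqrt_mult)
  have n2: "normal_density u (2 * \<sigma>) s = (1 / (sqrt (2 * pi) * (2 * \<sigma>))) * exp (- (w\<^sup>2) / 8)"
  proof -
    have r: "sqrt (2 * pi * (2 * \<sigma>)\<^sup>2) = sqrt (2 * pi) * (2 * \<sigma>)"
      by (subst real_sqrt_mult, subst real_sqrt_abs) (use assms in simp)
    have e: "- (\<sigma>\<^sup>2 * w\<^sup>2) / (2 * (2 * \<sigma>)\<^sup>2) = - (w\<^sup>2) / 8"
      using assms by (simp add: power2_eq_square field_simps)
    show ?thesis unfolding normal_density_def sq r e ..
  qed
  have "normal_density u \<sigma> s * (\<bar>s - u\<bar> * exp (K * \<bar>s - u\<bar>)) = (1 / sqrt (2 * pi)) * (exp (- (w\<^sup>2) / 2) * (w * exp (K * (\<sigma> * w))))"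
    unfolding n1 w(2) using assms by simp
  also have "\<dots> \<le> (1 / sqrt (2 * pi)) * (exp ((K + 1)\<^sup>2) * exp (- (w\<^sup>2) / 8))"
    using 3 by (intro mult_left_mono) auto
  also have "\<dots> = (2 * exp ((K + 1)\<^sup>2) * \<sigma>) * normal_density u (2 * \<sigma>) s"
    unfolding n2 using assms by simp
  finally show ?thesis .
qed

text \<open>The kernel has mass 1, so the error is the mean of h(s) - h(u), at most B |s - u|. This
  difference vanishes unless |u| <= M + |s - u|, as otherwise both points lie outside the support.
  That is the origin of the decrease exp (- K |u|), at the price exp (K M) exp (K |s - u|).\<close>

lemma heat_conv_error:
  assumes s: "\<sigma> > 0" "\<sigma> \<le> 1" and M: "M \<ge> 0" and K: "K \<ge> 0"
    and h: "\<And>s. (h has_vector_derivative h' s) (at s)" and h0: "\<And>s. \<bar>s\<bar> \<ge> M \<Longrightarrow> h s = 0"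
    and B: "\<And>s. norm (h' s) \<le> B"
  shows "norm (heat_conv M \<sigma> h (of_real u) - h u) \<le> (2 * B * exp (K * M) * exp ((K + 1)\<^sup>2) * \<sigma>) * exp (- K * \<bar>u\<bar>)"
proof -
  have cont: "continuous_on S h" for S
    by (intro continuous_at_imp_continuous_on ballI has_vector_derivative_continuous[OF h])
  have B0: "0 \<le> B" using order_trans[OF norm_ge_zero B] .
  let ?n = "normal_density u \<sigma>"
  have n_int: "integrable lborel ?n" "(\<integral>x. ?n x \<partial>lborel) = 1"
    using integrable_normal_density[of \<sigma> u] integral_normal_density[of \<sigma> u] s by simp_all
  have contn: "continuous_on S (\<lambda>s. complex_of_real (?n s) * h s)" for S
    unfolding heat_kernel_real[symmetric]
    by (intro continuous_intros continuous_on_heat_kernel cont)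
  have si: "set_integrable lborel {-M..M} (\<lambda>s. complex_of_real (?n s) * h s)"
    by (intro borel_integrable_atLeastAtMost' contn)
  have ind: "indicator {-M..M} s *\<^sub>R (complex_of_real (?n s) * h s) = ?n s *\<^sub>R h s" for s
  proof (cases "s \<in> {-M..M}")
    case False
    then have "\<bar>s\<bar> \<ge> M" by auto
    then show ?thesis using h0[of s] by simp
  qed (simp add: scaleR_conv_of_real)
  have int1: "integrable lborel (\<lambda>s. ?n s *\<^sub>R h s)"
    using si unfolding set_integrable_def ind .
  have "heat_conv M \<sigma> h (of_real u) = integral {-M..M} (\<lambda>s. complex_of_real (?n s) * h s)"
    unfolding heat_conv_def heat_kernel_real[symmetric] by simp
  also have "\<dots> = (\<integral>s. ?n s *\<^sub>R h s \<partial>lborel)"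
    using set_borel_integral_eq_integral(2)[OF si] unfolding set_lebesgue_integral_def ind by simp
  finally have 1: "heat_conv M \<sigma> h (of_real u) = (\<integral>s. ?n s *\<^sub>R h s \<partial>lborel)" .
  have int2: "integrable lborel (\<lambda>s. ?n s *\<^sub>R h u)" by (rule integrable_scaleR_left) (use n_int in simp)
  have "(\<integral>s. ?n s *\<^sub>R h u \<partial>lborel) = (\<integral>s. ?n s \<partial>lborel) *\<^sub>R h u"
    by (rule integral_scaleR_left) (use n_int in simp)
  then have 2: "(\<integral>s. ?n s *\<^sub>R h u \<partial>lborel) = h u" using n_int by simp
  have lip: "norm (h s - h u) \<le> (B * exp (K * M) * exp (- K * \<bar>u\<bar>)) * (\<bar>s - u\<bar> * exp (K * \<bar>s - u\<bar>))" for s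
  proof -
    have l: "norm (h s - h u) \<le> B * \<bar>s - u\<bar>"
    proof -
      have "norm (h s - h u) \<le> B * norm (s - u)"
      proof (rule differentiable_bound[where S = UNIV])
        show "(h has_derivative (\<lambda>x. x *\<^sub>R h' v)) (at v within UNIV)" for v
          using h[of v] by (simp add: has_vector_derivative_def)
        show "onorm (\<lambda>x. x *\<^sub>R h' v) \<le> B" for v
          by (rule onorm_le) (simp add: mult.commute[of B] mult_left_mono B)
      qed auto
      then show ?thesis by simp
    qed
    have "B * \<bar>s - u\<bar> \<le> (B * \<bar>s - u\<bar>) * (exp (K * M) * exp (- K * \<bar>u\<bar>) * exp (K * \<bar>s - u\<bar>))" if "\<bar>u\<bar> \<le> M + \<bar>s - u\<bar>"
    proof -
      have "K * \<bar>u\<bar> \<le> K * (M + \<bar>s - u\<bar>)" using that K by (intro mult_left_mono)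
      then have "0 \<le> K * M + - K * \<bar>u\<bar> + K * \<bar>s - u\<bar>" by (simp add: algebra_simps)
      then have "1 \<le> exp (K * M) * exp (- K * \<bar>u\<bar>) * exp (K * \<bar>s - u\<bar>)" unfolding exp_add[symmetric] by simp
      then show ?thesis using mult_left_mono[of 1 _ "B * \<bar>s - u\<bar>"] B0 by simp
    qed
    moreover have "norm (h s - h u) = 0" if "\<not> \<bar>u\<bar> \<le> M + \<bar>s - u\<bar>"
      using that h0[of s] h0[of u] by auto
    ultimately show ?thesis using l B0 by (cases "\<bar>u\<bar> \<le> M + \<bar>s - u\<bar>") (auto simp: mult_ac)
  qed
  define C where "C = B * exp (K * M) * exp (- K * \<bar>u\<bar>)"
  have C0: "C \<ge> 0" using B0 by (simp add: C_def)
  let ?G = "\<lambda>s. (C * (2 * exp ((K + 1)\<^sup>2) * \<sigma>)) * normal_density u (2 * \<sigma>) s"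
  have n2: "integrable lborel (normal_density u (2 * \<sigma>))" "(\<integral>x. normal_density u (2 * \<sigma>) x \<partial>lborel) = 1"
    using integrable_normal_density[of "2 * \<sigma>" u] integral_normal_density[of "2 * \<sigma>" u] s by simp_all
  have "heat_conv M \<sigma> h (of_real u) - h u = (\<integral>s. ?n s *\<^sub>R h s - ?n s *\<^sub>R h u \<partial>lborel)"
    using 1 2 Bochner_Integration.integral_diff[OF int1 int2] by simp
  also have "norm \<dots> \<le> (\<integral>s. ?G s \<partial>lborel)"
  proof (rule Bochner_Integration.integral_norm_bound_integral)
    show "integrable lborel (\<lambda>s. ?n s *\<^sub>R h s - ?n s *\<^sub>R h u)" by (rule Bochner_Integration.integrable_diff[OF int1 int2])
    show "integrable lborel ?G" by (intro integrable_mult_right n2)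
    fix s
    have "norm (?n s *\<^sub>R h s - ?n s *\<^sub>R h u) = ?n s * norm (h s - h u)"
      by (simp add: scaleR_diff_right[symmetric])
    also have "\<dots> \<le> ?n s * (C * (\<bar>s - u\<bar> * exp (K * \<bar>s - u\<bar>)))"
      unfolding C_def by (intro mult_left_mono lip) simp
    also have "\<dots> = C * (?n s * (\<bar>s - u\<bar> * exp (K * \<bar>s - u\<bar>)))" by simp
    also have "\<dots> \<le> C * ((2 * exp ((K + 1)\<^sup>2) * \<sigma>) * normal_density u (2 * \<sigma>) s)"
      by (intro mult_left_mono normal_density_moment_bound s K C0)
    finally show "norm (?n s *\<^sub>R h s - ?n s *\<^sub>R h u) \<le> ?G s" by (simp add: mult.assoc)
  qed
  also have "\<dots> = C * (2 * exp ((K + 1)\<^sup>2) * \<sigma>)" using n2 by simp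
  finally show ?thesis by (simp add: C_def mult_ac)
qed

lemma rapid_entire_approximation:
  assumes g: "rapid g" and supp: "\<And>u. \<bar>u\<bar> > M \<Longrightarrow> g u = 0"
  obtains \<gamma> where "\<And>m. rapid_entire (\<gamma> m)"
    "\<And>j K. \<exists>e. e \<longlonglongrightarrow> (0::real) \<and>
       (\<forall>m u. \<forall>i\<le>j. norm (iter_deriv i (\<lambda>u. \<gamma> m (of_real u)) u - iter_deriv i g u) \<le> e m * exp (- K * \<bar>u\<bar>))"
proof -
  \<comment> \<open>Larger than M, so that all derivatives of \<open>g\<close> vanish at N and -N,
    as the integration by parts requires.\<close>
  define N where "N = \<bar>M\<bar> + 1"
  have N0: "N \<ge> 0" by (simp add: N_def)
  have "open {u. \<bar>u\<bar> > M}" by (intro open_Collect_less continuous_intros)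
  then have zero: "iter_deriv j g u = 0" if "\<bar>u\<bar> \<ge> N" for j u
    by (rule iter_deriv_eq_0_open) (use that supp in \<open>auto simp: N_def\<close>)
  define \<sigma> where "\<sigma> m = 1 / (real m + 1)" for m
  have s: "\<sigma> m > 0" "\<sigma> m \<le> 1" for m by (auto simp: \<sigma>_def)
  define \<gamma> where "\<gamma> m = heat_conv N (\<sigma> m) g" for m
  have cont: "continuous_on S (iter_deriv j g)" for S j
    by (intro continuous_at_imp_continuous_on ballI has_vector_derivative_continuous[OF rapid_deriv[OF g]])
  have it: "iter_deriv i (\<lambda>u. \<gamma> m (of_real u)) = (\<lambda>u. heat_conv N (\<sigma> m) (iter_deriv i g) (of_real u))" for i m
  proof (rule iter_deriv_unique[where G = "\<lambda>i u. heat_conv N (\<sigma> m) (iter_deriv i g) (of_real u)"])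
    fix i u
    have "(heat_conv N (\<sigma> m) (iter_deriv i g) has_field_derivative heat_conv N (\<sigma> m) (iter_deriv (Suc i) g) (of_real u)) (at (of_real u))"
      by (rule heat_conv_deriv_parts[OF N0 rapid_deriv[OF g] rapid_deriv[OF g]]) (use zero[of N] zero[of "- N"] N0 in auto)
    from has_vector_derivative_real_field[OF this]
    show "((\<lambda>u. heat_conv N (\<sigma> m) (iter_deriv i g) (of_real u)) has_vector_derivative
        heat_conv N (\<sigma> m) (iter_deriv (Suc i) g) (of_real u)) (at u)" .
  qed (simp add: \<gamma>_def)
  show ?thesis
  proof (rule that[of \<gamma>])
    show "rapid_entire (\<gamma> m)" for m
      unfolding \<gamma>_def using cont[of _ 0] by (intro rapid_entire_heat_conv s N0) simp
    fix j K
    obtain B where B: "B \<ge> 0" "\<And>i u. i \<le> Suc j \<Longrightarrow> norm (iter_deriv i g u) \<le> B * exp (- 0 * \<bar>u\<bar>)"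
      using rapid_bound[OF g, where j = "Suc j" and K = 0] by blast
    define C where "C = 2 * B * exp (\<bar>K\<bar> * N) * exp ((\<bar>K\<bar> + 1)\<^sup>2)"
    have "norm (iter_deriv i (\<lambda>u. \<gamma> m (of_real u)) u - iter_deriv i g u) \<le> (C * \<sigma> m) * exp (- K * \<bar>u\<bar>)"
      if "i \<le> j" for i m u
    proof -
      have "norm (iter_deriv i (\<lambda>u. \<gamma> m (of_real u)) u - iter_deriv i g u) \<le> (C * \<sigma> m) * exp (- \<bar>K\<bar> * \<bar>u\<bar>)"
        unfolding it C_def using B(2)[of "Suc i"] that
        by (intro heat_conv_error[OF s N0 _ rapid_deriv[OF g] zero]) auto
      also have "\<dots> \<le> (C * \<sigma> m) * exp (- K * \<bar>u\<bar>)"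
        using B(1) s[of m] by (intro mult_left_mono) (auto simp: C_def intro!: mult_right_mono)
      finally show ?thesis .
    qed
    moreover have "\<sigma> \<longlonglongrightarrow> 0" unfolding \<sigma>_def using LIMSEQ_inverse_real_of_nat by (simp add: inverse_eq_divide add_ac)
    then have "(\<lambda>m. C * \<sigma> m) \<longlonglongrightarrow> 0" using tendsto_mult_right_zero by blast
    ultimately show "\<exists>e. e \<longlonglongrightarrow> 0 \<and> (\<forall>m u. \<forall>i\<le>j. norm (iter_deriv i (\<lambda>u. \<gamma> m (of_real u)) u - iter_deriv i g u) \<le> e m * exp (- K * \<bar>u\<bar>))"
      by blast
  qed
qed

section \<open>The KMS relation for entire test functions\<close>

lemma C_norm_zero: "C_norm N (\<lambda>z. 0) = 0"
  using C_norm_scale[OF smooth_circle_zero, of N 0] by simp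

lemma C_norm_diff_commute:
  assumes "f \<in> smooth_circle" "g \<in> smooth_circle"
  shows "C_norm N (\<lambda>z. f z - g z) = C_norm N (\<lambda>z. g z - f z)"
  using C_norm_scale[OF smooth_circle_diff[OF assms], of N "-1"] by simp

lemma C_norm_eq_0:
  assumes "f \<in> smooth_circle" "C_norm N f = 0"
  shows "f = (\<lambda>z. 0)"
proof (rule smooth_circle_eqI)
  show "f (cis \<theta>) = 0" for \<theta>
    using norm_angular_deriv_le_C_norm[OF assms(1), of 0 N \<theta>] assms(2) by (simp add: angular_deriv_0)
qed (use smooth_circle_outside[OF assms(1)] in auto)

text \<open>The C^N balls are declared as a subbasis. They give a neighbourhood basis because the
  norms increase with N, and because a ball around another centre contains a smaller one around
  \<open>f\<close> by the triangle inequality.\<close>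

lemma openin_smooth_topology_ball:
  assumes "openin smooth_topology V" "f \<in> V" "f \<in> smooth_circle"
  shows "\<exists>N e. e > 0 \<and> (\<forall>g\<in>smooth_circle. C_norm N (\<lambda>z. g z - f z) < e \<longrightarrow> g \<in> V)"
proof -
  have "generate_topology_on {{g \<in> smooth_circle. C_norm N (\<lambda>z. g z - f z) < e} | f N e. f \<in> smooth_circle \<and> e > 0} V"
    using assms(1) unfolding smooth_topology_def by (rule openin_topology_generated_by)
  then show ?thesis using assms(2)
  proof induction
    case (Int a b)
    then have "f \<in> a" "f \<in> b" by auto
    from Int.IH(1)[OF this(1)] Int.IH(2)[OF this(2)] obtain N e M e' where e: "e > 0" "e' > 0"
      "\<forall>g\<in>smooth_circle. C_norm N (\<lambda>z. g z - f z) < e \<longrightarrow> g \<in> a"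
      "\<forall>g\<in>smooth_circle. C_norm M (\<lambda>z. g z - f z) < e' \<longrightarrow> g \<in> b" by (elim exE conjE)
    have "g \<in> a \<inter> b" if g: "g \<in> smooth_circle" "C_norm (max N M) (\<lambda>z. g z - f z) < min e e'" for g
      using C_norm_mono[OF smooth_circle_diff[OF g(1) assms(3)], of N "max N M"]
        C_norm_mono[OF smooth_circle_diff[OF g(1) assms(3)], of M "max N M"] g bspec[OF e(3) g(1)] bspec[OF e(4) g(1)] by auto
    then show ?case using e(1,2) by (intro exI[of _ "max N M"] exI[of _ "min e e'"]) auto
  next
    case (UN K)
    then obtain k where k: "k \<in> K" "f \<in> k" by blast
    from UN.IH[OF k] obtain N e where e: "e > 0" "\<forall>g\<in>smooth_circle. C_norm N (\<lambda>z. g z - f z) < e \<longrightarrow> g \<in> k"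
      by (elim exE conjE)
    have "\<forall>g\<in>smooth_circle. C_norm N (\<lambda>z. g z - f z) < e \<longrightarrow> g \<in> \<Union> K"
    proof (intro ballI impI)
      fix g assume "g \<in> smooth_circle" "C_norm N (\<lambda>z. g z - f z) < e"
      then have "g \<in> k" using e(2) by simp
      then show "g \<in> \<Union> K" using k(1) by (rule UnionI[rotated])
    qed
    then show ?case using e(1) by (intro exI conjI)
  next
    case (Basis s)
    from Basis.hyps obtain h N e where s: "s = {g \<in> smooth_circle. C_norm N (\<lambda>z. g z - h z) < e}" "h \<in> smooth_circle"
      by (elim CollectE exE conjE)
    have "g \<in> s" if g: "g \<in> smooth_circle" "C_norm N (\<lambda>z. g z - f z) < e - C_norm N (\<lambda>z. f z - h z)" for g
      using C_norm_triangle[OF smooth_circle_diff[OF g(1) assms(3)] smooth_circle_diff[OF assms(3) s(2)], of N] g s(1) by simp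
    moreover have "e - C_norm N (\<lambda>z. f z - h z) > 0" using Basis.prems s(1) by simp
    ultimately show ?case by (intro exI[of _ N] exI[of _ "e - C_norm N (\<lambda>z. f z - h z)"]) simp
  qed simp
qed

lemma topspace_smooth_topology: "topspace smooth_topology = smooth_circle"
proof -
  let ?B = "{{g \<in> smooth_circle. C_norm N (\<lambda>z. g z - f z) < e} | f N e. f \<in> smooth_circle \<and> e > 0}"
  have "topspace smooth_topology = \<Union> ?B" unfolding smooth_topology_def by simp
  moreover have "\<Union> ?B \<subseteq> smooth_circle" by blast
  moreover have "smooth_circle \<subseteq> \<Union> ?B"
  proof
    fix f assume f: "f \<in> smooth_circle"
    have "C_norm 0 (\<lambda>z. f z - f z) < 1" by (simp add: C_norm_zero)
    then have "f \<in> {g \<in> smooth_circle. C_norm 0 (\<lambda>z. g z - f z) < 1}" using f by blast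
    moreover have "{g \<in> smooth_circle. C_norm 0 (\<lambda>z. g z - f z) < 1} \<in> ?B"
      using f zero_less_one by blast
    ultimately show "f \<in> \<Union> ?B" by (rule UnionI[rotated])
  qed
  ultimately show ?thesis by (simp add: subset_antisym)
qed

text \<open>Continuity at the zero tuple. Lists stand for tuples; points of the product topology are
  \<open>undefined\<close> outside \<open>{..<k}\<close>, which explains the padding.\<close>

lemma tuple_topology_bound:
  assumes cont: "continuous_map (tuple_topology k) euclidean G"
  obtains N e where "e > 0"
    "\<forall>fs :: (complex \<Rightarrow> complex) list. length fs = k \<longrightarrow> set fs \<subseteq> smooth_circle \<longrightarrow>
       (\<forall>f\<in>set fs. C_norm N f < e) \<longrightarrow>
       norm (G (\<lambda>i. if i < k then fs ! i else undefined) :: complex) < norm (G (\<lambda>i. if i < k then (\<lambda>z. 0) else undefined)) + 1"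
proof -
  define f0 :: "nat \<Rightarrow> complex \<Rightarrow> complex" where "f0 = (\<lambda>i. if i < k then (\<lambda>z. 0) else undefined)"
  have ts: "topspace (tuple_topology k) = Pi\<^sub>E {..<k} (\<lambda>_. smooth_circle)"
    by (simp add: tuple_topology_def topspace_product_topology topspace_smooth_topology)
  have f0: "f0 \<in> topspace (tuple_topology k)"
    unfolding ts f0_def by (auto simp: smooth_circle_zero PiE_def extensional_def)
  let ?V = "{f \<in> topspace (tuple_topology k). G f \<in> ball 0 (norm (G f0) + 1)}"
  have "openin (tuple_topology k) ?V"
    by (rule openin_continuous_map_preimage[OF cont]) simp
  moreover have "f0 \<in> ?V" using f0 by simp
  ultimately obtain W where W: "\<And>i. i < k \<Longrightarrow> openin smooth_topology (W i)" "f0 \<in> Pi\<^sub>E {..<k} W" "Pi\<^sub>E {..<k} W \<subseteq> ?V"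
    unfolding tuple_topology_def openin_product_topology_alt by (metis (no_types, lifting) lessThan_iff)
  have "\<exists>N e. e > 0 \<and> (\<forall>g\<in>smooth_circle. C_norm N (\<lambda>z. g z - 0) < e \<longrightarrow> g \<in> W i)" if "i < k" for i
  proof -
    have "(\<lambda>z. 0) \<in> W i" using W(2) that by (auto simp: f0_def PiE_def Pi_def)
    from openin_smooth_topology_ball[OF W(1)[OF that] this smooth_circle_zero] show ?thesis .
  qed
  then have "\<forall>i. \<exists>N. \<exists>e. i < k \<longrightarrow> e > 0 \<and> (\<forall>g\<in>smooth_circle. C_norm N g < e \<longrightarrow> g \<in> W i)"
    unfolding diff_zero by blast
  from choice[OF this] obtain N where "\<forall>i. \<exists>e. i < k \<longrightarrow> e > 0 \<and> (\<forall>g\<in>smooth_circle. C_norm (N i) g < e \<longrightarrow> g \<in> W i)"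
    by (elim exE)
  from choice[OF this] obtain e where ex: "\<forall>i. i < k \<longrightarrow> e i > 0 \<and> (\<forall>g\<in>smooth_circle. C_norm (N i) g < e i \<longrightarrow> g \<in> W i)"
    by (elim exE)
  have Ne: "e i > 0" if "i < k" for i using ex that by simp
  have Nw: "g \<in> W i" if "i < k" "g \<in> smooth_circle" "C_norm (N i) g < e i" for i g using ex that by simp
  \<comment> \<open>The inserted 0, like the 1 below, keeps the set nonempty for k = 0.\<close>
  define N' where "N' = Max (insert 0 (N ` {..<k}))"
  define e' where "e' = Min (insert 1 (e ` {..<k}))"
  have N': "N i \<le> N'" if "i < k" for i unfolding N'_def by (rule Max_ge) (use that in auto)
  have e': "e' \<le> e i" if "i < k" for i unfolding e'_def by (rule Min_le) (use that in auto)
  show ?thesis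
  proof (rule that[of e' N'])
    show "e' > 0" unfolding e'_def using Ne by (subst Min_gr_iff) auto
  next
    show "\<forall>fs. length fs = k \<longrightarrow> set fs \<subseteq> smooth_circle \<longrightarrow> (\<forall>f\<in>set fs. C_norm N' f < e') \<longrightarrow>
       norm (G (\<lambda>i. if i < k then fs ! i else undefined)) < norm (G (\<lambda>i. if i < k then (\<lambda>z. 0) else undefined)) + 1"
    proof (intro allI impI)
    fix fs :: "(complex \<Rightarrow> complex) list"
    assume fs: "length fs = k" "set fs \<subseteq> smooth_circle" "\<forall>f\<in>set fs. C_norm N' f < e'"
    have "fs ! i \<in> W i" if i: "i < k" for i
    proof (rule Nw[OF i])
      have m: "fs ! i \<in> set fs" using i fs(1) by simp
      then show "fs ! i \<in> smooth_circle" using fs(2) by blast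
      then show "C_norm (N i) (fs ! i) < e i"
        using C_norm_mono[OF _ N'[OF i], of "fs ! i"] bspec[OF fs(3) m] e'[OF i] by linarith
    qed
    then have "(\<lambda>i. if i < k then fs ! i else undefined) \<in> Pi\<^sub>E {..<k} W" by (auto simp: PiE_def extensional_def)
    with W(3) have "(\<lambda>i. if i < k then fs ! i else undefined) \<in> ?V" by blast
    then show "norm (G (\<lambda>i. if i < k then fs ! i else undefined)) < norm (G (\<lambda>i. if i < k then (\<lambda>z. 0) else undefined)) + 1"
      by (simp add: f0_def)
    qed
  qed
qed

text \<open>A list form of \<open>field_product\<close>, which can be split, concatenated and used
  in inductions over the factors.\<close>

primrec fprod :: "('d qfield \<times> (complex \<Rightarrow> complex)) list \<Rightarrow> 'd \<Rightarrow> 'd" where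
  "fprod [] \<Phi> = \<Phi>"
| "fprod (p # ps) \<Phi> = fst p (snd p) (fprod ps \<Phi>)"

lemma fprod_append: "fprod (ps @ qs) \<Phi> = fprod ps (fprod qs \<Phi>)"
  by (induction ps) auto

lemma field_product_Cons:
  "field_product (\<phi> # \<phi>s) f \<Phi> = \<phi> (f 0) (field_product \<phi>s (\<lambda>i. f (Suc i)) \<Phi>)"
proof -
  have "[0..<length (\<phi> # \<phi>s)] = 0 # map Suc [0..<length \<phi>s]"
    by (simp only: list.size add_Suc_right add_0_right upt_conv_Cons[OF zero_less_Suc] map_Suc_upt)
  then show ?thesis unfolding field_product_def by (simp add: foldr_map o_def)
qed

lemma field_product_fprod:
  "length fs = length \<phi>s \<Longrightarrow>
    field_product \<phi>s (\<lambda>i. if i < length \<phi>s then fs ! i else undefined) \<Phi> = fprod (zip \<phi>s fs) \<Phi>"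
proof (induction \<phi>s arbitrary: fs)
  case Nil then show ?case by (simp add: field_product_def)
next
  case (Cons \<phi> \<phi>s)
  then obtain f fs' where fs: "fs = f # fs'" "length fs' = length \<phi>s" by (cases fs) auto
  show ?case unfolding field_product_Cons fs(1) using Cons.IH[OF fs(2)] by (simp cong: if_cong)
qed

section \<open>Products of fields, covariance and locality\<close>

context wightman_cft
begin

definition admissible :: "('d qfield \<times> (complex \<Rightarrow> complex)) list \<Rightarrow> bool" where
  "admissible ps \<longleftrightarrow> (\<forall>p\<in>set ps. fst p \<in> \<F> \<and> snd p \<in> smooth_circle)"

lemma admissible_simps [simp]:
  "admissible []"
  "admissible (p # ps) \<longleftrightarrow> fst p \<in> \<F> \<and> snd p \<in> smooth_circle \<and> admissible ps"
  "admissible (ps @ qs) \<longleftrightarrow> admissible ps \<and> admissible qs"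
  by (auto simp: admissible_def)

lemma field_linear:
  assumes "\<phi> \<in> \<F>" "f \<in> smooth_circle"
  shows "\<phi> f (x + y) = \<phi> f x + \<phi> f y" "\<phi> f (smul c x) = smul c (\<phi> f x)" "\<phi> f 0 = 0"
proof -
  have l: "Vector_Spaces.linear smul smul (\<phi> f)"
    using fields[OF assms(1)] assms(2) by (auto simp: operator_valued_distribution_def)
  show "\<phi> f (x + y) = \<phi> f x + \<phi> f y" and sc: "\<phi> f (smul c x) = smul c (\<phi> f x)" for c x
    using Vector_Spaces.linear_iff[THEN iffD1, OF l] by auto
  show "\<phi> f 0 = 0" using sc[of 0 0] by simp
qed

lemma field_smear:
  assumes "\<phi> \<in> \<F>" "f \<in> smooth_circle"
  shows "g \<in> smooth_circle \<Longrightarrow> \<phi> (\<lambda>z. f z + g z) \<Phi> = \<phi> f \<Phi> + \<phi> g \<Phi>"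
    and "\<phi> (\<lambda>z. c * f z) \<Phi> = smul c (\<phi> f \<Phi>)"
  using fields[OF assms(1)] assms(2) unfolding operator_valued_distribution_def by blast+

lemma fprod_linear:
  assumes "admissible ps"
  shows "fprod ps (x + y) = fprod ps x + fprod ps y" "fprod ps (smul c x) = smul c (fprod ps x)" "fprod ps 0 = 0"
  using assms by (induction ps) (auto simp: field_linear)

text \<open>The scalar depends on the test function and not on the position. That suffices both for
  normalising each factor by its norm and for showing that a zero factor makes the product
  vanish.\<close>

lemma fprod_scale:
  assumes "admissible ps"
  shows "fprod (map (\<lambda>p. (fst p, \<lambda>z. c (snd p) * snd p z)) ps) \<Phi> = smul (\<Prod>p\<leftarrow>ps. c (snd p)) (fprod ps \<Phi>)"
  using assms
  by (induction ps) (auto simp: field_smear field_linear)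

lemma U_linear:
  assumes "\<gamma> \<in> Mob"
  shows "U \<gamma> (x + y) = U \<gamma> x + U \<gamma> y" "U \<gamma> (smul c x) = smul c (U \<gamma> x)" "U \<gamma> 0 = 0"
proof -
  have l: "Vector_Spaces.linear smul smul (U \<gamma>)" using U_End[OF assms] by (simp add: End_def)
  show "U \<gamma> (x + y) = U \<gamma> x + U \<gamma> y" and sc: "U \<gamma> (smul c x) = smul c (U \<gamma> x)" for c x
    using Vector_Spaces.linear_iff[THEN iffD1, OF l] by auto
  show "U \<gamma> 0 = 0" using sc[of 0 0] by simp
qed

lemma U_inverse:
  assumes "\<gamma> \<in> Mob" "\<gamma>' \<in> Mob" "\<gamma> \<circ> \<gamma>' = id" "\<gamma>' \<circ> \<gamma> = id"
  shows "U \<gamma> (U \<gamma>' \<Phi>) = \<Phi>" "U \<gamma>' (U \<gamma> \<Phi>) = \<Phi>" "inv (U \<gamma>) = U \<gamma>'"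
proof -
  show 1: "U \<gamma> (U \<gamma>' \<Phi>) = \<Phi>" for \<Phi> using U_comp[OF assms(1,2)] U_id assms(3) by (metis comp_apply id_apply)
  show 2: "U \<gamma>' (U \<gamma> \<Phi>) = \<Phi>" for \<Phi> using U_comp[OF assms(2,1)] U_id assms(4) by (metis comp_apply id_apply)
  show "inv (U \<gamma>) = U \<gamma>'" by (rule inv_equality) (auto simp: 1 2)
qed

lemma rot_comp: "rot \<theta> \<circ> rot (- \<theta>) = id"
  by (auto simp: rot_eq fun_eq_iff norm_mult cis_mult simp flip: mult.assoc)

lemmas U_boost_inverse = U_inverse[OF boost_Mob boost_Mob boost_comp_inverse boost_comp_inverse[of "- t" for t, simplified]]

lemma U_rot_inverse: "U (rot \<theta>) (U (rot (- \<theta>)) \<Phi>) = \<Phi>" "U (rot (- \<theta>)) (U (rot \<theta>) \<Phi>) = \<Phi>" "inv (U (rot \<theta>)) = U (rot (- \<theta>))"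
  using U_inverse[OF rot_Mob rot_Mob rot_comp[of \<theta>]] rot_comp[of "- \<theta>"] by simp_all

lemma U_boost_field:
  assumes "\<phi> \<in> \<F>" "f \<in> smooth_circle"
  shows "U (boost t) (\<phi> f \<Phi>) = \<phi> (beta (d \<phi>) (boost t) f) (U (boost t) \<Phi>)"
  using fun_cong[OF covariance[OF assms(1) boost_Mob assms(2)], of t "U (boost t) \<Phi>"]
  by (simp add: U_boost_inverse)

lemma U_rot_field:
  assumes "\<phi> \<in> \<F>" "f \<in> smooth_circle"
  shows "U (rot \<theta>) (\<phi> f \<Phi>) = \<phi> (beta (d \<phi>) (rot \<theta>) f) (U (rot \<theta>) \<Phi>)"
  using fun_cong[OF covariance[OF assms(1) rot_Mob assms(2)], of \<theta> "U (rot \<theta>) \<Phi>"]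
  by (simp add: U_rot_inverse)

text \<open>Rotation by \<theta> multiplies the vector by exp (- i n \<theta>), a negative weight,
  which the spectrum condition excludes.\<close>

lemma positive_mode_vacuum:
  assumes "\<phi> \<in> \<F>" "n > 0"
  shows "\<phi> (mode n) \<Omega> = 0"
proof (rule spectrum)
  show "- n < 0" using assms(2) by simp
  fix \<theta>
  have "beta (d \<phi>) (rot \<theta>) (mode n) = (\<lambda>z. cis (of_int (- n) * \<theta>) * mode n z)"
  proof
    fix z
    have o: "\<forall>z. z \<notin> sphere 0 1 \<longrightarrow> mode n z = 0" by (simp add: mode_def)
    have "cis (- \<theta>) powi n = cis (of_int (- n) * \<theta>)" by (simp add: cis_power_int)
    then show "beta (d \<phi>) (rot \<theta>) (mode n) z = cis (of_int (- n) * \<theta>) * mode n z"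
      unfolding beta_rot[OF o] by (simp add: mode_def norm_mult power_int_mult_distrib)
  qed
  then show "U (rot \<theta>) (\<phi> (mode n) \<Omega>) = smul (cis (of_int (- n) * \<theta>)) (\<phi> (mode n) \<Omega>)"
    unfolding U_rot_field[OF assms(1) smooth_circle_mode] vacuum_invariant[OF rot_Mob]
    by (simp only: field_smear(2)[OF assms(1) smooth_circle_mode])
qed

lemma field_locality:
  assumes "\<phi> \<in> \<F>" "f \<in> smooth_circle" "admissible ps"
    and "\<And>p. p \<in> set ps \<Longrightarrow> circle_support f \<inter> circle_support (snd p) = {}"
  shows "\<phi> f (fprod ps \<Phi>) = fprod ps (\<phi> f \<Phi>)"
  using assms(3,4)
proof (induction ps)
  case (Cons p ps)
  have "\<phi> f (fst p (snd p) (fprod ps \<Phi>)) = fst p (snd p) (\<phi> f (fprod ps \<Phi>))"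
    using locality[OF assms(1) _ assms(2), of "fst p" "snd p"] Cons.prems by (auto dest: fun_cong)
  then show ?case using Cons by simp
qed simp

lemma boost_fprod:
  assumes "admissible ps"
  shows "U (boost t) (fprod ps \<Phi>) = fprod (map (\<lambda>p. (fst p, beta (d (fst p)) (boost t) (snd p))) ps) (U (boost t) \<Phi>)"
  using assms by (induction ps) (auto simp: U_boost_field)

end

section \<open>Bounds on correlators and the vacuum modes\<close>

context involutive_wightman_cft
begin

lemma form_lin:
  "form (x + y) \<Psi> = form x \<Psi> + form y \<Psi>" "form (smul c x) \<Psi> = c * form x \<Psi>" "form 0 \<Psi> = 0"
proof -
  show "form (x + y) \<Psi> = form x \<Psi> + form y \<Psi>" and sc: "form (smul c x) \<Psi> = c * form x \<Psi>" for c x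
    using Vector_Spaces.linear_iff[THEN iffD1, OF form_linear[of \<Psi>]] by auto
  show "form 0 \<Psi> = 0" using sc[of 0 0] by simp
qed

lemma form_zero_right: "form \<Phi> 0 = 0"
  using form_hermitian[of 0 \<Phi>] form_lin(3)[of \<Phi>] by (metis complex_cnj_zero form_hermitian)

lemma correlator_continuous:
  assumes "set \<phi>s \<subseteq> \<F>"
  shows "continuous_map (tuple_topology (length \<phi>s)) euclidean (\<lambda>f. form (field_product \<phi>s f \<Phi>) \<Psi>)"
proof -
  have "continuous_map (tuple_topology (length \<phi>s)) (strong_topology smul \<F>) (\<lambda>f. field_product \<phi>s f \<Phi>)"
    using strong_topology_products assms unfolding field_products_continuous_def by blast
  then have "continuous_map (tuple_topology (length \<phi>s)) (prod_topology (strong_topology smul \<F>) (strong_topology smul \<F>))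
      (\<lambda>f. (field_product \<phi>s f \<Phi>, \<Psi>))"
    by (simp add: continuous_map_paired strong_topology_topspace)
  from continuous_map_compose[OF this form_continuous] show ?thesis by (simp add: o_def)
qed

text \<open>Joint continuity gives a bound on a ball around 0; multilinearity makes it homogeneous
  by rescaling each factor to norm e/2, inside the open ball. A factor of norm 0 is the zero
  function, and then the product vanishes.\<close>

theorem correlator_bound:
  assumes "set \<phi>s \<subseteq> \<F>"
  obtains N C where "C \<ge> 0" "\<And>fs. length fs = length \<phi>s \<Longrightarrow> set fs \<subseteq> smooth_circle \<Longrightarrow>
     norm (form (fprod (zip \<phi>s fs) \<Phi>) \<Psi>) \<le> C * (\<Prod>f\<leftarrow>fs. C_norm N f)"
proof -
  let ?k = "length \<phi>s"
  let ?G = "\<lambda>f. form (field_product \<phi>s f \<Phi>) \<Psi>"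
  obtain N e where e: "e > 0" and b: "\<forall>fs. length fs = ?k \<longrightarrow> set fs \<subseteq> smooth_circle \<longrightarrow>
       (\<forall>f\<in>set fs. C_norm N f < e) \<longrightarrow>
       norm (?G (\<lambda>i. if i < ?k then fs ! i else undefined)) < norm (?G (\<lambda>i. if i < ?k then (\<lambda>z. 0) else undefined)) + 1"
    by (rule tuple_topology_bound[OF correlator_continuous[OF assms, of \<Phi> \<Psi>]]) (rule that)
  define B where "B = norm (?G (\<lambda>i. if i < ?k then (\<lambda>z. 0) else undefined)) + 1"
  have B0: "B > 0" unfolding B_def by (simp add: add_nonneg_pos)
  have bB: "norm (form (fprod (zip \<phi>s fs) \<Phi>) \<Psi>) \<le> B"
    if "length fs = ?k" "set fs \<subseteq> smooth_circle" "\<And>f. f \<in> set fs \<Longrightarrow> C_norm N f < e" for fs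
    using b[rule_format, OF that] unfolding field_product_fprod[OF that(1)] B_def by (rule less_imp_le)
  have adm: "admissible (zip \<phi>s fs)" if "set fs \<subseteq> smooth_circle" for fs
    using assms that by (auto simp: admissible_def dest: set_zip_leftD set_zip_rightD)
  have "norm (form (fprod (zip \<phi>s fs) \<Phi>) \<Psi>) \<le> (B * (2 / e) ^ ?k) * (\<Prod>f\<leftarrow>fs. C_norm N f)"
    if fs: "length fs = ?k" "set fs \<subseteq> smooth_circle" for fs
  proof (cases "\<exists>f\<in>set fs. C_norm N f = 0")
    case True
    then obtain f where f: "f \<in> set fs" "C_norm N f = 0" by blast
    then have "f = (\<lambda>z. 0)" using C_norm_eq_0 fs(2) by blast
    then obtain us vs where us: "fs = us @ (\<lambda>z. 0) # vs" using f(1) split_list by metis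
    \<comment> \<open>Scaling by this \<open>c\<close> changes no test function of the list, yet the
      product acquires the scalar 0.\<close>
    define c where "c g = (if g = (\<lambda>z::complex. 0::complex) then 0 else 1 :: complex)" for g
    have "map (\<lambda>p. (fst p, \<lambda>z. c (snd p) * snd p z)) (zip \<phi>s fs) = zip \<phi>s fs"
      by (intro map_idI) (auto simp: c_def fun_eq_iff)
    with fprod_scale[OF adm[OF fs(2)], of c \<Phi>]
    have "fprod (zip \<phi>s fs) \<Phi> = smul (\<Prod>p\<leftarrow>zip \<phi>s fs. c (snd p)) (fprod (zip \<phi>s fs) \<Phi>)" by simp
    moreover have "(\<Prod>p\<leftarrow>zip \<phi>s fs. c (snd p)) = (\<Prod>f\<leftarrow>fs. c f)"
      using fs(1) by (metis (no_types, lifting) list.map_comp map_snd_zip o_def map_eq_conv)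
    moreover have "(\<Prod>f\<leftarrow>fs. c f) = 0" by (simp add: us c_def)
    ultimately have "fprod (zip \<phi>s fs) \<Phi> = smul 0 (fprod (zip \<phi>s fs) \<Phi>)" by simp
    then have "fprod (zip \<phi>s fs) \<Phi> = 0" by simp
    moreover have "(\<Prod>f\<leftarrow>fs. C_norm N f) = 0" using f by (auto simp: prod_list_zero_iff intro: image_eqI[of _ _ f])
    ultimately show ?thesis by (simp add: form_lin)
  next
    case False
    then have pos: "C_norm N f > 0" if "f \<in> set fs" for f
      using C_norm_nonneg[of f N] fs(2) that by force
    define c where "c f = complex_of_real (e / (2 * C_norm N f))" for f
    define fs' where "fs' = map (\<lambda>f z. c f * f z) fs"
    have "norm (form (fprod (zip \<phi>s fs') \<Phi>) \<Psi>) \<le> B"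
    proof (rule bB)
      fix g assume "g \<in> set fs'"
      then obtain f where f: "f \<in> set fs" "g = (\<lambda>z. c f * f z)" by (auto simp: fs'_def)
      have "C_norm N g = cmod (c f) * C_norm N f" unfolding f(2) using C_norm_scale fs(2) f(1) by blast
      also have "cmod (c f) = e / (2 * C_norm N f)" using pos[OF f(1)] e unfolding c_def norm_of_real by simp
      finally show "C_norm N g < e" using pos[OF f(1)] e by simp
    qed (use fs in \<open>auto simp: fs'_def intro: smooth_circle_scale\<close>)
    moreover have "zip \<phi>s fs' = map (\<lambda>p. (fst p, \<lambda>z. c (snd p) * snd p z)) (zip \<phi>s fs)"
      unfolding fs'_def zip_map2 by (intro map_cong) auto
    then have "fprod (zip \<phi>s fs') \<Phi> = smul (\<Prod>p\<leftarrow>zip \<phi>s fs. c (snd p)) (fprod (zip \<phi>s fs) \<Phi>)"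
      using fprod_scale[OF adm[OF fs(2)], of c \<Phi>] by simp
    moreover have "(\<Prod>p\<leftarrow>zip \<phi>s fs. c (snd p)) = (\<Prod>f\<leftarrow>fs. c f)"
      using fs(1) by (metis (no_types, lifting) list.map_comp map_snd_zip o_def map_eq_conv)
    ultimately have 1: "norm (\<Prod>f\<leftarrow>fs. c f) * norm (form (fprod (zip \<phi>s fs) \<Phi>) \<Psi>) \<le> B"
      by (simp add: form_lin norm_mult)
    have "norm (\<Prod>f\<leftarrow>gs. c f) * ((2 / e) ^ length gs * (\<Prod>f\<leftarrow>gs. C_norm N f)) = 1" if "set gs \<subseteq> set fs" for gs
      using that
    proof (induction gs)
      case (Cons g gs)
      have g: "C_norm N g > 0" using Cons.prems pos by simp
      have X: "norm (c g) * (2 / e) * C_norm N g = 1" using g e unfolding c_def norm_of_real by simp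
      have eq: "norm (\<Prod>f\<leftarrow>g # gs. c f) * ((2 / e) ^ length (g # gs) * (\<Prod>f\<leftarrow>g # gs. C_norm N f))
         = (norm (c g) * (2 / e) * C_norm N g) * (norm (\<Prod>f\<leftarrow>gs. c f) * ((2 / e) ^ length gs * (\<Prod>f\<leftarrow>gs. C_norm N f)))"
        by (simp add: norm_mult mult_ac)
      have Y: "norm (\<Prod>f\<leftarrow>gs. c f) * ((2 / e) ^ length gs * (\<Prod>f\<leftarrow>gs. C_norm N f)) = 1"
        using Cons.IH Cons.prems by simp
      show ?case unfolding eq X Y by simp
    qed simp
    from this[OF order_refl] have 2: "norm (\<Prod>f\<leftarrow>fs. c f) * ((2 / e) ^ ?k * (\<Prod>f\<leftarrow>fs. C_norm N f)) = 1" using fs(1) by simp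
    have nn: "0 \<le> (2 / e) ^ ?k * (\<Prod>f\<leftarrow>fs. C_norm N f)"
      using e pos by (intro mult_nonneg_nonneg prod_list_nonneg) (auto intro: less_imp_le)
    have "norm (form (fprod (zip \<phi>s fs) \<Phi>) \<Psi>) = (norm (\<Prod>f\<leftarrow>fs. c f) * ((2 / e) ^ ?k * (\<Prod>f\<leftarrow>fs. C_norm N f))) * norm (form (fprod (zip \<phi>s fs) \<Phi>) \<Psi>)"
      unfolding 2 by simp
    also have "\<dots> = (norm (\<Prod>f\<leftarrow>fs. c f) * norm (form (fprod (zip \<phi>s fs) \<Phi>) \<Psi>)) * ((2 / e) ^ ?k * (\<Prod>f\<leftarrow>fs. C_norm N f))"
      by (simp only: mult.assoc mult.commute mult.left_commute)
    also have "\<dots> \<le> B * ((2 / e) ^ ?k * (\<Prod>f\<leftarrow>fs. C_norm N f))" by (rule mult_right_mono[OF 1 nn])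
    finally show ?thesis by (simp add: mult.assoc)
  qed
  then show ?thesis using B0 e by (intro that[of "B * (2 / e) ^ ?k" N]) auto
qed

text \<open>All factors but one are frozen; their norms go into the constant.\<close>

lemma correlator_distribution:
  assumes A: "admissible ps" and B: "admissible qs" and \<phi>: "\<phi> \<in> \<F>"
  shows "circle_distribution (\<lambda>f. form (fprod ps (\<phi> f (fprod qs \<Phi>))) \<Psi>)"
proof -
  let ?\<phi>s = "map fst ps @ \<phi> # map fst qs"
  have F: "set ?\<phi>s \<subseteq> \<F>" using A B \<phi> by (auto simp: admissible_def)
  obtain N C where C: "C \<ge> 0" "\<And>fs. length fs = length ?\<phi>s \<Longrightarrow> set fs \<subseteq> smooth_circle \<Longrightarrow>
     norm (form (fprod (zip ?\<phi>s fs) \<Phi>) \<Psi>) \<le> C * (\<Prod>f\<leftarrow>fs. C_norm N f)"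
    by (rule correlator_bound[OF F]) (rule that)
  have "norm (form (fprod ps (\<phi> f (fprod qs \<Phi>))) \<Psi>)
      \<le> (C * (\<Prod>f\<leftarrow>map snd ps @ map snd qs. C_norm N f)) * C_norm N f" if f: "f \<in> smooth_circle" for f
  proof -
    have "norm (form (fprod (zip ?\<phi>s (map snd ps @ f # map snd qs)) \<Phi>) \<Psi>) \<le> C * (\<Prod>f\<leftarrow>map snd ps @ f # map snd qs. C_norm N f)"
      using A B f by (intro C) (auto simp: admissible_def)
    moreover have "zip ?\<phi>s (map snd ps @ f # map snd qs) = ps @ (\<phi>, f) # qs" by (simp add: zip_map_fst_snd)
    ultimately show ?thesis by (simp add: fprod_append mult_ac)
  qed
  then have "\<exists>N C. \<forall>f\<in>smooth_circle. norm (form (fprod ps (\<phi> f (fprod qs \<Phi>))) \<Psi>) \<le> C * C_norm N f" by blast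
  then show ?thesis
    unfolding circle_distribution_def
    by (auto simp: field_smear[OF \<phi>] fprod_linear[OF A] form_lin)
qed

text \<open>The adjoint of the field smeared with z^(-n) is, up to sign, a field of \<F> smeared
  with z^n, since conjugation inverts z on the circle; that field annihilates the vacuum in the
  second argument of the form.\<close>

lemma positive_mode_covacuum:
  assumes \<phi>: "\<phi> \<in> \<F>" and n: "n > 0"
  shows "form (\<phi> (mode (- n)) \<Phi>) \<Omega> = 0"
proof -
  let ?\<chi> = "\<lambda>f \<Phi>. smul ((-1) ^ d \<phi>) (dagger smul d pct \<phi> f \<Phi>)"
  have "?\<chi> (mode n) \<Omega> = 0" by (rule positive_mode_vacuum[OF dagger_closed[OF \<phi>] n])
  then have "dagger smul d pct \<phi> (mode n) \<Omega> = 0" by (simp add: scale_eq_0_iff)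
  moreover have "(\<lambda>z. cnj (mode (- n) z)) = mode n"
  proof
    fix z show "cnj (mode (- n) z) = mode n z"
      by (cases "z \<in> sphere 0 1")
         (auto simp: mode_def power_int_minus power_int_inverse[symmetric] inverse_sphere complex_cnj_power_int)
  qed
  ultimately show ?thesis
    using form_invariant[OF \<phi> smooth_circle_mode, of "- n" \<Phi> \<Omega>] by (simp add: form_zero_right)
qed

text \<open>By nondegeneracy the common kernel of the functionals consists of the f with
  \<phi>(f)\<Omega> = 0. It is invariant under boosts and rotations because \<Omega> is.\<close>

lemma vacuum_modes:
  assumes \<phi>: "\<phi> \<in> \<F>" and n: "n > - int (d \<phi>)"
  shows "form (\<phi> (mode n) \<Omega>) \<Phi> = 0"
proof -
  let ?Ls = "range (\<lambda>\<Phi> f. form (\<phi> f \<Omega>) \<Phi>)"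
  have zero: "\<phi> f \<Omega> = 0" if "\<And>L. L \<in> ?Ls \<Longrightarrow> L f = 0" for f
  proof (rule form_nondegenerate)
    show "form (\<phi> f \<Omega>) \<Psi> = 0" for \<Psi> using that[of "\<lambda>f. form (\<phi> f \<Omega>) \<Psi>"] by blast
  qed
  have "(\<lambda>f. form (\<phi> f \<Omega>) \<Phi>) (mode n) = 0"
  proof (rule vacuum_modes_vanish[where Ls = ?Ls and d = "d \<phi>"])
    fix L assume "L \<in> ?Ls"
    then obtain \<Psi> where L: "L = (\<lambda>f. form (\<phi> f \<Omega>) \<Psi>)" by blast
    show "circle_distribution L" using correlator_distribution[of "[]" "[]" \<phi> \<Omega> \<Psi>] \<phi> by (simp add: L)
    show "L (mode n) = 0" if "n > 0" for n by (simp add: L positive_mode_vacuum[OF \<phi> that] form_lin)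
    fix f t assume f: "f \<in> smooth_circle" "\<And>L. L \<in> ?Ls \<Longrightarrow> L f = 0"
    show "L (beta (d \<phi>) (boost t) f) = 0"
    proof -
      have "\<phi> f \<Omega> = 0" by (rule zero) (rule f(2))
      then have "\<phi> (beta (d \<phi>) (boost t) f) \<Omega> = 0"
        using U_boost_field[OF \<phi> f(1), of t \<Omega>] by (simp add: vacuum_invariant[OF boost_Mob] U_linear[OF boost_Mob])
      then show ?thesis by (simp add: L form_lin)
    qed
  next
    fix L f \<theta> assume "L \<in> ?Ls"
    then obtain \<Psi> where L: "L = (\<lambda>f. form (\<phi> f \<Omega>) \<Psi>)" by blast
    assume f: "f \<in> smooth_circle" "\<And>L. L \<in> ?Ls \<Longrightarrow> L f = 0"
    have "\<phi> f \<Omega> = 0" by (rule zero) (rule f(2))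
    then have "\<phi> (beta (d \<phi>) (rot \<theta>) f) \<Omega> = 0"
      using U_rot_field[OF \<phi> f(1), of \<theta> \<Omega>] by (simp add: vacuum_invariant[OF rot_Mob] U_linear[OF rot_Mob])
    then show "L (beta (d \<phi>) (rot \<theta>) f) = 0" by (simp add: L form_lin)
  qed (use n in auto)
  then show ?thesis .
qed

text \<open>Mirror image of \<open>vacuum_modes\<close>, with reflected modes and \<Omega> in the
  second argument. The common kernel is invariant because \<open>U\<close> preserves the form and
  \<Phi> ranges over the whole domain; reflection turns the rotation by \<theta> into the one by
  -\<theta>.\<close>

lemma covacuum_modes:
  assumes \<phi>: "\<phi> \<in> \<F>" and n: "n > - int (d \<phi>)"
  shows "form (\<phi> (reflect (mode n)) \<Phi>) \<Omega> = 0"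
proof -
  let ?Ls = "range (\<lambda>\<Phi> f. form (\<phi> (reflect f) \<Phi>) \<Omega>)"
  have zero: "form (\<phi> (reflect f) \<Psi>) \<Omega> = 0" if "\<And>L. L \<in> ?Ls \<Longrightarrow> L f = 0" for f \<Psi>
    using that[of "\<lambda>f. form (\<phi> (reflect f) \<Psi>) \<Omega>"] by blast
  have "(\<lambda>f. form (\<phi> (reflect f) \<Phi>) \<Omega>) (mode n) = 0"
  proof (rule vacuum_modes_vanish[where Ls = ?Ls and d = "d \<phi>"])
    fix L assume "L \<in> ?Ls"
    then obtain \<Psi> where L: "L = (\<lambda>f. form (\<phi> (reflect f) \<Psi>) \<Omega>)" by blast
    show "circle_distribution L"
      using circle_distribution_reflect[OF correlator_distribution[of "[]" "[]" \<phi> \<Psi> \<Omega>]] \<phi> by (simp add: L)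
    show "L (mode n) = 0" if "n > 0" for n by (simp add: L reflect_mode positive_mode_covacuum[OF \<phi> that])
    fix f assume f: "f \<in> smooth_circle" "\<And>L. L \<in> ?Ls \<Longrightarrow> L f = 0"
    note o = smooth_circle_off_circle[OF f(1)] and rs = smooth_circle_reflect[OF f(1)]
    show "L (beta (d \<phi>) (boost t) f) = 0" for t
    proof -
      have "form (\<phi> (reflect (beta (d \<phi>) (boost t) f)) \<Psi>) \<Omega>
          = form (U (boost t) (\<phi> (reflect f) (U (boost (- t)) \<Psi>))) (U (boost t) \<Omega>)"
        unfolding U_boost_field[OF \<phi> rs] U_boost_inverse beta_boost_reflect[OF o] vacuum_invariant[OF boost_Mob] ..
      also have "\<dots> = 0" unfolding U_unitary[OF boost_Mob] by (rule zero) (rule f(2))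
      finally show ?thesis by (simp add: L)
    qed
    show "L (beta (d \<phi>) (rot \<theta>) f) = 0" for \<theta>
    proof -
      have "form (\<phi> (reflect (beta (d \<phi>) (rot \<theta>) f)) \<Psi>) \<Omega>
          = form (U (rot (- \<theta>)) (\<phi> (reflect f) (U (rot \<theta>) \<Psi>))) (U (rot (- \<theta>)) \<Omega>)"
        unfolding U_rot_field[OF \<phi> rs] U_rot_inverse beta_rot_reflect[OF o] vacuum_invariant[OF rot_Mob] minus_minus ..
      also have "\<dots> = 0" unfolding U_unitary[OF rot_Mob] by (rule zero) (rule f(2))
      finally show ?thesis by (simp add: L)
    qed
  qed (use n in auto)
  then show ?thesis .
qed

text \<open>A closed condition: the support of \<open>arc_fun n g\<close> may reach the end points 1
  and -1 and then does not lie in I_+.\<close>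

definition upper :: "(complex \<Rightarrow> complex) \<Rightarrow> bool" where
  "upper f \<longleftrightarrow> (\<forall>z. f z \<noteq> 0 \<longrightarrow> Im z \<ge> 0)"

lemma circle_support_subset_closed:
  assumes "closed S" "\<And>z. z \<in> sphere 0 1 \<Longrightarrow> f z \<noteq> 0 \<Longrightarrow> z \<in> S"
  shows "circle_support f \<subseteq> S"
  unfolding circle_support_def by (rule closure_minimal) (use assms in auto)

lemma upper_arc_fun: "upper (arc_fun n g)"
  by (auto simp: upper_def arc_fun_eq split: if_splits)

text \<open>The support of a reflected arc function may touch the supports in \<open>ps\<close> at 1
  and -1, where locality says nothing. After a cutoff it lies strictly below the real axis, and both
  sides are continuous in the test function.\<close>

lemma reflected_arc_commutes:
  assumes \<phi>: "\<phi> \<in> \<F>" and A: "admissible ps" "\<And>p. p \<in> set ps \<Longrightarrow> upper (snd p)" and g: "rapid g"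
  shows "form (fprod ps (\<phi> (reflect (arc_fun n g)) \<Omega>)) \<Omega> = form (\<phi> (reflect (arc_fun n g)) (fprod ps \<Omega>)) \<Omega>"
proof -
  obtain G where G: "\<And>m. rapid (G m)" "\<And>m u. \<bar>u\<bar> > pi * (real m + 1) \<Longrightarrow> G m u = 0"
    "\<And>N. (\<lambda>m. C_norm N (\<lambda>z. arc_fun n (G m) z - arc_fun n g z)) \<longlonglongrightarrow> 0"
    using arc_fun_cutoff[OF g, of n] by blast
  let ?L = "\<lambda>f. form (fprod ps (\<phi> (reflect f) \<Omega>)) \<Omega>" and ?R = "\<lambda>f. form (\<phi> (reflect f) (fprod ps \<Omega>)) \<Omega>"
  have "circle_distribution ?L" "circle_distribution ?R"
    using circle_distribution_reflect[OF correlator_distribution[OF A(1) _ \<phi>, of "[]"]]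
      circle_distribution_reflect[OF correlator_distribution[OF _ A(1) \<phi>, of "[]"]] by simp_all
  note lim = circle_distribution_tendsto[OF this(1) smooth_circle_arc_fun[OF G(1)] smooth_circle_arc_fun[OF g] G(3)]
    circle_distribution_tendsto[OF this(2) smooth_circle_arc_fun[OF G(1)] smooth_circle_arc_fun[OF g] G(3)]
  have "?L (arc_fun n (G m)) = ?R (arc_fun n (G m))" for m
  proof -
    let ?f = "reflect (arc_fun n (G m))"
    have s: "?f \<in> smooth_circle" by (intro smooth_circle_reflect smooth_circle_arc_fun G)
    \<comment> \<open>The cutoff forces |u| <= \<pi> (m + 1), and Im w >= exp (- |u|) at the
      reflected point w.\<close>
    have "circle_support ?f \<subseteq> {z. Im z \<le> - exp (- (pi * (real m + 1)))}"
    proof (rule circle_support_subset_closed)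
      show "closed {z. Im z \<le> - exp (- (pi * (real m + 1)))}" by (intro closed_Collect_le continuous_intros)
      fix z :: complex assume z: "z \<in> sphere 0 1" "?f z \<noteq> 0"
      define w where "w = inverse z"
      have w: "w \<in> sphere 0 1" "Im w > 0" "G m (arc_coord w) \<noteq> 0"
        using z by (auto simp: reflect_def arc_fun_eq w_def split: if_splits)
      then have "\<bar>arc_coord w\<bar> \<le> pi * (real m + 1)" using G(2) by force
      then have "exp (- (pi * (real m + 1))) \<le> exp (- \<bar>arc_coord w\<bar>)" by simp
      also have "\<dots> \<le> Im w" by (rule exp_arc_coord_le[OF w(1,2)])
      also have "Im w = - Im z" by (simp only: w_def inverse_sphere[OF z(1)] cnj.sel)
      finally show "z \<in> {z. Im z \<le> - exp (- (pi * (real m + 1)))}" by simp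
    qed
    moreover have "circle_support (snd p) \<subseteq> {z. Im z \<ge> 0}" if "p \<in> set ps" for p
      by (rule circle_support_subset_closed)
         (use A(2)[OF that] in \<open>auto simp: upper_def intro!: closed_Collect_le continuous_intros\<close>)
    moreover have "{z. Im z \<le> - exp (- (pi * (real m + 1)))} \<inter> {z. Im z \<ge> 0} = {}"
      by (auto simp: not_le) (smt (verit) exp_gt_zero)
    ultimately have "circle_support ?f \<inter> circle_support (snd p) = {}" if "p \<in> set ps" for p
      using that by (meson disjoint_iff subsetD)
    from field_locality[OF \<phi> s A(1) this, of \<Omega>] show ?thesis by simp
  qed
  then show ?thesis using LIMSEQ_unique[OF lim(1)] lim(2) by simp
qed

text \<open>The one-field KMS relation: \<open>\<phi>\<close> is carried through the disk from \<open>I\<^sub>+\<close> to \<open>I\<^sub>-\<close>, moved to the left by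
  locality, and carried back to \<open>I\<^sub>+\<close> through the exterior of the disk.\<close>

lemma one_field_KMS:
  assumes \<phi>: "\<phi> \<in> \<F>" and A: "admissible ps" "\<And>p. p \<in> set ps \<Longrightarrow> upper (snd p)" and h: "rapid_entire h"
  shows "form (fprod ps (\<phi> (arc_fun (d \<phi>) (\<lambda>u. h (of_real u))) \<Omega>)) \<Omega>
    = form (\<phi> (arc_fun (d \<phi>) (\<lambda>u. h (of_real u + 2 * of_real pi * \<i>))) (fprod ps \<Omega>)) \<Omega>"
proof -
  let ?L = "\<lambda>f. form (fprod ps (\<phi> f \<Omega>)) \<Omega>" and ?R = "\<lambda>f. form (\<phi> f (fprod ps \<Omega>)) \<Omega>"
  have L: "circle_distribution ?L" using correlator_distribution[OF A(1) _ \<phi>, of "[]"] by simp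
  have R: "circle_distribution (\<lambda>f. ?R (reflect f))"
    using circle_distribution_reflect[OF correlator_distribution[OF _ A(1) \<phi>, of "[]"]] by simp
  define h1 where "h1 z = h (z + \<i> * pi)" for z
  have h1: "rapid_entire h1" using rapid_entire_shift[OF h, of "- \<i> * pi"] by (simp add: h1_def[abs_def])
  \<comment> \<open>Nondegeneracy makes the vector itself vanish, so the mode is also killed behind
    the operators \<open>ps\<close>.\<close>
  have "\<phi> (mode n) \<Omega> = 0" if "n > - int (d \<phi>)" for n
    using form_nondegenerate vacuum_modes[OF \<phi> that] by blast
  then have kill: "?L (mode n) = 0" if "n > - int (d \<phi>)" for n
    using that by (simp add: fprod_linear[OF A(1)] form_lin)
  have "?L (arc_fun (d \<phi>) (\<lambda>u. h (of_real u))) = (-1) ^ d \<phi> * ?L (reflect (arc_fun (d \<phi>) (\<lambda>u. h1 (of_real u))))"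
    using half_circle_rotation[OF L kill h] by (simp add: h1_def)
  also have "?L (reflect (arc_fun (d \<phi>) (\<lambda>u. h1 (of_real u)))) = ?R (reflect (arc_fun (d \<phi>) (\<lambda>u. h1 (of_real u))))"
    by (rule reflected_arc_commutes[OF \<phi> A rapid_entire_restrict(1)[OF h1]])
  also have "\<dots> = (-1) ^ d \<phi> * ?R (reflect (reflect (arc_fun (d \<phi>) (\<lambda>u. h1 (of_real u + \<i> * pi)))))"
    by (rule half_circle_rotation[OF R covacuum_modes[OF \<phi>] h1])
  finally have "?L (arc_fun (d \<phi>) (\<lambda>u. h (of_real u))) = ((-1) ^ d \<phi> * (-1) ^ d \<phi>) * ?R (arc_fun (d \<phi>) (\<lambda>u. h1 (of_real u + \<i> * pi)))"
    by (simp only: reflect_reflect mult.assoc)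
  moreover have "(-1) ^ d \<phi> * (-1) ^ d \<phi> = (1::complex)" by (simp flip: power_mult_distrib)
  moreover have "(\<lambda>u. h1 (of_real u + \<i> * pi)) = (\<lambda>u. h (of_real u + 2 * of_real pi * \<i>))"
    by (simp add: h1_def algebra_simps)
  ultimately show ?thesis by simp
qed

definition smear :: "('d qfield \<times> (real \<Rightarrow> complex)) list \<Rightarrow> ('d qfield \<times> (complex \<Rightarrow> complex)) list" where
  "smear = map (\<lambda>p. (fst p, arc_fun (d (fst p)) (snd p)))"

text \<open>The factor next to \<Omega> moves first: it jumps to the far left and joins
  \<open>ps\<close>. Repeating this, the factors arrive in their original order. The induction needs
  arbitrary \<open>ps\<close>, required only to be \<open>upper\<close>, because the moved factors
  need not be supported in I_+.\<close>

lemma KMS_shift: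
  assumes "\<And>q. q \<in> set qs \<Longrightarrow> fst q \<in> \<F> \<and> rapid_entire (snd q)"
    and "admissible ps" "\<And>p. p \<in> set ps \<Longrightarrow> upper (snd p)"
  shows "form (fprod ps (fprod (smear (map (\<lambda>q. (fst q, \<lambda>u. snd q (of_real u))) qs)) \<Omega>)) \<Omega>
     = form (fprod (smear (map (\<lambda>q. (fst q, \<lambda>u. snd q (of_real u + 2 * of_real pi * \<i>))) qs)) (fprod ps \<Omega>)) \<Omega>"
  using assms
proof (induction qs arbitrary: ps rule: rev_induct)
  case Nil then show ?case by (simp add: smear_def)
next
  case (snoc q qs)
  let ?S = "\<lambda>qs. smear (map (\<lambda>q. (fst q, \<lambda>u. snd q (of_real u))) qs)"
  let ?f = "arc_fun (d (fst q)) (\<lambda>u. snd q (of_real u + 2 * of_real pi * \<i>))"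
  have q: "fst q \<in> \<F>" "rapid_entire (snd q)" using snoc.prems(1)[of q] by auto
  have rq: "rapid (\<lambda>u. snd q (of_real u + 2 * of_real pi * \<i>))"
    using rapid_entire_restrict(1)[OF rapid_entire_shift[OF q(2), of "- (2 * of_real pi * \<i>)"]] by simp
  have qs: "fst p \<in> \<F>" "rapid_entire (snd p)" if "p \<in> set qs" for p using snoc.prems(1)[of p] that by auto
  have "admissible (?S qs)"
    using qs by (simp add: admissible_def smear_def smooth_circle_arc_fun rapid_entire_restrict)
  then have adm: "admissible (ps @ ?S qs)" using snoc.prems(2) by simp
  have up: "upper (snd p)" if "p \<in> set (ps @ ?S qs)" for p
    using that snoc.prems(3)[of p] by (auto simp: smear_def upper_arc_fun)
  have "form (fprod ps (fprod (?S (qs @ [q])) \<Omega>)) \<Omega>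
      = form (fprod (ps @ ?S qs) (fst q (arc_fun (d (fst q)) (\<lambda>u. snd q (of_real u))) \<Omega>)) \<Omega>"
    by (simp add: smear_def fprod_append)
  also have "\<dots> = form (fst q ?f (fprod (ps @ ?S qs) \<Omega>)) \<Omega>" by (rule one_field_KMS[OF q(1) adm up q(2)])
  also have "\<dots> = form (fprod ((fst q, ?f) # ps) (fprod (?S qs) \<Omega>)) \<Omega>" by (simp add: fprod_append)
  also have "\<dots> = form (fprod (smear (map (\<lambda>q. (fst q, \<lambda>u. snd q (of_real u + 2 * of_real pi * \<i>))) qs)) (fprod ((fst q, ?f) # ps) \<Omega>)) \<Omega>"
    using snoc.prems q rq by (intro snoc.IH) (auto simp: upper_arc_fun intro: smooth_circle_arc_fun)
  finally show ?case by (simp add: smear_def fprod_append)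
qed

end

section \<open>Multilinear maps along entire curves\<close>

text \<open>Quantitative joint continuity: one C^N norm serves for all slots. Linearity is stated
  with arbitrary lists on both sides of the slot, so that fixing the first slot leaves a map of the
  same kind.\<close>

definition bounded_multilinear :: "nat \<Rightarrow> ((complex \<Rightarrow> complex) list \<Rightarrow> complex) \<Rightarrow> bool" where
  "bounded_multilinear k T \<longleftrightarrow>
     (\<exists>N. \<exists>C\<ge>0. \<forall>fs. length fs = k \<longrightarrow> set fs \<subseteq> smooth_circle \<longrightarrow> norm (T fs) \<le> C * (\<Prod>f\<leftarrow>fs. C_norm N f)) \<and>
     (\<forall>us vs. \<forall>f\<in>smooth_circle. \<forall>g\<in>smooth_circle. \<forall>c.
        Suc (length us + length vs) = k \<longrightarrow> set us \<subseteq> smooth_circle \<longrightarrow> set vs \<subseteq> smooth_circle \<longrightarrow>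
        T (us @ (\<lambda>z. f z + c * g z) # vs) = T (us @ f # vs) + c * T (us @ g # vs))"

lemma bounded_multilinear_bound:
  assumes "bounded_multilinear k T"
  obtains N C where "C \<ge> 0"
    "\<forall>fs. length fs = k \<longrightarrow> set fs \<subseteq> smooth_circle \<longrightarrow> norm (T fs) \<le> C * (\<Prod>f\<leftarrow>fs. C_norm N f)"
  using assms unfolding bounded_multilinear_def by blast

lemma bounded_multilinear_Cons_add:
  assumes "bounded_multilinear (Suc k) T" "f \<in> smooth_circle" "g \<in> smooth_circle" "length vs = k" "set vs \<subseteq> smooth_circle"
  shows "T ((\<lambda>z. f z + c * g z) # vs) = T (f # vs) + c * T (g # vs)"
proof -
  have "Suc (length ([] :: (complex \<Rightarrow> complex) list) + length vs) = Suc k" "set [] \<subseteq> smooth_circle" using assms(4) by auto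
  with assms have "T ([] @ (\<lambda>z. f z + c * g z) # vs) = T ([] @ f # vs) + c * T ([] @ g # vs)"
    unfolding bounded_multilinear_def by blast
  then show ?thesis by simp
qed

lemma bounded_multilinear_Cons:
  assumes T: "bounded_multilinear (Suc k) T" and f: "f \<in> smooth_circle"
  shows "bounded_multilinear k (\<lambda>fs. T (f # fs))"
  unfolding bounded_multilinear_def
proof (intro conjI)
  obtain N C where C: "C \<ge> 0" "\<forall>fs. length fs = Suc k \<longrightarrow> set fs \<subseteq> smooth_circle \<longrightarrow> norm (T fs) \<le> C * (\<Prod>f\<leftarrow>fs. C_norm N f)"
    using bounded_multilinear_bound[OF T] .
  have "\<forall>fs. length fs = k \<longrightarrow> set fs \<subseteq> smooth_circle \<longrightarrow> norm (T (f # fs)) \<le> (C * C_norm N f) * (\<Prod>f\<leftarrow>fs. C_norm N f)"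
  proof (intro allI impI)
    fix fs :: "(complex \<Rightarrow> complex) list" assume "length fs = k" "set fs \<subseteq> smooth_circle"
    then show "norm (T (f # fs)) \<le> (C * C_norm N f) * (\<Prod>f\<leftarrow>fs. C_norm N f)"
      using C(2)[rule_format, of "f # fs"] f by (simp add: mult.assoc)
  qed
  moreover have "C * C_norm N f \<ge> 0" using C(1) C_norm_nonneg[OF f] by simp
  ultimately show "\<exists>N. \<exists>C\<ge>0. \<forall>fs. length fs = k \<longrightarrow> set fs \<subseteq> smooth_circle \<longrightarrow> norm (T (f # fs)) \<le> C * (\<Prod>f\<leftarrow>fs. C_norm N f)"
    by (intro exI conjI)
  show "\<forall>us vs. \<forall>fa\<in>smooth_circle. \<forall>g\<in>smooth_circle. \<forall>c.
        Suc (length us + length vs) = k \<longrightarrow> set us \<subseteq> smooth_circle \<longrightarrow> set vs \<subseteq> smooth_circle \<longrightarrow>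
        T (f # us @ (\<lambda>z. fa z + c * g z) # vs) = T (f # us @ fa # vs) + c * T (f # us @ g # vs)"
  proof (intro allI ballI impI)
    fix us vs fa g c
    assume a: "fa \<in> smooth_circle" "g \<in> smooth_circle" "Suc (length us + length vs) = k" "set us \<subseteq> smooth_circle" "set vs \<subseteq> smooth_circle"
    have "Suc (length (f # us) + length vs) = Suc k" "set (f # us) \<subseteq> smooth_circle" using a f by auto
    with T a have "T ((f # us) @ (\<lambda>z. fa z + c * g z) # vs) = T ((f # us) @ fa # vs) + c * T ((f # us) @ g # vs)"
      unfolding bounded_multilinear_def by blast
    then show "T (f # us @ (\<lambda>z. fa z + c * g z) # vs) = T (f # us @ fa # vs) + c * T (f # us @ g # vs)" by simp
  qed
qed

lemma prod_list_C_norm_le: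
  assumes "set fs \<subseteq> smooth_circle" "\<And>f. f \<in> set fs \<Longrightarrow> C_norm N f \<le> B"
  shows "(\<Prod>f\<leftarrow>fs. C_norm N f) \<le> B ^ length fs" "0 \<le> (\<Prod>f\<leftarrow>fs. C_norm N f)"
proof -
  have "0 \<le> (\<Prod>f\<leftarrow>fs. C_norm N f) \<and> (\<Prod>f\<leftarrow>fs. C_norm N f) \<le> B ^ length fs"
    using assms
  proof (induction fs)
    case (Cons f fs)
    have "0 \<le> C_norm N f" "C_norm N f \<le> B" using Cons.prems C_norm_nonneg by auto
    moreover have "0 \<le> (\<Prod>f\<leftarrow>fs. C_norm N f)" "(\<Prod>f\<leftarrow>fs. C_norm N f) \<le> B ^ length fs" using Cons by auto
    ultimately show ?case by (auto intro: mult_mono)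
  qed simp
  then show "(\<Prod>f\<leftarrow>fs. C_norm N f) \<le> B ^ length fs" "0 \<le> (\<Prod>f\<leftarrow>fs. C_norm N f)" by auto
qed

text \<open>Telescoping: exchanging one slot at a time gives k terms of size C \<epsilon> B^(k-1),
  and B >= 1 allows the power B^k.\<close>

lemma bounded_multilinear_diff_le:
  assumes "bounded_multilinear k T" "C \<ge> 0" "B \<ge> 1" "\<epsilon> \<ge> 0"
    and "\<forall>fs. length fs = k \<longrightarrow> set fs \<subseteq> smooth_circle \<longrightarrow> norm (T fs) \<le> C * (\<Prod>f\<leftarrow>fs. C_norm N f)"
    and "length fs = k" "length gs = k" "set fs \<subseteq> smooth_circle" "set gs \<subseteq> smooth_circle"
    and "\<And>f. f \<in> set fs \<union> set gs \<Longrightarrow> C_norm N f \<le> B"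
    and "\<And>i. i < k \<Longrightarrow> C_norm N (\<lambda>z. (fs ! i) z - (gs ! i) z) \<le> \<epsilon>"
  shows "norm (T fs - T gs) \<le> C * real k * \<epsilon> * B ^ k"
  using assms
proof (induction k arbitrary: T C fs gs)
  case 0 then show ?case by simp
next
  case (Suc k)
  obtain f fs' g gs' where fg: "fs = f # fs'" "gs = g # gs'" "length fs' = k" "length gs' = k"
    using Suc.prems(6,7) by (metis length_Suc_conv)
  have sm: "f \<in> smooth_circle" "g \<in> smooth_circle" "set fs' \<subseteq> smooth_circle" "set gs' \<subseteq> smooth_circle"
    using Suc.prems(8,9) fg by auto
  note bd = Suc.prems(5)
  have "T ((\<lambda>z. f z + (-1) * g z) # fs') = T (f # fs') + (-1) * T (g # fs')"
    by (rule bounded_multilinear_Cons_add[OF Suc.prems(1) sm(1,2) fg(3) sm(3)])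
  then have "norm (T (f # fs') - T (g # fs')) = norm (T ((\<lambda>z. f z - g z) # fs'))" by simp
  also have "\<dots> \<le> C * (C_norm N (\<lambda>z. f z - g z) * (\<Prod>f\<leftarrow>fs'. C_norm N f))"
    using bd[rule_format, of "(\<lambda>z. f z - g z) # fs'"] sm fg(3) smooth_circle_diff by simp
  also have "\<dots> \<le> C * (\<epsilon> * B ^ k)"
  proof (intro mult_left_mono mult_mono)
    show "C_norm N (\<lambda>z. f z - g z) \<le> \<epsilon>" using Suc.prems(11)[of 0] fg by simp
    show "(\<Prod>f\<leftarrow>fs'. C_norm N f) \<le> B ^ k" "0 \<le> (\<Prod>f\<leftarrow>fs'. C_norm N f)"
      using prod_list_C_norm_le[OF sm(3), of N B] Suc.prems(10) fg by auto
  qed (use Suc.prems in auto)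
  also have "\<dots> \<le> C * (\<epsilon> * B ^ Suc k)"
    using Suc.prems(2-4) by (intro mult_left_mono power_increasing) auto
  finally have 1: "norm (T (f # fs') - T (g # fs')) \<le> C * (\<epsilon> * B ^ Suc k)" .
  have Bg: "C_norm N g \<le> B" using Suc.prems(10) fg by simp
  have "norm (T (g # fs') - T (g # gs')) \<le> (C * B) * real k * \<epsilon> * B ^ k"
  proof (rule Suc.IH[OF bounded_multilinear_Cons[OF Suc.prems(1) sm(2)]])
    show "\<forall>fs. length fs = k \<longrightarrow> set fs \<subseteq> smooth_circle \<longrightarrow> norm (T (g # fs)) \<le> (C * B) * (\<Prod>f\<leftarrow>fs. C_norm N f)"
    proof (intro allI impI)
      fix hs :: "(complex \<Rightarrow> complex) list" assume hs: "length hs = k" "set hs \<subseteq> smooth_circle"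
      have "norm (T (g # hs)) \<le> C * (C_norm N g * (\<Prod>f\<leftarrow>hs. C_norm N f))"
        using bd[rule_format, of "g # hs"] hs sm by simp
      also have "\<dots> \<le> C * (B * (\<Prod>f\<leftarrow>hs. C_norm N f))"
        using Bg Suc.prems(2) hs(2) C_norm_nonneg
        by (intro mult_left_mono mult_right_mono prod_list_nonneg) auto
      finally show "norm (T (g # hs)) \<le> (C * B) * (\<Prod>f\<leftarrow>hs. C_norm N f)" by (simp add: mult.assoc)
    qed
    show "C_norm N (\<lambda>z. (fs' ! i) z - (gs' ! i) z) \<le> \<epsilon>" if "i < k" for i
      using Suc.prems(11)[of "Suc i"] that fg by simp
  qed (use Suc.prems fg sm in auto)
  with 1 have "norm ((T (f # fs') - T (g # fs')) + (T (g # fs') - T (g # gs'))) \<le> C * (\<epsilon> * B ^ Suc k) + (C * B) * real k * \<epsilon> * B ^ k"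
    by (rule norm_triangle_mono)
  then show ?case by (simp add: fg algebra_simps)
qed

text \<open>Complex differentiability of a curve in the Frechet space. Smoothness of the values is
  required along the entire curve, so that all difference quotients are test functions.\<close>

definition curve_deriv :: "(complex \<Rightarrow> complex \<Rightarrow> complex) \<Rightarrow> (complex \<Rightarrow> complex) \<Rightarrow> complex \<Rightarrow> bool" where
  "curve_deriv c c' \<tau> \<longleftrightarrow> (\<forall>\<tau>. c \<tau> \<in> smooth_circle) \<and> c' \<in> smooth_circle \<and>
     (\<forall>N. ((\<lambda>h. C_norm N (\<lambda>z. (1 / h) * (c (\<tau> + h) z - c \<tau> z) - c' z)) \<longlongrightarrow> 0) (at 0))"

lemma curve_deriv_tendsto:
  assumes "curve_deriv c c' \<tau>"
  shows "((\<lambda>h. C_norm N (c (\<tau> + h))) \<longlongrightarrow> C_norm N (c \<tau>)) (at 0)"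
proof -
  have s: "c \<tau> \<in> smooth_circle" "c' \<in> smooth_circle" for \<tau> using assms by (auto simp: curve_deriv_def)
  let ?E = "\<lambda>h. C_norm N (\<lambda>z. (1 / h) * (c (\<tau> + h) z - c \<tau> z) - c' z)"
  have E: "(?E \<longlongrightarrow> 0) (at 0)" using assms by (auto simp: curve_deriv_def)
  have "norm (C_norm N (c (\<tau> + h)) - C_norm N (c \<tau>)) \<le> norm h * (?E h + C_norm N c')" if "h \<noteq> 0" for h
  proof -
    have D: "(\<lambda>z. c (\<tau> + h) z - c \<tau> z) \<in> smooth_circle" by (intro smooth_circle_diff s)
    have D': "(\<lambda>z. (1 / h) * (c (\<tau> + h) z - c \<tau> z)) \<in> smooth_circle" by (intro smooth_circle_scale D)
    have "C_norm N (\<lambda>z. h * ((1 / h) * (c (\<tau> + h) z - c \<tau> z))) = norm h * C_norm N (\<lambda>z. (1 / h) * (c (\<tau> + h) z - c \<tau> z))"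
      by (rule C_norm_scale[OF D'])
    then have eq: "C_norm N (\<lambda>z. c (\<tau> + h) z - c \<tau> z) = norm h * C_norm N (\<lambda>z. (1 / h) * (c (\<tau> + h) z - c \<tau> z))"
      using that by simp
    have "C_norm N (\<lambda>z. (1 / h) * (c (\<tau> + h) z - c \<tau> z)) \<le> ?E h + C_norm N c'"
      using C_norm_triangle[OF smooth_circle_diff[OF D' s(2)] s(2), of N] by simp
    then have 1: "C_norm N (\<lambda>z. c (\<tau> + h) z - c \<tau> z) \<le> norm h * (?E h + C_norm N c')"
      unfolding eq by (intro mult_left_mono) auto
    have "C_norm N (c (\<tau> + h)) \<le> C_norm N (c \<tau>) + C_norm N (\<lambda>z. c (\<tau> + h) z - c \<tau> z)"
      using C_norm_triangle[OF s(1) D, of N \<tau>] by simp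
    moreover have "C_norm N (c \<tau>) \<le> C_norm N (c (\<tau> + h)) + C_norm N (\<lambda>z. c (\<tau> + h) z - c \<tau> z)"
      using C_norm_triangle[OF s(1) smooth_circle_diff[OF s(1) s(1)], of N "\<tau> + h" \<tau> "\<tau> + h"]
        C_norm_diff_commute[OF s(1) s(1), of N "\<tau> + h" \<tau>] by simp
    ultimately show ?thesis using 1 by (simp add: abs_le_iff)
  qed
  then have ev: "\<forall>\<^sub>F h in at 0. norm (C_norm N (c (\<tau> + h)) - C_norm N (c \<tau>)) \<le> norm h * (?E h + C_norm N c')"
    by (simp add: eventually_at_filter)
  have "((\<lambda>h. norm h * (?E h + C_norm N c')) \<longlongrightarrow> norm (0::complex) * (0 + C_norm N c')) (at 0)"
    by (intro tendsto_intros E)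
  then have "((\<lambda>h. norm h * (?E h + C_norm N c')) \<longlongrightarrow> 0) (at 0)" by simp
  from Lim_null_comparison[OF ev this] show ?thesis by (simp add: LIM_zero_iff)
qed

lemma tendsto_prod_list:
  fixes f :: "'a \<Rightarrow> 'b \<Rightarrow> real"
  assumes "\<And>x. x \<in> set xs \<Longrightarrow> (f x \<longlongrightarrow> l x) F"
  shows "((\<lambda>h. \<Prod>x\<leftarrow>xs. f x h) \<longlongrightarrow> (\<Prod>x\<leftarrow>xs. l x)) F"
  using assms by (induction xs) (auto intro!: tendsto_mult)

text \<open>The product rule, by induction on the number of slots.\<close>

lemma bounded_multilinear_curve:
  assumes "bounded_multilinear (length cs) T" "\<And>c. c \<in> set cs \<Longrightarrow> \<exists>c'. curve_deriv c c' \<tau>"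
  shows "(\<lambda>\<tau>. T (map (\<lambda>c. c \<tau>) cs)) field_differentiable (at \<tau>)"
  using assms
proof (induction cs arbitrary: T)
  case Nil then show ?case by simp
next
  case (Cons c cs)
  obtain c' where c': "curve_deriv c c' \<tau>" using Cons.prems(2)[of c] by auto
  have s: "c \<tau> \<in> smooth_circle" "c' \<in> smooth_circle" for \<tau> using c' by (auto simp: curve_deriv_def)
  have scs: "set (map (\<lambda>c. c \<sigma>) cs) \<subseteq> smooth_circle" for \<sigma>
    using Cons.prems(2) by (auto simp: curve_deriv_def)
  let ?fs = "\<lambda>\<sigma>. map (\<lambda>c. c \<sigma>) cs"
  have T: "bounded_multilinear (Suc (length cs)) T" using Cons.prems(1) by simp
  obtain N C where C: "C \<ge> 0" "\<forall>fs. length fs = Suc (length cs) \<longrightarrow> set fs \<subseteq> smooth_circle \<longrightarrow> norm (T fs) \<le> C * (\<Prod>f\<leftarrow>fs. C_norm N f)"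
    using bounded_multilinear_bound[OF T] .
  have IH: "(\<lambda>\<sigma>. T (f # ?fs \<sigma>)) field_differentiable (at \<tau>)" if "f \<in> smooth_circle" for f
    by (rule Cons.IH[OF bounded_multilinear_Cons[OF T that]]) (use Cons.prems(2) in auto)
  obtain D where D: "((\<lambda>\<sigma>. T (c \<tau> # ?fs \<sigma>)) has_field_derivative D) (at \<tau>)"
    using IH[OF s(1)] by (auto simp: field_differentiable_def)
  let ?\<Delta> = "\<lambda>h z. (1 / h) * (c (\<tau> + h) z - c \<tau> z)"
  have \<Delta>: "?\<Delta> h \<in> smooth_circle" for h by (intro smooth_circle_scale smooth_circle_diff s)
  \<comment> \<open>Three parts: the error of the difference quotient in the first slot, its limit
    with the other slots moving, and the first slot at rest with the others moving. The first tends
    to 0 because the norms in the other slots converge; the last two have a fixed first slot and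
    fall under the induction hypothesis.\<close>
  have split: "(T (c (\<tau> + h) # ?fs (\<tau> + h)) - T (c \<tau> # ?fs \<tau>)) / h
      = T ((\<lambda>z. ?\<Delta> h z - c' z) # ?fs (\<tau> + h)) + T (c' # ?fs (\<tau> + h))
        + (T (c \<tau> # ?fs (\<tau> + h)) - T (c \<tau> # ?fs \<tau>)) / h" if "h \<noteq> 0" for h
  proof -
    have a: "T ((\<lambda>z. f z + e * g z) # ?fs (\<tau> + h)) = T (f # ?fs (\<tau> + h)) + e * T (g # ?fs (\<tau> + h))"
      if "f \<in> smooth_circle" "g \<in> smooth_circle" for f g e
      by (rule bounded_multilinear_Cons_add[OF T that _ scs]) simp
    have "(\<lambda>z. c \<tau> z + h * ?\<Delta> h z) = c (\<tau> + h)" using that by (auto simp: fun_eq_iff)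
    then have 1: "T (c (\<tau> + h) # ?fs (\<tau> + h)) = T (c \<tau> # ?fs (\<tau> + h)) + h * T (?\<Delta> h # ?fs (\<tau> + h))"
      using a[OF s(1) \<Delta>, of \<tau> h h] by simp
    have 2: "T ((\<lambda>z. ?\<Delta> h z - c' z) # ?fs (\<tau> + h)) = T (?\<Delta> h # ?fs (\<tau> + h)) - T (c' # ?fs (\<tau> + h))"
      using a[OF \<Delta> s(2), of h "-1"] by simp
    show ?thesis unfolding 1 2 using that by (simp add: field_simps)
  qed
  have l1: "((\<lambda>h. T ((\<lambda>z. ?\<Delta> h z - c' z) # ?fs (\<tau> + h))) \<longlongrightarrow> 0) (at 0)"
  proof (rule Lim_null_comparison)
    show "\<forall>\<^sub>F h in at 0. norm (T ((\<lambda>z. ?\<Delta> h z - c' z) # ?fs (\<tau> + h)))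
        \<le> C * (C_norm N (\<lambda>z. ?\<Delta> h z - c' z) * (\<Prod>c\<leftarrow>cs. C_norm N (c (\<tau> + h))))"
    proof (intro always_eventually allI)
      fix h
      have "(\<lambda>z. ?\<Delta> h z - c' z) \<in> smooth_circle" by (intro smooth_circle_diff \<Delta> s)
      then show "norm (T ((\<lambda>z. ?\<Delta> h z - c' z) # ?fs (\<tau> + h)))
        \<le> C * (C_norm N (\<lambda>z. ?\<Delta> h z - c' z) * (\<Prod>c\<leftarrow>cs. C_norm N (c (\<tau> + h))))"
        using C(2)[rule_format, of "(\<lambda>z. ?\<Delta> h z - c' z) # ?fs (\<tau> + h)"] scs by (simp add: o_def)
    qed
    have "((\<lambda>h. \<Prod>c\<leftarrow>cs. C_norm N (c (\<tau> + h))) \<longlongrightarrow> (\<Prod>c\<leftarrow>cs. C_norm N (c \<tau>))) (at 0)"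
    proof (rule tendsto_prod_list)
      fix g assume "g \<in> set cs"
      then obtain g' where "curve_deriv g g' \<tau>" using Cons.prems(2)[of g] by auto
      then show "((\<lambda>h. C_norm N (g (\<tau> + h))) \<longlongrightarrow> C_norm N (g \<tau>)) (at 0)" by (rule curve_deriv_tendsto)
    qed
    moreover have "((\<lambda>h. C_norm N (\<lambda>z. ?\<Delta> h z - c' z)) \<longlongrightarrow> 0) (at 0)" using c' by (auto simp: curve_deriv_def)
    ultimately have "((\<lambda>h. C * (C_norm N (\<lambda>z. ?\<Delta> h z - c' z) * (\<Prod>c\<leftarrow>cs. C_norm N (c (\<tau> + h))))) \<longlongrightarrow>
        C * (0 * (\<Prod>c\<leftarrow>cs. C_norm N (c \<tau>)))) (at 0)"
      by (intro tendsto_intros)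
    then show "((\<lambda>h. C * (C_norm N (\<lambda>z. ?\<Delta> h z - c' z) * (\<Prod>c\<leftarrow>cs. C_norm N (c (\<tau> + h))))) \<longlongrightarrow> 0) (at 0)" by simp
  qed
  have l2: "((\<lambda>h. T (c' # ?fs (\<tau> + h))) \<longlongrightarrow> T (c' # ?fs \<tau>)) (at 0)"
    by (rule LIM_offset_zero[OF field_differentiable_imp_continuous_at[OF IH[OF s(2)], unfolded isCont_def]])
  have l3: "((\<lambda>h. (T (c \<tau> # ?fs (\<tau> + h)) - T (c \<tau> # ?fs \<tau>)) / h) \<longlongrightarrow> D) (at 0)"
    using D unfolding DERIV_def .
  have "((\<lambda>h. T ((\<lambda>z. ?\<Delta> h z - c' z) # ?fs (\<tau> + h)) + T (c' # ?fs (\<tau> + h))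
        + (T (c \<tau> # ?fs (\<tau> + h)) - T (c \<tau> # ?fs \<tau>)) / h) \<longlongrightarrow> 0 + T (c' # ?fs \<tau>) + D) (at 0)"
    by (intro tendsto_add l1 l2 l3)
  then have "((\<lambda>h. (T (c (\<tau> + h) # ?fs (\<tau> + h)) - T (c \<tau> # ?fs \<tau>)) / h) \<longlongrightarrow> 0 + T (c' # ?fs \<tau>) + D) (at 0)"
    by (rule Lim_transform_eventually) (simp add: eventually_at_filter split)
  then have "((\<lambda>\<sigma>. T (map (\<lambda>c. c \<sigma>) (c # cs))) has_field_derivative 0 + T (c' # ?fs \<tau>) + D) (at \<tau>)"
    by (simp add: DERIV_def)
  then show ?case unfolding field_differentiable_def by blast
qed

lemma rapid_entire_translate:
  assumes "rapid_entire h"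
  shows "rapid (\<lambda>u. h (of_real u - a))"
    "iter_deriv j (\<lambda>u. h (of_real u - a)) = (\<lambda>u. (deriv ^^ j) h (of_real u - a))"
proof -
  show "rapid (\<lambda>u. h (of_real u - a))"
    using rapid_entire_restrict(1)[OF rapid_entire_shift[OF assms, of a]] .
  show "iter_deriv j (\<lambda>u. h (of_real u - a)) = (\<lambda>u. (deriv ^^ j) h (of_real u - a))"
  proof (rule iter_deriv_unique[where G = "\<lambda>j u. (deriv ^^ j) h (of_real u - a)"])
    fix j u
    have "((deriv ^^ j) h has_field_derivative deriv ((deriv ^^ j) h) (of_real u - a)) (at (of_real u - a))"
      using rapid_entire_higher_deriv[OF assms, of j] holomorphic_derivI[of _ UNIV]
      by (auto simp: rapid_entire_def)
    then have "((\<lambda>z. (deriv ^^ j) h (z - a)) has_field_derivative deriv ((deriv ^^ j) h) (of_real u - a)) (at (of_real u))"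
      using DERIV_shift[of "(deriv ^^ j) h" _ "of_real u" "- a"] by simp
    from has_vector_derivative_real_field[OF this]
    show "((\<lambda>u. (deriv ^^ j) h (of_real u - a)) has_vector_derivative (deriv ^^ Suc j) h (of_real u - a)) (at u)" by simp
  qed simp
qed

text \<open>Translating the weight exp (- K |u|) by Re \<tau> costs exp (K |Re \<tau>|); the shift
  by Im \<tau> stays in a strip where the derivatives of \<open>h\<close> decrease
  uniformly.\<close>

lemma rapid_entire_translate_bound:
  assumes h: "rapid_entire h"
  obtains C where "C \<ge> 0" "\<And>\<tau>. \<bar>Im \<tau>\<bar> \<le> V \<Longrightarrow> C_norm N (arc_fun d (\<lambda>u. h (of_real u - \<tau>))) \<le> C * exp ((real d + 1 + real N) * \<bar>Re \<tau>\<bar>)"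
proof -
  define K where "K = real d + 1 + real N"
  have K0: "K \<ge> 0" by (simp add: K_def)
  obtain C where C: "C \<ge> 0" "\<And>g \<epsilon>. rapid g \<Longrightarrow> (\<And>i u. i \<le> N \<Longrightarrow> norm (iter_deriv i g u) \<le> \<epsilon> * exp (- (real d + 1 + real N) * \<bar>u\<bar>)) \<Longrightarrow>
       C_norm N (arc_fun d g) \<le> C * \<epsilon>"
    using C_norm_arc_fun_bound[of N d] by blast
  note C = C[folded K_def]
  have "\<forall>i. \<exists>A\<ge>0. \<forall>z. \<bar>Im z\<bar> \<le> V \<longrightarrow> norm ((deriv ^^ i) h z) \<le> A * exp (- K * \<bar>Re z\<bar>)"
  proof
    fix i
    obtain A where "A \<ge> 0" "\<And>z. \<bar>Im z\<bar> \<le> V \<Longrightarrow> norm ((deriv ^^ i) h z) \<le> A * exp (- K * \<bar>Re z\<bar>)"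
      using rapid_entire_bound[OF rapid_entire_higher_deriv[OF h, of i], where V = V and K = K] by blast
    then show "\<exists>A\<ge>0. \<forall>z. \<bar>Im z\<bar> \<le> V \<longrightarrow> norm ((deriv ^^ i) h z) \<le> A * exp (- K * \<bar>Re z\<bar>)" by blast
  qed
  then obtain A where A: "\<And>i. A i \<ge> 0" "\<And>i z. \<bar>Im z\<bar> \<le> V \<Longrightarrow> norm ((deriv ^^ i) h z) \<le> A i * exp (- K * \<bar>Re z\<bar>)"
    by metis
  define B where "B = (\<Sum>i\<le>N. A i)"
  have B0: "B \<ge> 0" unfolding B_def using A(1) by (intro sum_nonneg)
  have "C_norm N (arc_fun d (\<lambda>u. h (of_real u - \<tau>))) \<le> C * (B * exp (K * \<bar>Re \<tau>\<bar>))" if V: "\<bar>Im \<tau>\<bar> \<le> V" for \<tau>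
  proof (rule C(2)[OF rapid_entire_translate(1)[OF h]])
    fix i u assume "i \<le> N"
    have "norm ((deriv ^^ i) h (of_real u - \<tau>)) \<le> A i * exp (- K * \<bar>Re (of_real u - \<tau>)\<bar>)"
      using V by (intro A) simp
    also have "\<dots> \<le> A i * (exp (\<bar>K\<bar> * \<bar>Re (of_real u - \<tau>) - u\<bar>) * exp (- K * \<bar>u\<bar>))"
      by (intro mult_left_mono exp_abs_shift_le A)
    also have "\<dots> \<le> B * (exp (\<bar>K\<bar> * \<bar>Re (of_real u - \<tau>) - u\<bar>) * exp (- K * \<bar>u\<bar>))"
      unfolding B_def using A(1) \<open>i \<le> N\<close> by (intro mult_right_mono member_le_sum) auto
    finally show "norm (iter_deriv i (\<lambda>u. h (of_real u - \<tau>)) u) \<le> B * exp (K * \<bar>Re \<tau>\<bar>) * exp (- K * \<bar>u\<bar>)"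
      unfolding rapid_entire_translate(2)[OF h] using K0 by (simp add: mult.assoc)
  qed
  then have "C_norm N (arc_fun d (\<lambda>u. h (of_real u - \<tau>))) \<le> (C * B) * exp ((real d + 1 + real N) * \<bar>Re \<tau>\<bar>)"
    if "\<bar>Im \<tau>\<bar> \<le> V" for \<tau> using that by (simp add: K_def mult.assoc)
  then show ?thesis using C(1) B0 by (intro that[of "C * B"]) auto
qed

text \<open>Taylor expansion of first order with quadratic remainder, applied to each derivative of
  \<open>h\<close>; the weighted remainder bound makes it converge in C^N. The derivative of the
  curve is - h'(u - \<tau>).\<close>

lemma rapid_entire_curve_deriv:
  assumes h: "rapid_entire h"
  shows "\<exists>c'. curve_deriv (\<lambda>\<tau>. arc_fun d (\<lambda>u. h (of_real u - \<tau>))) c' \<tau>"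
proof -
  have h': "rapid_entire (deriv h)" using rapid_entire_higher_deriv[OF h, of 1] by simp
  let ?c' = "arc_fun d (\<lambda>u. (-1) * deriv h (of_real u - \<tau>))"
  note r = rapid_entire_translate[OF h] and r'1 = rapid_scale(1)[OF rapid_entire_translate(1)[OF h'], of "-1"]
    and r'2 = rapid_scale(2)[OF rapid_entire_translate(1)[OF h'], of _ "-1"]
  have "((\<lambda>e. C_norm N (\<lambda>z. (1 / e) * (arc_fun d (\<lambda>u. h (of_real u - (\<tau> + e))) z - arc_fun d (\<lambda>u. h (of_real u - \<tau>)) z) - ?c' z)) \<longlongrightarrow> 0) (at 0)" for N
  proof -
    define K where "K = real d + 1 + real N"
    have K0: "K \<ge> 0" by (simp add: K_def)
    obtain C where C: "C \<ge> 0" "\<And>g \<epsilon>. rapid g \<Longrightarrow> (\<And>i u. i \<le> N \<Longrightarrow> norm (iter_deriv i g u) \<le> \<epsilon> * exp (- (real d + 1 + real N) * \<bar>u\<bar>)) \<Longrightarrow>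
         C_norm N (arc_fun d g) \<le> C * \<epsilon>"
      using C_norm_arc_fun_bound[of N d] by blast
    note C = C[folded K_def]
    have "\<forall>i. \<exists>A\<ge>0. \<forall>z. \<bar>Im z\<bar> \<le> \<bar>Im \<tau>\<bar> + 1 \<longrightarrow> norm ((deriv ^^ i) h z) \<le> A * exp (- K * \<bar>Re z\<bar>)"
    proof
      fix i
      obtain A where "A \<ge> 0" "\<And>z. \<bar>Im z\<bar> \<le> \<bar>Im \<tau>\<bar> + 1 \<Longrightarrow> norm ((deriv ^^ i) h z) \<le> A * exp (- K * \<bar>Re z\<bar>)"
        using rapid_entire_bound[OF rapid_entire_higher_deriv[OF h, of i], where V = "\<bar>Im \<tau>\<bar> + 1" and K = K] by blast
      then show "\<exists>A\<ge>0. \<forall>z. \<bar>Im z\<bar> \<le> \<bar>Im \<tau>\<bar> + 1 \<longrightarrow> norm ((deriv ^^ i) h z) \<le> A * exp (- K * \<bar>Re z\<bar>)" by blast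
    qed
    then obtain A where A: "\<And>i. A i \<ge> 0" "\<And>i z. \<bar>Im z\<bar> \<le> \<bar>Im \<tau>\<bar> + 1 \<Longrightarrow> norm ((deriv ^^ i) h z) \<le> A i * exp (- K * \<bar>Re z\<bar>)"
      by metis
    \<comment> \<open>For increments of norm at most 1 the real part of the argument stays within
      |Re \<tau>| + 1 of u. The remainder for the derivative of order i <= N involves order i +
      2.\<close>
    define B where "B = (\<Sum>i\<le>N + 2. A i) * exp (K * (\<bar>Re \<tau>\<bar> + 1))"
    have B0: "B \<ge> 0" unfolding B_def using A(1) by (intro mult_nonneg_nonneg sum_nonneg) auto
    have Bd: "norm ((deriv ^^ (i + 2)) h v) \<le> B * exp (- K * \<bar>u\<bar>)"
      if "i \<le> N" "v \<in> cball (of_real u - \<tau>) 1" for i u v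
    proof -
      have v: "\<bar>Re (of_real u - \<tau> - v)\<bar> \<le> 1" "\<bar>Im (of_real u - \<tau> - v)\<bar> \<le> 1"
        using that(2) abs_Re_le_cmod[of "of_real u - \<tau> - v"] abs_Im_le_cmod[of "of_real u - \<tau> - v"]
        by (simp_all add: dist_norm)
      have "norm ((deriv ^^ (i + 2)) h v) \<le> A (i + 2) * exp (- K * \<bar>Re v\<bar>)" using v by (intro A) auto
      also have "\<dots> \<le> A (i + 2) * (exp (\<bar>K\<bar> * \<bar>Re v - u\<bar>) * exp (- K * \<bar>u\<bar>))"
        by (intro mult_left_mono exp_abs_shift_le A)
      also have "\<dots> \<le> A (i + 2) * (exp (K * (\<bar>Re \<tau>\<bar> + 1)) * exp (- K * \<bar>u\<bar>))"
        using v K0 A(1) by (intro mult_left_mono mult_right_mono) (auto intro!: mult_left_mono)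
      also have "\<dots> \<le> (\<Sum>i\<le>N + 2. A i) * (exp (K * (\<bar>Re \<tau>\<bar> + 1)) * exp (- K * \<bar>u\<bar>))"
        using that(1) A(1) by (intro mult_right_mono member_le_sum) auto
      finally show ?thesis by (simp add: B_def mult.assoc)
    qed
    have est: "C_norm N (\<lambda>z. (1 / e) * (arc_fun d (\<lambda>u. h (of_real u - (\<tau> + e))) z - arc_fun d (\<lambda>u. h (of_real u - \<tau>)) z) - ?c' z) \<le> C * (B * norm e)"
      if e: "e \<noteq> 0" "norm e \<le> 1" for e
    proof -
      let ?g = "\<lambda>u. (1 / e) * (h (of_real u - (\<tau> + e)) - h (of_real u - \<tau>)) - (-1) * deriv h (of_real u - \<tau>)"
      note d1 = rapid_diff[OF r(1) r(1)]
      note s1 = rapid_scale[OF d1(1)]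
      have rg: "rapid ?g" by (intro rapid_diff(1) rapid_scale(1) r(1) rapid_entire_translate(1) h')
      have ig: "iter_deriv i ?g u = (1 / e) * ((deriv ^^ i) h (of_real u - (\<tau> + e)) - (deriv ^^ i) h (of_real u - \<tau>))
          + (deriv ^^ Suc i) h (of_real u - \<tau>)" for i u
      proof -
        have "(deriv ^^ i) (deriv h) = (deriv ^^ Suc i) h" by (simp add: funpow_Suc_right del: funpow.simps)
        then show ?thesis
          unfolding rapid_diff(2)[OF s1(1) r'1] s1(2) d1(2) r(2) r'2 rapid_entire_translate(2)[OF h'] by simp
      qed
      have "norm (iter_deriv i ?g u) \<le> (B * norm e) * exp (- K * \<bar>u\<bar>)" if i: "i \<le> N" for i u
      proof -
        define w where "w = of_real u - \<tau>"
        have "norm ((deriv ^^ (i + 0)) h (w - e) - (\<Sum>j\<le>1. (deriv ^^ (i + j)) h w * ((w - e) - w) ^ j / fact j))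
            \<le> (B * exp (- K * \<bar>u\<bar>)) * norm ((w - e) - w) ^ Suc 1 / fact 1"
        proof (rule complex_Taylor[where S = "cball w 1" and f = "\<lambda>j. (deriv ^^ (i + j)) h"])
          show "((deriv ^^ (i + j)) h has_field_derivative (deriv ^^ (i + Suc j)) h x) (at x within cball w 1)" for j x
            using rapid_entire_higher_deriv[OF h, of "i + j"] holomorphic_derivI[of _ UNIV]
            by (auto simp: rapid_entire_def intro!: has_field_derivative_at_within)
          show "norm ((deriv ^^ (i + Suc 1)) h x) \<le> B * exp (- K * \<bar>u\<bar>)" if "x \<in> cball w 1" for x
            using Bd[OF i, of x u] that by (simp add: w_def)
        qed (use e in \<open>auto simp: dist_norm\<close>)
        then have t: "norm ((deriv ^^ i) h (w - e) - ((deriv ^^ i) h w - (deriv ^^ Suc i) h w * e)) \<le> (B * exp (- K * \<bar>u\<bar>)) * norm e ^ 2"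
          by (simp add: numeral_2_eq_2)
        have "iter_deriv i ?g u = (1 / e) * ((deriv ^^ i) h (w - e) - ((deriv ^^ i) h w - (deriv ^^ Suc i) h w * e))"
          unfolding ig w_def using e(1) by (simp add: field_simps)
        then have "norm (iter_deriv i ?g u) = norm ((deriv ^^ i) h (w - e) - ((deriv ^^ i) h w - (deriv ^^ Suc i) h w * e)) / norm e"
          by (simp only: norm_mult norm_divide norm_one) simp
        also have "\<dots> \<le> ((B * exp (- K * \<bar>u\<bar>)) * norm e ^ 2) / norm e"
          by (rule divide_right_mono[OF t]) simp
        also have "\<dots> = (B * norm e) * exp (- K * \<bar>u\<bar>)" using e(1) by (simp add: power2_eq_square)
        finally show ?thesis .
      qed
      from C(2)[OF rg this] show ?thesis
        unfolding arc_fun_diff arc_fun_scale by simp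
    qed
    show ?thesis
    proof (rule Lim_null_comparison)
      have "((\<lambda>e. C * (B * norm (e::complex))) \<longlongrightarrow> C * (B * norm (0::complex))) (at 0)" by (intro tendsto_mult tendsto_const tendsto_norm tendsto_ident_at)
      then show "((\<lambda>e. C * (B * norm (e::complex))) \<longlongrightarrow> 0) (at 0)" by simp
      have "\<forall>\<^sub>F e in at (0::complex). e \<noteq> 0 \<and> norm e \<le> 1"
        unfolding eventually_at by (intro exI[of _ 1]) auto
      then show "\<forall>\<^sub>F e in at 0. norm (C_norm N (\<lambda>z. (1 / e) * (arc_fun d (\<lambda>u. h (of_real u - (\<tau> + e))) z - arc_fun d (\<lambda>u. h (of_real u - \<tau>)) z) - ?c' z)) \<le> C * (B * norm e)"
      proof eventually_elim
        case (elim e)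
        have "0 \<le> C_norm N (\<lambda>z. (1 / e) * (arc_fun d (\<lambda>u. h (of_real u - (\<tau> + e))) z - arc_fun d (\<lambda>u. h (of_real u - \<tau>)) z) - ?c' z)"
          by (intro C_norm_nonneg smooth_circle_diff smooth_circle_scale smooth_circle_arc_fun r r'1)
        then show ?case using est[of e] elim by simp
      qed
    qed
  qed
  moreover have "?c' \<in> smooth_circle" by (intro smooth_circle_arc_fun r'1)
  moreover have "arc_fun d (\<lambda>u. h (of_real u - \<tau>)) \<in> smooth_circle" for \<tau> by (intro smooth_circle_arc_fun r)
  ultimately have "curve_deriv (\<lambda>\<tau>. arc_fun d (\<lambda>u. h (of_real u - \<tau>))) ?c' \<tau>"
    unfolding curve_deriv_def by blast
  then show ?thesis by (intro exI[of _ ?c'])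
qed

section \<open>The strip\<close>

text \<open>Decay at infinity makes the vertical sides of a long rectangle negligible, so the
  maximum principle for the rectangle gives the bound up to \<eta>.\<close>

lemma strip_maximum_principle:
  assumes H: "H holomorphic_on UNIV"
    and decay: "\<And>\<eta>. \<eta> > 0 \<Longrightarrow> \<exists>R. \<forall>\<tau>\<in>strip. \<bar>Re \<tau>\<bar> \<ge> R \<longrightarrow> norm (H \<tau>) \<le> \<eta>"
    and bd: "\<And>t. norm (H (of_real t)) \<le> B" "\<And>t. norm (H (of_real t + 2 * of_real pi * \<i>)) \<le> B"
    and \<tau>: "\<tau> \<in> strip"
  shows "norm (H \<tau>) \<le> B"
proof (rule field_le_epsilon)
  fix \<eta> :: real assume \<eta>: "\<eta> > 0"
  have B0: "B \<ge> 0" using order_trans[OF norm_ge_zero bd(1)[of 0]] .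
  obtain R0 where R0: "\<And>\<tau>. \<tau> \<in> strip \<Longrightarrow> \<bar>Re \<tau>\<bar> \<ge> R0 \<Longrightarrow> norm (H \<tau>) \<le> \<eta>" using decay[OF \<eta>] by blast
  define R where "R = max R0 (\<bar>Re \<tau>\<bar> + 1)"
  let ?S = "cbox (Complex (- R) 0) (Complex R (2 * pi))"
  have S: "z \<in> ?S \<longleftrightarrow> - R \<le> Re z \<and> Re z \<le> R \<and> 0 \<le> Im z \<and> Im z \<le> 2 * pi" for z
    by (auto simp: in_cbox_complex_iff)
  show "norm (H \<tau>) \<le> B + \<eta>"
  proof (rule maximum_modulus_frontier[of H ?S])
    show "H holomorphic_on interior ?S" by (rule holomorphic_on_subset[OF H]) simp
    show "continuous_on (closure ?S) H"
      by (rule holomorphic_on_imp_continuous_on[OF holomorphic_on_subset[OF H]]) simp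
    show "bounded ?S" by (rule bounded_cbox)
    show "\<tau> \<in> ?S" unfolding S using \<tau> by (auto simp: R_def strip_def)
    fix z assume "z \<in> frontier ?S"
    then have z: "z \<in> ?S" "z \<notin> box (Complex (- R) 0) (Complex R (2 * pi))" by (auto simp: frontier_cbox)
    then have zs: "z \<in> strip" unfolding S by (auto simp: strip_def)
    have "\<bar>Re z\<bar> = R \<or> Im z = 0 \<or> Im z = 2 * pi"
      using z unfolding S by (auto simp: in_box_complex_iff)
    then show "norm (H z) \<le> B + \<eta>"
    proof (elim disjE)
      assume "\<bar>Re z\<bar> = R"
      then have "norm (H z) \<le> \<eta>" by (intro R0 zs) (simp add: R_def)
      then show ?thesis using B0 by simp
    next
      assume "Im z = 0"
      then have "z = of_real (Re z)" by (simp add: complex_eq_iff)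
      then show ?thesis using bd(1)[of "Re z"] \<eta> by simp
    next
      assume "Im z = 2 * pi"
      then have "z = of_real (Re z) + 2 * of_real pi * \<i>" by (simp add: complex_eq_iff)
      then show ?thesis using bd(2)[of "Re z"] \<eta> by simp
    qed
  qed
qed

lemma gaussian_times_exponential:
  fixes K t :: real
  shows "exp (K * \<bar>t\<bar>) * exp (- t\<^sup>2) \<le> exp (K\<^sup>2)"
proof -
  have "0 \<le> (K - \<bar>t\<bar> / 2)\<^sup>2 + (3 / 4) * t\<^sup>2" by simp
  then have "K * \<bar>t\<bar> + - t\<^sup>2 \<le> K\<^sup>2" by (simp add: power2_eq_square algebra_simps)
  then show ?thesis unfolding exp_add[symmetric] by simp
qed

lemma norm_exp_neg_square: "norm (exp (- \<tau>\<^sup>2)) = exp (- (Re \<tau>)\<^sup>2) * exp ((Im \<tau>)\<^sup>2)"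
  unfolding norm_exp_eq_Re exp_add[symmetric] by (simp add: power2_eq_square)

text \<open>\<open>growth\<close> may depend on m in any way: it merely makes each multiple by exp
  (- \<tau>^2) decay, so that the maximum principle applies. Convergence is assumed on the two
  boundary lines alone.\<close>

lemma strip_limit:
  assumes F: "\<And>m. F m holomorphic_on UNIV"
    and growth: "\<And>m. \<exists>C K. \<forall>\<tau>\<in>strip. norm (F m \<tau>) \<le> C * exp (K * \<bar>Re \<tau>\<bar>)"
    and e: "e \<longlonglongrightarrow> 0" and lim: "\<And>m t. norm (F m (of_real t) - f0 t) \<le> e m * exp (K * \<bar>t\<bar>)"
    and e': "e' \<longlonglongrightarrow> 0" and lim': "\<And>m t. norm (F m (of_real t + 2 * of_real pi * \<i>) - f1 t) \<le> e' m * exp (K' * \<bar>t\<bar>)"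
  shows "\<exists>G. continuous_on strip G \<and> G holomorphic_on interior strip \<and>
     (\<forall>t::real. G (of_real t) = f0 t \<and> G (of_real t + 2 * of_real pi * \<i>) = f1 t)"
proof -
  \<comment> \<open>|exp (- \<tau>^2)| is exp (- t^2) on the real line and exp (- t^2 + (2 \<pi>)^2)
    on the upper line; the squares of the rates come from exp (K |t|) exp (- t^2) <= exp
    (K^2).\<close>
  define D where "D = exp (K\<^sup>2 + K'\<^sup>2 + (2 * pi)\<^sup>2)"
  define E where "E m = D * (\<bar>e m\<bar> + \<bar>e' m\<bar>)" for m
  have E: "E \<longlonglongrightarrow> 0"
  proof -
    have "E \<longlonglongrightarrow> D * (\<bar>0\<bar> + \<bar>0\<bar>)" unfolding E_def by (intro tendsto_intros e e')
    then show ?thesis by simp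
  qed
  define G where "G m \<tau> = exp (- \<tau>\<^sup>2) * F m \<tau>" for m \<tau>
  have G: "G m holomorphic_on UNIV" for m unfolding G_def by (intro holomorphic_intros F)
  have D1: "exp (K * \<bar>t\<bar>) * exp (- t\<^sup>2) \<le> D" "exp (K' * \<bar>t\<bar>) * exp (- t\<^sup>2) * exp ((2 * pi)\<^sup>2) \<le> D" for t
  proof -
    have "exp (K\<^sup>2) \<le> D" unfolding D_def by simp
    then show "exp (K * \<bar>t\<bar>) * exp (- t\<^sup>2) \<le> D" using gaussian_times_exponential[of K t] by linarith
    have "exp (K' * \<bar>t\<bar>) * exp (- t\<^sup>2) * exp ((2 * pi)\<^sup>2) \<le> exp (K'\<^sup>2) * exp ((2 * pi)\<^sup>2)"
      by (intro mult_right_mono gaussian_times_exponential) simp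
    also have "\<dots> \<le> D" unfolding D_def exp_add[symmetric] by simp
    finally show "exp (K' * \<bar>t\<bar>) * exp (- t\<^sup>2) * exp ((2 * pi)\<^sup>2) \<le> D" .
  qed
  have b0: "norm (G m (of_real t) - exp (- (of_real t)\<^sup>2) * f0 t) \<le> E m" for m t
  proof -
    have "norm (G m (of_real t) - exp (- (of_real t)\<^sup>2) * f0 t) = norm (exp (- (complex_of_real t)\<^sup>2)) * norm (F m (of_real t) - f0 t)"
      unfolding G_def by (simp add: norm_mult right_diff_distrib[symmetric])
    also have "\<dots> \<le> exp (- t\<^sup>2) * (\<bar>e m\<bar> * exp (K * \<bar>t\<bar>))"
    proof (rule mult_mono)
      show "norm (F m (of_real t) - f0 t) \<le> \<bar>e m\<bar> * exp (K * \<bar>t\<bar>)"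
        by (rule order_trans[OF lim]) (intro mult_right_mono, auto)
    qed (auto simp: norm_exp_neg_square)
    also have "\<dots> = \<bar>e m\<bar> * (exp (K * \<bar>t\<bar>) * exp (- t\<^sup>2))" by simp
    also have "\<dots> \<le> \<bar>e m\<bar> * D" by (intro mult_left_mono D1) simp
    also have "\<dots> \<le> E m" by (simp add: E_def D_def algebra_simps)
    finally show ?thesis .
  qed
  have b1: "norm (G m (of_real t + 2 * of_real pi * \<i>) - exp (- (of_real t + 2 * of_real pi * \<i>)\<^sup>2) * f1 t) \<le> E m" for m t
  proof -
    let ?\<tau> = "of_real t + 2 * of_real pi * \<i>"
    have "norm (G m ?\<tau> - exp (- ?\<tau>\<^sup>2) * f1 t) = norm (exp (- ?\<tau>\<^sup>2)) * norm (F m ?\<tau> - f1 t)"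
      unfolding G_def by (simp add: norm_mult right_diff_distrib[symmetric])
    also have "\<dots> \<le> (exp (- t\<^sup>2) * exp ((2 * pi)\<^sup>2)) * (\<bar>e' m\<bar> * exp (K' * \<bar>t\<bar>))"
    proof (rule mult_mono)
      show "norm (F m ?\<tau> - f1 t) \<le> \<bar>e' m\<bar> * exp (K' * \<bar>t\<bar>)"
        by (rule order_trans[OF lim']) (intro mult_right_mono, auto)
      show "norm (exp (- ?\<tau>\<^sup>2)) \<le> exp (- t\<^sup>2) * exp ((2 * pi)\<^sup>2)"
        by (simp add: norm_exp_eq_Re power2_eq_square exp_add[symmetric])
    qed auto
    also have "\<dots> = \<bar>e' m\<bar> * (exp (K' * \<bar>t\<bar>) * exp (- t\<^sup>2) * exp ((2 * pi)\<^sup>2))" by simp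
    also have "\<dots> \<le> \<bar>e' m\<bar> * D" by (intro mult_left_mono D1) simp
    also have "\<dots> \<le> E m" by (simp add: E_def D_def algebra_simps)
    finally show ?thesis .
  qed
  have decay: "\<exists>R. \<forall>\<tau>\<in>strip. \<bar>Re \<tau>\<bar> \<ge> R \<longrightarrow> norm (G m \<tau>) \<le> \<eta>" if \<eta>: "\<eta> > 0" for m \<eta>
  proof -
    obtain C L where CL: "\<And>\<tau>. \<tau> \<in> strip \<Longrightarrow> norm (F m \<tau>) \<le> C * exp (L * \<bar>Re \<tau>\<bar>)" using growth[of m] by blast
    \<comment> \<open>The spare unit in L + 1 leaves a factor exp (- |t|), and A exp (- |t|) <=
      \<eta> as soon as |t| >= A / \<eta>.\<close>
    define A where "A = \<bar>C\<bar> * exp ((2 * pi)\<^sup>2) * exp ((L + 1)\<^sup>2)"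
    have A0: "A \<ge> 0" by (simp add: A_def)
    have "norm (G m \<tau>) \<le> \<eta>" if \<tau>: "\<tau> \<in> strip" "\<bar>Re \<tau>\<bar> \<ge> A / \<eta>" for \<tau>
    proof -
      define t where "t = Re \<tau>"
      have Im: "(Im \<tau>)\<^sup>2 \<le> (2 * pi)\<^sup>2" using \<tau>(1) by (intro power_mono) (auto simp: strip_def)
      have "norm (G m \<tau>) = (exp (- t\<^sup>2) * exp ((Im \<tau>)\<^sup>2)) * norm (F m \<tau>)"
        by (simp add: G_def norm_mult norm_exp_neg_square t_def del: norm_exp_eq_Re)
      also have "\<dots> \<le> (exp (- t\<^sup>2) * exp ((2 * pi)\<^sup>2)) * (\<bar>C\<bar> * exp (L * \<bar>t\<bar>))"
      proof (intro mult_mono)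
        show "norm (F m \<tau>) \<le> \<bar>C\<bar> * exp (L * \<bar>t\<bar>)"
          unfolding t_def by (rule order_trans[OF CL[OF \<tau>(1)]]) (intro mult_right_mono, auto)
      qed (use Im in auto)
      also have "\<dots> = (\<bar>C\<bar> * exp ((2 * pi)\<^sup>2)) * (exp ((L + 1) * \<bar>t\<bar>) * exp (- t\<^sup>2)) * exp (- \<bar>t\<bar>)"
      proof -
        have "exp (L * \<bar>t\<bar>) = exp ((L + 1) * \<bar>t\<bar>) * exp (- \<bar>t\<bar>)"
          unfolding exp_add[symmetric] by (simp add: algebra_simps)
        then show ?thesis by simp
      qed
      also have "\<dots> \<le> (\<bar>C\<bar> * exp ((2 * pi)\<^sup>2)) * exp ((L + 1)\<^sup>2) * exp (- \<bar>t\<bar>)"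
        by (intro mult_right_mono mult_left_mono gaussian_times_exponential) auto
      also have "\<dots> = A / exp \<bar>t\<bar>" by (simp add: A_def exp_minus divide_inverse)
      also have "\<dots> \<le> \<eta>"
      proof -
        have "A / \<eta> \<le> exp \<bar>t\<bar>" using \<tau>(2) exp_ge_add_one_self[of "\<bar>t\<bar>"] unfolding t_def by linarith
        then show ?thesis using \<eta> by (simp add: field_simps)
      qed
      finally show ?thesis .
    qed
    then show ?thesis by blast
  qed
  have cauchy: "norm (G m \<tau> - G n \<tau>) \<le> E m + E n" if \<tau>: "\<tau> \<in> strip" for m n \<tau>
  proof (rule strip_maximum_principle[where H = "\<lambda>\<tau>. G m \<tau> - G n \<tau>", OF _ _ _ _ \<tau>])
    show "(\<lambda>\<tau>. G m \<tau> - G n \<tau>) holomorphic_on UNIV" by (intro holomorphic_intros G)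
    show "\<exists>R. \<forall>\<tau>\<in>strip. \<bar>Re \<tau>\<bar> \<ge> R \<longrightarrow> norm (G m \<tau> - G n \<tau>) \<le> \<eta>" if "\<eta> > 0" for \<eta>
    proof -
      have "\<eta> / 2 > 0" using that by simp
      from decay[OF this, of m] decay[OF this, of n] obtain R1 R2 where
        "\<forall>\<tau>\<in>strip. \<bar>Re \<tau>\<bar> \<ge> R1 \<longrightarrow> norm (G m \<tau>) \<le> \<eta> / 2" "\<forall>\<tau>\<in>strip. \<bar>Re \<tau>\<bar> \<ge> R2 \<longrightarrow> norm (G n \<tau>) \<le> \<eta> / 2" by blast
      then have "norm (G m \<tau> - G n \<tau>) \<le> \<eta>" if "\<tau> \<in> strip" "\<bar>Re \<tau>\<bar> \<ge> max R1 R2" for \<tau>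
        using that norm_triangle_ineq4[of "G m \<tau>" "G n \<tau>"] by force
      then show ?thesis by blast
    qed
    show "norm (G m (of_real t) - G n (of_real t)) \<le> E m + E n" for t
      using norm_triangle_le_diff[OF add_mono[OF b0[of m t] b0[of n t]]] by simp
    show "norm (G m (of_real t + 2 * of_real pi * \<i>) - G n (of_real t + 2 * of_real pi * \<i>)) \<le> E m + E n" for t
      using norm_triangle_le_diff[OF add_mono[OF b1[of m t] b1[of n t]]] by simp
  qed
  have "uniformly_Cauchy_on strip G"
    unfolding uniformly_Cauchy_on_def
  proof (intro allI impI)
    fix \<eta> :: real assume "\<eta> > 0"
    then have "\<eta> / 2 > 0" by simp
    from order_tendstoD(2)[OF E this] obtain M where M: "\<And>m. m \<ge> M \<Longrightarrow> E m < \<eta> / 2"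
      by (auto simp: eventually_sequentially)
    have "dist (G m \<tau>) (G n \<tau>) < \<eta>" if "\<tau> \<in> strip" "m \<ge> M" "n \<ge> M" for \<tau> m n
      using cauchy[OF that(1), of m n] M[OF that(2)] M[OF that(3)] by (simp add: dist_norm)
    then show "\<exists>M. \<forall>x\<in>strip. \<forall>m\<ge>M. \<forall>n\<ge>M. dist (G m x) (G n x) < \<eta>" by blast
  qed
  then obtain g where g: "uniform_limit strip G g sequentially"
    using Cauchy_uniformly_convergent unfolding uniformly_convergent_on_def by blast
  have gc: "continuous_on strip g"
    by (rule uniform_limit_theorem[OF _ g])
       (auto intro!: always_eventually holomorphic_on_imp_continuous_on[OF holomorphic_on_subset[OF G]])
  have gh: "g holomorphic_on interior strip"
  proof (rule holomorphic_uniform_sequence[OF open_interior])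
    show "G m holomorphic_on interior strip" for m by (rule holomorphic_on_subset[OF G]) simp
    fix x assume "x \<in> interior strip"
    then obtain r where r: "r > 0" "cball x r \<subseteq> interior strip"
      using open_contains_cball[of "interior strip"] by auto
    then have "cball x r \<subseteq> strip" using interior_subset by blast
    then show "\<exists>d>0. cball x d \<subseteq> interior strip \<and> uniform_limit (cball x d) G g sequentially"
      using r uniform_limit_on_subset[OF g] by blast
  qed
  have pt: "g \<tau> = l" if \<tau>: "\<tau> \<in> strip" and l: "\<And>m. norm (G m \<tau> - l) \<le> E m" for \<tau> l
  proof (rule LIMSEQ_unique)
    show "(\<lambda>m. G m \<tau>) \<longlonglongrightarrow> g \<tau>" by (rule tendsto_uniform_limitI[OF g \<tau>])
    have "(\<lambda>m. G m \<tau> - l) \<longlonglongrightarrow> 0" by (rule Lim_null_comparison[OF _ E]) (use l in simp)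
    then show "(\<lambda>m. G m \<tau>) \<longlonglongrightarrow> l" by (simp add: LIM_zero_iff)
  qed
  have in_strip: "of_real t \<in> strip" "of_real t + 2 * of_real pi * \<i> \<in> strip" for t
    by (auto simp: strip_def)
  show ?thesis
  proof (intro exI[of _ "\<lambda>\<tau>. exp (\<tau>\<^sup>2) * g \<tau>"] conjI allI)
    show "continuous_on strip (\<lambda>\<tau>. exp (\<tau>\<^sup>2) * g \<tau>)" by (intro continuous_intros gc)
    show "(\<lambda>\<tau>. exp (\<tau>\<^sup>2) * g \<tau>) holomorphic_on interior strip" by (intro holomorphic_intros gh)
    fix t :: real
    show "exp ((of_real t)\<^sup>2) * g (of_real t) = f0 t"
      unfolding pt[OF in_strip(1) b0] by (simp add: exp_minus)
    show "exp ((of_real t + 2 * of_real pi * \<i>)\<^sup>2) * g (of_real t + 2 * of_real pi * \<i>) = f1 t"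
      unfolding pt[OF in_strip(2) b1] by (simp add: exp_minus)
  qed
qed

definition approximated_by :: "(real \<Rightarrow> complex) \<Rightarrow> (nat \<Rightarrow> complex \<Rightarrow> complex) \<Rightarrow> bool" where
  "approximated_by g \<gamma> \<longleftrightarrow> rapid g \<and> (\<forall>m. rapid_entire (\<gamma> m)) \<and>
     (\<forall>j K. \<exists>e. e \<longlonglongrightarrow> (0::real) \<and>
       (\<forall>m u. \<forall>i\<le>j. norm (iter_deriv i (\<lambda>u. \<gamma> m (of_real u)) u - iter_deriv i g u) \<le> e m * exp (- K * \<bar>u\<bar>)))"

text \<open>The bounds that \<open>bounded_multilinear_diff_le\<close> asks for, with common
  constants. The one for the approximants follows from the other two and the boundedness of the
  errors, so it is uniform in m.\<close>

lemma approximated_by_C_norm: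
  assumes "approximated_by g \<gamma>"
  shows "\<exists>e B K. e \<longlonglongrightarrow> (0::real) \<and> (\<forall>m. e m \<ge> 0) \<and> B \<ge> 1 \<and> K \<ge> 0 \<and> (\<forall>m t.
     C_norm N (\<lambda>z. arc_fun d (\<lambda>u. \<gamma> m (of_real u - of_real t)) z - arc_fun d (\<lambda>u. g (u - t)) z) \<le> e m * exp (K * \<bar>t\<bar>) \<and>
     C_norm N (arc_fun d (\<lambda>u. \<gamma> m (of_real u - of_real t))) \<le> B * exp (K * \<bar>t\<bar>) \<and>
     C_norm N (arc_fun d (\<lambda>u. g (u - t))) \<le> B * exp (K * \<bar>t\<bar>))"
proof -
  define K where "K = real d + 1 + real N"
  have K0: "K \<ge> 0" by (simp add: K_def)
  have g: "rapid g" and \<gamma>: "\<And>m. rapid_entire (\<gamma> m)" using assms by (auto simp: approximated_by_def)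
  obtain C where C: "C \<ge> 0" "\<And>g \<epsilon>. rapid g \<Longrightarrow> (\<And>i u. i \<le> N \<Longrightarrow> norm (iter_deriv i g u) \<le> \<epsilon> * exp (- (real d + 1 + real N) * \<bar>u\<bar>)) \<Longrightarrow>
       C_norm N (arc_fun d g) \<le> C * \<epsilon>"
    using C_norm_arc_fun_bound[of N d] by blast
  note C = C[folded K_def]
  obtain e where e: "e \<longlonglongrightarrow> 0"
    "\<And>m u i. i \<le> N \<Longrightarrow> norm (iter_deriv i (\<lambda>u. \<gamma> m (of_real u)) u - iter_deriv i g u) \<le> e m * exp (- K * \<bar>u\<bar>)"
    using assms unfolding approximated_by_def by blast
  have e0: "e m \<ge> 0" for m using order_trans[OF norm_ge_zero e(2)[of 0 m 0]] by simp
  obtain A where A: "A \<ge> 0" "\<And>i u. i \<le> N \<Longrightarrow> norm (iter_deriv i g u) \<le> A * exp (- K * \<bar>u\<bar>)"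
    using rapid_bound[OF g] by blast
  obtain M where M: "\<And>m. e m \<le> M"
    using convergent_imp_Bseq[OF convergentI[OF e(1)]] unfolding Bseq_def by (metis abs_le_D1 real_norm_def)
  have M0: "M \<ge> 0" using order_trans[OF e0 M[of 0]] .
  have shift: "exp (- K * \<bar>u - t\<bar>) \<le> exp (K * \<bar>t\<bar>) * exp (- K * \<bar>u\<bar>)" for u t
    using exp_abs_shift_le[of K "u - t" u] K0 by simp
  have r: "rapid (\<lambda>u. \<gamma> m (of_real u - of_real t))" for m t by (rule rapid_entire_translate(1)[OF \<gamma>])
  have it: "iter_deriv i (\<lambda>u. \<gamma> m (of_real u - of_real t)) = (\<lambda>u. iter_deriv i (\<lambda>u. \<gamma> m (of_real u)) (u - t))" for i m t
    using rapid_shift(2)[OF rapid_entire_restrict(1)[OF \<gamma>[of m]], of i t] by simp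
  have 1: "C_norm N (\<lambda>z. arc_fun d (\<lambda>u. \<gamma> m (of_real u - of_real t)) z - arc_fun d (\<lambda>u. g (u - t)) z) \<le> C * (e m * exp (K * \<bar>t\<bar>))" for m t
    unfolding arc_fun_diff[symmetric]
  proof (rule C(2)[OF rapid_diff(1)[OF r rapid_shift(1)[OF g]]])
    fix i u assume i: "i \<le> N"
    have "norm (iter_deriv i (\<lambda>u. \<gamma> m (of_real u)) (u - t) - iter_deriv i g (u - t)) \<le> e m * exp (- K * \<bar>u - t\<bar>)" by (rule e(2)[OF i])
    also have "\<dots> \<le> e m * (exp (K * \<bar>t\<bar>) * exp (- K * \<bar>u\<bar>))" by (intro mult_left_mono shift e0)
    finally show "norm (iter_deriv i (\<lambda>u. \<gamma> m (of_real u - of_real t) - g (u - t)) u) \<le> e m * exp (K * \<bar>t\<bar>) * exp (- K * \<bar>u\<bar>)"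
      unfolding rapid_diff(2)[OF r rapid_shift(1)[OF g]] it rapid_shift(2)[OF g] by (simp add: mult.assoc)
  qed
  have 2: "C_norm N (arc_fun d (\<lambda>u. g (u - t))) \<le> C * (A * exp (K * \<bar>t\<bar>))" for t
  proof (rule C(2)[OF rapid_shift(1)[OF g]])
    fix i u assume i: "i \<le> N"
    have "norm (iter_deriv i g (u - t)) \<le> A * exp (- K * \<bar>u - t\<bar>)" by (rule A(2)[OF i])
    also have "\<dots> \<le> A * (exp (K * \<bar>t\<bar>) * exp (- K * \<bar>u\<bar>))" by (intro mult_left_mono shift A)
    finally show "norm (iter_deriv i (\<lambda>u. g (u - t)) u) \<le> A * exp (K * \<bar>t\<bar>) * exp (- K * \<bar>u\<bar>)"
      unfolding rapid_shift(2)[OF g] by (simp add: mult.assoc)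
  qed
  define B where "B = 1 + C * A + C * M"
  have CAM: "C * A \<ge> 0" "C * M \<ge> 0" using C(1) A(1) M0 by auto
  have 3: "C_norm N (arc_fun d (\<lambda>u. g (u - t))) \<le> B * exp (K * \<bar>t\<bar>)" for t
  proof -
    have "(C * A) * exp (K * \<bar>t\<bar>) \<le> B * exp (K * \<bar>t\<bar>)" using CAM by (intro mult_right_mono) (auto simp: B_def)
    moreover have "C_norm N (arc_fun d (\<lambda>u. g (u - t))) \<le> (C * A) * exp (K * \<bar>t\<bar>)" using 2[of t] by (simp add: mult.assoc)
    ultimately show ?thesis by (rule order_trans[rotated])
  qed
  have 4: "C_norm N (arc_fun d (\<lambda>u. \<gamma> m (of_real u - of_real t))) \<le> B * exp (K * \<bar>t\<bar>)" for m t
  proof -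
    have "C_norm N (arc_fun d (\<lambda>u. \<gamma> m (of_real u - of_real t))) \<le>
        C_norm N (\<lambda>z. arc_fun d (\<lambda>u. \<gamma> m (of_real u - of_real t)) z - arc_fun d (\<lambda>u. g (u - t)) z) + C_norm N (arc_fun d (\<lambda>u. g (u - t)))"
      using C_norm_triangle[OF smooth_circle_diff[OF smooth_circle_arc_fun[OF r] smooth_circle_arc_fun[OF rapid_shift(1)[OF g]]]
          smooth_circle_arc_fun[OF rapid_shift(1)[OF g]], of N d m t d t d t] by simp
    also have "\<dots> \<le> C * (e m * exp (K * \<bar>t\<bar>)) + C * (A * exp (K * \<bar>t\<bar>))" by (intro add_mono 1 2)
    also have "\<dots> \<le> C * (M * exp (K * \<bar>t\<bar>)) + C * (A * exp (K * \<bar>t\<bar>))"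
      by (intro add_mono mult_left_mono mult_right_mono M C) auto
    also have "\<dots> \<le> B * exp (K * \<bar>t\<bar>)" by (simp add: B_def algebra_simps)
    finally show ?thesis .
  qed
  have "(\<lambda>m. C * e m) \<longlonglongrightarrow> 0" using tendsto_mult_right_zero[OF e(1)] .
  moreover have "B \<ge> 1" using CAM by (simp add: B_def)
  ultimately show ?thesis using K0 C(1) e0 1 3 4
    by (intro exI[of _ "\<lambda>m. C * e m"] exI[of _ B] exI[of _ K]) (auto simp: mult.assoc)
qed

text \<open>A field, its test function in the coordinate u, and a sequence of entire
  approximants.\<close>

type_synonym 'd smeared = "'d qfield \<times> (real \<Rightarrow> complex) \<times> (nat \<Rightarrow> complex \<Rightarrow> complex)"

section \<open>Boosted correlators and their approximation\<close>

context involutive_wightman_cft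
begin

definition exact :: "real \<Rightarrow> 'd smeared \<Rightarrow> complex \<Rightarrow> complex" where
  "exact t l = arc_fun (d (fst l)) (\<lambda>u. fst (snd l) (u - t))"

definition approx :: "nat \<Rightarrow> complex \<Rightarrow> 'd smeared \<Rightarrow> complex \<Rightarrow> complex" where
  "approx m \<tau> l = arc_fun (d (fst l)) (\<lambda>u. snd (snd l) m (of_real u - \<tau>))"

definition good :: "'d smeared list \<Rightarrow> bool" where
  "good ls \<longleftrightarrow> (\<forall>l\<in>set ls. fst l \<in> \<F> \<and> approximated_by (fst (snd l)) (snd (snd l)))"

lemma exact_smooth: "good ls \<Longrightarrow> l \<in> set ls \<Longrightarrow> exact t l \<in> smooth_circle"
  unfolding good_def exact_def approximated_by_def by (blast intro: smooth_circle_arc_fun rapid_shift(1))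

lemma approx_smooth: "good ls \<Longrightarrow> l \<in> set ls \<Longrightarrow> approx m \<tau> l \<in> smooth_circle"
  unfolding good_def approx_def approximated_by_def by (blast intro: smooth_circle_arc_fun rapid_entire_translate(1))

lemma uniform_approximation:
  assumes "good ls"
  shows "\<exists>e B K. e \<longlonglongrightarrow> (0::real) \<and> (\<forall>m. e m \<ge> 0) \<and> B \<ge> 1 \<and> K \<ge> 0 \<and> (\<forall>l\<in>set ls. \<forall>m t.
     C_norm N (\<lambda>z. approx m (of_real t) l z - exact t l z) \<le> e m * exp (K * \<bar>t\<bar>) \<and>
     C_norm N (approx m (of_real t) l) \<le> B * exp (K * \<bar>t\<bar>) \<and>
     C_norm N (exact t l) \<le> B * exp (K * \<bar>t\<bar>))"
  using assms
proof (induction ls)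
  case Nil
  show ?case by (intro exI[of _ "\<lambda>_. 0"] exI[of _ 1] exI[of _ 0]) auto
next
  case (Cons l ls)
  then have "good ls" by (simp add: good_def)
  from Cons.IH[OF this] obtain e B K where 1: "e \<longlonglongrightarrow> 0" "\<forall>m. e m \<ge> 0" "B \<ge> 1" "K \<ge> 0" "\<forall>l\<in>set ls. \<forall>m t.
     C_norm N (\<lambda>z. approx m (of_real t) l z - exact t l z) \<le> e m * exp (K * \<bar>t\<bar>) \<and>
     C_norm N (approx m (of_real t) l) \<le> B * exp (K * \<bar>t\<bar>) \<and>
     C_norm N (exact t l) \<le> B * exp (K * \<bar>t\<bar>)" by (elim exE conjE)
  have "approximated_by (fst (snd l)) (snd (snd l))" using Cons.prems by (simp add: good_def)
  from approximated_by_C_norm[OF this, of N "d (fst l)"] obtain e' B' K' where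
    2: "e' \<longlonglongrightarrow> 0" "\<forall>m. e' m \<ge> 0" "B' \<ge> 1" "K' \<ge> 0" "\<forall>m t.
     C_norm N (\<lambda>z. approx m (of_real t) l z - exact t l z) \<le> e' m * exp (K' * \<bar>t\<bar>) \<and>
     C_norm N (approx m (of_real t) l) \<le> B' * exp (K' * \<bar>t\<bar>) \<and>
     C_norm N (exact t l) \<le> B' * exp (K' * \<bar>t\<bar>)" unfolding approx_def exact_def by (elim exE conjE)
  have w: "a * exp (K1 * \<bar>t\<bar>) \<le> b * exp ((K + K') * \<bar>t\<bar>)" if "0 \<le> a" "a \<le> b" "K1 \<le> K + K'" for a b K1 t :: real
    using that by (intro mult_mono) (auto intro: mult_right_mono)
  have "(\<lambda>m. e m + e' m) \<longlonglongrightarrow> 0" using tendsto_add[OF 1(1) 2(1)] by simp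
  moreover have "C_norm N (\<lambda>z. approx m (of_real t) k z - exact t k z) \<le> (e m + e' m) * exp ((K + K') * \<bar>t\<bar>) \<and>
     C_norm N (approx m (of_real t) k) \<le> (B + B') * exp ((K + K') * \<bar>t\<bar>) \<and>
     C_norm N (exact t k) \<le> (B + B') * exp ((K + K') * \<bar>t\<bar>)" if k: "k \<in> set (l # ls)" for k m t
  proof (cases "k = l")
    case True
    then show ?thesis
      using 2(5)[rule_format, of m t] 1(2)[rule_format, of m] 2(2)[rule_format, of m] 1(3,4) 2(3,4)
        w[of "e' m" "e m + e' m" K' t] w[of B' "B + B'" K' t] by auto
  next
    case False
    then have "k \<in> set ls" using k by simp
    from bspec[OF 1(5) this, rule_format, of m t] show ?thesis
      using 1(2)[rule_format, of m] 2(2)[rule_format, of m] 1(3,4) 2(3,4)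
        w[of "e m" "e m + e' m" K t] w[of B "B + B'" K t] by auto
  qed
  ultimately show ?case
    using 1(2-4) 2(2-4) by (intro exI[of _ "\<lambda>m. e m + e' m"] exI[of _ "B + B'"] exI[of _ "K + K'"]) auto
qed

lemma multilinear_approximation:
  assumes T: "bounded_multilinear (length ls) T" and ls: "good ls"
  shows "\<exists>e K. e \<longlonglongrightarrow> (0::real) \<and> (\<forall>m t. norm (T (map (approx m (of_real t)) ls) - T (map (exact t) ls)) \<le> e m * exp (K * \<bar>t\<bar>))"
proof -
  let ?k = "length ls"
  obtain N C where C: "C \<ge> 0" "\<forall>fs. length fs = ?k \<longrightarrow> set fs \<subseteq> smooth_circle \<longrightarrow> norm (T fs) \<le> C * (\<Prod>f\<leftarrow>fs. C_norm N f)"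
    using bounded_multilinear_bound[OF T] .
  obtain e B K where a: "e \<longlonglongrightarrow> 0" "\<forall>m. e m \<ge> 0" "B \<ge> 1" "K \<ge> 0" "\<forall>l\<in>set ls. \<forall>m t.
     C_norm N (\<lambda>z. approx m (of_real t) l z - exact t l z) \<le> e m * exp (K * \<bar>t\<bar>) \<and>
     C_norm N (approx m (of_real t) l) \<le> B * exp (K * \<bar>t\<bar>) \<and>
     C_norm N (exact t l) \<le> B * exp (K * \<bar>t\<bar>)"
    using uniform_approximation[OF ls, of N] by (elim exE conjE)
  \<comment> \<open>Each of the k norms contributes a factor exp (K |t|) and the distance one more,
    hence the exponent (k + 1) K.\<close>
  have "norm (T (map (approx m (of_real t)) ls) - T (map (exact t) ls)) \<le> (C * real ?k * B ^ ?k * e m) * exp ((real (Suc ?k) * K) * \<bar>t\<bar>)" for m t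
  proof -
    define x where "x = exp (K * \<bar>t\<bar>)"
    have x1: "x \<ge> 1" using a(4) by (simp add: x_def)
    have "norm (T (map (approx m (of_real t)) ls) - T (map (exact t) ls)) \<le> C * real ?k * (e m * x) * (B * x) ^ ?k"
    proof (rule bounded_multilinear_diff_le[OF T C(1) _ _ C(2)])
      show "B * x \<ge> 1" using mult_mono[of 1 B 1 x] a(3) x1 by simp
      show "0 \<le> e m * x" using a(2) x1 by simp
      show "set (map (approx m (of_real t)) ls) \<subseteq> smooth_circle" "set (map (exact t) ls) \<subseteq> smooth_circle"
        using approx_smooth[OF ls] exact_smooth[OF ls] by auto
      show "C_norm N f \<le> B * x" if "f \<in> set (map (approx m (of_real t)) ls) \<union> set (map (exact t) ls)" for f
        using that a(5) by (auto simp: x_def)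
      show "C_norm N (\<lambda>z. (map (approx m (of_real t)) ls ! i) z - (map (exact t) ls ! i) z) \<le> e m * x" if "i < ?k" for i
        using that a(5) by (simp add: x_def)
    qed simp_all
    also have "\<dots> = (C * real ?k * B ^ ?k * e m) * x ^ Suc ?k" by (simp add: power_mult_distrib)
    also have "x ^ Suc ?k = exp ((real (Suc ?k) * K) * \<bar>t\<bar>)" unfolding x_def exp_of_nat_mult[symmetric] by (simp only: mult.assoc)
    finally show ?thesis .
  qed
  moreover have "(\<lambda>m. C * real ?k * B ^ ?k * e m) \<longlonglongrightarrow> 0" using tendsto_mult_right_zero[OF a(1)] .
  ultimately show ?thesis by blast
qed

text \<open>The constants depend on m, which is all that the growth hypothesis of
  \<open>strip_limit\<close> asks for.\<close>

lemma approx_growth: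
  assumes "good ls"
  shows "\<exists>C K. \<forall>\<tau>\<in>strip. (\<Prod>l\<leftarrow>ls. C_norm N (approx m \<tau> l)) \<le> C * exp (K * \<bar>Re \<tau>\<bar>)"
  using assms
proof (induction ls)
  case Nil
  show ?case by (intro exI[of _ 1] exI[of _ 0]) simp
next
  case (Cons l ls)
  have gl: "good ls" using Cons.prems by (simp add: good_def)
  from Cons.IH[OF this] obtain C K where 1: "\<forall>\<tau>\<in>strip. (\<Prod>l\<leftarrow>ls. C_norm N (approx m \<tau> l)) \<le> C * exp (K * \<bar>Re \<tau>\<bar>)"
    by (elim exE)
  have "rapid_entire (snd (snd l) m)" using Cons.prems by (simp add: good_def approximated_by_def)
  from rapid_entire_translate_bound[OF this, where V = "2 * pi" and N = N and d = "d (fst l)"]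
  obtain D where D: "D \<ge> 0" "\<And>\<tau>. \<bar>Im \<tau>\<bar> \<le> 2 * pi \<Longrightarrow> C_norm N (approx m \<tau> l) \<le> D * exp ((real (d (fst l)) + 1 + real N) * \<bar>Re \<tau>\<bar>)"
    unfolding approx_def by blast
  have "(\<Prod>l\<leftarrow>l # ls. C_norm N (approx m \<tau> l)) \<le> (D * C) * exp (((real (d (fst l)) + 1 + real N) + K) * \<bar>Re \<tau>\<bar>)" if \<tau>: "\<tau> \<in> strip" for \<tau>
  proof -
    have "\<bar>Im \<tau>\<bar> \<le> 2 * pi" using \<tau> by (simp add: strip_def)
    then have "C_norm N (approx m \<tau> l) * (\<Prod>l\<leftarrow>ls. C_norm N (approx m \<tau> l))
        \<le> (D * exp ((real (d (fst l)) + 1 + real N) * \<bar>Re \<tau>\<bar>)) * (C * exp (K * \<bar>Re \<tau>\<bar>))"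
      using 1 \<tau> D C_norm_nonneg[OF approx_smooth[OF gl]]
      by (intro mult_mono prod_list_nonneg) auto
    also have "\<dots> = (D * C) * exp (((real (d (fst l)) + 1 + real N) + K) * \<bar>Re \<tau>\<bar>)"
      by (simp only: distrib_left distrib_right exp_add mult_ac)
    finally show ?thesis by simp
  qed
  then show ?case by blast
qed

lemma correlator_multilinear:
  assumes ps: "admissible ps" and \<phi>s: "set \<phi>s \<subseteq> \<F>"
  shows "bounded_multilinear (length \<phi>s) (\<lambda>fs. form (fprod ps (fprod (zip \<phi>s fs) \<Phi>)) \<Psi>)"
  unfolding bounded_multilinear_def
proof (intro conjI)
  have F: "set (map fst ps @ \<phi>s) \<subseteq> \<F>" using ps \<phi>s by (auto simp: admissible_def)
  obtain N C where C: "C \<ge> 0" "\<And>fs. length fs = length (map fst ps @ \<phi>s) \<Longrightarrow> set fs \<subseteq> smooth_circle \<Longrightarrow>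
     norm (form (fprod (zip (map fst ps @ \<phi>s) fs) \<Phi>) \<Psi>) \<le> C * (\<Prod>f\<leftarrow>fs. C_norm N f)"
    by (rule correlator_bound[OF F]) (rule that)
  have snd_ps: "set (map snd ps) \<subseteq> smooth_circle" using ps by (auto simp: admissible_def)
  have "norm (form (fprod ps (fprod (zip \<phi>s fs) \<Phi>)) \<Psi>) \<le> (C * (\<Prod>f\<leftarrow>map snd ps. C_norm N f)) * (\<Prod>f\<leftarrow>fs. C_norm N f)"
    if "length fs = length \<phi>s" "set fs \<subseteq> smooth_circle" for fs
  proof -
    have "zip (map fst ps @ \<phi>s) (map snd ps @ fs) = ps @ zip \<phi>s fs" by (simp add: zip_map_fst_snd)
    then show ?thesis
      using C(2)[of "map snd ps @ fs"] that snd_ps by (simp add: fprod_append mult_ac)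
  qed
  moreover have "0 \<le> C * (\<Prod>f\<leftarrow>map snd ps. C_norm N f)"
    using C(1) snd_ps C_norm_nonneg by (intro mult_nonneg_nonneg prod_list_nonneg) auto
  ultimately show "\<exists>N. \<exists>C\<ge>0. \<forall>fs. length fs = length \<phi>s \<longrightarrow> set fs \<subseteq> smooth_circle \<longrightarrow>
      norm (form (fprod ps (fprod (zip \<phi>s fs) \<Phi>)) \<Psi>) \<le> C * (\<Prod>f\<leftarrow>fs. C_norm N f)" by blast
  show "\<forall>us vs. \<forall>f\<in>smooth_circle. \<forall>g\<in>smooth_circle. \<forall>c.
        Suc (length us + length vs) = length \<phi>s \<longrightarrow> set us \<subseteq> smooth_circle \<longrightarrow> set vs \<subseteq> smooth_circle \<longrightarrow>
        form (fprod ps (fprod (zip \<phi>s (us @ (\<lambda>z. f z + c * g z) # vs)) \<Phi>)) \<Psi>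
        = form (fprod ps (fprod (zip \<phi>s (us @ f # vs)) \<Phi>)) \<Psi> + c * form (fprod ps (fprod (zip \<phi>s (us @ g # vs)) \<Phi>)) \<Psi>"
  proof (intro allI ballI impI)
    fix us vs :: "(complex \<Rightarrow> complex) list" and f g c
    assume a: "f \<in> smooth_circle" "g \<in> smooth_circle" "Suc (length us + length vs) = length \<phi>s" "set us \<subseteq> smooth_circle" "set vs \<subseteq> smooth_circle"
    define \<alpha>s \<phi> \<beta>s where "\<alpha>s = take (length us) \<phi>s" and "\<phi> = \<phi>s ! length us" and "\<beta>s = drop (Suc (length us)) \<phi>s"
    have \<phi>s_eq: "\<phi>s = \<alpha>s @ \<phi> # \<beta>s" unfolding \<alpha>s_def \<phi>_def \<beta>s_def using a(3) by (intro id_take_nth_drop) simp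
    have len: "length \<alpha>s = length us" using a(3) by (simp add: \<alpha>s_def)
    have z: "zip \<phi>s (us @ h # vs) = zip \<alpha>s us @ (\<phi>, h) # zip \<beta>s vs" for h unfolding \<phi>s_eq using len by simp
    have \<phi>: "\<phi> \<in> \<F>" using \<phi>s \<phi>s_eq by auto
    have "set \<alpha>s \<subseteq> \<F>" using \<phi>s \<phi>s_eq by auto
    then have adm: "admissible (zip \<alpha>s us)" using a(4) by (auto simp: admissible_def dest: set_zip_leftD set_zip_rightD)
    show "form (fprod ps (fprod (zip \<phi>s (us @ (\<lambda>z. f z + c * g z) # vs)) \<Phi>)) \<Psi>
        = form (fprod ps (fprod (zip \<phi>s (us @ f # vs)) \<Phi>)) \<Psi> + c * form (fprod ps (fprod (zip \<phi>s (us @ g # vs)) \<Phi>)) \<Psi>"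
      unfolding z using field_smear(1)[OF \<phi> a(1) smooth_circle_scale[OF a(2)]] field_smear(2)[OF \<phi> a(2)]
      by (simp add: fprod_append fprod_linear[OF adm] fprod_linear[OF ps] form_lin)
  qed
qed

definition kms :: "('d \<Rightarrow> 'd) \<Rightarrow> ('d \<Rightarrow> 'd) \<Rightarrow> bool" where
  "kms x y \<longleftrightarrow> (\<exists>F :: complex \<Rightarrow> complex.
           continuous_on strip F \<and> F holomorphic_on interior strip \<and>
           (\<forall>t::real. F (of_real t) = vacuum_functional form \<Omega> (x \<circ> boost_aut U t y) \<and>
                      F (of_real t + 2 * of_real pi * \<i>)
                        = vacuum_functional form \<Omega> (boost_aut U t y \<circ> x)))"

lemma zip_map_same: "zip (map f xs) (map g xs) = map (\<lambda>x. (f x, g x)) xs"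
  by (induction xs) auto

text \<open>Each local test function is pulled back to the line, where it has compact support, and
  is stored together with Gaussian approximants.\<close>

lemma local_product_smeared:
  assumes "admissible qs" "\<And>q. q \<in> set qs \<Longrightarrow> circle_support (snd q) \<subseteq> upper_semicircle"
  shows "\<exists>ls. good ls \<and> qs = map (\<lambda>l. (fst l, exact 0 l)) ls"
  using assms
proof (induction qs)
  case Nil then show ?case by (intro exI[of _ "[]"]) (simp add: good_def)
next
  case (Cons q qs)
  then obtain ls where ls: "good ls" "qs = map (\<lambda>l. (fst l, exact 0 l)) ls" by auto
  have q: "fst q \<in> \<F>" "snd q \<in> smooth_circle" "circle_support (snd q) \<subseteq> upper_semicircle"
    using Cons.prems by auto
  obtain g M where g: "rapid g" "\<And>u. \<bar>u\<bar> > M \<Longrightarrow> g u = 0" "snd q = arc_fun (d (fst q)) g"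
    using local_function_arc_fun[OF q(2,3), of "d (fst q)"] by blast
  obtain \<gamma> where \<gamma>: "\<And>m. rapid_entire (\<gamma> m)"
    "\<And>j K. \<exists>e. e \<longlonglongrightarrow> (0::real) \<and>
       (\<forall>m u. \<forall>i\<le>j. norm (iter_deriv i (\<lambda>u. \<gamma> m (of_real u)) u - iter_deriv i g u) \<le> e m * exp (- K * \<bar>u\<bar>))"
    by (rule rapid_entire_approximation[OF g(1,2)]) (assumption, rule that)
  have "approximated_by g \<gamma>" unfolding approximated_by_def using g(1) \<gamma> by blast
  then have "good ((fst q, g, \<gamma>) # ls)" using ls(1) q(1) by (simp add: good_def)
  moreover have "q # qs = map (\<lambda>l. (fst l, exact 0 l)) ((fst q, g, \<gamma>) # ls)"
    using ls(2) g(3) by (simp add: exact_def prod_eq_iff)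
  ultimately show ?case by (intro exI[of _ "(fst q, g, \<gamma>) # ls"] conjI)
qed

text \<open>Covariance carries the boost through every factor, where
  \<open>beta_boost_arc_fun\<close> turns it into a translation of u; the boost that is left cancels
  with its inverse.\<close>

lemma boost_aut_smeared:
  assumes "good ls"
  shows "boost_aut U t (fprod (map (\<lambda>l. (fst l, exact 0 l)) ls)) \<Phi> = fprod (map (\<lambda>l. (fst l, exact t l)) ls) \<Phi>"
proof -
  have "admissible (map (\<lambda>l. (fst l, exact 0 l)) ls)"
    using assms exact_smooth[OF assms] by (auto simp: admissible_def good_def)
  moreover have "beta (d (fst l)) (boost t) (exact 0 l) = exact t l" for l :: "'d smeared"
    by (simp add: exact_def beta_boost_arc_fun)
  ultimately show ?thesis
    by (simp add: boost_aut_def boost_fprod U_boost_inverse o_def)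
qed

text \<open>\<open>F m\<close> is a correlator of entire test functions and hence entire in the
  boost parameter. Its values on the upper line are correlators in the opposite order, and on both
  lines they converge to the correlators of the exact test functions.\<close>

lemma kms_fprod:
  assumes ps: "admissible ps" "\<And>p. p \<in> set ps \<Longrightarrow> circle_support (snd p) \<subseteq> upper_semicircle"
    and qs: "admissible qs" "\<And>q. q \<in> set qs \<Longrightarrow> circle_support (snd q) \<subseteq> upper_semicircle"
  shows "kms (fprod ps) (fprod qs)"
proof -
  obtain ls where ls: "good ls" "qs = map (\<lambda>l. (fst l, exact 0 l)) ls"
    using local_product_smeared[OF qs] by blast
  have up: "upper (snd p)" if "p \<in> set ps" for p
    unfolding upper_def
  proof (intro allI impI)
    fix z assume "snd p z \<noteq> 0"
    moreover have "snd p \<in> smooth_circle" using ps(1) that by (simp add: admissible_def)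
    ultimately have "z \<in> sphere 0 1" using smooth_circle_outside by blast
    then have "z \<in> circle_support (snd p)" using \<open>snd p z \<noteq> 0\<close> by (rule circle_support_superset)
    then show "Im z \<ge> 0" using ps(2)[OF that] by (auto simp: upper_semicircle_def)
  qed
  let ?\<phi>s = "map fst ls"
  have \<phi>s: "set ?\<phi>s \<subseteq> \<F>" using ls(1) by (auto simp: good_def)
  define T1 where "T1 fs = form (fprod ps (fprod (zip ?\<phi>s fs) \<Omega>)) \<Omega>" for fs
  define T2 where "T2 fs = form (fprod (zip ?\<phi>s fs) (fprod ps \<Omega>)) \<Omega>" for fs
  have T1: "bounded_multilinear (length ls) T1"
    using correlator_multilinear[OF ps(1) \<phi>s, of \<Omega> \<Omega>] by (simp add: T1_def[abs_def])
  have T2: "bounded_multilinear (length ls) T2"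
    using correlator_multilinear[OF _ \<phi>s, of "[]" "fprod ps \<Omega>" \<Omega>] by (simp add: T2_def[abs_def])
  define F where "F m \<tau> = T1 (map (approx m \<tau>) ls)" for m \<tau>
  have ent: "rapid_entire (snd (snd l) m)" if "l \<in> set ls" for l m
    using ls(1) that by (simp add: good_def approximated_by_def)
  have shifted: "F m (\<tau> + 2 * of_real pi * \<i>) = T2 (map (approx m \<tau>) ls)" for m \<tau>
  proof -
    \<comment> \<open>The translation by 2 \<pi> i is built into the test functions;
      \<open>KMS_shift\<close> adds 2 \<pi> i to their argument and so removes it.\<close>
    let ?Q = "map (\<lambda>l. (fst l, \<lambda>z. snd (snd l) m (z - (\<tau> + 2 * of_real pi * \<i>)))) ls"
    have "fst q \<in> \<F> \<and> rapid_entire (snd q)" if "q \<in> set ?Q" for q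
      using that ls(1) ent rapid_entire_shift by (auto simp: good_def)
    from KMS_shift[where qs = ?Q, OF this ps(1) up]
    show ?thesis
      by (simp add: F_def T1_def T2_def zip_map_same smear_def o_def approx_def[abs_def] diff_add_eq_diff_diff_swap)
  qed
  obtain e K where e: "e \<longlonglongrightarrow> (0::real)" "\<And>m t. norm (T1 (map (approx m (of_real t)) ls) - T1 (map (exact t) ls)) \<le> e m * exp (K * \<bar>t\<bar>)"
    using multilinear_approximation[OF T1 ls(1)] by blast
  obtain e' K' where e': "e' \<longlonglongrightarrow> (0::real)" "\<And>m t. norm (T2 (map (approx m (of_real t)) ls) - T2 (map (exact t) ls)) \<le> e' m * exp (K' * \<bar>t\<bar>)"
    using multilinear_approximation[OF T2 ls(1)] by blast
  have "\<exists>G. continuous_on strip G \<and> G holomorphic_on interior strip \<and>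
     (\<forall>t::real. G (of_real t) = T1 (map (exact t) ls) \<and> G (of_real t + 2 * of_real pi * \<i>) = T2 (map (exact t) ls))"
  proof (rule strip_limit[OF _ _ e(1) _ e'(1)])
    show "F m holomorphic_on UNIV" for m
      unfolding holomorphic_on_def
    proof
      fix \<tau>
      let ?cs = "map (\<lambda>l \<tau>. approx m \<tau> l) ls"
      have "(\<lambda>\<tau>. T1 (map (\<lambda>c. c \<tau>) ?cs)) field_differentiable at \<tau>"
      proof (rule bounded_multilinear_curve)
        fix c assume "c \<in> set ?cs"
        then obtain l where l: "l \<in> set ls" "c = (\<lambda>\<tau>. approx m \<tau> l)" by auto
        from rapid_entire_curve_deriv[OF ent[OF l(1)], of "d (fst l)" m \<tau>]
        show "\<exists>c'. curve_deriv c c' \<tau>" unfolding l(2) approx_def .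
      qed (use T1 in simp)
      then show "F m field_differentiable at \<tau> within UNIV" by (simp add: F_def[abs_def] o_def)
    qed
    show "\<exists>C K. \<forall>\<tau>\<in>strip. norm (F m \<tau>) \<le> C * exp (K * \<bar>Re \<tau>\<bar>)" for m
    proof -
      obtain N C where C: "C \<ge> 0" "\<forall>fs. length fs = length ls \<longrightarrow> set fs \<subseteq> smooth_circle \<longrightarrow> norm (T1 fs) \<le> C * (\<Prod>f\<leftarrow>fs. C_norm N f)"
        using bounded_multilinear_bound[OF T1] .
      obtain D K where D: "\<forall>\<tau>\<in>strip. (\<Prod>l\<leftarrow>ls. C_norm N (approx m \<tau> l)) \<le> D * exp (K * \<bar>Re \<tau>\<bar>)"
        using approx_growth[OF ls(1), of N m] by (elim exE)
      have "norm (F m \<tau>) \<le> (C * D) * exp (K * \<bar>Re \<tau>\<bar>)" if "\<tau> \<in> strip" for \<tau>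
      proof -
        have "set (map (approx m \<tau>) ls) \<subseteq> smooth_circle" using approx_smooth[OF ls(1)] by auto
        then have "norm (F m \<tau>) \<le> C * (\<Prod>f\<leftarrow>map (approx m \<tau>) ls. C_norm N f)"
          unfolding F_def by (intro C(2)[rule_format]) simp_all
        also have "(\<Prod>f\<leftarrow>map (approx m \<tau>) ls. C_norm N f) = (\<Prod>l\<leftarrow>ls. C_norm N (approx m \<tau> l))" by (simp add: o_def)
        also have "C * \<dots> \<le> C * (D * exp (K * \<bar>Re \<tau>\<bar>))" using D that C(1) by (intro mult_left_mono) auto
        finally show ?thesis by (simp add: mult.assoc)
      qed
      then show ?thesis by blast
    qed
    show "norm (F m (of_real t) - T1 (map (exact t) ls)) \<le> e m * exp (K * \<bar>t\<bar>)" for m t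
      unfolding F_def by (rule e(2))
    show "norm (F m (of_real t + 2 * of_real pi * \<i>) - T2 (map (exact t) ls)) \<le> e' m * exp (K' * \<bar>t\<bar>)" for m t
      unfolding shifted by (rule e'(2))
  qed
  then show ?thesis
    unfolding kms_def vacuum_functional_def ls(2) o_apply boost_aut_smeared[OF ls(1)] T1_def T2_def zip_map_same .
qed

text \<open>The algebra is an intersection of subalgebras and offers no induction. Linear
  combinations of products of local fields form a subalgebra containing the generators, so every
  element of the algebra is of this form.\<close>

inductive_set local_polynomials :: "('d \<Rightarrow> 'd) set" where
  product: "admissible ps \<Longrightarrow> (\<forall>p\<in>set ps. circle_support (snd p) \<subseteq> upper_semicircle) \<Longrightarrow> fprod ps \<in> local_polynomials"
| add: "x \<in> local_polynomials \<Longrightarrow> y \<in> local_polynomials \<Longrightarrow> (\<lambda>\<Phi>. x \<Phi> + y \<Phi>) \<in> local_polynomials"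
| scale: "x \<in> local_polynomials \<Longrightarrow> (\<lambda>\<Phi>. smul c (x \<Phi>)) \<in> local_polynomials"

lemma local_polynomials_linear:
  assumes "x \<in> local_polynomials"
  shows "x (\<Phi> + \<Psi>) = x \<Phi> + x \<Psi>" "x (smul c \<Phi>) = smul c (x \<Phi>)"
  using assms
  by (induction arbitrary: \<Phi> \<Psi> c) (auto simp: fprod_linear scale_right_distrib add_ac mult_ac)

lemma local_polynomials_comp:
  assumes "x \<in> local_polynomials" "y \<in> local_polynomials"
  shows "x \<circ> y \<in> local_polynomials"
  using assms(1)
proof induction
  case (product ps)
  from assms(2) show ?case
  proof induction
    case (product qs)
    have "fprod ps \<circ> fprod qs = fprod (ps @ qs)" by (auto simp: fprod_append)
    then show ?case using local_polynomials.product[of "ps @ qs"] product \<open>admissible ps\<close>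
        \<open>\<forall>p\<in>set ps. circle_support (snd p) \<subseteq> upper_semicircle\<close> by auto
  next
    case (add y z)
    have "fprod ps \<circ> (\<lambda>\<Phi>. y \<Phi> + z \<Phi>) = (\<lambda>\<Phi>. (fprod ps \<circ> y) \<Phi> + (fprod ps \<circ> z) \<Phi>)"
      by (auto simp: fprod_linear[OF \<open>admissible ps\<close>])
    then show ?case using local_polynomials.add[OF add.IH] by simp
  next
    case (scale y c)
    have "fprod ps \<circ> (\<lambda>\<Phi>. smul c (y \<Phi>)) = (\<lambda>\<Phi>. smul c ((fprod ps \<circ> y) \<Phi>))"
      by (auto simp: fprod_linear[OF \<open>admissible ps\<close>])
    then show ?case using local_polynomials.scale[OF scale.IH] by simp
  qed
next
  case (add x z)
  then show ?case using local_polynomials.add[OF add.IH] by (simp add: o_def)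
next
  case (scale x c)
  then show ?case using local_polynomials.scale[OF scale.IH] by (simp add: o_def)
qed

lemma local_algebra_subset: "local_algebra smul \<F> upper_semicircle \<subseteq> local_polynomials"
proof -
  have "(fprod [] :: 'd \<Rightarrow> 'd) = id" by auto
  moreover have "fprod [] \<in> local_polynomials" by (intro local_polynomials.product) simp_all
  ultimately have "id \<in> local_polynomials" by (simp only:)
  then have "unital_subalgebra smul local_polynomials"
    unfolding unital_subalgebra_def
    by (auto intro: local_polynomials.add local_polynomials.scale local_polynomials_comp)
  moreover have "\<phi> f \<in> local_polynomials" if "\<phi> \<in> \<F>" "f \<in> smooth_circle" "circle_support f \<subseteq> upper_semicircle" for \<phi> f
  proof -
    have "fprod [(\<phi>, f)] = \<phi> f" by auto
    then show ?thesis using local_polynomials.product[of "[(\<phi>, f)]"] that by simp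
  qed
  ultimately show ?thesis unfolding local_algebra_def by blast
qed

text \<open>One rule for sums and scalar multiples in either argument; a multiple is the case b = 0
  with the same pair used twice.\<close>

lemma kms_combination:
  assumes "kms x y" "kms x' y'"
    and "\<And>t. vacuum_functional form \<Omega> (v \<circ> boost_aut U t w) =
       a * vacuum_functional form \<Omega> (x \<circ> boost_aut U t y) + b * vacuum_functional form \<Omega> (x' \<circ> boost_aut U t y')"
    and "\<And>t. vacuum_functional form \<Omega> (boost_aut U t w \<circ> v) =
       a * vacuum_functional form \<Omega> (boost_aut U t y \<circ> x) + b * vacuum_functional form \<Omega> (boost_aut U t y' \<circ> x')"
  shows "kms v w"
proof -
  obtain F where F: "continuous_on strip F" "F holomorphic_on interior strip"
    "\<forall>t::real. F (of_real t) = vacuum_functional form \<Omega> (x \<circ> boost_aut U t y) \<and>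
       F (of_real t + 2 * of_real pi * \<i>) = vacuum_functional form \<Omega> (boost_aut U t y \<circ> x)"
    using assms(1) unfolding kms_def by (elim exE conjE)
  obtain F' where F': "continuous_on strip F'" "F' holomorphic_on interior strip"
    "\<forall>t::real. F' (of_real t) = vacuum_functional form \<Omega> (x' \<circ> boost_aut U t y') \<and>
       F' (of_real t + 2 * of_real pi * \<i>) = vacuum_functional form \<Omega> (boost_aut U t y' \<circ> x')"
    using assms(2) unfolding kms_def by (elim exE conjE)
  show ?thesis unfolding kms_def
  proof (intro exI conjI allI)
    show "continuous_on strip (\<lambda>\<tau>. a * F \<tau> + b * F' \<tau>)" by (intro continuous_intros F F')
    show "(\<lambda>\<tau>. a * F \<tau> + b * F' \<tau>) holomorphic_on interior strip" by (intro holomorphic_intros F F')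
  qed (use F(3) F'(3) assms(3,4) in auto)
qed

lemma boost_aut_local_linear:
  assumes "y \<in> local_polynomials"
  shows "boost_aut U t y (\<Phi> + \<Psi>) = boost_aut U t y \<Phi> + boost_aut U t y \<Psi>"
    "boost_aut U t y (smul c \<Phi>) = smul c (boost_aut U t y \<Phi>)"
  using local_polynomials_linear[OF assms]
  by (simp_all add: boost_aut_def U_boost_inverse U_linear[OF boost_Mob])

text \<open>Both boundary correlators are bilinear in x and y, thanks to the linearity of local
  polynomials and of the boosts; nested inductions reduce the claim to products of fields.\<close>

theorem kms_local_algebra:
  assumes "x \<in> local_algebra smul \<F> upper_semicircle" "y \<in> local_algebra smul \<F> upper_semicircle"
  shows "kms x y"
proof -
  have "x \<in> local_polynomials" and y: "y \<in> local_polynomials" using assms local_algebra_subset by auto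
  then show ?thesis
  proof (induction x)
    case (product ps)
    have x: "fprod ps \<in> local_polynomials" by (rule local_polynomials.product[OF product.hyps])
    note lin = local_polynomials_linear[OF x]
    show ?case using y
    proof induction
      case (product qs)
      then show ?case using \<open>admissible ps\<close> \<open>\<forall>p\<in>set ps. circle_support (snd p) \<subseteq> upper_semicircle\<close>
        by (intro kms_fprod) auto
    next
      case (add y z)
      show ?case
        by (rule kms_combination[OF add.IH, where a = 1 and b = 1])
           (simp_all add: vacuum_functional_def boost_aut_def U_linear[OF boost_Mob] lin form_lin)
    next
      case (scale y c)
      show ?case
        by (rule kms_combination[OF scale.IH scale.IH, where a = c and b = 0])
           (simp_all add: vacuum_functional_def boost_aut_def U_linear[OF boost_Mob] lin form_lin)
    qed
  next
    case (add x z)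
    show ?case
      by (rule kms_combination[OF add.IH[OF y], where a = 1 and b = 1])
         (simp_all add: vacuum_functional_def boost_aut_local_linear[OF y] form_lin)
  next
    case (scale x c)
    show ?case
      by (rule kms_combination[OF scale.IH[OF y] scale.IH[OF y], where a = c and b = 0])
         (simp_all add: vacuum_functional_def boost_aut_local_linear[OF y] form_lin)
  qed
qed

end

theorem corollary3:
  fixes smul :: "complex \<Rightarrow> 'd::ab_group_add \<Rightarrow> 'd"
    and \<F> :: "'d qfield set"
    and d :: "'d qfield \<Rightarrow> nat"
    and U :: "(complex \<Rightarrow> complex) \<Rightarrow> 'd \<Rightarrow> 'd"
    and \<Omega> :: 'd
    and form :: "'d \<Rightarrow> 'd \<Rightarrow> complex"
    and pct :: "'d \<Rightarrow> 'd"
    and x y :: "'d \<Rightarrow> 'd"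
  assumes "involutive_wightman_cft smul \<F> d U \<Omega> form pct"
    and "x \<in> local_algebra smul \<F> upper_semicircle"
    and "y \<in> local_algebra smul \<F> upper_semicircle"
  shows "\<exists>F :: complex \<Rightarrow> complex.
           continuous_on strip F \<and> F holomorphic_on interior strip \<and>
           (\<forall>t::real. F (of_real t) = vacuum_functional form \<Omega> (x \<circ> boost_aut U t y) \<and>
                      F (of_real t + 2 * of_real pi * \<i>)
                        = vacuum_functional form \<Omega> (boost_aut U t y \<circ> x))"
proof -
  interpret involutive_wightman_cft smul \<F> d U \<Omega> form pct by (rule assms(1))
  from kms_local_algebra[OF assms(2,3)] show ?thesis unfolding kms_def .
qed

end
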